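(* Let $m \le n$ be positive integers, let $U \subset \mathbf{R}^n$ be open, and let $V_1, V_2, \dots$ be a sequence of $m$-dimensional varifolds in $U$ with $V = \lim_{i\to\infty} V_i$. Let $Y$ be a second-countable locally compact Hausdorff space, let $L_1, L_2, \dots$ be compact subsets of $Y$ such that $\bigcup_{j=1}^\infty L_j = Y$ and $L_j \subset \operatorname{Int} L_{j+1}$ for every positive integer $j$, and for each positive integer $i$ let $f_i$ be a $\|V_i\|$ Young function of type $Y$, such that $$\lim_{j\to\infty} \sup\{ \mathbf{Y}(\|V_i\|, f_i)(K \times (Y \setminus L_j)) : i = 1,2,\dots \} = 0$$ whenever $K$ is a compact subset of $U$. Then there exists a $\|V\|$ Young function $f$ of type $Y$ such that, possibly passing to a subsequence, $$\mathbf{Y}(\|V\|, f) = \lim_{i\to\infty} \mathbf{Y}(\|V_i\|, f_i).$$ Moreover, if all $V_i$ and $V$ are rectifiable, then (along that subsequence) $$\mathbf{Y}(V, f\circ p) = \lim_{i\to\infty} \mathbf{Y}(V_i, f_i \circ p),$$ where $p: U \times \mathbf{G}(n,m) \to U$ is the projection map.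
   Context: Measures are outer measures in Federer's sense: a Radon measure over a locally compact Hausdorff space $X$ is finite on compact sets, all open sets are measurable and inner regular by compact sets, and every set is outer regular by open sets. $\mathscr{K}(X)$ is the space of continuous functions $X\to\mathbf{R}$ with compact support. Convergence of Radon measures over $X$ (in particular of varifolds and of graph measures) is weak convergence: $\mu_i \to \mu$ iff $\int g\,d\mu_i \to \int g\,d\mu$ for all $g \in \mathscr{K}(X)$. $\mathbf{P}(Y)$ is the space of probability Radon measures over $Y$ with the initial topology induced by the maps $\nu \mapsto \int k\,d\nu$, $k \in \mathscr{K}(Y)$. For a Radon measure $\mu$ over a locally compact Hausdorff space $X$, a $\mu$ Young function of type $Y$ is a $\mu$ measurable function (defined $\mu$ almost everywhere) with values in $\mathbf{P}(Y)$. The graph measure $\mathbf{Y}(\mu,f)$ is the Radon measure over $X\times Y$ such that $\int \psi\, d\mathbf{Y}(\mu,f) = \int\int \psi(x,y)\,df(x)(y)\,d\mu(x)$ for all $\psi\in\mathscr{K}(X\times Y)$. $\mathbf{G}(n,m)$ is the Grassmannian of $m$-dimensional linear subspaces of $\mathbf{R}^n$. An $m$-dimensional varifold in $U$ is a Radon measure $V$ over $U\times\mathbf{G}(n,m)$; its weight $\|V\|$ is the Radon measure $p_\#V$ over $U$, i.e. $\|V\|(A)=V(A\times \mathbf{G}(n,m))$. The varifold $V$ is rectifiable (Allard) if there are countably many positive real numbers $c_j$ and $\mathscr{H}^m$ measurable sets $E_j\subset U$, each meeting every compact subset of $U$ in an $(\mathscr{H}^m,m)$ rectifiable set, such that $\int\beta\,dV=\sum_j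 c_j\int_{E_j}\beta(x,\operatorname{Tan}^m(\mathscr{H}^m\llcorner E_j,x))\,d\mathscr{H}^m(x)$ for every continuous $\beta:U\times \mathbf{G}(n,m)\to\mathbf{R}$ with compact support, where $\operatorname{Tan}^m$ denotes the approximate tangent space. *)

theory Defs
  imports "HOL-Analysis.Analysis"
begin

section \<open>Outer measures\<close>

text \<open>
  A measure over \<open>S\<close> in Federer's sense, i.e. an outer measure defined on all subsets of \<open>S\<close>.
  The last conjunct fixes the irrelevant values at sets that are not contained in \<open>S\<close>, so
  that measures over \<open>S\<close> are equal as soon as they agree on the subsets of \<open>S\<close>.
\<close>

definition measure_over :: "'a set \<Rightarrow> ('a set \<Rightarrow> ennreal) \<Rightarrow> bool" where
  "measure_over S \<phi> \<longleftrightarrow>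
     outer_measure_space (Pow S) \<phi> \<and> (\<forall>A. \<phi> A = \<phi> (A \<inter> S))"

abbreviation caratheodory_sets :: "'a set \<Rightarrow> ('a set \<Rightarrow> ennreal) \<Rightarrow> 'a set set" where
  "caratheodory_sets S \<phi> \<equiv> lambda_system S (Pow S) \<phi>"

text \<open>Integration with respect to \<open>\<phi>\<close> is integration with respect to this complete measure.\<close>

definition caratheodory_measure :: "'a set \<Rightarrow> ('a set \<Rightarrow> ennreal) \<Rightarrow> 'a measure" where
  "caratheodory_measure S \<phi> = measure_of S (caratheodory_sets S \<phi>) \<phi>"

definition outer_restrict :: "('a set \<Rightarrow> ennreal) \<Rightarrow> 'a set \<Rightarrow> 'a set \<Rightarrow> ennreal" where
  "outer_restrict \<phi> E = (\<lambda>A. \<phi> (E \<inter> A))"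


section \<open>Radon measures and weak convergence\<close>

definition radon_measure :: "'a topology \<Rightarrow> ('a set \<Rightarrow> ennreal) \<Rightarrow> bool" where
  "radon_measure X \<phi> \<longleftrightarrow>
     measure_over (topspace X) \<phi> \<and>
     (\<forall>K. compactin X K \<longrightarrow> \<phi> K < \<infinity>) \<and>
     (\<forall>W. openin X W \<longrightarrow>
        W \<in> caratheodory_sets (topspace X) \<phi> \<and>
        \<phi> W = (SUP K\<in>{K. compactin X K \<and> K \<subseteq> W}. \<phi> K)) \<and>
     (\<forall>A\<subseteq>topspace X. \<phi> A = (INF W\<in>{W. openin X W \<and> A \<subseteq> W}. \<phi> W))"

definition radon_integral :: "'a topology \<Rightarrow> ('a set \<Rightarrow> ennreal) \<Rightarrow> ('a \<Rightarrow> real) \<Rightarrow> real" where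
  "radon_integral X \<phi> g = (\<integral>x. g x \<partial>(caratheodory_measure (topspace X) \<phi>))"

text \<open>The values of members of \<open>test_functions X\<close> outside \<open>topspace X\<close> are arbitrary.\<close>

definition test_functions :: "'a topology \<Rightarrow> ('a \<Rightarrow> real) set" where
  "test_functions X =
     {g. continuous_map X euclideanreal g \<and>
         compactin X (X closure_of {x \<in> topspace X. g x \<noteq> 0})}"

definition weakly_converges ::
    "'a topology \<Rightarrow> (nat \<Rightarrow> 'a set \<Rightarrow> ennreal) \<Rightarrow> ('a set \<Rightarrow> ennreal) \<Rightarrow> bool" where
  "weakly_converges X \<mu>s \<mu> \<longleftrightarrow>
     (\<forall>g\<in>test_functions X.
        (\<lambda>i. radon_integral X (\<mu>s i) g) \<longlonglongrightarrow> radon_integral X \<mu> g)"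


section \<open>Young functions and graph measures\<close>

definition prob_radon :: "'y topology \<Rightarrow> ('y set \<Rightarrow> ennreal) set" where
  "prob_radon Y = {\<nu>. radon_measure Y \<nu> \<and> \<nu> (topspace Y) = 1}"

definition prob_topology :: "'y topology \<Rightarrow> ('y set \<Rightarrow> ennreal) topology" where
  "prob_topology Y =
     topology_generated_by
       {{\<nu> \<in> prob_radon Y. radon_integral Y \<nu> k \<in> W} | k W. k \<in> test_functions Y \<and> open W}"

text \<open>
  A function that is defined only \<open>\<mu>\<close> almost everywhere is represented by a total function;
  its domain is the set of points with value in \<open>prob_radon Y\<close>.
\<close>

definition young_function ::
    "'x topology \<Rightarrow> 'y topology \<Rightarrow> ('x set \<Rightarrow> ennreal) \<Rightarrow> ('x \<Rightarrow> 'y set \<Rightarrow> ennreal) \<Rightarrow> bool" where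
  "young_function X Y \<mu> f \<longleftrightarrow>
     \<mu> {x \<in> topspace X. f x \<notin> prob_radon Y} = 0 \<and>
     (\<forall>W. openin (prob_topology Y) W \<longrightarrow>
        {x \<in> topspace X. f x \<in> W} \<in> caratheodory_sets (topspace X) \<mu>)"

definition graph_measure ::
    "'x topology \<Rightarrow> 'y topology \<Rightarrow> ('x set \<Rightarrow> ennreal) \<Rightarrow> ('x \<Rightarrow> 'y set \<Rightarrow> ennreal)
       \<Rightarrow> ('x \<times> 'y) set \<Rightarrow> ennreal" where
  "graph_measure X Y \<mu> f =
     (THE \<gamma>. radon_measure (prod_topology X Y) \<gamma> \<and>
        (\<forall>\<psi>\<in>test_functions (prod_topology X Y).
           radon_integral (prod_topology X Y) \<gamma> \<psi> =
           radon_integral X \<mu> (\<lambda>x. radon_integral Y (f x) (\<lambda>y. \<psi> (x, y)))))"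


section \<open>Hausdorff measure, rectifiable sets and approximate tangent cones\<close>

text \<open>
  Federer 2.10.1--2: countable covers by sets of diameter at most \<open>\<delta>\<close>. Boundedness is required
  because \<open>diameter\<close> is real-valued. For \<open>m > 0\<close>, sequences of sets suffice, since
  the empty set contributes \<open>0\<close>.
\<close>

definition hausdorff_measure :: "nat \<Rightarrow> 'a::metric_space set \<Rightarrow> ennreal" where
  "hausdorff_measure m A =
     (SUP \<delta>\<in>{0<..}.
        INF C\<in>{C :: nat \<Rightarrow> 'a set.
                 A \<subseteq> (\<Union>i. C i) \<and> (\<forall>i. bounded (C i) \<and> diameter (C i) \<le> \<delta>)}.
          \<Sum>i. ennreal (unit_ball_vol (real m) * (diameter (C i) / 2) ^ m))"

text \<open>Federer 3.2.14; the type \<open>'m\<close> is the index type of the parameter space of dimension \<open>CARD('m)\<close>.\<close>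

definition m_rectifiable :: "'m::finite itself \<Rightarrow> 'a::metric_space set \<Rightarrow> bool" where
  "m_rectifiable _ E \<longleftrightarrow>
     (\<exists>(h :: real^'m \<Rightarrow> 'a) B C. bounded B \<and> C-lipschitz_on B h \<and> E = h ` B)"

definition hm_rectifiable :: "'m::finite itself \<Rightarrow> 'a::metric_space set \<Rightarrow> bool" where
  "hm_rectifiable m E \<longleftrightarrow>
     hausdorff_measure CARD('m) E < \<infinity> \<and>
     (\<exists>\<F>. countable \<F> \<and> (\<forall>S\<in>\<F>. m_rectifiable m S) \<and>
          hausdorff_measure CARD('m) (E - \<Union>\<F>) = 0)"

text \<open>Federer 3.1.21.\<close>

definition tangent_cone :: "'a::real_normed_vector set \<Rightarrow> 'a \<Rightarrow> 'a set" where
  "tangent_cone S a =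
     {v. \<forall>\<epsilon>>0. \<exists>x\<in>S. \<exists>r>0. norm (x - a) < \<epsilon> \<and> norm (r *\<^sub>R (x - a) - v) < \<epsilon>}"

definition has_density ::
    "nat \<Rightarrow> ('a::metric_space set \<Rightarrow> ennreal) \<Rightarrow> 'a \<Rightarrow> ennreal \<Rightarrow> bool" where
  "has_density m \<phi> a d \<longleftrightarrow>
     ((\<lambda>r. \<phi> (cball a r) / ennreal (unit_ball_vol (real m) * r ^ m)) \<longlongrightarrow> d) (at_right 0)"

text \<open>Federer 3.2.16.\<close>

definition approx_tangent_cone ::
    "nat \<Rightarrow> ('a::real_normed_vector set \<Rightarrow> ennreal) \<Rightarrow> 'a \<Rightarrow> 'a set" where
  "approx_tangent_cone m \<phi> a =
     \<Inter> {tangent_cone S a | S. has_density m (outer_restrict \<phi> (- S)) a 0}"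


section \<open>Varifolds\<close>

definition grassmannian :: "nat \<Rightarrow> (real^'n::finite) set set" where
  "grassmannian m = {S. subspace S \<and> dim S = m}"

text \<open>
  The usual topology, obtained by identifying a subspace with the matrix of the orthogonal
  projection onto it (which is the nearest point map).
\<close>

definition grassmannian_topology :: "nat \<Rightarrow> (real^'n::finite) set topology" where
  "grassmannian_topology m =
     pullback_topology (grassmannian m) (\<lambda>S. matrix (closest_point S)) euclidean"

abbreviation varifold_space ::
    "nat \<Rightarrow> (real^'n::finite) set \<Rightarrow> ((real^'n) \<times> (real^'n) set) topology" where
  "varifold_space m U \<equiv> prod_topology (top_of_set U) (grassmannian_topology m)"

definition varifold ::
    "nat \<Rightarrow> (real^'n::finite) set \<Rightarrow> (((real^'n) \<times> (real^'n) set) set \<Rightarrow> ennreal) \<Rightarrow> bool" where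
  "varifold m U V \<longleftrightarrow> radon_measure (varifold_space m U) V"

definition varifold_weight ::
    "nat \<Rightarrow> (((real^'n::finite) \<times> (real^'n) set) set \<Rightarrow> ennreal) \<Rightarrow> (real^'n) set \<Rightarrow> ennreal" where
  "varifold_weight m V A = V (A \<times> grassmannian m)"

text \<open>
  The clauses on almost everywhere membership and on integrability say that the integrals over
  \<open>E j\<close> are meaningful: \<open>\<beta>\<close> is a function on \<open>U \<times> grassmannian m\<close>. By
  Federer 3.2.19 they hold automatically for rectifiable sets; they are spelled out because
  functions and integrals are total in HOL. Finite families \<open>c\<close>, \<open>E\<close> are included, by taking
  \<open>E j = {}\<close> for almost all \<open>j\<close>.
\<close>

definition rectifiable_varifold ::
    "'m::finite itself \<Rightarrow> (real^'n::finite) set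
       \<Rightarrow> (((real^'n) \<times> (real^'n) set) set \<Rightarrow> ennreal) \<Rightarrow> bool" where
  "rectifiable_varifold m U V \<longleftrightarrow>
     varifold CARD('m) U V \<and>
     (\<exists>(c :: nat \<Rightarrow> real) (E :: nat \<Rightarrow> (real^'n) set).
        let H = hausdorff_measure CARD('m);
            M = caratheodory_measure UNIV H;
            T = (\<lambda>j. approx_tangent_cone CARD('m) (outer_restrict H (E j)))
        in (\<forall>j. c j > 0 \<and> E j \<subseteq> U \<and> E j \<in> caratheodory_sets UNIV H \<and>
                (\<forall>K. compact K \<and> K \<subseteq> U \<longrightarrow> hm_rectifiable m (E j \<inter> K)) \<and>
                (AE x\<in>E j in M. T j x \<in> grassmannian CARD('m))) \<and>
           (\<forall>\<beta>\<in>test_functions (varifold_space CARD('m) U).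
              (\<forall>j. set_integrable M (E j) (\<lambda>x. \<beta> (x, T j x))) \<and>
              (\<lambda>j. c j * (LINT x:E j|M. \<beta> (x, T j x)))
                sums radon_integral (varifold_space CARD('m) U) V \<beta>))"

end

(*
  Integrating against a Young function turns the graph measures into bilinear functionals of a test
  function g on U and a test function k on Y. A diagonal argument extracts a subsequence along which
  these converge for all g and k; the limit is dominated by sup |k| times the integral of |g| against
  the limit weight, so Radon-Nikodym densities, indexed by a countable dense set of functions k, and
  the Riesz representation theorem in each fibre give the limit Young function. Tightness makes its
  values probability measures almost everywhere.

  For the second part only the rectifiability of the limit V matters: V is concentrated on the graph of
  its tangent plane map, since the approximate tangent cones of two of the sets E j agree almost
  everywhere on their intersection by a density theorem for Hausdorff measure. Hence every test
  function w on U x G(n,m) is V-close in the mean to a function a of the base point alone, and weak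
  convergence makes w and a close in the mean with respect to the approximating varifolds as well,
  which reduces the claim to the first part.
*)

theory Submission
  imports Defs "HOL-Library.Diagonal_Subsequence"
begin

section \<open>Outer measures\<close>

text \<open>The danger in the second claim is correlation. Near a base point the planes of
  \<open>Vs i\<close> may oscillate, and \<open>fs i\<close> with them; the limit would then link
  plane and point of \<open>Y\<close>, whereas \<open>f \<circ> fst\<close> makes them independent
  given the base point. A fibre of \<open>V\<close> that is a single plane leaves no room for this.
  The gap \<open>\<bar>w z - a (fst z)\<bar>\<close> is again a test function because the
  Grassmannian is compact, so its integrals converge.

  The measures are finite on compact sets only. A uniform error is worthless against them, so
  approximations come with one fixed test function \<open>\<eta>\<close> and errors at most
  \<open>e * \<eta>\<close>; in the variable of \<open>Y\<close>, where the fibre measures have mass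
  1, uniform errors do suffice.

  \<open>graph_measure\<close> is a definite description: Riesz representation and uniqueness of the
  representing measure are needed before it has any property at all. Caratheodory sets depend on the
  measure; their completeness pays for functions known only almost everywhere, but densities are
  formed on a common sigma-algebra.\<close>

locale outer_meas =
  fixes S :: "'a set" and \<phi> :: "'a set \<Rightarrow> ennreal"
  assumes meas: "measure_over S \<phi>"
begin

abbreviation "CM \<equiv> caratheodory_measure S \<phi>"

lemma out_space: "outer_measure_space (Pow S) \<phi>"
  and out_Int: "\<phi> A = \<phi> (A \<inter> S)"
  using meas unfolding measure_over_def by blast+

lemma out_mono: "A \<subseteq> B \<Longrightarrow> \<phi> A \<le> \<phi> B"
  using out_space out_Int[of A] out_Int[of B]
  unfolding outer_measure_space_def increasing_def
  by (metis Int_lower2 Int_mono Pow_iff order_refl)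

lemma out_empty [simp]: "\<phi> {} = 0"
  using out_space unfolding outer_measure_space_def positive_def by simp

text \<open>\<open>countably_subadditive\<close> speaks of disjoint sequences of subsets of
  \<open>S\<close>. Disjointing the sequence and cutting it to \<open>S\<close> by means of
  \<open>out_Int\<close> extends subadditivity to all sequences.\<close>

lemma out_UN: "\<phi> (\<Union>i::nat. A i) \<le> (\<Sum>i. \<phi> (A i))"
proof -
  let ?B = "\<lambda>i. disjointed A i \<inter> S"
  have "\<phi> (\<Union>i. A i) = \<phi> (\<Union>i. ?B i)"
    by (subst out_Int) (simp add: UN_disjointed_eq flip: Int_UN_distrib2)
  also have "\<dots> \<le> (\<Sum>i. \<phi> (?B i))"
  proof -
    have "disjoint_family ?B"
      using disjoint_family_disjointed[of A] by (auto simp: disjoint_family_on_def)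
    then show ?thesis
      using out_space unfolding outer_measure_space_def countably_subadditive_def
      by (auto dest!: spec[of _ ?B])
  qed
  also have "\<dots> \<le> (\<Sum>i. \<phi> (A i))"
    by (intro suminf_le summableI out_mono) (use disjointed_subset[of A] in blast)
  finally show ?thesis .
qed

lemma out_Un: "\<phi> (A \<union> B) \<le> \<phi> A + \<phi> B"
proof -
  have "\<phi> (A \<union> B) \<le> (\<Sum>i. \<phi> (binaryset A B i))"
    using out_UN[of "binaryset A B"] by (simp add: UN_binaryset_eq)
  also have "\<dots> = \<phi> A + \<phi> B"
    by (subst suminf_binaryset_eq[of \<phi>]) auto
  finally show ?thesis .
qed

text \<open>The other inequality in Caratheodory's condition is finite subadditivity, so
  measurability proofs only have to produce this one.\<close>

lemma carath_iff: "A \<in> caratheodory_sets S \<phi> \<longleftrightarrow> A \<subseteq> S \<and> (\<forall>B\<subseteq>S. \<phi> B \<ge> \<phi> (B \<inter> A) + \<phi> (B - A))"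
proof -
  interpret algebra S "Pow S" by (rule algebra_Pow)
  have "\<phi> (B \<inter> A) + \<phi> (B - A) = \<phi> B \<longleftrightarrow> \<phi> B \<ge> \<phi> (B \<inter> A) + \<phi> (B - A)" for B
    using out_Un[of "B \<inter> A" "B - A"] by (auto simp: Int_Diff_Un intro: antisym)
  then show ?thesis by (auto simp: lambda_system_eq)
qed

lemma CM_measure_space: "measure_space S (caratheodory_sets S \<phi>) \<phi>"
  using sigma_algebra.caratheodory_lemma[OF sigma_algebra_Pow out_space] .

lemma space_CM [simp]: "space CM = S"
  unfolding caratheodory_measure_def by (rule space_measure_of) (auto simp: carath_iff)

lemma sets_CM: "sets CM = caratheodory_sets S \<phi>"
proof -
  interpret sigma_algebra S "caratheodory_sets S \<phi>"
    using CM_measure_space unfolding measure_space_def by blast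
  show ?thesis
    unfolding caratheodory_measure_def by (subst sets_measure_of) (auto simp: carath_iff sigma_sets_eq)
qed

lemma emeasure_CM: "A \<in> caratheodory_sets S \<phi> \<Longrightarrow> emeasure CM A = \<phi> A"
  unfolding caratheodory_measure_def
  using CM_measure_space unfolding measure_space_def
  by (intro emeasure_measure_of_sigma) auto

lemma null_carath: "A \<subseteq> S \<Longrightarrow> \<phi> A = 0 \<Longrightarrow> A \<in> caratheodory_sets S \<phi>"
  unfolding carath_iff
  by (metis Int_lower2 out_mono add_0 Diff_subset le_zero_eq)

lemma null_sets_CM: "A \<in> null_sets CM \<longleftrightarrow> A \<subseteq> S \<and> \<phi> A = 0"
  using null_carath emeasure_CM by (auto simp: null_sets_def sets_CM carath_iff)

lemma AE_CM_iff: "(AE x in CM. P x) \<longleftrightarrow> \<phi> {x\<in>S. \<not> P x} = 0"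
proof
  assume "AE x in CM. P x"
  then obtain N where "{x\<in>S. \<not> P x} \<subseteq> N" "N \<in> null_sets CM"
    by (auto simp: eventually_ae_filter)
  then show "\<phi> {x\<in>S. \<not> P x} = 0"
    by (metis out_mono null_sets_CM le_zero_eq)
qed (intro AE_I'[of "{x\<in>S. \<not> P x}"], auto simp: null_sets_CM)

lemma complete_CM: "complete_measure CM"
  by unfold_locales (metis null_sets_CM null_carath out_mono le_zero_eq order_trans sets_CM)

text \<open>Whatever \<open>g\<close> does on the null set where it differs from \<open>f\<close> is
  measurable, by completeness. Fibre integrals are known almost everywhere only, and this is how
  they become measurable.\<close>

lemma borel_measurable_CM_AE:
  fixes f g :: "'a \<Rightarrow> 'b::topological_space"
  assumes f: "f \<in> borel_measurable CM" and eq: "AE x in CM. f x = g x"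
  shows "g \<in> borel_measurable CM"
proof (rule borel_measurableI)
  fix O' :: "'b set" assume "open O'"
  let ?N = "{x\<in>S. f x \<noteq> g x}"
  have N: "?N \<in> null_sets CM" using eq unfolding AE_CM_iff null_sets_CM by auto
  have "\<And>Z. Z \<subseteq> ?N \<Longrightarrow> Z \<in> sets CM"
    using complete_measure.complete[OF complete_CM _ N] .
  then have 1: "(g -` O' \<inter> S) \<inter> ?N \<in> sets CM" by (meson Int_lower2)
  have 2: "(f -` O' \<inter> S) - ?N \<in> sets CM"
    using measurable_sets[OF f, of O'] \<open>open O'\<close> N by (intro sets.Diff) auto
  have "g -` O' \<inter> S = ((g -` O' \<inter> S) \<inter> ?N) \<union> ((f -` O' \<inter> S) - ?N)" by auto
  then show "g -` O' \<inter> space CM \<in> sets CM" using sets.Un[OF 1 2] by simp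
qed

end

lemma measure_overI:
  assumes "\<phi> {} = 0" "\<And>A B. A \<subseteq> B \<Longrightarrow> B \<subseteq> S \<Longrightarrow> \<phi> A \<le> \<phi> B"
    "\<And>A :: nat \<Rightarrow> 'a set. (\<And>i. A i \<subseteq> S) \<Longrightarrow> \<phi> (\<Union>i. A i) \<le> (\<Sum>i. \<phi> (A i))"
    "\<And>A. \<phi> A = \<phi> (A \<inter> S)"
  shows "measure_over S \<phi>"
  using assms unfolding measure_over_def outer_measure_space_def positive_def increasing_def
    countably_subadditive_def
  by (auto simp: image_subset_iff)

section \<open>Test functions on locally compact Hausdorff spaces\<close>

text \<open>\<open>lch\<close>: locally compact Hausdorff; \<open>lch2\<close>: moreover second countable.\<close>

locale lch =
  fixes X :: "'a topology"
  assumes lc: "locally_compact_space X" and hd: "Hausdorff_space X"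
begin

lemma compactin_closedin: "compactin X K \<Longrightarrow> closedin X K"
  using compactin_imp_closedin[OF hd] .

lemma completely_regular: "completely_regular_space X"
  using lc hd locally_compact_Hausdorff_imp_regular_space completely_regular_eq_regular_space by blast

text \<open>Any compact set off which \<open>g\<close> vanishes serves as well as the closure of its
  nonvanishing set, because compact sets are closed here; unlike the closure, such a set is easily
  found for sums, products and compositions.\<close>

lemma tf_iff: "g \<in> test_functions X \<longleftrightarrow>
    continuous_map X euclideanreal g \<and> (\<exists>K. compactin X K \<and> (\<forall>x\<in>topspace X - K. g x = 0))"
proof -
  have "compactin X (X closure_of {x \<in> topspace X. g x \<noteq> 0})"
    if K: "compactin X K" "\<forall>x\<in>topspace X - K. g x = 0" for K
  proof (rule closed_compactin[OF K(1)])
    show "X closure_of {x \<in> topspace X. g x \<noteq> 0} \<subseteq> K"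
      by (rule closure_of_minimal[OF _ compactin_closedin[OF K(1)]]) (use K(2) in auto)
  qed simp
  moreover have "g x = 0" if "x \<in> topspace X - X closure_of {x \<in> topspace X. g x \<noteq> 0}" for x
    using that closure_of_subset[of "{x \<in> topspace X. g x \<noteq> 0}" X] by auto
  ultimately show ?thesis unfolding test_functions_def by blast
qed

lemma tfI: "continuous_map X euclideanreal g \<Longrightarrow> compactin X K \<Longrightarrow>
    (\<And>x. x \<in> topspace X \<Longrightarrow> x \<notin> K \<Longrightarrow> g x = 0) \<Longrightarrow> g \<in> test_functions X"
  unfolding tf_iff by blast

lemma tf_cont: "g \<in> test_functions X \<Longrightarrow> continuous_map X euclideanreal g"
  unfolding tf_iff by blast

lemma tf_supp:
  assumes "g \<in> test_functions X"
  obtains K where "compactin X K" "\<And>x. x \<in> topspace X \<Longrightarrow> x \<notin> K \<Longrightarrow> g x = 0"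
  using assms unfolding tf_iff by blast

lemma tf_zero: "(\<lambda>x. 0) \<in> test_functions X"
  by (rule tfI[of _ "{}"]) auto

lemma tf_comp:
  assumes "continuous_on UNIV r" "r 0 = 0" "g \<in> test_functions X"
  shows "(\<lambda>x. r (g x) :: real) \<in> test_functions X"
proof -
  obtain K where K: "compactin X K" "\<And>x. x \<in> topspace X \<Longrightarrow> x \<notin> K \<Longrightarrow> g x = 0"
    using tf_supp[OF assms(3)] by blast
  have "continuous_map X euclideanreal (r \<circ> g)"
    using tf_cont[OF assms(3)] assms(1) by (intro continuous_map_compose) auto
  then show ?thesis by (intro tfI[OF _ K(1)]) (auto simp: o_def K(2) assms(2))
qed

lemma tf_mult:
  assumes "continuous_map X euclideanreal h" "g \<in> test_functions X"
  shows "(\<lambda>x. h x * g x) \<in> test_functions X"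
proof -
  obtain K where K: "compactin X K" "\<And>x. x \<in> topspace X \<Longrightarrow> x \<notin> K \<Longrightarrow> g x = 0"
    using tf_supp[OF assms(2)] by blast
  then show ?thesis
    using assms tf_cont by (intro tfI[OF _ K(1)] continuous_map_real_mult) auto
qed

lemma tf_mult2:
  assumes "continuous_map X euclideanreal h" "g \<in> test_functions X"
  shows "(\<lambda>x. g x * h x) \<in> test_functions X"
  using tf_mult[OF assms] by (simp add: mult.commute)

lemma tf_cmult: "g \<in> test_functions X \<Longrightarrow> (\<lambda>x. c * g x) \<in> test_functions X"
  by (rule tf_mult) auto

lemma tf_add:
  assumes "g \<in> test_functions X" "h \<in> test_functions X"
  shows "(\<lambda>x. g x + h x) \<in> test_functions X"
proof -
  obtain K K' where "compactin X K" "\<And>x. x \<in> topspace X \<Longrightarrow> x \<notin> K \<Longrightarrow> g x = 0"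
    "compactin X K'" "\<And>x. x \<in> topspace X \<Longrightarrow> x \<notin> K' \<Longrightarrow> h x = 0"
    using tf_supp assms by metis
  then show ?thesis
    using assms tf_cont by (intro tfI[of _ "K \<union> K'"] continuous_map_add compactin_Un) auto
qed

lemma tf_uminus: "g \<in> test_functions X \<Longrightarrow> (\<lambda>x. - g x) \<in> test_functions X"
  using tf_cmult[of g "-1"] by simp

lemma tf_diff: "g \<in> test_functions X \<Longrightarrow> h \<in> test_functions X \<Longrightarrow> (\<lambda>x. g x - h x) \<in> test_functions X"
  using tf_add[OF _ tf_uminus, of g h] by simp

lemma tf_abs: "g \<in> test_functions X \<Longrightarrow> (\<lambda>x. \<bar>g x\<bar>) \<in> test_functions X"
  by (rule tf_comp[where r = abs]) (auto intro!: continuous_intros)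

lemma tf_sum: "(\<And>i. i \<in> I \<Longrightarrow> g i \<in> test_functions X) \<Longrightarrow> (\<lambda>x. \<Sum>i\<in>I. g i x) \<in> test_functions X"
  by (induction I rule: infinite_finite_induct) (auto intro: tf_zero tf_add)

lemma tf_bounded:
  assumes "g \<in> test_functions X"
  obtains C where "C > 0" "\<And>x. x \<in> topspace X \<Longrightarrow> \<bar>g x\<bar> \<le> C"
proof -
  obtain K where K: "compactin X K" "\<And>x. x \<in> topspace X \<Longrightarrow> x \<notin> K \<Longrightarrow> g x = 0"
    using tf_supp[OF assms] by blast
  have "compact (g ` K)"
    using image_compactin[OF K(1) tf_cont[OF assms]] by simp
  then obtain C where "C > 0" "\<forall>y\<in>g ` K. norm y \<le> C"
    using compact_imp_bounded bounded_pos by metis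
  then show ?thesis using K(2) by (intro that[of C]) force+
qed

text \<open>Sharper than the separation of \<open>K\<close> from the complement of \<open>W\<close>:
  \<open>u\<close> is 1 on a whole neighbourhood of \<open>K\<close>, and \<open>W\<close> contains
  a compact set off which \<open>u\<close> vanishes. Both are needed to cut test functions into
  pieces with compact support.\<close>

lemma urysohn:
  assumes "compactin X K" "openin X W" "K \<subseteq> W"
  obtains u Q K' where "u \<in> test_functions X" "\<And>x. 0 \<le> u x" "\<And>x. u x \<le> 1"
    "openin X Q" "K \<subseteq> Q" "\<And>x. x \<in> Q \<Longrightarrow> u x = 1"
    "compactin X K'" "K' \<subseteq> W" "\<And>x. x \<in> topspace X \<Longrightarrow> x \<notin> K' \<Longrightarrow> u x = 0"
proof -
  obtain U L where UL: "openin X U" "compactin X L" "K \<subseteq> U" "U \<subseteq> L"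
    using lc hd assms(1) locally_compact_space_compact_closed_compact[of X] by meson
  let ?T = "topspace X - (U \<inter> W)"
  have "closedin X ?T" using UL(1) assms(2) by blast
  moreover have "disjnt K ?T" using assms UL by (auto simp: disjnt_def)
  ultimately obtain f where f: "continuous_map X euclideanreal f" "f ` ?T \<subseteq> {0}" "f ` K \<subseteq> {1}"
    using Urysohn_completely_regular_compact_closed_alt[OF completely_regular assms(1)] by metis
  \<comment> \<open>The ramp between the levels \<open>1/3\<close> and \<open>2/3\<close> of
    \<open>f\<close> leaves room on both sides: \<open>u\<close> is 1 where \<open>f\<close> exceeds
    \<open>2/3\<close>, an open set around \<open>K\<close>, and 0 off the closed set where
    \<open>f\<close> is at least \<open>1/3\<close>, which avoids the complement of
    \<open>U \<inter> W\<close>.\<close>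
  define u where "u x = max 0 (min 1 (3 * f x - 1))" for x
  define K' where "K' = L \<inter> {x \<in> topspace X. f x \<in> {1/3..}}"
  have "closedin X {x \<in> topspace X. f x \<in> {1/3..}}"
    using f(1) by (rule closedin_continuous_map_preimage) auto
  then have K': "compactin X K'"
    unfolding K'_def using UL(2) by (simp add: compact_Int_closedin)
  have u0: "u x = 0" if "x \<in> topspace X" "x \<notin> K'" for x
    using that f(2) UL(4) unfolding u_def K'_def by (cases "x \<in> L") (force simp: image_subset_iff)+
  have "continuous_map X euclideanreal u"
    unfolding u_def using f(1)
    by (intro continuous_map_real_max continuous_map_real_min continuous_map_diff continuous_map_real_mult_left) auto
  then have "u \<in> test_functions X" using K' u0 by (rule tfI)
  moreover have "openin X {x \<in> topspace X. f x \<in> {2/3<..}}"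
    using f(1) by (rule openin_continuous_map_preimage) auto
  moreover have "K \<subseteq> {x \<in> topspace X. f x \<in> {2/3<..}}"
    using f(3) compactin_subset_topspace[OF assms(1)] by auto
  moreover have "K' \<subseteq> W"
    using f(2) unfolding K'_def by (auto simp: image_subset_iff) force
  ultimately show ?thesis
    using K' u0 by (intro that[of u "{x \<in> topspace X. f x \<in> {2/3<..}}" K']) (auto simp: u_def)
qed

end


section \<open>Radon measures\<close>

locale radon = lch X for X :: "'a topology" +
  fixes \<phi> :: "'a set \<Rightarrow> ennreal"
  assumes rm: "radon_measure X \<phi>"
begin

sublocale outer_meas "topspace X" \<phi>
  using rm by unfold_locales (simp add: radon_measure_def)

lemma rm_compact: "compactin X K \<Longrightarrow> \<phi> K < \<infinity>"
  and rm_open: "openin X W \<Longrightarrow> W \<in> sets CM"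
  and rm_inner: "openin X W \<Longrightarrow> \<phi> W = (SUP K\<in>{K. compactin X K \<and> K \<subseteq> W}. \<phi> K)"
  and rm_outer: "A \<subseteq> topspace X \<Longrightarrow> \<phi> A = (INF W\<in>{W. openin X W \<and> A \<subseteq> W}. \<phi> W)"
  using rm unfolding radon_measure_def sets_CM by blast+

lemma rm_closed: "closedin X C \<Longrightarrow> C \<in> sets CM"
  using sets.Diff[OF sets.top[of CM] rm_open, of "topspace X - C"]
  by (simp add: closedin_def double_diff)

lemma rm_compact_sets: "compactin X K \<Longrightarrow> K \<in> sets CM"
  using rm_closed compactin_closedin by blast

lemma sigma_sets_CM: "A \<in> sigma_sets (topspace X) (Collect (openin X)) \<Longrightarrow> A \<in> sets CM"
  using sets.sigma_sets_subset[of "Collect (openin X)" CM] rm_open by auto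

lemma cont_measurable:
  fixes g :: "'a \<Rightarrow> 'b::topological_space"
  assumes "continuous_map X euclidean g"
  shows "g \<in> borel_measurable CM"
proof (rule borel_measurableI)
  fix W :: "'b set" assume "open W"
  then have "openin X {x \<in> topspace X. g x \<in> W}"
    using assms by (intro openin_continuous_map_preimage) auto
  then have "{x \<in> topspace X. g x \<in> W} \<in> sets CM" by (rule rm_open)
  moreover have "g -` W \<inter> space CM = {x \<in> topspace X. g x \<in> W}" by auto
  ultimately show "g -` W \<inter> space CM \<in> sets CM" by simp
qed

lemma supp_integrable:
  fixes g :: "'a \<Rightarrow> real"
  assumes "g \<in> borel_measurable CM" "compactin X K" "AE x in CM. \<bar>g x\<bar> \<le> C * indicator K x"
  shows "integrable CM g"
proof (rule Bochner_Integration.integrable_bound[OF _ assms(1)])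
  show "integrable CM (\<lambda>x. C * indicator K x)"
    using rm_compact[OF assms(2)] rm_compact_sets[OF assms(2)]
    by (intro integrable_mult_right integrable_real_indicator) (simp_all add: emeasure_CM flip: sets_CM)
  show "AE x in CM. norm (g x) \<le> norm (C * indicator K x)"
    using assms(3) by eventually_elim auto
qed

lemma tf_measurable: "g \<in> test_functions X \<Longrightarrow> g \<in> borel_measurable CM"
  using cont_measurable tf_cont by blast

lemma tf_integrable: "g \<in> test_functions X \<Longrightarrow> integrable CM g"
proof -
  assume g: "g \<in> test_functions X"
  obtain K where K: "compactin X K" "\<And>x. x \<in> topspace X \<Longrightarrow> x \<notin> K \<Longrightarrow> g x = 0"
    using tf_supp[OF g] by blast
  obtain C where "\<And>x. x \<in> topspace X \<Longrightarrow> \<bar>g x\<bar> \<le> C" using tf_bounded[OF g] by blast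
  then show ?thesis
    using K tf_measurable[OF g] by (intro supp_integrable[of g K C] AE_I2) (auto simp: indicator_def)
qed

lemma ri_eq: "radon_integral X \<phi> g = integral\<^sup>L CM g"
  by (simp add: radon_integral_def)

lemma measure_CM: "A \<in> sets CM \<Longrightarrow> \<phi> A < \<infinity> \<Longrightarrow> ennreal (measure CM A) = \<phi> A"
  by (metis emeasure_CM emeasure_eq_ennreal_measure infinity_ennreal_def less_irrefl sets_CM)

lemma ri_upper:
  assumes "g \<in> test_functions X" "compactin X K" "\<And>x. x \<in> topspace X \<Longrightarrow> x \<notin> K \<Longrightarrow> g x \<le> 0"
    "\<And>x. x \<in> topspace X \<Longrightarrow> g x \<le> 1"
  shows "ennreal (radon_integral X \<phi> g) \<le> \<phi> K"
proof -
  have K: "K \<in> sets CM" "\<phi> K < \<infinity>" using assms(2) rm_compact rm_compact_sets by auto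
  have "integral\<^sup>L CM g \<le> integral\<^sup>L CM (indicator K)"
    using assms K by (intro integral_mono tf_integrable integrable_real_indicator)
      (auto simp: emeasure_CM indicator_def simp flip: sets_CM)
  also have "\<dots> = measure CM K" using sets.sets_into_space[OF K(1)] by (simp add: Int_absorb2)
  finally show ?thesis
    using measure_CM[OF K] by (metis ri_eq ennreal_leI)
qed

lemma ri_lower:
  assumes "g \<in> test_functions X" "K \<in> sets CM" "\<phi> K < \<infinity>" "\<And>x. x \<in> K \<Longrightarrow> g x \<ge> 1"
    "\<And>x. x \<in> topspace X \<Longrightarrow> g x \<ge> 0"
  shows "\<phi> K \<le> ennreal (radon_integral X \<phi> g)"
proof -
  note K = assms(2,3)
  have "measure CM K = integral\<^sup>L CM (indicator K)"
    using sets.sets_into_space[OF K(1)] by (simp add: Int_absorb2)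
  also have "\<dots> \<le> integral\<^sup>L CM g"
    using assms K by (intro integral_mono tf_integrable integrable_real_indicator)
      (auto simp: emeasure_CM indicator_def simp flip: sets_CM)
  finally show ?thesis
    using measure_CM[OF K] by (metis ri_eq ennreal_leI)
qed

end

text \<open>Outer regularity reduces to open sets and inner regularity to a compact set in an open
  one, where a Urysohn function fits between the two indicators. It gives uniqueness of the
  representing measure and, later, the absolute continuity behind Radon-Nikodym densities.\<close>

lemma radon_measure_le:
  assumes "radon X \<mu>" "radon X \<nu>"
    and le: "\<And>g. g \<in> test_functions X \<Longrightarrow> (\<And>x. 0 \<le> g x) \<Longrightarrow> radon_integral X \<mu> g \<le> radon_integral X \<nu> g"
  shows "\<mu> A \<le> \<nu> A"
proof -
  interpret m: radon X \<mu> by fact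
  interpret n: radon X \<nu> by fact
  have K: "\<mu> K \<le> \<nu> W" if W: "openin X W" and K: "compactin X K" "K \<subseteq> W" for K W
  proof -
    obtain u Q K' where u: "u \<in> test_functions X" "\<And>x. 0 \<le> u x" "\<And>x. u x \<le> 1"
        "K \<subseteq> Q" "\<And>x. x \<in> Q \<Longrightarrow> u x = 1" "compactin X K'" "K' \<subseteq> W"
        "\<And>x. x \<in> topspace X \<Longrightarrow> x \<notin> K' \<Longrightarrow> u x = 0"
      using m.urysohn[OF K(1) W K(2)] by metis
    have "\<mu> K \<le> ennreal (radon_integral X \<mu> u)"
      using u K by (intro m.ri_lower m.rm_compact m.rm_compact_sets) auto
    also have "\<dots> \<le> ennreal (radon_integral X \<nu> u)" using le u by (auto intro: ennreal_leI)
    also have "\<dots> \<le> \<nu> K'" using u by (intro n.ri_upper) auto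
    also have "\<dots> \<le> \<nu> W" using u by (intro n.out_mono)
    finally show ?thesis .
  qed
  have W: "\<mu> W \<le> \<nu> W" if "openin X W" for W
    unfolding m.rm_inner[OF that] using K[OF that] by (auto intro: SUP_least)
  have "\<mu> A \<le> \<nu> A" if "A \<subseteq> topspace X" for A
    unfolding m.rm_outer[OF that] n.rm_outer[OF that] by (intro INF_mono) (use W in auto)
  then show ?thesis by (metis Int_lower2 m.out_Int n.out_Int)
qed

lemma radon_measure_eq:
  assumes "radon X \<mu>" "radon X \<nu>"
    and "\<And>g. g \<in> test_functions X \<Longrightarrow> radon_integral X \<mu> g = radon_integral X \<nu> g"
  shows "\<mu> = \<nu>"
  using assms by (intro ext antisym radon_measure_le) auto

section \<open>The Riesz representation theorem\<close>

locale riesz = lch X for X :: "'a topology" +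
  fixes \<Lambda> :: "('a \<Rightarrow> real) \<Rightarrow> real"
  assumes add: "g \<in> test_functions X \<Longrightarrow> h \<in> test_functions X \<Longrightarrow> \<Lambda> (\<lambda>x. g x + h x) = \<Lambda> g + \<Lambda> h"
    and cmult: "g \<in> test_functions X \<Longrightarrow> \<Lambda> (\<lambda>x. c * g x) = c * \<Lambda> g"
    and pos: "g \<in> test_functions X \<Longrightarrow> (\<And>x. x \<in> topspace X \<Longrightarrow> 0 \<le> g x) \<Longrightarrow> 0 \<le> \<Lambda> g"
begin

lemma diff: "g \<in> test_functions X \<Longrightarrow> h \<in> test_functions X \<Longrightarrow> \<Lambda> (\<lambda>x. g x - h x) = \<Lambda> g - \<Lambda> h"
  using add[of g "\<lambda>x. (-1) * h x"] cmult[of h "-1"] tf_uminus[of h] by simp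

lemma mono:
  "g \<in> test_functions X \<Longrightarrow> h \<in> test_functions X \<Longrightarrow> (\<And>x. x \<in> topspace X \<Longrightarrow> g x \<le> h x) \<Longrightarrow> \<Lambda> g \<le> \<Lambda> h"
  using pos[OF tf_diff[of h g]] diff[of h g] by simp

lemma zero: "\<Lambda> (\<lambda>x. 0) = 0"
  using cmult[OF tf_zero, of 0] by simp

lemma sum: "(\<And>i. i \<in> I \<Longrightarrow> g i \<in> test_functions X) \<Longrightarrow> \<Lambda> (\<lambda>x. \<Sum>i\<in>I. g i x) = (\<Sum>i\<in>I. \<Lambda> (g i))"
  by (induction I rule: infinite_finite_induct) (auto simp: zero add tf_sum)

text \<open>The relation usually written g \<prec> W means \<open>fits g K\<close> for some
  \<open>K \<subseteq> W\<close>. Carrying the witness \<open>K\<close> along allows comparison with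
  the measure of the compact set itself, as in \<open>lam_le_rep_compact\<close>.\<close>

definition fits :: "('a \<Rightarrow> real) \<Rightarrow> 'a set \<Rightarrow> bool" where
  "fits g K \<longleftrightarrow> g \<in> test_functions X \<and> (\<forall>x\<in>topspace X. 0 \<le> g x \<and> g x \<le> 1) \<and>
     compactin X K \<and> (\<forall>x\<in>topspace X - K. g x = 0)"

definition lam :: "'a set \<Rightarrow> ennreal" where
  "lam W = Sup {ennreal (\<Lambda> g) | g K. fits g K \<and> K \<subseteq> W}"

text \<open>Only \<open>A \<inter> topspace X\<close> is covered, so that the values at other sets
  are the ones \<open>measure_over\<close> prescribes.\<close>

definition rep :: "'a set \<Rightarrow> ennreal" where
  "rep A = (INF W\<in>{W. openin X W \<and> A \<inter> topspace X \<subseteq> W}. lam W)"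

lemma lam_upper: "fits g K \<Longrightarrow> K \<subseteq> W \<Longrightarrow> ennreal (\<Lambda> g) \<le> lam W"
  unfolding lam_def by (rule Sup_upper) blast

lemma lam_least: "(\<And>g K. fits g K \<Longrightarrow> K \<subseteq> W \<Longrightarrow> ennreal (\<Lambda> g) \<le> c) \<Longrightarrow> lam W \<le> c"
  unfolding lam_def by (rule Sup_least) blast

lemma lam_mono: "W \<subseteq> W' \<Longrightarrow> lam W \<le> lam W'"
  by (rule lam_least) (meson lam_upper order_trans)

lemma fits_pos: "fits g K \<Longrightarrow> 0 \<le> \<Lambda> g"
  unfolding fits_def by (auto intro: pos)

lemma lam_empty: "lam {} = 0"
proof -
  have "ennreal (\<Lambda> g) \<le> 0" if "fits g K" "K \<subseteq> {}" for g K
  proof -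
    have "\<Lambda> g \<le> \<Lambda> (\<lambda>x. 0)" using that by (intro mono) (auto simp: fits_def tf_zero)
    then show ?thesis by (simp add: zero ennreal_neg)
  qed
  then show ?thesis using lam_least[of "{}" 0] by simp
qed

text \<open>\<open>u\<close> cuts \<open>g\<close> in two: \<open>u x * g x\<close> lives in
  \<open>W1\<close>, and \<open>g x - u x * g x\<close> vanishes on the neighbourhood
  \<open>Q\<close> of \<open>K - W2\<close>, hence lives on the compact set \<open>K - Q\<close>,
  which \<open>W2\<close> contains. A function equal to 1 merely on \<open>K - W2\<close> would
  leave no compact set inside \<open>W2\<close>.\<close>

lemma lam_Un:
  assumes W: "openin X W1" "openin X W2"
  shows "lam (W1 \<union> W2) \<le> lam W1 + lam W2"
proof (rule lam_least)
  fix g K assume g: "fits g K" and K: "K \<subseteq> W1 \<union> W2"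
  have Kc: "compactin X K" using g by (simp add: fits_def)
  have "compactin X (K - W2)"
  proof -
    have "compactin X (K \<inter> (topspace X - W2))"
      using Kc W(2) by (intro compact_Int_closedin) auto
    moreover have "K \<inter> (topspace X - W2) = K - W2" using compactin_subset_topspace[OF Kc] by blast
    ultimately show ?thesis by simp
  qed
  then obtain u Q K1 where u: "u \<in> test_functions X" "\<And>x. 0 \<le> u x" "\<And>x. u x \<le> 1"
      "openin X Q" "K - W2 \<subseteq> Q" "\<And>x. x \<in> Q \<Longrightarrow> u x = 1" "compactin X K1" "K1 \<subseteq> W1"
      "\<And>x. x \<in> topspace X \<Longrightarrow> x \<notin> K1 \<Longrightarrow> u x = 0"
    using urysohn[of "K - W2" W1] W(1) K by blast
  have gt: "g \<in> test_functions X" using g by (simp add: fits_def)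
  let ?g1 = "\<lambda>x. u x * g x" and ?g2 = "\<lambda>x. g x - u x * g x"
  have g12: "?g1 \<in> test_functions X" "?g2 \<in> test_functions X"
    using gt u(1) by (auto intro!: tf_mult tf_diff tf_cont)
  have "fits ?g1 K1"
    using g u g12 by (auto simp: fits_def intro: mult_le_one)
  moreover have "fits ?g2 (K - Q)"
  proof -
    have "compactin X (K \<inter> (topspace X - Q))"
      using Kc u(4) by (intro compact_Int_closedin) auto
    moreover have "K \<inter> (topspace X - Q) = K - Q" using compactin_subset_topspace[OF Kc] by blast
    moreover have "u x * g x \<le> g x" "g x - u x * g x \<le> 1" if "x \<in> topspace X" for x
    proof -
      have gx: "0 \<le> g x" "g x \<le> 1" using that g by (auto simp: fits_def)
      show "u x * g x \<le> g x" using mult_right_mono[OF u(3)[of x] gx(1)] by simp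
      show "g x - u x * g x \<le> 1" using mult_nonneg_nonneg[OF u(2)[of x] gx(1)] gx(2) by simp
    qed
    ultimately show ?thesis using g u(6) g12 by (auto simp: fits_def)
  qed
  moreover have "K - Q \<subseteq> W2" using u(5) K by blast
  ultimately have "ennreal (\<Lambda> ?g1) \<le> lam W1" "ennreal (\<Lambda> ?g2) \<le> lam W2"
    using lam_upper u(8) by blast+
  moreover have "ennreal (\<Lambda> g) = ennreal (\<Lambda> ?g1) + ennreal (\<Lambda> ?g2)"
    using add[OF g12] fits_pos[OF \<open>fits ?g1 K1\<close>] fits_pos[OF \<open>fits ?g2 _\<close>]
    by (simp flip: ennreal_plus)
  ultimately show "ennreal (\<Lambda> g) \<le> lam W1 + lam W2" by (simp add: add_mono)
qed

lemma lam_UN_finite: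
  "(\<And>i. openin X (W i)) \<Longrightarrow> lam (\<Union>i<n. W i) \<le> (\<Sum>i<n. lam (W i))" for W :: "nat \<Rightarrow> 'a set"
proof (induction n)
  case (Suc n)
  have "openin X (\<Union>i<n. W i)" using Suc.prems by (intro openin_Union) auto
  then have "lam (\<Union>i<Suc n. W i) \<le> lam (\<Union>i<n. W i) + lam (W n)"
    using lam_Un[of "\<Union>i<n. W i" "W n"] Suc.prems by (simp add: lessThan_Suc Un_commute)
  then show ?case using Suc by (simp add: add_right_mono order_trans)
qed (simp add: lam_empty)

lemma lam_UN:
  assumes W: "\<And>i. openin X (W i)"
  shows "lam (\<Union>i::nat. W i) \<le> (\<Sum>i. lam (W i))"
proof (rule lam_least)
  fix g K assume g: "fits g K" and K: "K \<subseteq> (\<Union>i. W i)"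
  obtain F where F: "finite F" "F \<subseteq> range W" "K \<subseteq> \<Union>F"
    using compactinD[of X K "range W"] g K W unfolding fits_def by blast
  then obtain I where I: "finite I" "F = W ` I" using finite_subset_image by metis
  obtain n where "I \<subseteq> {..<n}" using finite_nat_bounded[OF I(1)] by blast
  then have "K \<subseteq> (\<Union>i<n. W i)" using F(3) I(2) by blast
  then have "ennreal (\<Lambda> g) \<le> lam (\<Union>i<n. W i)" using g by (intro lam_upper)
  also have "\<dots> \<le> (\<Sum>i<n. lam (W i))" using W by (rule lam_UN_finite)
  also have "\<dots> \<le> (\<Sum>i. lam (W i))" by (intro sum_le_suminf) auto
  finally show "ennreal (\<Lambda> g) \<le> (\<Sum>i. lam (W i))" .
qed

lemma rep_open: "openin X W \<Longrightarrow> rep W = lam W"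
proof (rule antisym)
  assume W: "openin X W"
  show "rep W \<le> lam W" unfolding rep_def by (rule INF_lower) (use W in auto)
  show "lam W \<le> rep W" unfolding rep_def
    using openin_subset[OF W] by (intro INF_greatest lam_mono) auto
qed

lemma rep_mono: "A \<subseteq> B \<Longrightarrow> rep A \<le> rep B"
  unfolding rep_def by (rule INF_superset_mono) auto

lemma rep_less:
  assumes "rep A < c" obtains W where "openin X W" "A \<inter> topspace X \<subseteq> W" "lam W < c"
  using assms unfolding rep_def INF_less_iff by auto

lemma rep_UN: "rep (\<Union>i::nat. A i) \<le> (\<Sum>i. rep (A i))"
proof (cases "(\<Sum>i. rep (A i)) = \<infinity>")
  case False
  then have fin: "rep (A i) < \<infinity>" for i
    by (metis ennreal_suminf_lessD infinity_ennreal_def less_top)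
  show ?thesis
  proof (rule ennreal_le_epsilon)
    fix e :: real assume e: "0 < e"
    have "\<exists>W. openin X W \<and> A i \<inter> topspace X \<subseteq> W \<and> lam W \<le> rep (A i) + ennreal (e * (1/2)^Suc i)" for i
    proof -
      have "rep (A i) < rep (A i) + ennreal (e * (1/2)^Suc i)"
        using fin[of i] e ennreal_add_left_cancel_less[of "rep (A i)" 0 "ennreal (e * (1/2)^Suc i)"]
        by (simp add: less_top[symmetric])
      then show ?thesis by (metis rep_less less_imp_le)
    qed
    then obtain W where W: "\<And>i. openin X (W i)" "\<And>i. A i \<inter> topspace X \<subseteq> W i"
        "\<And>i. lam (W i) \<le> rep (A i) + ennreal (e * (1/2)^Suc i)" by metis
    have "rep (\<Union>i. A i) \<le> lam (\<Union>i. W i)"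
    proof -
      have "openin X (\<Union>i. W i)" using W(1) by (intro openin_Union) auto
      moreover have "(\<Union>i. A i) \<inter> topspace X \<subseteq> (\<Union>i. W i)" using W(2) by blast
      ultimately show ?thesis unfolding rep_def by (intro INF_lower) auto
    qed
    also have "\<dots> \<le> (\<Sum>i. lam (W i))" using W(1) by (rule lam_UN)
    also have "\<dots> \<le> (\<Sum>i. rep (A i) + ennreal (e * (1/2)^Suc i))"
      using W(3) by (intro suminf_le) auto
    also have "\<dots> = (\<Sum>i. rep (A i)) + (\<Sum>i. ennreal (e * (1/2)^Suc i))"
      by (intro suminf_add[symmetric]) auto
    also have "(\<Sum>i. ennreal (e * (1/2)^Suc i)) = ennreal e"
    proof (rule suminf_ennreal_eq)
      show "(\<lambda>i. e * (1/2)^Suc i) sums e" using sums_mult[OF power_half_series, of e] by simp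
    qed (use e in auto)
    finally show "rep (\<Union>i. A i) \<le> (\<Sum>i. rep (A i)) + ennreal e" .
  qed
qed simp

lemma measure_over_rep: "measure_over (topspace X) rep"
proof (rule measure_overI)
  show "rep {} = 0" using rep_open[of "{}"] lam_empty by simp
qed (auto intro: rep_mono rep_UN, simp add: rep_def)

sublocale outer_meas "topspace X" rep by unfold_locales (rule measure_over_rep)

lemma lam_le_rep_compact: "fits g K \<Longrightarrow> ennreal (\<Lambda> g) \<le> rep K"
proof -
  assume g: "fits g K"
  then have "K \<subseteq> topspace X" by (simp add: fits_def compactin_subset_topspace)
  then show ?thesis unfolding rep_def by (intro INF_greatest lam_upper[OF g]) auto
qed

text \<open>From \<open>1 \<le> g\<close> on \<open>K\<close> one gets only the open superset where
  \<open>g\<close> exceeds some \<open>t < 1\<close>, and every function below that set is at most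
  \<open>g / t\<close>. The loss disappears as \<open>t\<close> tends to 1.\<close>

lemma rep_le:
  assumes g: "g \<in> test_functions X" "\<And>x. x \<in> topspace X \<Longrightarrow> 0 \<le> g x" and K: "\<And>x. x \<in> K \<Longrightarrow> 1 \<le> g x"
  shows "rep K \<le> ennreal (\<Lambda> g)"
proof -
  have *: "rep K \<le> ennreal (\<Lambda> g / t)" if t: "0 < t" "t < 1" for t
  proof -
    let ?Q = "{x \<in> topspace X. g x \<in> {t<..}}"
    have Q: "openin X ?Q" using tf_cont[OF g(1)] by (rule openin_continuous_map_preimage) auto
    have "K \<inter> topspace X \<subseteq> ?Q" using K t by force
    then have "rep K \<le> lam ?Q" unfolding rep_def using Q by (intro INF_lower) auto
    also have "\<dots> \<le> ennreal (\<Lambda> g / t)"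
    proof (rule lam_least)
      fix h L assume h: "fits h L" "L \<subseteq> ?Q"
      have "h x \<le> (1 / t) * g x" if "x \<in> topspace X" for x
      proof (cases "x \<in> L")
        case True
        then have "h x \<le> 1" "t \<le> g x" using h that by (auto simp: fits_def)
        then show ?thesis using t by (simp add: field_simps) (metis mult.commute mult_left_mono mult.right_neutral order_trans less_imp_le)
      next
        case False
        then have "h x = 0" using h that by (auto simp: fits_def)
        then show ?thesis using t g(2)[OF that] by simp
      qed
      then have "\<Lambda> h \<le> \<Lambda> (\<lambda>x. (1 / t) * g x)"
        using h g by (intro mono tf_cmult) (auto simp: fits_def)
      then show "ennreal (\<Lambda> h) \<le> ennreal (\<Lambda> g / t)" using cmult[OF g(1), of "1/t"] by (simp add: ennreal_leI)
    qed
    finally show ?thesis .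
  qed
  show ?thesis
  proof (rule ennreal_le_epsilon)
    fix e :: real assume "0 < e"
    have p: "0 \<le> \<Lambda> g" using g by (intro pos)
    \<comment> \<open>A level \<open>t\<close> with
      \<open>\<Lambda> g / t \<le> \<Lambda> g + e\<close> must be at least \<open>r\<close>; the
      midpoint of \<open>r\<close> and 1 is in addition positive when
      \<open>\<Lambda> g = 0\<close>.\<close>
    define r where "r = \<Lambda> g / (\<Lambda> g + e)"
    define t where "t = (r + 1) / 2"
    have "0 \<le> r" "r < 1" using p \<open>0 < e\<close> by (auto simp: r_def)
    then have t: "0 < t" "t < 1" "\<Lambda> g / (\<Lambda> g + e) \<le> t" by (auto simp: t_def simp flip: r_def)
    have "\<Lambda> g / t \<le> \<Lambda> g + e" using t p \<open>0 < e\<close> by (auto simp: field_simps)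
    then show "rep K \<le> ennreal (\<Lambda> g) + ennreal e"
      using *[OF t(1,2)] p \<open>0 < e\<close> by (metis ennreal_leI ennreal_plus less_imp_le order_trans)
  qed
qed

text \<open>For an open \<open>U\<close>, exhaust \<open>U \<inter> W\<close> by functions
  \<open>g\<close> supported in a compact \<open>K\<close>. The open set \<open>U - K\<close>
  contains \<open>U - W\<close>, and a function below it vanishes off a compact set disjoint from
  \<open>K\<close>, so that its sum with \<open>g\<close> is still below \<open>U\<close>. Arbitrary
  sets \<open>B\<close> follow from the infimum that defines \<open>rep B\<close>.\<close>

lemma rep_open_carath: 
  assumes W: "openin X W"
  shows "W \<in> caratheodory_sets (topspace X) rep"
  unfolding carath_iff
proof (intro conjI allI impI)
  show "W \<subseteq> topspace X" by (rule openin_subset[OF W])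
  fix B assume B: "B \<subseteq> topspace X"
  have *: "rep (U \<inter> W) + rep (U - W) \<le> rep U" if U: "openin X U" for U
  proof -
    have 1: "ennreal (\<Lambda> g) + rep (U - W) \<le> lam U" if g: "fits g K" "K \<subseteq> U \<inter> W" for g K
    proof -
      have Kc: "compactin X K" using g by (simp add: fits_def)
      have o: "openin X (U - K)" using U compactin_closedin[OF Kc] by (rule openin_diff)
      have "ennreal (\<Lambda> g) + ennreal (\<Lambda> h) \<le> lam U" if h: "fits h L" "L \<subseteq> U - K" for h L
      proof -
        have "fits (\<lambda>x. g x + h x) (K \<union> L)"
          unfolding fits_def
        proof (intro conjI ballI)
          fix x assume x: "x \<in> topspace X"
          have "g x = 0 \<or> h x = 0" using x g h by (auto simp: fits_def)
          then show "g x + h x \<le> 1" "0 \<le> g x + h x" using x g h by (auto simp: fits_def)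
        qed (use g h in \<open>auto simp: fits_def intro: tf_add compactin_Un\<close>)
        then have "ennreal (\<Lambda> (\<lambda>x. g x + h x)) \<le> lam U" using g h by (intro lam_upper) auto
        then show ?thesis
          using add[of g h] g h fits_pos[OF g(1)] fits_pos[OF h(1)] by (simp add: fits_def)
      qed
      then have "lam (U - K) \<le> lam U - ennreal (\<Lambda> g)"
        by (intro lam_least) (simp add: ennreal_le_minus_iff add.commute)
      moreover have "ennreal (\<Lambda> g) \<le> lam U" using g by (intro lam_upper) auto
      ultimately have "ennreal (\<Lambda> g) + lam (U - K) \<le> lam U"
        by (metis add_left_mono ennreal_minus_cancel_iff add_diff_inverse_ennreal)
      moreover have "rep (U - W) \<le> lam (U - K)"
        using rep_mono[of "U - W" "U - K"] rep_open[OF o] g by auto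
      ultimately show ?thesis by (meson add_left_mono order_trans)
    qed
    have "rep (U - W) + lam (U \<inter> W) \<le> lam U"
    proof (cases "rep (U - W) = \<infinity>")
      case True
      then have "lam U = \<infinity>" using rep_mono[of "U - W" U] rep_open[OF U] by (simp add: top_unique)
      then show ?thesis by simp
    next
      case False
      have "lam (U \<inter> W) \<le> lam U - rep (U - W)"
        using 1 False by (intro lam_least) (simp add: ennreal_le_minus_iff)
      moreover have "rep (U - W) \<le> lam U" using rep_mono[of "U - W" U] rep_open[OF U] by auto
      ultimately show ?thesis by (metis add_left_mono add_diff_inverse_ennreal)
    qed
    then show ?thesis using rep_open[OF U] rep_open[of "U \<inter> W"] U W by (simp add: add.commute openin_Int)
  qed
  have "rep (B \<inter> W) + rep (B - W) \<le> lam U" if U: "openin X U" "B \<inter> topspace X \<subseteq> U" for U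
  proof -
    have "B \<subseteq> U" using U B by blast
    then have "rep (B \<inter> W) + rep (B - W) \<le> rep (U \<inter> W) + rep (U - W)"
      by (intro add_mono rep_mono) auto
    also have "\<dots> \<le> lam U" using *[OF U(1)] rep_open[OF U(1)] by simp
    finally show ?thesis .
  qed
  then show "rep (B \<inter> W) + rep (B - W) \<le> rep B"
    unfolding rep_def[of B] by (intro INF_greatest) auto
qed

lemma radon_rep: "radon_measure X rep"
  unfolding radon_measure_def
proof (intro conjI allI impI)
  show "measure_over (topspace X) rep" by (rule measure_over_rep)
next
  fix K assume K: "compactin X K"
  then obtain u where u: "u \<in> test_functions X" "\<And>x. 0 \<le> u x" "\<And>x. x \<in> K \<Longrightarrow> u x = 1"
    using urysohn[OF K, of "topspace X"] compactin_subset_topspace[OF K] by (metis openin_topspace subsetD)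
  have "rep K \<le> ennreal (\<Lambda> u)" using u by (intro rep_le) auto
  then show "rep K < \<infinity>" using le_less_trans by fastforce
next
  fix W assume W: "openin X W"
  show "W \<in> caratheodory_sets (topspace X) rep" using W by (rule rep_open_carath)
  show "rep W = (SUP K\<in>{K. compactin X K \<and> K \<subseteq> W}. rep K)"
  proof (rule antisym)
    show "rep W \<le> (SUP K\<in>{K. compactin X K \<and> K \<subseteq> W}. rep K)"
      unfolding rep_open[OF W]
    proof (rule lam_least)
      fix g K assume "fits g K" "K \<subseteq> W"
      then show "ennreal (\<Lambda> g) \<le> (SUP K\<in>{K. compactin X K \<and> K \<subseteq> W}. rep K)"
        by (intro SUP_upper2[of K] lam_le_rep_compact) (auto simp: fits_def)
    qed
  qed (auto intro!: SUP_least rep_mono)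
next
  fix A assume A: "A \<subseteq> topspace X"
  show "rep A = (INF W\<in>{W. openin X W \<and> A \<subseteq> W}. rep W)"
    unfolding rep_def[of A] using A by (intro INF_cong) (auto simp: Int_absorb2 rep_open)
qed

sublocale R: radon X rep by unfold_locales (rule radon_rep)

text \<open>Cut \<open>n g\<close> into layers of height \<open>1\<close>; both functionals lie, on each layer, between the measures of
  two consecutive superlevel sets, and the sum of these bounds telescopes.\<close>

lemma rep_integral_nonneg:
  assumes g: "g \<in> test_functions X" and g0: "\<And>x. x \<in> topspace X \<Longrightarrow> 0 \<le> g x"
  shows "radon_integral X rep g = \<Lambda> g"
proof -
  obtain K where K: "compactin X K" "\<And>x. x \<in> topspace X \<Longrightarrow> x \<notin> K \<Longrightarrow> g x = 0"
    using tf_supp[OF g] by blast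
  obtain C where C: "\<And>x. x \<in> topspace X \<Longrightarrow> \<bar>g x\<bar> \<le> C" using tf_bounded[OF g] by blast
  interpret I: riesz X "radon_integral X rep"
    by unfold_locales
      (auto simp: R.ri_eq R.tf_integrable intro!: integral_nonneg_AE AE_I2)
  \<comment> \<open>A bound independent of \<open>n\<close> on \<open>n\<close> times the error
    forces the error to vanish.\<close>
  have n: "real n * \<bar>\<Lambda> g - radon_integral X rep g\<bar> \<le> enn2real (rep K)" for n
  proof (cases "n = 0")
    case False
    obtain N :: nat where N: "real n * C \<le> real N" using real_arch_simple by blast
    define u where "u k x = max 0 (min 1 (real n * g x - real k))" for k :: nat and x
    define c where "c k = enn2real (rep {x \<in> K. real k \<le> real n * g x})" for k :: nat
    have ut: "u k \<in> test_functions X" for k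
      unfolding u_def
      by (rule tf_comp[where r = "\<lambda>t. max 0 (min 1 (real n * t - real k))", OF _ _ g])
        (auto intro!: continuous_intros)
    have Kk: "compactin X {x \<in> K. real k \<le> real n * g x}" for k
    proof -
      have "closedin X {x \<in> topspace X. g x \<in> {real k / real n..}}"
        using tf_cont[OF g] by (rule closedin_continuous_map_preimage) auto
      then have "compactin X (K \<inter> {x \<in> topspace X. g x \<in> {real k / real n..}})"
        using K(1) by (rule compact_Int_closedin[rotated])
      moreover have "K \<inter> {x \<in> topspace X. g x \<in> {real k / real n..}} = {x \<in> K. real k \<le> real n * g x}"
        using compactin_subset_topspace[OF K(1)] False by (auto simp: field_simps)
      ultimately show ?thesis by simp
    qed
    have fin: "rep {x \<in> K. real k \<le> real n * g x} < \<infinity>" for k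
      using R.rm_compact[OF Kk] .
    have c: "ennreal (c k) = rep {x \<in> K. real k \<le> real n * g x}" for k
      unfolding c_def using fin[of k] by simp
    have c0: "0 \<le> c k" for k by (simp add: c_def)
    have u01: "0 \<le> u k x" "u k x \<le> 1" for k x by (auto simp: u_def)
    have uf: "fits (u k) {x \<in> K. real k \<le> real n * g x}" for k
      unfolding fits_def
    proof (intro conjI ballI)
      fix x assume x: "x \<in> topspace X - {x \<in> K. real k \<le> real n * g x}"
      then have "real n * g x \<le> real k" using K(2) by (cases "x \<in> K") auto
      then show "u k x = 0" by (simp add: u_def)
    qed (use ut Kk u01 in auto)
    have up: "\<Lambda> (u k) \<le> c k" "radon_integral X rep (u k) \<le> c k" for k
    proof -
      have "ennreal (\<Lambda> (u k)) \<le> ennreal (c k)" unfolding c by (rule lam_le_rep_compact[OF uf])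
      then show "\<Lambda> (u k) \<le> c k" using c0 ennreal_le_iff by blast
      have "ennreal (radon_integral X rep (u k)) \<le> ennreal (c k)"
        unfolding c using uf[of k] unfolding fits_def by (intro R.ri_upper) auto
      then show "radon_integral X rep (u k) \<le> c k" using c0 ennreal_le_iff by blast
    qed
    have lo: "c (Suc k) \<le> \<Lambda> (u k)" "c (Suc k) \<le> radon_integral X rep (u k)" for k
    proof -
      have u1: "1 \<le> u k x" if "x \<in> {x \<in> K. real (Suc k) \<le> real n * g x}" for x
        using that by (auto simp: u_def)
      have "ennreal (c (Suc k)) \<le> ennreal (\<Lambda> (u k))"
        unfolding c using ut u01 u1 by (intro rep_le)
      then show "c (Suc k) \<le> \<Lambda> (u k)" using fits_pos[OF uf] ennreal_le_iff by blast
      have "ennreal (c (Suc k)) \<le> ennreal (radon_integral X rep (u k))"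
        unfolding c using ut u01 u1 fin R.rm_compact_sets[OF Kk] by (intro R.ri_lower)
      moreover have "0 \<le> radon_integral X rep (u k)" using ut u01 by (intro I.pos)
      ultimately show "c (Suc k) \<le> radon_integral X rep (u k)" using ennreal_le_iff by blast
    qed
    \<comment> \<open>The summand \<open>k\<close> is the part of the interval from 0 to
      \<open>t\<close> between the heights \<open>k\<close> and \<open>k + 1\<close>, so
      \<open>M\<close> layers recover \<open>t\<close> up to height \<open>M\<close>.\<close>
    have layers: "(\<Sum>k<M. max 0 (min 1 (t - real k))) = min t (real M)" if "0 \<le> t" for t M
      using that by (induction M) (auto simp: max_def min_def)
    have s: "real n * g x = (\<Sum>k<N. u k x)" if "x \<in> topspace X" for x
    proof -
      have "real n * g x \<le> real N"
        using C[OF that] N mult_left_mono[of "g x" C "real n"] by (simp add: abs_le_iff)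
      then show ?thesis unfolding u_def using g0[OF that] by (subst layers) auto
    qed
    have su: "(\<lambda>x. \<Sum>k<N. u k x) \<in> test_functions X" "(\<lambda>x. real n * g x) \<in> test_functions X"
      using ut g by (auto intro: tf_sum tf_cmult)
    have "real n * \<Lambda> g = \<Lambda> (\<lambda>x. \<Sum>k<N. u k x)"
      unfolding cmult[OF g, symmetric] using su s by (intro antisym mono) auto
    then have 1: "real n * \<Lambda> g = (\<Sum>k<N. \<Lambda> (u k))" using sum[of "{..<N}" u] ut by simp
    have "real n * radon_integral X rep g = radon_integral X rep (\<lambda>x. \<Sum>k<N. u k x)"
      unfolding I.cmult[OF g, symmetric] using su s by (intro antisym I.mono) auto
    then have 2: "real n * radon_integral X rep g = (\<Sum>k<N. radon_integral X rep (u k))"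
      using I.sum[of "{..<N}" u] ut by simp
    have "\<bar>real n * \<Lambda> g - real n * radon_integral X rep g\<bar>
        \<le> (\<Sum>k<N. \<bar>\<Lambda> (u k) - radon_integral X rep (u k)\<bar>)"
      unfolding 1 2 sum_subtractf[symmetric] by (rule sum_abs)
    also have "\<dots> \<le> (\<Sum>k<N. c k - c (Suc k))"
    proof (rule sum_mono)
      fix k show "\<bar>\<Lambda> (u k) - radon_integral X rep (u k)\<bar> \<le> c k - c (Suc k)"
        using up[of k] lo[of k] by linarith
    qed
    also have "\<dots> = c 0 - c N" by (rule sum_lessThan_telescope')
    also have "\<dots> \<le> c 0" using c0[of N] by linarith
    also have "c 0 \<le> enn2real (rep K)"
      unfolding c_def using R.rm_compact[OF K(1)] by (intro enn2real_mono rep_mono) auto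
    finally show ?thesis by (simp add: right_diff_distrib[symmetric] abs_mult)
  qed simp
  have "\<bar>\<Lambda> g - radon_integral X rep g\<bar> = 0"
  proof (rule ccontr)
    assume "\<bar>\<Lambda> g - radon_integral X rep g\<bar> \<noteq> 0"
    then obtain n :: nat where "enn2real (rep K) < real n * \<bar>\<Lambda> g - radon_integral X rep g\<bar>"
      using reals_Archimedean3[of "\<bar>\<Lambda> g - radon_integral X rep g\<bar>"] by auto
    then show False using n[of n] by linarith
  qed
  then show ?thesis by simp
qed

lemma rep_integral:
  assumes g: "g \<in> test_functions X"
  shows "radon_integral X rep g = \<Lambda> g"
proof -
  let ?p = "\<lambda>x. \<bar>g x\<bar>" and ?q = "\<lambda>x. \<bar>g x\<bar> - g x"
  have t: "?p \<in> test_functions X" "?q \<in> test_functions X" using g by (auto intro: tf_abs tf_diff)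
  have "\<Lambda> g = \<Lambda> ?p - \<Lambda> ?q" using diff[OF t] by simp
  also have "\<dots> = radon_integral X rep ?p - radon_integral X rep ?q"
    using t by (simp add: rep_integral_nonneg)
  also have "\<dots> = radon_integral X rep g"
    using t by (simp add: R.ri_eq R.tf_integrable flip: Bochner_Integration.integral_diff)
  finally show ?thesis by simp
qed

theorem riesz_representation:
  "\<exists>\<phi>. radon X \<phi> \<and> (\<forall>g\<in>test_functions X. radon_integral X \<phi> g = \<Lambda> g)"
  using rep_integral R.radon_axioms by blast

end

section \<open>Approximation of test functions\<close>

lemma second_countable_prod_topology:
  assumes "second_countable X" "second_countable Y"
  shows "second_countable (prod_topology X Y)"
proof -
  obtain A B where A: "countable A" "\<forall>V\<in>A. openin X V" "\<And>U x. openin X U \<Longrightarrow> x \<in> U \<Longrightarrow> \<exists>V\<in>A. x \<in> V \<and> V \<subseteq> U"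
    and B: "countable B" "\<forall>V\<in>B. openin Y V" "\<And>U x. openin Y U \<Longrightarrow> x \<in> U \<Longrightarrow> \<exists>V\<in>B. x \<in> V \<and> V \<subseteq> U"
    using assms unfolding second_countable_def by metis
  show ?thesis
    unfolding second_countable_def
  proof (intro exI[of _ "(\<lambda>(V, V'). V \<times> V') ` (A \<times> B)"] conjI allI impI)
    fix U z assume U: "openin (prod_topology X Y) U \<and> z \<in> U"
    obtain x y where z: "z = (x, y)" by fastforce
    obtain V V' where V: "openin X V" "openin Y V'" "x \<in> V" "y \<in> V'" "V \<times> V' \<subseteq> U"
      using U z by (metis openin_prod_topology_alt)
    obtain W W' where W: "W \<in> A" "x \<in> W" "W \<subseteq> V" "W' \<in> B" "y \<in> W'" "W' \<subseteq> V'"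
      using A(3)[OF V(1,3)] B(3)[OF V(2,4)] by metis
    then show "\<exists>Q\<in>(\<lambda>(V, V'). V \<times> V') ` (A \<times> B). z \<in> Q \<and> Q \<subseteq> U"
      using V(5) z by (intro bexI[of _ "W \<times> W'"]) auto
  qed (use A(1,2) B(1,2) in \<open>auto simp: openin_prod_Times_iff\<close>)
qed

lemma (in lch) cutoff:
  assumes K: "compactin X K"
  obtains u Q where "u \<in> test_functions X" "\<And>x. 0 \<le> u x" "\<And>x. u x \<le> 1"
    "openin X Q" "K \<subseteq> Q" "\<And>x. x \<in> Q \<Longrightarrow> u x = 1"
  by (rule urysohn[OF K openin_topspace compactin_subset_topspace[OF K]]) (rule that)

locale lch2 = lch X for X :: "'a topology" +
  assumes sc: "second_countable X"
begin

text \<open>One function is chosen for each pair of members of a countable base that admits a bump,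
  so the family is countable. A bump at \<open>x\<close> inside \<open>W\<close>, given by Urysohn,
  shows that a suitable pair is admissible, and the function chosen for that pair replaces
  it.\<close>

lemma bumps:
  obtains U where "countable U" "U \<subseteq> test_functions X" "\<And>u x. u \<in> U \<Longrightarrow> 0 \<le> u x"
    "\<And>x W. openin X W \<Longrightarrow> x \<in> W \<Longrightarrow>
      \<exists>u\<in>U. \<exists>Q. openin X Q \<and> x \<in> Q \<and> (\<forall>y\<in>Q. u y = 1) \<and> (\<forall>y\<in>topspace X - W. u y = 0)"
proof -
  obtain B where B: "countable B" "\<forall>V\<in>B. openin X V" "\<And>U x. openin X U \<Longrightarrow> x \<in> U \<Longrightarrow> \<exists>V\<in>B. x \<in> V \<and> V \<subseteq> U"
    using sc unfolding second_countable_def by metis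
  define good where "good B1 B2 u \<longleftrightarrow> u \<in> test_functions X \<and> (\<forall>x. 0 \<le> u x) \<and> (\<forall>y\<in>B1. u y = 1) \<and>
      (\<forall>y\<in>topspace X - B2. u y = (0::real))" for B1 B2 u
  define c where "c B1 B2 = (SOME u. good B1 B2 u)" for B1 B2
  define U where "U = (\<lambda>(B1, B2). c B1 B2) ` {(B1, B2) \<in> B \<times> B. \<exists>u. good B1 B2 u}"
  have c: "good B1 B2 (c B1 B2)" if "good B1 B2 u" for B1 B2 u
    unfolding c_def using someI[of "good B1 B2", OF that] .
  have U: "\<exists>B1 B2. good B1 B2 u" if u: "u \<in> U" for u
  proof -
    obtain B1 B2 v where "good B1 B2 v" "u = c B1 B2" using u unfolding U_def by auto
    then show ?thesis using c by blast
  qed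
  show thesis
  proof
    show "countable U"
    proof -
      have "{(B1, B2) \<in> B \<times> B. \<exists>u. good B1 B2 u} \<subseteq> B \<times> B" by auto
      then have "countable {(B1, B2) \<in> B \<times> B. \<exists>u. good B1 B2 u}"
        using countable_subset countable_SIGMA[OF B(1) B(1)] by blast
      then show ?thesis unfolding U_def by (rule countable_image)
    qed
    show "0 \<le> u x" if "u \<in> U" for u x using U[OF that] by (auto simp: good_def)
    show "U \<subseteq> test_functions X"
    proof
      fix u assume "u \<in> U"
      from U[OF this] show "u \<in> test_functions X" by (auto simp: good_def)
    qed
    fix x W assume W: "openin X W" "x \<in> W"
    obtain B2 where B2: "B2 \<in> B" "x \<in> B2" "B2 \<subseteq> W" using B(3)[OF W] by blast
    have *: "compactin X {x}" "openin X B2" using B(2) B2 W(2) openin_subset[OF W(1)] by auto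
    have "{x} \<subseteq> B2" using B2 by simp
    then obtain u Q K' where u: "u \<in> test_functions X" "\<And>x. 0 \<le> u x" "openin X Q" "{x} \<subseteq> Q"
        "\<And>x. x \<in> Q \<Longrightarrow> u x = 1" "K' \<subseteq> B2" "\<And>x. x \<in> topspace X \<Longrightarrow> x \<notin> K' \<Longrightarrow> u x = 0"
      by (rule urysohn[OF *]) (rule that)
    obtain B1 where B1: "B1 \<in> B" "x \<in> B1" "B1 \<subseteq> Q" using B(3)[OF u(3)] u(4) by auto
    have g: "good B1 B2 u" unfolding good_def using u B1 by auto
    have "c B1 B2 \<in> U" unfolding U_def using g B1 B2 by auto
    then show "\<exists>u\<in>U. \<exists>Q. openin X Q \<and> x \<in> Q \<and> (\<forall>y\<in>Q. u y = 1) \<and> (\<forall>y\<in>topspace X - W. u y = 0)"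
      using c[OF g] B1 B2 B(2) unfolding good_def by (intro bexI exI[of _ B1]) auto
  qed
qed

text \<open>The order of quantifiers matters: one countable \<open>P\<close> serves all compact sets
  \<open>K\<close> and all assignments \<open>N\<close> of neighbourhoods. The points
  \<open>p i\<close> record which neighbourhood confines the weight \<open>w i\<close>; outside
  \<open>K\<close> the weights may add up to less than 1.\<close>

definition partition_family :: "('a \<Rightarrow> real) set \<Rightarrow> bool" where
  "partition_family P \<longleftrightarrow> countable P \<and> P \<subseteq> test_functions X \<and>
    (\<forall>K N. compactin X K \<longrightarrow> (\<forall>x\<in>K. openin X (N x) \<and> x \<in> N x) \<longrightarrow>
      (\<exists>(n::nat) w p. (\<forall>i<n. w i \<in> P \<and> p i \<in> K \<and> (\<forall>x\<in>topspace X - N (p i). w i x = 0) \<and> (\<forall>x. 0 \<le> w i x)) \<and>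
        (\<forall>x. (\<Sum>i<n. w i x) \<le> 1) \<and> (\<forall>x\<in>K. (\<Sum>i<n. w i x) = 1)))"

lemma partition_of_unity: "\<exists>P. partition_family P"
proof -
  obtain U where U: "countable U" "U \<subseteq> test_functions X" "\<And>u x. u \<in> U \<Longrightarrow> 0 \<le> u x"
    "\<And>x W. openin X W \<Longrightarrow> x \<in> W \<Longrightarrow>
      \<exists>u\<in>U. \<exists>Q. openin X Q \<and> x \<in> Q \<and> (\<forall>y\<in>Q. u y = 1) \<and> (\<forall>y\<in>topspace X - W. u y = 0)"
    by (rule bumps) (rule that)
  \<comment> \<open>Normalising by \<open>max 1\<close> of the sum instead of the sum keeps the
    denominator positive everywhere and changes nothing on \<open>K\<close>, where the sum is at
    least 1. Finite lists over the countable set \<open>U\<close> keep \<open>P\<close>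
    countable.\<close>
  define f where "f us u = (\<lambda>x. inverse (max 1 (\<Sum>v\<leftarrow>us. v x)) * u x :: real)"
    for us :: "('a \<Rightarrow> real) list" and u
  define P where "P = (\<lambda>(us, u). f us u) ` (lists U \<times> U)"
  have "partition_family P"
    unfolding partition_family_def
  proof (intro conjI allI impI)
    show "countable P" unfolding P_def using U(1) by auto
    show "P \<subseteq> test_functions X"
    proof
      fix g assume "g \<in> P"
      then obtain us u where g: "us \<in> lists U" "u \<in> U" "g = f us u" unfolding P_def by auto
      have "continuous_map X euclideanreal (\<lambda>x. \<Sum>v\<leftarrow>us. v x)"
        using g(1) by (induction us) (use U(2) tf_cont in \<open>auto intro!: continuous_map_add\<close>)
      then have "continuous_map X euclideanreal (\<lambda>x. inverse (max 1 (\<Sum>v\<leftarrow>us. v x)))"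
        by (intro continuous_map_real_inverse continuous_map_real_max) auto
      then show "g \<in> test_functions X"
        unfolding g(3) f_def using U(2) g(2) by (intro tf_mult) auto
    qed
    fix K N assume K: "compactin X K" and "\<forall>x\<in>K. openin X (N x) \<and> x \<in> N x"
    then have N: "\<And>x. x \<in> K \<Longrightarrow> openin X (N x) \<and> x \<in> N x" by blast
    have "\<forall>x\<in>K. \<exists>u Q. u \<in> U \<and> openin X Q \<and> x \<in> Q \<and> (\<forall>y\<in>Q. u y = 1) \<and> (\<forall>y\<in>topspace X - N x. u y = 0)"
    proof
      fix x assume "x \<in> K"
      then show "\<exists>u Q. u \<in> U \<and> openin X Q \<and> x \<in> Q \<and> (\<forall>y\<in>Q. u y = 1) \<and> (\<forall>y\<in>topspace X - N x. u y = 0)"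
        using U(4)[of "N x" x] N[of x] by (simp add: Bex_def)
    qed
    from bchoice[OF this] obtain u where "\<forall>x\<in>K. \<exists>Q. u x \<in> U \<and> openin X Q \<and> x \<in> Q \<and>
        (\<forall>y\<in>Q. u x y = 1) \<and> (\<forall>y\<in>topspace X - N x. u x y = 0)" ..
    from bchoice[OF this] obtain Q where "\<forall>x\<in>K. u x \<in> U \<and> openin X (Q x) \<and> x \<in> Q x \<and>
        (\<forall>y\<in>Q x. u x y = 1) \<and> (\<forall>y\<in>topspace X - N x. u x y = 0)" ..
    then have uQ: "\<And>x. x \<in> K \<Longrightarrow> u x \<in> U" "\<And>x. x \<in> K \<Longrightarrow> openin X (Q x)" "\<And>x. x \<in> K \<Longrightarrow> x \<in> Q x"
        "\<And>x y. x \<in> K \<Longrightarrow> y \<in> Q x \<Longrightarrow> u x y = 1"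
        "\<And>x y. x \<in> K \<Longrightarrow> y \<in> topspace X \<Longrightarrow> y \<notin> N x \<Longrightarrow> u x y = 0"
      by simp_all
    obtain F where F: "finite F" "F \<subseteq> K" "K \<subseteq> \<Union>(Q ` F)"
    proof -
      have "\<exists>\<F>. finite \<F> \<and> \<F> \<subseteq> Q ` K \<and> K \<subseteq> \<Union>\<F>"
        by (rule compactinD[OF K]) (use uQ(2,3) in auto)
      then show thesis using that by (metis finite_subset_image)
    qed
    obtain ps where ps: "set ps = F" "distinct ps" using finite_distinct_list[OF F(1)] by blast
    let ?us = "map u ps"
    define w where "w i = f ?us (?us ! i)" for i
    have us: "?us \<in> lists U" using uQ(1) F(2) ps(1) by (auto simp: subset_iff)
    have sum0: "(\<Sum>v\<leftarrow>?us. v x) = (\<Sum>i<length ps. u (ps ! i) x)" for x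
      by (simp add: sum_list_sum_nth atLeast0LessThan)
    have sumw: "(\<Sum>i<length ps. w i x) = inverse (max 1 (\<Sum>v\<leftarrow>?us. v x)) * (\<Sum>v\<leftarrow>?us. v x)" for x
    proof -
      have "(\<Sum>i<length ps. w i x) = (\<Sum>i<length ps. inverse (max 1 (\<Sum>v\<leftarrow>?us. v x)) * u (ps ! i) x)"
        by (simp add: w_def f_def)
      then show ?thesis by (simp only: sum_distrib_left[symmetric] sum0)
    qed
    have nn: "0 \<le> u p x" if "p \<in> K" for p x using U(3) uQ(1) that by blast
    have "(\<Sum>i<length ps. w i x) = 1" if "x \<in> K" for x
    proof -
      obtain p where p: "p \<in> F" "x \<in> Q p" using F(3) \<open>x \<in> K\<close> by blast
      then obtain j where j: "j < length ps" "ps ! j = p" using ps(1) by (metis in_set_conv_nth)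
      have "u (ps ! j) x \<le> (\<Sum>i<length ps. u (ps ! i) x)"
        using nn F(2) ps(1) j by (intro member_le_sum) (auto simp: subset_iff)
      then have "1 \<le> (\<Sum>v\<leftarrow>?us. v x)" unfolding sum0 using uQ(4)[of p x] p F(2) j by auto
      then show ?thesis unfolding sumw by simp
    qed
    moreover have "(\<Sum>i<length ps. w i x) \<le> 1" for x
    proof -
      have "inverse (max 1 t) * t \<le> 1" for t :: real by (simp add: max_def field_simps)
      then show ?thesis unfolding sumw .
    qed
    moreover have "w i \<in> P \<and> ps ! i \<in> K \<and> (\<forall>x\<in>topspace X - N (ps ! i). w i x = 0) \<and> (\<forall>x. 0 \<le> w i x)"
      if "i < length ps" for i
    proof -
      have i: "ps ! i \<in> K" using that F(2) ps(1) nth_mem by blast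
      have "w i \<in> P" unfolding w_def P_def using us i that uQ(1)
        by (intro image_eqI[of _ _ "(?us, ?us ! i)"]) auto
      then show ?thesis using i that uQ(5) nn[OF i] unfolding w_def f_def by auto
    qed
    ultimately show "\<exists>(n::nat) w p. (\<forall>i<n. w i \<in> P \<and> p i \<in> K \<and> (\<forall>x\<in>topspace X - N (p i). w i x = 0) \<and> (\<forall>x. 0 \<le> w i x)) \<and>
        (\<forall>x. (\<Sum>i<n. w i x) \<le> 1) \<and> (\<forall>x\<in>K. (\<Sum>i<n. w i x) = 1)"
      by (intro exI[of _ "length ps"] exI[of _ w] exI[of _ "\<lambda>i. ps ! i"]) auto
  qed
  then show ?thesis ..
qed

lemma partition_of_unityE:
  assumes "partition_family P" "compactin X K" "\<And>x. x \<in> K \<Longrightarrow> openin X (N x) \<and> x \<in> N x"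
  obtains n :: nat and w p where "\<And>i. i < n \<Longrightarrow> w i \<in> P" "\<And>i. i < n \<Longrightarrow> p i \<in> K"
    "\<And>i x. i < n \<Longrightarrow> x \<in> topspace X \<Longrightarrow> x \<notin> N (p i) \<Longrightarrow> w i x = 0" "\<And>i x. i < n \<Longrightarrow> 0 \<le> w i x"
    "\<And>x. (\<Sum>i<n. w i x) \<le> 1" "\<And>x. x \<in> K \<Longrightarrow> (\<Sum>i<n. w i x) = 1"
proof -
  have "\<exists>(n::nat) w p. (\<forall>i<n. w i \<in> P \<and> p i \<in> K \<and> (\<forall>x\<in>topspace X - N (p i). w i x = 0) \<and> (\<forall>x. 0 \<le> w i x)) \<and>
        (\<forall>x. (\<Sum>i<n. w i x) \<le> 1) \<and> (\<forall>x\<in>K. (\<Sum>i<n. w i x) = 1)"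
    using assms unfolding partition_family_def by simp
  then obtain n :: nat and w p where "\<forall>i<n. w i \<in> P \<and> p i \<in> K \<and> (\<forall>x\<in>topspace X - N (p i). w i x = 0) \<and> (\<forall>x. 0 \<le> w i x)"
      "\<forall>x. (\<Sum>i<n. w i x) \<le> 1" "\<forall>x\<in>K. (\<Sum>i<n. w i x) = 1"
    by (elim exE conjE) (rule that)
  then show thesis by (intro that[of n w p]) simp_all
qed

text \<open>Where the weights do not add up to 1 the number \<open>a\<close> has to be 0, so that
  \<open>a\<close> equals its product with the total weight in every case. The error is then a
  combination of the \<open>a - q i\<close> with total weight at most 1.\<close>

lemma convex_combination_close:
  fixes w :: "nat \<Rightarrow> 'a \<Rightarrow> real"
  assumes "\<And>i. i < n \<Longrightarrow> 0 \<le> w i x" "(\<Sum>i<n. w i x) \<le> 1" "a \<noteq> 0 \<Longrightarrow> (\<Sum>i<n. w i x) = 1"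
    "\<And>i. i < n \<Longrightarrow> w i x \<noteq> 0 \<Longrightarrow> \<bar>a - q i\<bar> \<le> e" "0 \<le> e"
  shows "\<bar>a - (\<Sum>i<n. w i x * q i)\<bar> \<le> e"
proof -
  have "a = (\<Sum>i<n. w i x) * a" using assms(3) by (cases "a = 0") auto
  then have "\<bar>a - (\<Sum>i<n. w i x * q i)\<bar> = \<bar>\<Sum>i<n. w i x * (a - q i)\<bar>"
    by (simp add: right_diff_distrib sum_subtractf sum_distrib_right)
  also have "\<dots> \<le> (\<Sum>i<n. \<bar>w i x * (a - q i)\<bar>)" by (rule sum_abs)
  also have "\<dots> \<le> (\<Sum>i<n. w i x * e)"
  proof (rule sum_mono)
    fix i assume "i \<in> {..<n}"
    then show "\<bar>w i x * (a - q i)\<bar> \<le> w i x * e"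
      using assms(1,4)[of i] by (cases "w i x = 0") (auto simp: abs_mult intro!: mult_left_mono)
  qed
  also have "\<dots> = (\<Sum>i<n. w i x) * e" by (simp add: sum_distrib_right)
  also have "\<dots> \<le> e" using mult_right_mono[OF assms(2,5)] by simp
  finally show ?thesis .
qed

text \<open>The weight \<open>\<eta>\<close> depends on \<open>g\<close> but not on
  \<open>e\<close>, so that the errors integrate to a multiple of \<open>e\<close> for every Radon
  measure. Sums and rational factors make \<open>D\<close> a countable rational vector space: linear
  relations that hold almost everywhere for each choice of members hold on all of \<open>D\<close>
  off one null set.\<close>

definition dense_family :: "('a \<Rightarrow> real) set \<Rightarrow> bool" where
  "dense_family D \<longleftrightarrow> countable D \<and> D \<subseteq> test_functions X \<and>
    (\<forall>d\<in>D. \<forall>d'\<in>D. (\<lambda>x. d x + d' x) \<in> D) \<and> (\<forall>d\<in>D. \<forall>q\<in>\<rat>. (\<lambda>x. q * d x) \<in> D) \<and>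
    (\<forall>g\<in>test_functions X. \<exists>\<eta>\<in>test_functions X. (\<forall>x. 0 \<le> \<eta> x \<and> \<eta> x \<le> 1) \<and>
        (\<forall>e>0. \<exists>d\<in>D. \<forall>x\<in>topspace X. \<bar>g x - d x\<bar> \<le> e * \<eta> x))"

lemma dense_family_exists: "\<exists>D. dense_family D"
proof -
  obtain P where pf: "partition_family P" using partition_of_unity by blast
  then have P: "countable P" "P \<subseteq> test_functions X" unfolding partition_family_def by auto
  define D where "D = (\<lambda>l x. \<Sum>(q, w)\<leftarrow>l. q * w x :: real) ` lists (\<rat> \<times> P)"
  have "dense_family D"
    unfolding dense_family_def
  proof (intro conjI ballI)
    show "countable D" unfolding D_def using P(1) by (auto simp: countable_rat)
    show "D \<subseteq> test_functions X"
    proof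
      fix d assume "d \<in> D"
      then obtain l where l: "l \<in> lists (\<rat> \<times> P)" "d = (\<lambda>x. \<Sum>(q, w)\<leftarrow>l. q * w x)" unfolding D_def by auto
      have "(\<lambda>x. \<Sum>(q, w)\<leftarrow>l. q * w x) \<in> test_functions X"
        using l(1) P(2) by (induction l) (auto intro!: tf_zero tf_add tf_cmult)
      then show "d \<in> test_functions X" using l(2) by simp
    qed
    show "(\<lambda>x. d x + d' x) \<in> D" if dd: "d \<in> D" "d' \<in> D" for d d'
    proof -
      obtain l l' where "l \<in> lists (\<rat> \<times> P)" "d = (\<lambda>x. \<Sum>(q, w)\<leftarrow>l. q * w x)"
        "l' \<in> lists (\<rat> \<times> P)" "d' = (\<lambda>x. \<Sum>(q, w)\<leftarrow>l'. q * w x)" using dd unfolding D_def by auto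
      then show ?thesis unfolding D_def by (intro image_eqI[of _ _ "l @ l'"]) auto
    qed
    show "(\<lambda>x. q * d x) \<in> D" if "d \<in> D" "q \<in> \<rat>" for d q
    proof -
      obtain l where l: "l \<in> lists (\<rat> \<times> P)" "d = (\<lambda>x. \<Sum>(q, w)\<leftarrow>l. q * w x)"
        using \<open>d \<in> D\<close> unfolding D_def by auto
      have "q * (\<Sum>(q, w)\<leftarrow>l. q * w x) = (\<Sum>(r, w)\<leftarrow>map (\<lambda>(r, w). (q * r, w)) l. r * w x)" for x
        by (induction l) (auto simp: algebra_simps)
      moreover have "map (\<lambda>(r, w). (q * r, w)) l \<in> lists (\<rat> \<times> P)"
        using l(1) \<open>q \<in> \<rat>\<close> by (induction l) auto
      ultimately show ?thesis unfolding D_def l(2) by (intro image_eqI) auto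
    qed
    fix g assume g: "g \<in> test_functions X"
    obtain K where K: "compactin X K" "\<And>x. x \<in> topspace X \<Longrightarrow> x \<notin> K \<Longrightarrow> g x = 0"
      using tf_supp[OF g] by blast
    obtain \<eta> Q where \<eta>: "\<eta> \<in> test_functions X" "\<And>x. 0 \<le> \<eta> x" "\<And>x. \<eta> x \<le> 1"
        "openin X Q" "K \<subseteq> Q" "\<And>x. x \<in> Q \<Longrightarrow> \<eta> x = 1"
      by (rule cutoff[OF K(1)]) (rule that)
    have "\<exists>d\<in>D. \<forall>x\<in>topspace X. \<bar>g x - d x\<bar> \<le> e * \<eta> x" if e: "0 < e" for e
    proof -
      \<comment> \<open>Intersecting with \<open>Q\<close> makes every weight vanish off
        \<open>Q\<close>, where \<open>\<eta>\<close> may be 0 and no error is allowed. Half of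
        \<open>e\<close> pays for the oscillation of \<open>g\<close>, half for rounding
        \<open>g (p i)\<close> to a rational.\<close>
      define N where "N x = Q \<inter> {y \<in> topspace X. g y \<in> ball (g x) (e/2)}" for x
      have N: "openin X (N x) \<and> x \<in> N x" if "x \<in> K" for x
      proof
        show "openin X (N x)" unfolding N_def
          using \<eta>(4) tf_cont[OF g] by (intro openin_Int openin_continuous_map_preimage) auto
        show "x \<in> N x" unfolding N_def using \<eta>(5) that compactin_subset_topspace[OF K(1)] e by auto
      qed
      obtain n :: nat and w p where w: "\<And>i. i < n \<Longrightarrow> w i \<in> P" "\<And>i. i < n \<Longrightarrow> p i \<in> K"
          "\<And>i x. i < n \<Longrightarrow> x \<in> topspace X \<Longrightarrow> x \<notin> N (p i) \<Longrightarrow> w i x = 0" "\<And>i x. i < n \<Longrightarrow> 0 \<le> w i x"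
          "\<And>x. (\<Sum>i<n. w i x) \<le> 1" "\<And>x. x \<in> K \<Longrightarrow> (\<Sum>i<n. w i x) = 1"
        by (rule partition_of_unityE[where N = N, OF pf K(1)], erule N) (rule that)
      have "\<exists>q\<in>\<rat>. \<bar>g x - q\<bar> < e/2" for x
      proof -
        obtain q where "q \<in> \<rat>" "g x - e/2 < q" "q < g x" using Rats_dense_in_real[of "g x - e/2" "g x"] e by auto
        then show ?thesis by (intro bexI[of _ q]) auto
      qed
      then obtain q where q: "\<And>x. q x \<in> \<rat>" "\<And>x. \<bar>g x - q x\<bar> < e/2" by metis
      define d where "d x = (\<Sum>i<n. w i x * q (p i))" for x
      have "d \<in> D"
        unfolding D_def
      proof (rule image_eqI)
        show "d = (\<lambda>x. \<Sum>(q, w)\<leftarrow>map (\<lambda>i. (q (p i), w i)) [0..<n]. q * w x)"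
          by (simp add: d_def fun_eq_iff o_def mult.commute interv_sum_list_conv_sum_set_nat atLeast0LessThan)
        show "map (\<lambda>i. (q (p i), w i)) [0..<n] \<in> lists (\<rat> \<times> P)" using q w by auto
      qed
      moreover have "\<bar>g x - d x\<bar> \<le> e * \<eta> x" if x: "x \<in> topspace X" for x
      proof (cases "x \<in> Q")
        case True
        have "\<bar>g x - d x\<bar> \<le> e"
          unfolding d_def
        proof (rule convex_combination_close)
          show "\<bar>g x - q (p i)\<bar> \<le> e" if "i < n" "w i x \<noteq> 0" for i
          proof -
            have "x \<in> N (p i)" using w(3) x that by blast
            then have "\<bar>g x - g (p i)\<bar> < e/2" unfolding N_def by (auto simp: dist_real_def abs_minus_commute)
            then show ?thesis using q(2)[of "p i"] by linarith
          qed
          show "(\<Sum>i<n. w i x) = 1" if "g x \<noteq> 0" using w(6)[of x] K(2)[OF x] that by blast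
      qed (use w e in auto)
        then show ?thesis using \<eta>(6)[OF True] by simp
      next
        case False
        then have "g x = 0" "d x = 0" using K \<eta>(5) w(3) x unfolding d_def N_def by (auto intro!: sum.neutral)
        then show ?thesis using e \<eta>(2)[of x] by simp
      qed
      ultimately show ?thesis by blast
    qed
    then show "\<exists>\<eta>\<in>test_functions X. (\<forall>x. 0 \<le> \<eta> x \<and> \<eta> x \<le> 1) \<and>
        (\<forall>e>0. \<exists>d\<in>D. \<forall>x\<in>topspace X. \<bar>g x - d x\<bar> \<le> e * \<eta> x)"
      using \<eta>(1-3) by blast
  qed
  then show ?thesis ..
qed

end

section \<open>Test functions on a product and their approximation by tensor products\<close>

locale lch2_pair = X: lch2 X + Y: lch2 Y for X :: "'a topology" and Y :: "'b topology"
begin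

sublocale P: lch2 "prod_topology X Y"
proof
  show "locally_compact_space (prod_topology X Y)"
    using X.lc Y.lc by (simp add: locally_compact_space_prod_topology)
  show "Hausdorff_space (prod_topology X Y)"
    using X.hd Y.hd by (simp add: Hausdorff_space_prod_topology)
  show "second_countable (prod_topology X Y)"
    using X.sc Y.sc by (rule second_countable_prod_topology)
qed

lemma tf_slice:
  assumes "\<psi> \<in> test_functions (prod_topology X Y)" "x \<in> topspace X"
  shows "(\<lambda>y. \<psi> (x, y)) \<in> test_functions Y"
proof -
  obtain M where M: "compactin (prod_topology X Y) M" "\<And>z. z \<in> topspace (prod_topology X Y) \<Longrightarrow> z \<notin> M \<Longrightarrow> \<psi> z = 0"
    using P.tf_supp[OF assms(1)] by blast
  have "continuous_map Y euclideanreal (\<psi> \<circ> (\<lambda>y. (x, y)))"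
    using P.tf_cont[OF assms(1)] assms(2)
    by (intro continuous_map_compose[of _ "prod_topology X Y"]) (auto intro!: continuous_map_pairedI)
  moreover have "compactin Y (snd ` M)"
    by (rule image_compactin[OF M(1)]) (rule continuous_map_snd)
  ultimately show ?thesis
    using M(2) assms(2) by (intro Y.tfI[of _ "snd ` M"]) (force simp: o_def)+
qed

lemma tf_tensor:
  assumes g: "g \<in> test_functions X" and k: "k \<in> test_functions Y"
  shows "(\<lambda>z. g (fst z) * k (snd z)) \<in> test_functions (prod_topology X Y)"
proof -
  obtain K where K: "compactin X K" "\<And>x. x \<in> topspace X \<Longrightarrow> x \<notin> K \<Longrightarrow> g x = 0"
    using X.tf_supp[OF g] by blast
  obtain L where L: "compactin Y L" "\<And>x. x \<in> topspace Y \<Longrightarrow> x \<notin> L \<Longrightarrow> k x = 0"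
    using Y.tf_supp[OF k] by blast
  have "continuous_map (prod_topology X Y) euclideanreal (g \<circ> fst)"
       "continuous_map (prod_topology X Y) euclideanreal (k \<circ> snd)"
    using X.tf_cont[OF g] Y.tf_cont[OF k]
    by (auto intro!: continuous_map_compose continuous_map_fst continuous_map_snd)
  then have "continuous_map (prod_topology X Y) euclideanreal (\<lambda>z. g (fst z) * k (snd z))"
    by (intro continuous_map_real_mult) (auto simp: o_def)
  then show ?thesis
    using K L by (intro P.tfI[of _ "K \<times> L"]) (auto simp: compactin_Times, blast+)
qed

lemma tf_tensor_approx:
  assumes \<psi>: "\<psi> \<in> test_functions (prod_topology X Y)"
  obtains \<eta> K where "\<eta> \<in> test_functions X" "\<And>x. 0 \<le> \<eta> x" "compactin X K"
    "\<And>x y. x \<in> topspace X \<Longrightarrow> y \<in> topspace Y \<Longrightarrow> x \<notin> K \<Longrightarrow> \<psi> (x, y) = 0"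
    "\<And>e. 0 < e \<Longrightarrow> \<exists>(n::nat) w p. (\<forall>i<n. w i \<in> test_functions X \<and> p i \<in> topspace X) \<and>
        (\<forall>x\<in>topspace X. \<forall>y\<in>topspace Y. \<bar>\<psi> (x, y) - (\<Sum>i<n. w i x * \<psi> (p i, y))\<bar> \<le> e * \<eta> x)"
proof -
  let ?XY = "prod_topology X Y"
  obtain M where M: "compactin ?XY M" "\<And>z. z \<in> topspace ?XY \<Longrightarrow> z \<notin> M \<Longrightarrow> \<psi> z = 0"
    using P.tf_supp[OF \<psi>] by blast
  define K L where "K = fst ` M" and "L = snd ` M"
  have K: "compactin X K" and L: "compactin Y L"
    unfolding K_def L_def using M(1) continuous_map_fst continuous_map_snd by (blast intro: image_compactin)+
  have KX: "K \<subseteq> topspace X" and LY: "L \<subseteq> topspace Y" using K L compactin_subset_topspace by blast+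
  have K0: "\<psi> (x, y) = 0" if "x \<in> topspace X" "y \<in> topspace Y" "x \<notin> K \<or> y \<notin> L" for x y
    using M(2)[of "(x, y)"] that unfolding K_def L_def by force
  obtain \<eta> Q where \<eta>: "\<eta> \<in> test_functions X" "\<And>x. 0 \<le> \<eta> x"
        "openin X Q" "K \<subseteq> Q" "\<And>x. x \<in> Q \<Longrightarrow> \<eta> x = 1"
    by (rule X.cutoff[OF K]) (rule that)
  obtain P where pf: "X.partition_family P" using X.partition_of_unity by blast
  then have P: "P \<subseteq> test_functions X" unfolding X.partition_family_def by auto
  show thesis
  proof (rule that[OF \<eta>(1,2) K])
    fix e :: real assume e: "0 < e"
    have "\<exists>U. openin X U \<and> x \<in> U \<and> U \<subseteq> Q \<and> (\<forall>x'\<in>U. \<forall>y\<in>topspace Y. \<bar>\<psi> (x', y) - \<psi> (x, y)\<bar> < e)" if x: "x \<in> K" for x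
    proof -
      have xX: "x \<in> topspace X" using x KX by blast
      have "continuous_map ?XY euclideanreal ((\<lambda>y. \<psi> (x, y)) \<circ> snd)"
        using Y.tf_cont[OF tf_slice[OF \<psi> xX]] by (intro continuous_map_compose[OF continuous_map_snd])
      then have "continuous_map ?XY euclideanreal (\<lambda>z. \<psi> z - \<psi> (x, snd z))"
        using P.tf_cont[OF \<psi>] by (intro continuous_map_diff) (auto simp: o_def)
      then have "openin ?XY {z \<in> topspace ?XY. \<psi> z - \<psi> (x, snd z) \<in> {-e<..<e}}"
        by (rule openin_continuous_map_preimage) auto
      moreover have "{x} \<times> L \<subseteq> {z \<in> topspace ?XY. \<psi> z - \<psi> (x, snd z) \<in> {-e<..<e}}"
        using xX LY e by auto
      ultimately obtain U V where UV: "openin X U" "x \<in> U" "L \<subseteq> V"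
          "U \<times> V \<subseteq> {z \<in> topspace ?XY. \<psi> z - \<psi> (x, snd z) \<in> {-e<..<e}}"
        using tube_lemma_right[OF _ L xX] by meson
      have "\<bar>\<psi> (x', y) - \<psi> (x, y)\<bar> < e" if "x' \<in> U" "y \<in> topspace Y" for x' y
      proof (cases "y \<in> L")
        case True
        then have "(x', y) \<in> U \<times> V" using UV(3) that by blast
        then have "\<psi> (x', y) - \<psi> (x, y) \<in> {-e<..<e}" using UV(4) by auto
        then show ?thesis by auto
      next
        case False
        then show ?thesis using K0[of _ y] that openin_subset[OF UV(1)] xX e by auto
      qed
      then show ?thesis using UV(1,2) \<eta>(3,4) x by (intro exI[of _ "U \<inter> Q"]) auto
    qed
    then obtain N where N: "\<And>x. x \<in> K \<Longrightarrow> openin X (N x) \<and> x \<in> N x" "\<And>x. x \<in> K \<Longrightarrow> N x \<subseteq> Q"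
        "\<And>x x' y. x \<in> K \<Longrightarrow> x' \<in> N x \<Longrightarrow> y \<in> topspace Y \<Longrightarrow> \<bar>\<psi> (x', y) - \<psi> (x, y)\<bar> < e"
      by metis
      obtain n :: nat and w p where w: "\<And>i. i < n \<Longrightarrow> w i \<in> P" "\<And>i. i < n \<Longrightarrow> p i \<in> K"
          "\<And>i x. i < n \<Longrightarrow> x \<in> topspace X \<Longrightarrow> x \<notin> N (p i) \<Longrightarrow> w i x = 0" "\<And>i x. i < n \<Longrightarrow> 0 \<le> w i x"
          "\<And>x. (\<Sum>i<n. w i x) \<le> 1" "\<And>x. x \<in> K \<Longrightarrow> (\<Sum>i<n. w i x) = 1"
        by (rule X.partition_of_unityE[where N = N, OF pf K], erule N(1)) (rule that)
    have "\<bar>\<psi> (x, y) - (\<Sum>i<n. w i x * \<psi> (p i, y))\<bar> \<le> e * \<eta> x" if xy: "x \<in> topspace X" "y \<in> topspace Y" for x y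
    proof (cases "x \<in> Q")
      case True
      have "\<bar>\<psi> (x, y) - (\<Sum>i<n. w i x * \<psi> (p i, y))\<bar> \<le> e"
      proof (rule X.convex_combination_close)
        show "\<bar>\<psi> (x, y) - \<psi> (p i, y)\<bar> \<le> e" if "i < n" "w i x \<noteq> 0" for i
          using N(3)[of "p i" x y] w(2,3) that xy by force
        show "(\<Sum>i<n. w i x) = 1" if "\<psi> (x, y) \<noteq> 0" using w(6)[of x] K0[OF xy] that by blast
      qed (use w e in auto)
      then show ?thesis using \<eta>(5)[OF True] by simp
    next
      case False
      then have "w i x = 0" if "i < n" for i using w(2,3) N(2) xy that by blast
      moreover have "\<psi> (x, y) = 0" using False \<eta>(4) K0 xy by blast
      ultimately show ?thesis using e \<eta>(2)[of x] by simp
    qed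
    then show "\<exists>(n::nat) w p. (\<forall>i<n. w i \<in> test_functions X \<and> p i \<in> topspace X) \<and>
        (\<forall>x\<in>topspace X. \<forall>y\<in>topspace Y. \<bar>\<psi> (x, y) - (\<Sum>i<n. w i x * \<psi> (p i, y))\<bar> \<le> e * \<eta> x)"
      using w(1,2) P KX by (intro exI[of _ n] exI[of _ w] exI[of _ p]) blast
  qed (use K0 in auto)
qed

end

section \<open>Young functions and their graph measures\<close>

lemma prob_topology_basic:
  "k \<in> test_functions Y \<Longrightarrow> open W \<Longrightarrow> openin (prob_topology Y) {\<nu> \<in> prob_radon Y. radon_integral Y \<nu> k \<in> W}"
  unfolding prob_topology_def by (rule topology_generated_by_Basis) auto

context lch
begin

lemma prob_radonD: "\<nu> \<in> prob_radon X \<Longrightarrow> radon X \<nu>"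
  unfolding prob_radon_def by unfold_locales auto

lemma prob_space_CM: "\<nu> \<in> prob_radon X \<Longrightarrow> emeasure (caratheodory_measure (topspace X) \<nu>) (space (caratheodory_measure (topspace X) \<nu>)) = 1"
proof -
  assume \<nu>: "\<nu> \<in> prob_radon X"
  interpret radon X \<nu> using prob_radonD[OF \<nu>] .
  have "topspace X \<in> caratheodory_sets (topspace X) \<nu>" using sets.top[of CM] by (simp add: sets_CM)
  then show ?thesis using \<nu> by (simp add: emeasure_CM prob_radon_def)
qed

lemma prob_diff_le:
  assumes \<nu>: "\<nu> \<in> prob_radon X" and g: "g \<in> test_functions X" "h \<in> test_functions X"
    and le: "\<And>x. x \<in> topspace X \<Longrightarrow> \<bar>g x - h x\<bar> \<le> c"
  shows "\<bar>radon_integral X \<nu> g - radon_integral X \<nu> h\<bar> \<le> c"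
proof -
  interpret radon X \<nu> using prob_radonD[OF \<nu>] .
  interpret prob: finite_measure CM by (rule finite_measureI) (simp only: prob_space_CM[OF \<nu>], simp)
  have "measure CM (space CM) = 1" using prob_space_CM[OF \<nu>] by (simp add: measure_def)
  then have c: "(\<integral>x. c \<partial>CM) = c" by simp
  have "\<bar>radon_integral X \<nu> g - radon_integral X \<nu> h\<bar> = \<bar>\<integral>x. g x - h x \<partial>CM\<bar>"
    using g by (simp add: ri_eq tf_integrable)
  also have "\<dots> \<le> (\<integral>x. \<bar>g x - h x\<bar> \<partial>CM)" by (rule integral_abs_bound)
  also have "\<dots> \<le> (\<integral>x. c \<partial>CM)"
  proof (rule integral_mono)
    show "integrable CM (\<lambda>x. \<bar>g x - h x\<bar>)"
      using g by (intro integrable_abs Bochner_Integration.integrable_diff tf_integrable)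
  qed (use le in auto)
  finally show ?thesis unfolding c .
qed

lemma ri_zero: "radon_integral X \<nu> (\<lambda>x. 0) = 0"
  by (simp add: radon_integral_def)

lemma prob_abs_le:
  assumes \<nu>: "\<nu> \<in> prob_radon X" and g: "g \<in> test_functions X"
    and le: "\<And>x. x \<in> topspace X \<Longrightarrow> \<bar>g x\<bar> \<le> c"
  shows "\<bar>radon_integral X \<nu> g\<bar> \<le> c"
  using prob_diff_le[OF \<nu> g tf_zero, of c] le by (simp add: ri_zero)

end

section \<open>Linearity and monotonicity of integrals of test functions\<close>

lemma (in radon) ri_add:
  "g \<in> test_functions X \<Longrightarrow> h \<in> test_functions X \<Longrightarrow>
    radon_integral X \<phi> (\<lambda>x. g x + h x) = radon_integral X \<phi> g + radon_integral X \<phi> h"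
  by (simp add: ri_eq tf_integrable)

lemma (in radon) ri_diff:
  "g \<in> test_functions X \<Longrightarrow> h \<in> test_functions X \<Longrightarrow>
    radon_integral X \<phi> (\<lambda>x. g x - h x) = radon_integral X \<phi> g - radon_integral X \<phi> h"
  by (simp add: ri_eq tf_integrable)

lemma (in radon) ri_cmult: "radon_integral X \<phi> (\<lambda>x. c * g x) = c * radon_integral X \<phi> g"
  by (simp add: ri_eq)

lemma (in radon) ri_mono:
  assumes "g \<in> test_functions X" "h \<in> test_functions X" "\<And>x. x \<in> topspace X \<Longrightarrow> g x \<le> h x"
  shows "radon_integral X \<phi> g \<le> radon_integral X \<phi> h"
  unfolding ri_eq using assms by (intro integral_mono tf_integrable) auto

lemma (in radon) ri_sum:
  assumes "\<And>i. i \<in> I \<Longrightarrow> g i \<in> test_functions X"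
  shows "radon_integral X \<phi> (\<lambda>x. \<Sum>i\<in>I. g i x) = (\<Sum>i\<in>I. radon_integral X \<phi> (g i))"
  unfolding ri_eq using assms by (intro Bochner_Integration.integral_sum tf_integrable)

locale young = lch2_pair X Y + mu: radon X \<mu>
  for X :: "'a topology" and Y :: "'b topology" and \<mu> +
  fixes f :: "'a \<Rightarrow> 'b set \<Rightarrow> ennreal"
  assumes yf: "young_function X Y \<mu> f"
begin

abbreviation "XY \<equiv> prod_topology X Y"

abbreviation pair :: "'a \<Rightarrow> ('b \<Rightarrow> real) \<Rightarrow> real" where "pair x k \<equiv> radon_integral Y (f x) k"

lemma AE_prob: "AE x in mu.CM. f x \<in> prob_radon Y"
  using yf unfolding young_function_def mu.AE_CM_iff by auto

lemma young_preimage: "openin (prob_topology Y) W \<Longrightarrow> {x \<in> topspace X. f x \<in> W} \<in> sets mu.CM"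
  using yf unfolding young_function_def mu.sets_CM by auto

lemma prob_radon_sets: "{x \<in> topspace X. f x \<in> prob_radon Y} \<in> sets mu.CM"
proof -
  have "{x \<in> topspace X. f x \<notin> prob_radon Y} \<in> sets mu.CM"
    using yf unfolding young_function_def mu.sets_CM by (intro mu.null_carath) auto
  then have "space mu.CM - {x \<in> topspace X. f x \<notin> prob_radon Y} \<in> sets mu.CM" by (rule sets.compl_sets)
  moreover have "space mu.CM - {x \<in> topspace X. f x \<notin> prob_radon Y} = {x \<in> topspace X. f x \<in> prob_radon Y}" by auto
  ultimately show ?thesis by simp
qed

text \<open>Open sets of \<open>prob_topology Y\<close> contain probability measures only, so the
  hypothesis on preimages is silent about the other points; the value 0 fills the gap, and
  completeness removes it again in \<open>pair_slice_measurable\<close>.\<close>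

lemma pair_measurable:
  assumes k: "k \<in> test_functions Y"
  shows "(\<lambda>x. if f x \<in> prob_radon Y then pair x k else 0) \<in> borel_measurable mu.CM"
proof (rule borel_measurableI)
  fix W :: "real set" assume W: "open W"
  let ?A = "{x \<in> topspace X. f x \<in> {\<nu> \<in> prob_radon Y. radon_integral Y \<nu> k \<in> W}}"
  let ?N = "space mu.CM - {x \<in> topspace X. f x \<in> prob_radon Y}"
  have 1: "?A \<in> sets mu.CM" by (rule young_preimage[OF prob_topology_basic[OF k W]])
  have 2: "?N \<in> sets mu.CM" by (rule sets.compl_sets[OF prob_radon_sets])
  have "(\<lambda>x. if f x \<in> prob_radon Y then pair x k else 0) -` W \<inter> space mu.CM
      = ?A \<union> (if 0 \<in> W then ?N else {})" by (auto split: if_splits)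
  moreover have "?A \<union> (if 0 \<in> W then ?N else {}) \<in> sets mu.CM"
    by (cases "0 \<in> W") (simp_all only: if_True if_False Un_empty_right sets.Un 1 2)
  ultimately show "(\<lambda>x. if f x \<in> prob_radon Y then pair x k else 0) -` W \<inter> space mu.CM \<in> sets mu.CM"
    by (simp only:)
qed

text \<open>The integrand changes with \<open>x\<close>, so that no single function on the space of
  probability measures is composed with \<open>f\<close>. Tensor approximations separate the
  variables and exhibit the fibre integral as a pointwise limit of measurable functions.\<close>

lemma pair_slice_measurable:
  assumes \<psi>: "\<psi> \<in> test_functions XY"
  shows "(\<lambda>x. pair x (\<lambda>y. \<psi> (x, y))) \<in> borel_measurable mu.CM"
proof -
  obtain \<eta> where \<eta>: "\<eta> \<in> test_functions X" "\<And>x. 0 \<le> \<eta> x"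
    and approx: "\<And>e. 0 < e \<Longrightarrow> \<exists>(n::nat) w p. (\<forall>i<n. w i \<in> test_functions X \<and> p i \<in> topspace X) \<and>
        (\<forall>x\<in>topspace X. \<forall>y\<in>topspace Y. \<bar>\<psi> (x, y) - (\<Sum>i<n. w i x * \<psi> (p i, y))\<bar> \<le> e * \<eta> x)"
    by (rule tf_tensor_approx[OF \<psi>]) (rule that)
  define I where "I x = (if f x \<in> prob_radon Y then pair x (\<lambda>y. \<psi> (x, y)) else 0)" for x
  have "\<exists>s\<in>borel_measurable mu.CM. \<forall>x\<in>topspace X. \<bar>I x - s x\<bar> \<le> e * \<eta> x" if e: "0 < e" for e
  proof -
    obtain n :: nat and w p where w: "\<forall>i<n. w i \<in> test_functions X \<and> p i \<in> topspace X"
      "\<forall>x\<in>topspace X. \<forall>y\<in>topspace Y. \<bar>\<psi> (x, y) - (\<Sum>i<n. w i x * \<psi> (p i, y))\<bar> \<le> e * \<eta> x"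
      using approx[OF e] by auto
    define s where "s x = (\<Sum>i<n. w i x * (if f x \<in> prob_radon Y then pair x (\<lambda>y. \<psi> (p i, y)) else 0))" for x
    have sl: "(\<lambda>y. \<psi> (p i, y)) \<in> test_functions Y" if "i < n" for i
      using w(1) that by (intro tf_slice[OF \<psi>]) auto
    have "s \<in> borel_measurable mu.CM"
      unfolding s_def using w(1) sl
      by (intro borel_measurable_sum borel_measurable_times mu.tf_measurable pair_measurable) auto
    moreover have "\<bar>I x - s x\<bar> \<le> e * \<eta> x" if x: "x \<in> topspace X" for x
    proof (cases "f x \<in> prob_radon Y")
      case True
      interpret fx: radon Y "f x" using Y.prob_radonD[OF True] .
      have "s x = pair x (\<lambda>y. \<Sum>i<n. w i x * \<psi> (p i, y))"
        unfolding s_def using True sl by (subst fx.ri_sum) (auto intro: Y.tf_cmult simp: fx.ri_cmult)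
      moreover have "\<bar>pair x (\<lambda>y. \<psi> (x, y)) - pair x (\<lambda>y. \<Sum>i<n. w i x * \<psi> (p i, y))\<bar> \<le> e * \<eta> x"
        using w(2) x sl by (intro Y.prob_diff_le[OF True] tf_slice[OF \<psi> x] Y.tf_sum Y.tf_cmult) auto
      ultimately show ?thesis using True by (simp add: I_def)
    next
      case False
      then show ?thesis using e \<eta>(2)[of x] by (simp add: I_def s_def)
    qed
    ultimately show ?thesis by blast
  qed
  then have "\<exists>s\<in>borel_measurable mu.CM. \<forall>x\<in>topspace X. \<bar>I x - s x\<bar> \<le> inverse (real (Suc j)) * \<eta> x" for j
    by simp
  then obtain s where s: "\<And>j. s j \<in> borel_measurable mu.CM"
      "\<And>j x. x \<in> topspace X \<Longrightarrow> \<bar>I x - s j x\<bar> \<le> inverse (real (Suc j)) * \<eta> x" by metis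
  have lim: "(\<lambda>j. s j x) \<longlonglongrightarrow> I x" if "x \<in> space mu.CM" for x
  proof -
    have lim0: "(\<lambda>j. inverse (real (Suc j)) * \<eta> x) \<longlonglongrightarrow> 0"
      by (rule tendsto_mult_left_zero[OF LIMSEQ_inverse_real_of_nat])
    have "norm (s j x - I x) \<le> inverse (real (Suc j)) * \<eta> x" for j
      unfolding real_norm_def by (subst abs_minus_commute) (rule s(2), use that in simp)
    then have "(\<lambda>j. s j x - I x) \<longlonglongrightarrow> 0"
      by (intro Lim_null_comparison[OF _ lim0] always_eventually allI)
    then show ?thesis by (simp add: LIM_zero_iff)
  qed
  have "I \<in> borel_measurable mu.CM" using lim s(1) by (rule borel_measurable_LIMSEQ_real)
  moreover have "AE x in mu.CM. I x = pair x (\<lambda>y. \<psi> (x, y))"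
    using AE_prob by eventually_elim (simp add: I_def)
  ultimately show ?thesis by (rule mu.borel_measurable_CM_AE)
qed

lemma pair_slice_integrable:
  assumes \<psi>: "\<psi> \<in> test_functions XY"
  shows "integrable mu.CM (\<lambda>x. pair x (\<lambda>y. \<psi> (x, y)))"
proof -
  obtain K where K: "compactin X K" "\<And>x y. x \<in> topspace X \<Longrightarrow> y \<in> topspace Y \<Longrightarrow> x \<notin> K \<Longrightarrow> \<psi> (x, y) = 0"
    by (rule tf_tensor_approx[OF \<psi>]) (rule that)
  obtain C where C: "\<And>z. z \<in> topspace XY \<Longrightarrow> \<bar>\<psi> z\<bar> \<le> C" by (rule P.tf_bounded[OF \<psi>]) (rule that)
  have "AE x in mu.CM. \<bar>pair x (\<lambda>y. \<psi> (x, y))\<bar> \<le> C * indicator K x"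
  proof (rule AE_mp[OF AE_prob AE_I2], intro impI)
    fix x assume x: "x \<in> space mu.CM" "f x \<in> prob_radon Y"
    show "\<bar>pair x (\<lambda>y. \<psi> (x, y))\<bar> \<le> C * indicator K x"
      using x C K(2) by (intro Y.prob_abs_le[OF x(2)] tf_slice[OF \<psi>]) (auto simp: indicator_def)
  qed
  then show ?thesis by (rule mu.supp_integrable[OF pair_slice_measurable[OF \<psi>] K(1)])
qed

lemma graph_exists:
  "\<exists>\<gamma>. radon XY \<gamma> \<and> (\<forall>\<psi>\<in>test_functions XY.
      radon_integral XY \<gamma> \<psi> = radon_integral X \<mu> (\<lambda>x. pair x (\<lambda>y. \<psi> (x, y))))"
proof -
  let ?L = "\<lambda>\<psi>. radon_integral X \<mu> (\<lambda>x. pair x (\<lambda>y. \<psi> (x, y)))"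
  interpret L: riesz XY ?L
  proof
    fix g h assume gh: "g \<in> test_functions XY" "h \<in> test_functions XY"
    have "?L (\<lambda>z. g z + h z) = (\<integral>x. pair x (\<lambda>y. g (x, y)) + pair x (\<lambda>y. h (x, y)) \<partial>mu.CM)"
      unfolding mu.ri_eq
    proof (rule integral_cong_AE)
      show "AE x in mu.CM. pair x (\<lambda>y. g (x, y) + h (x, y)) = pair x (\<lambda>y. g (x, y)) + pair x (\<lambda>y. h (x, y))"
      proof (rule AE_mp[OF AE_prob AE_I2], intro impI)
        fix x assume x: "x \<in> space mu.CM" "f x \<in> prob_radon Y"
        interpret fx: radon Y "f x" using Y.prob_radonD[OF x(2)] .
        show "pair x (\<lambda>y. g (x, y) + h (x, y)) = pair x (\<lambda>y. g (x, y)) + pair x (\<lambda>y. h (x, y))"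
          using x gh by (intro fx.ri_add tf_slice) auto
      qed
    qed (use gh pair_slice_measurable[OF P.tf_add[OF gh]] in
        \<open>auto intro!: borel_measurable_add pair_slice_measurable\<close>)
    also have "\<dots> = ?L g + ?L h"
      unfolding mu.ri_eq using gh by (intro Bochner_Integration.integral_add pair_slice_integrable)
    finally show "?L (\<lambda>z. g z + h z) = ?L g + ?L h" .
  next
    fix g :: "'a \<times> 'b \<Rightarrow> real" and c :: real assume g: "g \<in> test_functions XY"
    have "?L (\<lambda>z. c * g z) = (\<integral>x. c * pair x (\<lambda>y. g (x, y)) \<partial>mu.CM)"
      unfolding mu.ri_eq
    proof (rule integral_cong_AE)
      show "AE x in mu.CM. pair x (\<lambda>y. c * g (x, y)) = c * pair x (\<lambda>y. g (x, y))"
      proof (rule AE_mp[OF AE_prob AE_I2], intro impI)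
        fix x assume x: "x \<in> space mu.CM" "f x \<in> prob_radon Y"
        interpret fx: radon Y "f x" using Y.prob_radonD[OF x(2)] .
        show "pair x (\<lambda>y. c * g (x, y)) = c * pair x (\<lambda>y. g (x, y))"
          by (rule fx.ri_cmult)
      qed
    qed (use g pair_slice_measurable[OF P.tf_cmult[OF g]] in
        \<open>auto intro!: borel_measurable_times pair_slice_measurable\<close>)
    also have "\<dots> = c * ?L g" unfolding mu.ri_eq by simp
    finally show "?L (\<lambda>z. c * g z) = c * ?L g" .
  next
    fix g :: "'a \<times> 'b \<Rightarrow> real" assume g: "g \<in> test_functions XY" "\<And>z. z \<in> topspace XY \<Longrightarrow> 0 \<le> g z"
    show "0 \<le> ?L g"
      unfolding mu.ri_eq
    proof (rule integral_nonneg_AE, rule AE_mp[OF AE_prob AE_I2], intro impI)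
      fix x assume x: "x \<in> space mu.CM" "f x \<in> prob_radon Y"
      interpret fx: radon Y "f x" using Y.prob_radonD[OF x(2)] .
      show "0 \<le> pair x (\<lambda>y. g (x, y))"
        unfolding fx.ri_eq using x g(2) by (intro integral_nonneg_AE AE_I2) auto
    qed
  qed
  show ?thesis by (rule L.riesz_representation)
qed

abbreviation "GM \<equiv> graph_measure X Y \<mu> f"

text \<open>\<open>THE\<close> yields the intended measure because \<open>graph_exists\<close>
  provides one and \<open>radon_measure_eq\<close> rules out a second.\<close>

lemma graph_measure: "radon XY GM"
  "\<psi> \<in> test_functions XY \<Longrightarrow> radon_integral XY GM \<psi> = radon_integral X \<mu> (\<lambda>x. pair x (\<lambda>y. \<psi> (x, y)))"
proof -
  let ?P = "\<lambda>\<gamma>. radon_measure XY \<gamma> \<and> (\<forall>\<psi>\<in>test_functions XY.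
      radon_integral XY \<gamma> \<psi> = radon_integral X \<mu> (\<lambda>x. pair x (\<lambda>y. \<psi> (x, y))))"
  have r: "radon_measure XY \<gamma> \<longleftrightarrow> radon XY \<gamma>" for \<gamma>
    by (auto intro: radon.intro P.lch_axioms radon_axioms.intro dest: radon.rm)
  obtain \<gamma> where \<gamma>: "?P \<gamma>" using graph_exists unfolding r by blast
  have "?P GM"
    unfolding graph_measure_def
  proof (rule theI[of ?P])
    show "\<gamma>' = \<gamma>" if "?P \<gamma>'" for \<gamma>'
      using that \<gamma> unfolding r by (intro radon_measure_eq) auto
  qed (rule \<gamma>)
  then show "radon XY GM" "\<psi> \<in> test_functions XY \<Longrightarrow> radon_integral XY GM \<psi> = radon_integral X \<mu> (\<lambda>x. pair x (\<lambda>y. \<psi> (x, y)))"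
    unfolding r by auto
qed

end

section \<open>Densities of functionals dominated by a Radon measure\<close>

text \<open>The supports of a countable family of bumps are compact, and each point lies in one of
  them because some bump is 1 there.\<close>

lemma (in lch2) sigma_compact:
  obtains K :: "nat \<Rightarrow> 'a set" where "\<And>n. compactin X (K n)" "(\<Union>n. K n) = topspace X"
proof -
  obtain U where U: "countable U" "U \<subseteq> test_functions X" 
    "\<And>x W. openin X W \<Longrightarrow> x \<in> W \<Longrightarrow>
      \<exists>u\<in>U. \<exists>Q. openin X Q \<and> x \<in> Q \<and> (\<forall>y\<in>Q. u y = 1) \<and> (\<forall>y\<in>topspace X - W. u y = 0)"
    by (rule bumps) (rule that)
  \<comment> \<open>Adding the zero function keeps the set nonempty, which
    \<open>from_nat_into\<close> needs; its support is empty.\<close>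
  let ?U = "insert (\<lambda>x. 0) U"
  define s where "s u = X closure_of {x \<in> topspace X. u x \<noteq> (0::real)}" for u
  have c: "countable ?U" using U(1) by simp
  have K: "compactin X (s (from_nat_into ?U n))" for n
    using from_nat_into[of ?U n] U(2) tf_zero unfolding s_def test_functions_def by auto
  have "x \<in> (\<Union>n. s (from_nat_into ?U n))" if x: "x \<in> topspace X" for x
  proof -
    obtain u where u: "u \<in> U" "u x = 1" using U(3)[OF openin_topspace x] by auto
    then have "x \<in> s u"
      unfolding s_def using x closure_of_subset[of "{x \<in> topspace X. u x \<noteq> 0}" X] by auto
    then show ?thesis using from_nat_into_surj[OF c, of u] u(1) by auto
  qed
  moreover have "(\<Union>n. s (from_nat_into ?U n)) \<subseteq> topspace X"
    using K compactin_subset_topspace by blast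
  ultimately have "(\<Union>n. s (from_nat_into ?U n)) = topspace X" by blast
  then show thesis using K by (intro that[of "\<lambda>n. s (from_nat_into ?U n)"])
qed

locale radon2 = lch2 X + radon X \<phi> for X :: "'a topology" and \<phi>
begin

text \<open>Inner regularity is available for open sets only, so \<open>K\<close> exhausts the open
  hull \<open>W\<close> and need not lie in \<open>A\<close>. A Urysohn function between
  \<open>K\<close> and \<open>W\<close> differs from the indicator of \<open>A\<close> at most by
  the two errors, each of mass at most \<open>e / 2\<close>.\<close>

lemma tf_approx_indicator:
  assumes A: "A \<in> sets CM" "\<phi> A < \<infinity>" and e: "0 < e"
  obtains g where "g \<in> test_functions X" "\<And>x. 0 \<le> g x" "\<And>x. g x \<le> 1" "(\<integral>x. \<bar>g x - indicator A x\<bar> \<partial>CM) \<le> e"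
proof -
  have AX: "A \<subseteq> topspace X" using sets.sets_into_space[OF A(1)] by simp
  have "(INF W\<in>{W. openin X W \<and> A \<subseteq> W}. \<phi> W) < \<phi> A + ennreal (e/2)"
    using A(2) e rm_outer[OF AX] ennreal_add_left_cancel_less[of "\<phi> A" 0 "ennreal (e/2)"]
    by (simp add: less_top[symmetric])
  then obtain W where W: "openin X W" "A \<subseteq> W" "\<phi> W < \<phi> A + ennreal (e/2)"
    unfolding INF_less_iff by auto
  have Wf: "\<phi> W < \<infinity>" using W(3) A(2) by (metis ennreal_add_eq_top ennreal_neq_top infinity_ennreal_def less_top order_less_trans top.not_eq_extremum)
  have "\<exists>K. compactin X K \<and> K \<subseteq> W \<and> \<phi> W \<le> \<phi> K + ennreal (e/2)"
  proof (cases "\<phi> W = 0")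
    case True
    then show ?thesis by (intro exI[of _ "{}"]) auto
  next
    case False
    then have "\<phi> W - ennreal (e/2) < \<phi> W"
      using Wf e by (intro ennreal_between) (auto simp: less_top[symmetric] zero_less_iff_neq_zero)
    then have "\<phi> W - ennreal (e/2) < (SUP K\<in>{K. compactin X K \<and> K \<subseteq> W}. \<phi> K)"
      using rm_inner[OF W(1)] by simp
    then obtain K where K: "compactin X K" "K \<subseteq> W" "\<phi> W - ennreal (e/2) < \<phi> K" unfolding less_SUP_iff by auto
    have "\<phi> W \<le> \<phi> K + ennreal (e/2)"
    proof (cases "ennreal (e/2) \<le> \<phi> W")
      case True
      then have "\<phi> W = ennreal (e/2) + (\<phi> W - ennreal (e/2))" by (simp add: add_diff_inverse_ennreal)
      also have "\<dots> \<le> ennreal (e/2) + \<phi> K" using K(3) by (intro add_left_mono) simp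
      finally show ?thesis by (simp add: add.commute)
    qed (simp add: add_increasing)
    then show ?thesis using K(1,2) by blast
  qed
  then obtain K where K: "compactin X K" "K \<subseteq> W" "\<phi> W \<le> \<phi> K + ennreal (e/2)" by blast
  obtain g Q K' where g: "g \<in> test_functions X" "\<And>x. 0 \<le> g x" "\<And>x. g x \<le> 1"
    "openin X Q" "K \<subseteq> Q" "\<And>x. x \<in> Q \<Longrightarrow> g x = 1"
    "compactin X K'" "K' \<subseteq> W" "\<And>x. x \<in> topspace X \<Longrightarrow> x \<notin> K' \<Longrightarrow> g x = 0"
    by (rule urysohn[OF K(1) W(1) K(2)]) (rule that)
  have S: "W \<in> sets CM" "K \<in> sets CM" "A \<in> sets CM" using W K A rm_open rm_compact_sets by auto
  have Kf: "\<phi> K < \<infinity>" using rm_compact K by blast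
  have m: "measure CM W \<le> measure CM A + e/2" "measure CM W \<le> measure CM K + e/2"
  proof -
    have "ennreal (measure CM W) \<le> ennreal (measure CM A + e/2)"
      using W(3) e measure_CM[OF S(1) Wf] measure_CM[OF S(3) A(2)] by simp
    then show "measure CM W \<le> measure CM A + e/2" by (rule ennreal_le_iff[THEN iffD1, rotated]) (use e in simp)
    have "ennreal (measure CM W) \<le> ennreal (measure CM K + e/2)"
      using K(3) e measure_CM[OF S(1) Wf] measure_CM[OF S(2) Kf] by simp
    then show "measure CM W \<le> measure CM K + e/2" by (rule ennreal_le_iff[THEN iffD1, rotated]) (use e in simp)
  qed
  have int: "integrable CM (indicator W :: 'a \<Rightarrow> real)" "integrable CM (indicator K :: 'a \<Rightarrow> real)"
      "integrable CM (indicator A :: 'a \<Rightarrow> real)"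
    using S Wf Kf A(2) by (auto simp: emeasure_CM simp flip: sets_CM intro!: integrable_real_indicator)
  have "(\<integral>x. \<bar>g x - indicator A x\<bar> \<partial>CM) \<le> (\<integral>x. (indicator W x - indicator K x) + (indicator W x - indicator A x) \<partial>CM)"
  proof (rule integral_mono)
    show "integrable CM (\<lambda>x. \<bar>g x - indicator A x\<bar>)" using int tf_integrable[OF g(1)] by auto
    show "integrable CM (\<lambda>x. (indicator W x - indicator K x) + (indicator W x - indicator A x) :: real)" using int by auto
    fix x assume x: "x \<in> space CM"
    have "x \<in> K \<Longrightarrow> g x = 1" using g(5,6) by auto
    moreover have "x \<notin> W \<Longrightarrow> g x = 0" using g(8) g(9)[of x] x by auto
    ultimately show "\<bar>g x - indicator A x\<bar> \<le> (indicator W x - indicator K x) + (indicator W x - indicator A x)"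
      using W(2) K(2) g(2)[of x] g(3)[of x] by (auto simp: indicator_def)
  qed
  also have "\<dots> = (measure CM W - measure CM K) + (measure CM W - measure CM A)"
    using int S[THEN sets.sets_into_space] by (simp add: Int_absorb2)
  also have "\<dots> \<le> e" using m by simp
  finally show thesis using g(1-3) by (intro that) auto
qed

lemma mult_bounded_integrable:
  assumes "h \<in> borel_measurable CM" "\<And>x. \<bar>h x\<bar> \<le> (C::real)" "integrable CM g"
  shows "integrable CM (\<lambda>x. g x * h x)"
proof (rule Bochner_Integration.integrable_bound[of _ "\<lambda>x. C * g x"])
  have "\<bar>g x * h x\<bar> \<le> \<bar>C * g x\<bar>" for x
  proof -
    have "\<bar>g x\<bar> * \<bar>h x\<bar> \<le> \<bar>g x\<bar> * \<bar>C\<bar>"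
      using assms(2)[of x] by (intro mult_left_mono) auto
    then show ?thesis by (simp add: abs_mult mult.commute)
  qed
  then show "AE x in CM. norm (g x * h x) \<le> norm (C * g x)" by auto
qed (use assms in auto)

text \<open>If \<open>h\<close> were negative on a non-null set, test functions close to the
  indicator of its part in some \<open>K n\<close> would have a negative integral against
  \<open>h\<close>. Boundedness of \<open>h\<close> converts closeness in the mean into closeness of
  these integrals; the sets \<open>K n\<close> provide finite measure.\<close>

lemma AE_nonneg_if_tf_nonneg:
  assumes h: "h \<in> borel_measurable CM" "\<And>x. \<bar>h x\<bar> \<le> (C::real)"
    and nn: "\<And>g. g \<in> test_functions X \<Longrightarrow> (\<And>x. 0 \<le> g x) \<Longrightarrow> 0 \<le> (\<integral>x. g x * h x \<partial>CM)"
  shows "AE x in CM. 0 \<le> h x"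
proof -
  obtain K where K: "\<And>n::nat. compactin X (K n)" "(\<Union>n. K n) = topspace X"
    by (rule sigma_compact) (rule that)
  have C: "0 \<le> C" using h(2)[of undefined] by linarith
  have "AE x in CM. x \<in> K n \<longrightarrow> 0 \<le> h x" for n
  proof -
    define A where "A = {x \<in> space CM. h x < 0} \<inter> K n"
    have A: "A \<in> sets CM" unfolding A_def using h(1) rm_compact_sets[OF K(1)[of n]] by measurable
    have Af: "\<phi> A < \<infinity>"
      using out_mono[of A "K n"] rm_compact[OF K(1)[of n]] unfolding A_def by (meson inf_le2 le_less_trans)
    have iA: "integrable CM (indicator A :: 'a \<Rightarrow> real)"
      using A Af by (auto simp: emeasure_CM simp flip: sets_CM intro!: integrable_real_indicator)
    have ih: "integrable CM (\<lambda>x. indicator A x * h x)"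
      using h iA by (rule mult_bounded_integrable)
    have "- (C * e) \<le> (\<integral>x. indicator A x * h x \<partial>CM)" if e: "0 < e" for e
    proof -
      obtain g where g: "g \<in> test_functions X" "\<And>x. 0 \<le> g x" "(\<integral>x. \<bar>g x - indicator A x\<bar> \<partial>CM) \<le> e"
        by (rule tf_approx_indicator[OF A Af e]) (rule that)
      have ig: "integrable CM (\<lambda>x. g x * h x)"
        using h tf_integrable[OF g(1)] by (rule mult_bounded_integrable)
      have "(\<integral>x. g x * h x \<partial>CM) - (\<integral>x. indicator A x * h x \<partial>CM) = (\<integral>x. g x * h x - indicator A x * h x \<partial>CM)"
        using ig ih by simp
      also have "\<dots> \<le> (\<integral>x. C * \<bar>g x - indicator A x\<bar> \<partial>CM)"
      proof (rule integral_mono)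
        fix x
        have "(g x - indicator A x) * h x \<le> \<bar>g x - indicator A x\<bar> * \<bar>h x\<bar>"
          by (metis abs_ge_self abs_mult)
        also have "\<dots> \<le> \<bar>g x - indicator A x\<bar> * C" using h(2) by (intro mult_left_mono) auto
        finally show "g x * h x - indicator A x * h x \<le> C * \<bar>g x - indicator A x\<bar>" by (simp add: algebra_simps)
      qed (use ig ih iA tf_integrable[OF g(1)] in auto)
      also have "\<dots> \<le> C * e" using g(3) C by (simp add: mult_left_mono)
      finally show ?thesis using nn[OF g(1,2)] by linarith
    qed
    note le = this
    have "0 \<le> (\<integral>x. indicator A x * h x \<partial>CM)"
    proof (rule field_le_epsilon)
      fix e :: real assume "0 < e"
      have "C * (e / (C + 1)) \<le> e" using C \<open>0 < e\<close> by (simp add: field_simps)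
      then show "0 \<le> (\<integral>x. indicator A x * h x \<partial>CM) + e"
        using le[of "e / (C + 1)"] C \<open>0 < e\<close> by simp
    qed
    then have "(\<integral>x. - (indicator A x * h x) \<partial>CM) = 0 \<or> (\<integral>x. - (indicator A x * h x) \<partial>CM) < 0" by auto
    moreover have nA: "AE x in CM. 0 \<le> - (indicator A x * h x)"
      by (rule AE_I2) (auto simp: A_def indicator_def)
    ultimately have "(\<integral>x. - (indicator A x * h x) \<partial>CM) = 0"
      using integral_nonneg_AE[OF nA] by linarith
    then have "AE x in CM. - (indicator A x * h x) = 0"
      using integral_nonneg_eq_0_iff_AE[OF _ nA] ih by auto
    then show ?thesis
      by (rule AE_mp) (auto simp: A_def indicator_def)
  qed
  then have "AE x in CM. \<forall>n. x \<in> K n \<longrightarrow> 0 \<le> h x" unfolding AE_all_countable ..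
  then show ?thesis by (rule AE_mp) (use K(2) in \<open>auto intro!: AE_I2\<close>)
qed

text \<open>The representing measure \<open>\<nu>\<close> of \<open>l\<close> is at most
  \<open>\<phi>\<close>, hence absolutely continuous with a density at most 1.\<close>

lemma functional_density:
  assumes add: "\<And>g h. g \<in> test_functions X \<Longrightarrow> h \<in> test_functions X \<Longrightarrow> l (\<lambda>x. g x + h x) = l g + l h"
    and cmult: "\<And>g c. g \<in> test_functions X \<Longrightarrow> l (\<lambda>x. c * g x) = c * l g"
    and pos: "\<And>g. g \<in> test_functions X \<Longrightarrow> (\<And>x. x \<in> topspace X \<Longrightarrow> 0 \<le> g x) \<Longrightarrow> 0 \<le> l g"
    and le: "\<And>g. g \<in> test_functions X \<Longrightarrow> (\<And>x. 0 \<le> g x) \<Longrightarrow> l g \<le> radon_integral X \<phi> g"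
  obtains h where "h \<in> borel_measurable CM" "\<And>x. 0 \<le> h x \<and> h x \<le> (1::real)"
    "\<And>g. g \<in> test_functions X \<Longrightarrow> l g = (\<integral>x. g x * h x \<partial>CM)"
proof -
  interpret l: riesz X l by unfold_locales (use add cmult pos in auto)
  obtain \<nu> where "radon X \<nu>" and \<nu>: "\<And>g. g \<in> test_functions X \<Longrightarrow> radon_integral X \<nu> g = l g"
    using l.riesz_representation by blast
  interpret nu: radon X \<nu> by fact
  have nule: "\<nu> A \<le> \<phi> A" for A
    by (rule radon_measure_le[OF \<open>radon X \<nu>\<close> radon_axioms]) (use \<nu> le in auto)
  \<comment> \<open>The Caratheodory sets of \<open>\<phi>\<close> and \<open>\<nu>\<close> may
    differ. Both measures are moved to the sigma-algebra generated by the open sets, where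
    Radon-Nikodym applies and all test functions are still measurable.\<close>
  define B where "B = sigma (topspace X) (Collect (openin X))"
  have sp: "space B = topspace X" unfolding B_def by (rule space_measure_of) (auto dest: openin_subset)
  have setsB: "sets B = sigma_sets (topspace X) (Collect (openin X))"
    unfolding B_def by (rule sets_measure_of) (auto dest: openin_subset)
  have idM: "(\<lambda>x. x) \<in> measurable CM B"
    by (rule measurableI) (auto simp: sp setsB Int_absorb2 sets.sets_into_space sigma_sets_CM dest: sigma_sets_into_sp[rotated] sets.sets_into_space[OF sigma_sets_CM])
  have idN: "(\<lambda>x. x) \<in> measurable nu.CM B"
    by (rule measurableI) (auto simp: sp setsB Int_absorb2 sets.sets_into_space nu.sigma_sets_CM dest: sets.sets_into_space[OF nu.sigma_sets_CM])
  define M where "M = distr CM B (\<lambda>x. x)"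
  define N where "N = distr nu.CM B (\<lambda>x. x)"
  have sM: "sets M = sets B" "space M = topspace X" "sets N = sets M"
    by (simp_all add: M_def N_def sp)
  have subB: "A \<subseteq> topspace X" if "A \<in> sets B" for A using sets.sets_into_space[OF that] sp by simp
  have eM: "emeasure M A = \<phi> A" "emeasure N A = \<nu> A" if A: "A \<in> sets B" for A
  proof -
    have "A \<in> sets CM" "A \<in> sets nu.CM" using A unfolding setsB by (auto intro: sigma_sets_CM nu.sigma_sets_CM)
    then show "emeasure M A = \<phi> A" "emeasure N A = \<nu> A"
      using subB[OF A] unfolding M_def N_def
      by (simp_all add: emeasure_distr[OF idM A] emeasure_distr[OF idN A] Int_absorb2 emeasure_CM nu.emeasure_CM sets_CM nu.sets_CM)
  qed
  have closedB: "A \<in> sets B" if "closedin X A" for A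
  proof -
    have "topspace X - (topspace X - A) \<in> sets B"
      unfolding setsB using that by (intro sigma_sets.Compl sigma_sets.Basic) auto
    then show ?thesis using closedin_subset[OF that] by (simp add: double_diff)
  qed
  obtain K where K: "\<And>n::nat. compactin X (K n)" "(\<Union>n. K n) = topspace X"
    by (rule sigma_compact) (rule that)
  have KB: "K n \<in> sets B" for n using closedB compactin_closedin K(1) by blast
  interpret M: sigma_finite_measure M
  proof
    show "\<exists>A. countable A \<and> A \<subseteq> sets M \<and> \<Union> A = space M \<and> (\<forall>a\<in>A. emeasure M a \<noteq> \<infinity>)"
      using K KB rm_compact sM by (intro exI[of _ "range K"]) (auto simp: eM less_top)
  qed
  have "absolutely_continuous M N"
    unfolding absolutely_continuous_def null_sets_def using sM nule by (auto simp: eM) (metis le_zero_eq)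
  then obtain f where f: "f \<in> borel_measurable M" "density M f = N"
    using M.Radon_Nikodym sM by metis
  have "AE x in M. x \<in> K n \<longrightarrow> f x \<le> 1" for n
  proof -
    \<comment> \<open>If \<open>f\<close> exceeded 1 on a non-null part of \<open>K n\<close>, then
      \<open>N\<close> would exceed \<open>M\<close> on \<open>A\<close>, against
      \<open>nule\<close>; finiteness of \<open>M\<close> on \<open>A\<close> makes the comparison
      of integrals strict.\<close>
    define A where "A = {x \<in> space M. 1 < f x} \<inter> K n"
    have A: "A \<in> sets M" unfolding A_def using f(1) KB[of n] sM by measurable
    have Af: "emeasure M A < \<infinity>"
      using out_mono[of A "K n"] rm_compact[OF K(1)[of n]] A sM eM unfolding A_def
      by (metis inf_le2 le_less_trans)
    have "\<not> (\<integral>\<^sup>+x. indicator A x \<partial>M) < (\<integral>\<^sup>+x. f x * indicator A x \<partial>M)"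
    proof -
      have "(\<integral>\<^sup>+x. f x * indicator A x \<partial>M) = emeasure N A"
        unfolding f(2)[symmetric] using f(1) A by (simp add: emeasure_density)
      also have "\<dots> \<le> emeasure M A" using A nule eM sM by simp
      finally show ?thesis using A by simp
    qed
    then have "AE x in M. f x * indicator A x \<le> indicator A x"
    proof (rule contrapos_np)
      assume n: "\<not> (AE x in M. f x * indicator A x \<le> indicator A x)"
      show "(\<integral>\<^sup>+x. indicator A x \<partial>M) < (\<integral>\<^sup>+x. f x * indicator A x \<partial>M)"
      proof (rule nn_integral_less[OF _ _ _ _ n])
        show "AE x in M. indicator A x \<le> f x * indicator A x"
          by (rule AE_I2) (auto simp: A_def indicator_def)
      qed (use f(1) A Af in \<open>auto\<close>)
    qed
    then show ?thesis by (rule AE_mp) (auto simp: A_def indicator_def not_less intro!: AE_I2)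
  qed
  then have "AE x in M. \<forall>n. x \<in> K n \<longrightarrow> f x \<le> 1" unfolding AE_all_countable ..
  then have f1: "AE x in M. f x \<le> 1" by (rule AE_mp) (use K(2) sM in \<open>auto intro!: AE_I2\<close>)
  \<comment> \<open>The truncation bounds the density everywhere and not only almost everywhere, and
    it makes the density real-valued.\<close>
  define h where "h x = enn2real (min 1 (f x))" for x
  have hM: "h \<in> borel_measurable M" unfolding h_def using f(1) by measurable
  have h01: "0 \<le> h x \<and> h x \<le> 1" for x
    unfolding h_def using enn2real_mono[of "min 1 (f x)" 1] by simp
  have eh: "ennreal (h x) = min 1 (f x)" for x
    unfolding h_def by (simp add: min_less_iff_disj)
  have "density M (\<lambda>x. ennreal (h x)) = density M f"
    unfolding eh using f1 by (intro density_cong) (use f(1) in \<open>auto simp: min_def\<close>)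
  then have dN: "density M (\<lambda>x. ennreal (h x)) = N" using f(2) by simp
  have gB: "g \<in> borel_measurable B" if "g \<in> test_functions X" for g
  proof (rule borel_measurableI)
    fix W :: "real set" assume "open W"
    then have "openin X {x \<in> topspace X. g x \<in> W}"
      using tf_cont[OF that] by (intro openin_continuous_map_preimage) auto
    moreover have "g -` W \<inter> space B = {x \<in> topspace X. g x \<in> W}" using sp by auto
    ultimately show "g -` W \<inter> space B \<in> sets B" unfolding setsB by auto
  qed
  have hB: "h \<in> borel_measurable B" using hM sM by (metis measurable_cong_sets)
  show thesis
  proof (rule that[of h])
    show "h \<in> borel_measurable CM" using measurable_compose[OF idM hB] .
    fix g assume g: "g \<in> test_functions X"
    have gM: "g \<in> borel_measurable M" using gB[OF g] sM by (metis measurable_cong_sets)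
    have "l g = (\<integral>x. g x \<partial>nu.CM)" using \<nu>[OF g] by (simp add: nu.ri_eq)
    also have "\<dots> = (\<integral>x. g x \<partial>N)" unfolding N_def by (rule integral_distr[symmetric, OF idN gB[OF g]])
    also have "\<dots> = (\<integral>x. h x * g x \<partial>M)"
      unfolding dN[symmetric] using hM gM h01 by (intro integral_real_density) auto
    also have "\<dots> = (\<integral>x. h x * g x \<partial>CM)"
      unfolding M_def using hB gB[OF g] by (intro integral_distr[OF idM]) auto
    finally show "l g = (\<integral>x. g x * h x \<partial>CM)" by (simp add: mult.commute)
  qed (rule h01)
qed

end

section \<open>Disintegration\<close>

lemma (in lch2) dense_approx:
  assumes D: "dense_family D" and k: "k \<in> test_functions X" and e: "0 < e"
  obtains d where "d \<in> D" "\<And>x. x \<in> topspace X \<Longrightarrow> \<bar>k x - d x\<bar> \<le> e"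
proof -
  obtain \<eta> where \<eta>: "\<forall>x. 0 \<le> \<eta> x \<and> \<eta> x \<le> 1" "\<forall>e>0. \<exists>d\<in>D. \<forall>x\<in>topspace X. \<bar>k x - d x\<bar> \<le> e * \<eta> x"
    using D k unfolding dense_family_def by blast
  then obtain d where d: "d \<in> D" "\<forall>x\<in>topspace X. \<bar>k x - d x\<bar> \<le> e * \<eta> x" using e by blast
  have "e * \<eta> x \<le> e" for x using \<eta>(1) e by (simp add: mult_left_le)
  then show thesis using d by (intro that[of d]) (auto intro: order_trans)
qed

text \<open>\<open>bound\<close> does the work of both positivity and continuity: by linearity over
  the rationals it makes \<open>H\<close> nonexpansive for the uniform norm, so \<open>H\<close>
  extends along uniform approximations to all test functions, and the extension is positive. The
  last two conclusions retain the link to \<open>H\<close> and the fact that the total mass is at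
  most 1.\<close>

lemma (in lch2) dense_functional_radon:
  assumes D: "dense_family D"
    and add: "\<And>d d'. d \<in> D \<Longrightarrow> d' \<in> D \<Longrightarrow> H (\<lambda>x. d x + d' x) = H d + H d'"
    and cmult: "\<And>d q. d \<in> D \<Longrightarrow> q \<in> \<rat> \<Longrightarrow> H (\<lambda>x. q * d x) = q * H d"
    and bound: "\<And>d c. d \<in> D \<Longrightarrow> c \<in> \<rat> \<Longrightarrow> 0 \<le> c \<Longrightarrow> (\<And>x. x \<in> topspace X \<Longrightarrow> d x \<le> c) \<Longrightarrow> H d \<le> c"
  obtains \<nu> where "radon X \<nu>"
    "\<And>k d e. k \<in> test_functions X \<Longrightarrow> d \<in> D \<Longrightarrow> 0 \<le> e \<Longrightarrow> (\<And>x. x \<in> topspace X \<Longrightarrow> \<bar>k x - d x\<bar> \<le> e) \<Longrightarrow>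
        \<bar>radon_integral X \<nu> k - H d\<bar> \<le> e"
    "\<And>k c. k \<in> test_functions X \<Longrightarrow> 0 \<le> c \<Longrightarrow> (\<And>x. x \<in> topspace X \<Longrightarrow> k x \<le> c) \<Longrightarrow> radon_integral X \<nu> k \<le> c"
proof -
  have Dadd: "(\<lambda>x. d x + d' x) \<in> D" if "d \<in> D" "d' \<in> D" for d d'
    using D that unfolding dense_family_def by blast
  have Dmult: "(\<lambda>x. q * d x) \<in> D" if "d \<in> D" "q \<in> \<rat>" for d q
    using D that unfolding dense_family_def by blast
  have bound': "H d \<le> c" if d: "d \<in> D" and c: "0 \<le> c" and le: "\<And>x. x \<in> topspace X \<Longrightarrow> d x \<le> c" for d c
  proof (rule field_le_epsilon)
    fix e :: real assume "0 < e"
    then obtain q where q: "q \<in> \<rat>" "c < q" "q < c + e" using Rats_dense_in_real[of c "c + e"] by auto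
    then have "H d \<le> q" using d c le by (intro bound) (auto intro: order_trans less_imp_le)
    then show "H d \<le> c + e" using q by simp
  qed
  have close: "\<bar>H d - H d'\<bar> \<le> c" if d: "d \<in> D" "d' \<in> D" and le: "\<And>x. x \<in> topspace X \<Longrightarrow> \<bar>d x - d' x\<bar> \<le> c" and c: "0 \<le> c" for d d' c
  proof -
    have *: "H d - H d' \<le> c" if "d \<in> D" "d' \<in> D" "\<And>x. x \<in> topspace X \<Longrightarrow> d x - d' x \<le> c" for d d'
    proof -
      have "H (\<lambda>x. d x + (-1) * d' x) \<le> c" using that c by (intro bound' Dadd Dmult) auto
      then show ?thesis using that add[OF that(1) Dmult[OF that(2), of "-1"]] cmult[OF that(2), of "-1"] by simp
    qed
    have "d x - d' x \<le> c" "d' x - d x \<le> c" if "x \<in> topspace X" for x using le[OF that] by linarith+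
    then show ?thesis using *[of d d'] *[of d' d] d by (simp add: abs_le_iff)
  qed
  have "\<exists>\<delta>. \<forall>n. \<delta> n \<in> D \<and> (\<forall>x\<in>topspace X. \<bar>k x - \<delta> n x\<bar> \<le> inverse (real (Suc n)))" if k: "k \<in> test_functions X" for k
  proof (rule choice, rule allI)
    fix n :: nat
    obtain d where "d \<in> D" "\<And>x. x \<in> topspace X \<Longrightarrow> \<bar>k x - d x\<bar> \<le> inverse (real (Suc n))"
      by (rule dense_approx[OF D k, of "inverse (real (Suc n))"]) auto
    then show "\<exists>d. d \<in> D \<and> (\<forall>x\<in>topspace X. \<bar>k x - d x\<bar> \<le> inverse (real (Suc n)))" by blast
  qed
  then obtain \<delta> where \<delta>: "\<And>k n. k \<in> test_functions X \<Longrightarrow> \<delta> k n \<in> D"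
      "\<And>k n x. k \<in> test_functions X \<Longrightarrow> x \<in> topspace X \<Longrightarrow> \<bar>k x - \<delta> k n x\<bar> \<le> inverse (real (Suc n))"
    by metis
  define F where "F k = lim (\<lambda>n. H (\<delta> k n))" for k
  have lim0: "(\<lambda>n. inverse (real (Suc n))) \<longlonglongrightarrow> 0" by (rule LIMSEQ_inverse_real_of_nat)
  have Fconv: "(\<lambda>n. H (\<delta> k n)) \<longlonglongrightarrow> F k" if k: "k \<in> test_functions X" for k
  proof -
    have "Cauchy (\<lambda>n. H (\<delta> k n))"
    proof (rule metric_CauchyI)
      fix e :: real assume "0 < e"
      then obtain N where N: "inverse (real (Suc N)) < e / 2" using reals_Archimedean[of "e/2"] by auto
      have "dist (H (\<delta> k m)) (H (\<delta> k n)) < e" if mn: "m \<ge> N" "n \<ge> N" for m n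
      proof -
        have i: "inverse (real (Suc m)) \<le> inverse (real (Suc N))" "inverse (real (Suc n)) \<le> inverse (real (Suc N))"
          using mn by (auto intro!: le_imp_inverse_le)
        have "\<bar>\<delta> k m x - \<delta> k n x\<bar> \<le> inverse (real (Suc m)) + inverse (real (Suc n))" if "x \<in> topspace X" for x
          using \<delta>(2)[OF k that, of m] \<delta>(2)[OF k that, of n] by linarith
        then have "\<bar>H (\<delta> k m) - H (\<delta> k n)\<bar> \<le> inverse (real (Suc m)) + inverse (real (Suc n))"
          using \<delta>(1)[OF k] by (intro close) auto
        then show ?thesis using i N unfolding dist_real_def by linarith
      qed
      then show "\<exists>M. \<forall>m\<ge>M. \<forall>n\<ge>M. dist (H (\<delta> k m)) (H (\<delta> k n)) < e" by blast
    qed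
    then show ?thesis unfolding F_def by (simp add: Cauchy_convergent convergent_LIMSEQ_iff[symmetric])
  qed
  have FH: "\<bar>F k - H d\<bar> \<le> e" if k: "k \<in> test_functions X" and d: "d \<in> D"
    and le: "\<And>x. x \<in> topspace X \<Longrightarrow> \<bar>k x - d x\<bar> \<le> e" and e: "0 \<le> e" for k d e
  proof (rule LIMSEQ_le)
    show "(\<lambda>n. \<bar>H (\<delta> k n) - H d\<bar>) \<longlonglongrightarrow> \<bar>F k - H d\<bar>" by (intro tendsto_intros Fconv k)
    show "(\<lambda>n. e + inverse (real (Suc n))) \<longlonglongrightarrow> e" using tendsto_add[OF tendsto_const lim0, of e] by simp
    have "\<bar>H (\<delta> k n) - H d\<bar> \<le> e + inverse (real (Suc n))" for n
    proof (rule close[OF \<delta>(1)[OF k] d])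
      fix x assume x: "x \<in> topspace X"
      show "\<bar>\<delta> k n x - d x\<bar> \<le> e + inverse (real (Suc n))"
        using \<delta>(2)[OF k x, of n] le[OF x] by linarith
    qed (use e in auto)
    then show "\<exists>N. \<forall>n\<ge>N. \<bar>H (\<delta> k n) - H d\<bar> \<le> e + inverse (real (Suc n))" by blast
  qed
  have Fle: "F k \<le> c" if k: "k \<in> test_functions X" and c: "0 \<le> c" and le: "\<And>x. x \<in> topspace X \<Longrightarrow> k x \<le> c" for k c
  proof (rule LIMSEQ_le[OF Fconv[OF k]])
    show "(\<lambda>n. c + inverse (real (Suc n))) \<longlonglongrightarrow> c" using tendsto_add[OF tendsto_const lim0, of c] by simp
    have "H (\<delta> k n) \<le> c + inverse (real (Suc n))" for n
    proof (rule bound'[OF \<delta>(1)[OF k]])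
      fix x assume x: "x \<in> topspace X"
      show "\<delta> k n x \<le> c + inverse (real (Suc n))"
        using \<delta>(2)[OF k x, of n] le[OF x] by linarith
    qed (use c in auto)
    then show "\<exists>N. \<forall>n\<ge>N. H (\<delta> k n) \<le> c + inverse (real (Suc n))" by blast
  qed
  have Fadd: "F (\<lambda>x. g x + h x) = F g + F h" if g: "g \<in> test_functions X" and h: "h \<in> test_functions X" for g h
  proof -
    have "\<bar>F (\<lambda>x. g x + h x) - (F g + F h)\<bar> \<le> 0"
    proof (rule field_le_epsilon)
      fix e :: real assume e: "0 < e"
      obtain d where d: "d \<in> D" "\<And>x. x \<in> topspace X \<Longrightarrow> \<bar>g x - d x\<bar> \<le> e / 4"
        by (rule dense_approx[OF D g, of "e/4"]) (use e in auto)
      obtain d' where d': "d' \<in> D" "\<And>x. x \<in> topspace X \<Longrightarrow> \<bar>h x - d' x\<bar> \<le> e / 4"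
        by (rule dense_approx[OF D h, of "e/4"]) (use e in auto)
      have "\<bar>F (\<lambda>x. g x + h x) - H (\<lambda>x. d x + d' x)\<bar> \<le> e / 2"
      proof (rule FH[OF tf_add[OF g h] Dadd[OF d(1) d'(1)]])
        fix x assume x: "x \<in> topspace X"
        show "\<bar>g x + h x - (d x + d' x)\<bar> \<le> e / 2" using d(2)[OF x] d'(2)[OF x] by linarith
      qed (use e in auto)
      moreover have "\<bar>F g - H d\<bar> \<le> e / 4" using g d e by (intro FH) auto
      moreover have "\<bar>F h - H d'\<bar> \<le> e / 4" using h d' e by (intro FH) auto
      ultimately show "\<bar>F (\<lambda>x. g x + h x) - (F g + F h)\<bar> \<le> 0 + e"
        unfolding add[OF d(1) d'(1)] by linarith
    qed
    then show ?thesis by simp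
  qed
  have Fcmult: "F (\<lambda>x. c * g x) = c * F g" if g: "g \<in> test_functions X" for g c
  proof -
    obtain C where C: "0 < C" "\<And>x. x \<in> topspace X \<Longrightarrow> \<bar>g x\<bar> \<le> C" by (rule tf_bounded[OF g]) (rule that)
    \<comment> \<open>\<open>M\<close> collects the factors of \<open>e\<close> in the final
      estimate: two summands \<open>\<bar>c\<bar> + 1\<close> from replacing \<open>g\<close> by
      \<open>d\<close>, and \<open>C\<close> and \<open>\<bar>F g\<bar>\<close> from replacing
      \<open>c\<close> by the rational \<open>q\<close>.\<close>
    define M where "M = 2 * (\<bar>c\<bar> + 1) + C + \<bar>F g\<bar>"
    have M: "0 < M" using C(1) by (simp add: M_def)
    have "\<bar>F (\<lambda>x. c * g x) - c * F g\<bar> \<le> 0"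
    proof (rule field_le_epsilon)
      fix e' :: real assume e': "0 < e'"
      define e where "e = min 1 (e' / M)"
      have e: "0 < e" "e \<le> 1" "M * e \<le> e'" using e' M by (auto simp: e_def min_def field_simps)
      obtain d where d: "d \<in> D" "\<And>x. x \<in> topspace X \<Longrightarrow> \<bar>g x - d x\<bar> \<le> e"
        by (rule dense_approx[OF D g e(1)]) (rule that)
      obtain q where q: "q \<in> \<rat>" "c < q" "q < c + e" using Rats_dense_in_real[of c "c + e"] e by auto
      have qc: "\<bar>c - q\<bar> \<le> e" "\<bar>q\<bar> \<le> \<bar>c\<bar> + 1" using q e(2) by auto
      have "\<bar>F (\<lambda>x. c * g x) - H (\<lambda>x. q * d x)\<bar> \<le> e * C + (\<bar>c\<bar> + 1) * e"
      proof (rule FH[OF tf_cmult[OF g] Dmult[OF d(1) q(1)]])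
        fix x assume x: "x \<in> topspace X"
        have "c * g x - q * d x = (c - q) * g x + q * (g x - d x)" by (simp add: algebra_simps)
        then have "\<bar>c * g x - q * d x\<bar> \<le> \<bar>c - q\<bar> * \<bar>g x\<bar> + \<bar>q\<bar> * \<bar>g x - d x\<bar>"
          by (metis abs_mult abs_triangle_ineq)
        also have "\<dots> \<le> e * C + (\<bar>c\<bar> + 1) * e"
          using qc C(2)[OF x] d(2)[OF x] e(1) by (intro add_mono mult_mono) auto
        finally show "\<bar>c * g x - q * d x\<bar> \<le> e * C + (\<bar>c\<bar> + 1) * e" .
      qed (use e C in auto)
      moreover have "\<bar>c * F g - q * H d\<bar> \<le> e * \<bar>F g\<bar> + (\<bar>c\<bar> + 1) * e"
      proof -
        have "c * F g - q * H d = (c - q) * F g + q * (F g - H d)" by (simp add: algebra_simps)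
        then have "\<bar>c * F g - q * H d\<bar> \<le> \<bar>c - q\<bar> * \<bar>F g\<bar> + \<bar>q\<bar> * \<bar>F g - H d\<bar>"
          by (metis abs_mult abs_triangle_ineq)
        also have "\<dots> \<le> e * \<bar>F g\<bar> + (\<bar>c\<bar> + 1) * e"
          using qc FH[OF g d(1) d(2)] e(1) by (intro add_mono mult_mono) auto
        finally show ?thesis .
      qed
      ultimately have "\<bar>F (\<lambda>x. c * g x) - c * F g\<bar> \<le> e * C + (\<bar>c\<bar> + 1) * e + (e * \<bar>F g\<bar> + (\<bar>c\<bar> + 1) * e)"
        unfolding cmult[OF d(1) q(1)] by linarith
      also have "\<dots> = M * e" by (simp add: M_def algebra_simps)
      finally show "\<bar>F (\<lambda>x. c * g x) - c * F g\<bar> \<le> 0 + e'" using e(3) by simp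
    qed
    then show ?thesis by simp
  qed
  interpret R: riesz X F
  proof
    show "0 \<le> F g" if "g \<in> test_functions X" "\<And>x. x \<in> topspace X \<Longrightarrow> 0 \<le> g x" for g
      using Fle[OF tf_cmult[OF that(1), of "-1"], of 0] Fcmult[OF that(1), of "-1"] that(2) by simp
  qed (use Fadd Fcmult in auto)
  obtain \<nu> where \<nu>: "radon X \<nu>" "\<And>g. g \<in> test_functions X \<Longrightarrow> radon_integral X \<nu> g = F g"
    using R.riesz_representation by blast
  show thesis
  proof (rule that[OF \<nu>(1)])
    show "\<bar>radon_integral X \<nu> k - H d\<bar> \<le> e"
      if "k \<in> test_functions X" "d \<in> D" "0 \<le> e" "\<And>x. x \<in> topspace X \<Longrightarrow> \<bar>k x - d x\<bar> \<le> e" for k d e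
      using FH[OF that(1,2,4,3)] \<nu>(2)[OF that(1)] by simp
    show "radon_integral X \<nu> k \<le> c"
      if "k \<in> test_functions X" "0 \<le> c" "\<And>x. x \<in> topspace X \<Longrightarrow> k x \<le> c" for k c
      using Fle[OF that] \<nu>(2)[OF that(1)] by simp
  qed
qed

context lch2
begin

text \<open>With \<open>d\<close> in a countable dense family and rational \<open>q\<close> and
  \<open>r\<close> there are only countably many cylinders of finite sets, and they form a base.
  This turns the topological measurability of Young functions into countably many
  conditions.\<close>

definition cylinder :: "(('a \<Rightarrow> real) \<times> real \<times> real) set \<Rightarrow> ('a set \<Rightarrow> ennreal) set" where
  "cylinder F = {\<nu> \<in> prob_radon X. \<forall>(d, q, r)\<in>F. \<bar>radon_integral X \<nu> d - q\<bar> < r}"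

text \<open>Integrals against probability measures change by at most the uniform distance of the
  integrands, with the same constant for all of them. Hence a subbasic condition on \<open>k\<close>
  follows, near \<open>\<nu>\<close>, from a condition on a nearby \<open>d\<close> in
  \<open>D\<close>.\<close>

lemma prob_topology_cylinder_base:
  assumes D: "dense_family D" and W: "openin (prob_topology X) W"
  shows "W \<subseteq> prob_radon X \<and> (\<forall>\<nu>\<in>W. \<exists>F. finite F \<and> F \<subseteq> D \<times> \<rat> \<times> \<rat> \<and> \<nu> \<in> cylinder F \<and> cylinder F \<subseteq> W)"
proof -
  have "generate_topology_on {{\<nu> \<in> prob_radon X. radon_integral X \<nu> k \<in> W} | k W. k \<in> test_functions X \<and> open W} W"
    using W unfolding prob_topology_def by (rule openin_topology_generated_by)
  then show ?thesis
  proof (induction rule: generate_topology_on.induct)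
    case (Int a b)
    have "\<exists>F. finite F \<and> F \<subseteq> D \<times> \<rat> \<times> \<rat> \<and> \<nu> \<in> cylinder F \<and> cylinder F \<subseteq> a \<inter> b" if "\<nu> \<in> a \<inter> b" for \<nu>
    proof -
      obtain F where F: "finite F" "F \<subseteq> D \<times> \<rat> \<times> \<rat>" "\<nu> \<in> cylinder F" "cylinder F \<subseteq> a"
        using Int.IH(1) \<open>\<nu> \<in> a \<inter> b\<close> by blast
      obtain G where G: "finite G" "G \<subseteq> D \<times> \<rat> \<times> \<rat>" "\<nu> \<in> cylinder G" "cylinder G \<subseteq> b"
        using Int.IH(2) \<open>\<nu> \<in> a \<inter> b\<close> by blast
      have "cylinder (F \<union> G) = cylinder F \<inter> cylinder G" unfolding cylinder_def ball_Un by blast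
      then show ?thesis using F G by (intro exI[of _ "F \<union> G"]) auto
    qed
    then show ?case using Int.IH by blast
  next
    case (UN K)
    have "\<exists>F. finite F \<and> F \<subseteq> D \<times> \<rat> \<times> \<rat> \<and> \<nu> \<in> cylinder F \<and> cylinder F \<subseteq> \<Union>K" if \<nu>: "\<nu> \<in> \<Union>K" for \<nu>
    proof -
      obtain a where a: "a \<in> K" "\<nu> \<in> a" using \<nu> by blast
      from bspec[OF conjunct2[OF UN.IH[OF a(1)]] a(2)]
      obtain F where "finite F" "F \<subseteq> D \<times> \<rat> \<times> \<rat>" "\<nu> \<in> cylinder F" "cylinder F \<subseteq> a"
        by (elim exE conjE) (rule that)
      then show ?thesis using a(1) by (intro exI[of _ F]) auto
    qed
    moreover have "\<Union>K \<subseteq> prob_radon X" using UN.IH by (intro Union_least) simp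
    ultimately show ?case by simp
  next
    case (Basis s)
    then obtain k W where k: "k \<in> test_functions X" and W: "open W"
      and s: "s = {\<nu> \<in> prob_radon X. radon_integral X \<nu> k \<in> W}" by blast
    have "\<exists>F. finite F \<and> F \<subseteq> D \<times> \<rat> \<times> \<rat> \<and> \<nu> \<in> cylinder F \<and> cylinder F \<subseteq> s" if \<nu>: "\<nu> \<in> s" for \<nu>
    proof -
      have \<nu>P: "\<nu> \<in> prob_radon X" using \<nu> s by blast
      obtain e where e: "0 < e" "\<And>t. \<bar>t - radon_integral X \<nu> k\<bar> < e \<Longrightarrow> t \<in> W"
        using W \<nu> s unfolding open_real by (metis (no_types, lifting) mem_Collect_eq)
      \<comment> \<open>Replacing \<open>k\<close> by \<open>d\<close> costs \<open>e / 8\<close>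
        for each of the two measures, \<open>q\<close> misses the integral of \<open>d\<close> by
        less than \<open>e / 8\<close>, and \<open>r < e / 4\<close>: less than \<open>e\<close> in
        total. \<open>r > e / 8\<close> keeps \<open>\<nu>\<close> in its own cylinder.\<close>
      obtain d where d: "d \<in> D" "\<And>x. x \<in> topspace X \<Longrightarrow> \<bar>k x - d x\<bar> \<le> e / 8"
        by (rule dense_approx[OF D k, of "e/8"]) (use e in auto)
      have dt: "d \<in> test_functions X" using D d(1) unfolding dense_family_def by blast
      obtain q where q: "q \<in> \<rat>" "radon_integral X \<nu> d < q" "q < radon_integral X \<nu> d + e / 8"
        using Rats_dense_in_real[of "radon_integral X \<nu> d" "radon_integral X \<nu> d + e / 8"] e by auto
      obtain r where r: "r \<in> \<rat>" "e / 8 < r" "r < e / 4" using Rats_dense_in_real[of "e/8" "e/4"] e by auto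
      have "\<nu>' \<in> s" if \<nu>': "\<nu>' \<in> cylinder {(d, q, r)}" for \<nu>'
      proof -
        have P: "\<nu>' \<in> prob_radon X" "\<bar>radon_integral X \<nu>' d - q\<bar> < r" using \<nu>' by (auto simp: cylinder_def)
        have "\<bar>radon_integral X \<nu>' k - radon_integral X \<nu>' d\<bar> \<le> e / 8"
          by (rule prob_diff_le[OF P(1) k dt]) (rule d(2))
        moreover have "\<bar>radon_integral X \<nu> k - radon_integral X \<nu> d\<bar> \<le> e / 8"
          by (rule prob_diff_le[OF \<nu>P k dt]) (rule d(2))
        ultimately have "\<bar>radon_integral X \<nu>' k - radon_integral X \<nu> k\<bar> < e" using P(2) q r by linarith
        then show ?thesis using e(2) P(1) s by blast
      qed
      moreover have "\<nu> \<in> cylinder {(d, q, r)}" using \<nu>P q r by (auto simp: cylinder_def)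
      ultimately show ?thesis using d(1) q(1) r(1) by (intro exI[of _ "{(d, q, r)}"]) auto
    qed
    then show ?case using s by blast
  qed auto
qed

end

section \<open>Measurability and construction of Young functions over a Radon measure\<close>

locale lch2_pair_radon = lch2_pair X Y + mu: radon2 X \<mu>
  for X :: "'a topology" and Y :: "'b topology" and \<mu>
begin

text \<open>The preimage of a cylinder agrees, up to a null set, with finitely many strict
  inequalities between the measurable functions \<open>h d\<close> and rationals; an open set is the
  countable union of the cylinders inside it.\<close>

lemma young_functionI:
  assumes D: "Y.dense_family D" and AE: "AE x in mu.CM. f x \<in> prob_radon Y"
    and h: "\<And>d. d \<in> D \<Longrightarrow> h d \<in> borel_measurable mu.CM"
      "\<And>d. d \<in> D \<Longrightarrow> AE x in mu.CM. radon_integral Y (f x) d = h d x"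
  shows "young_function X Y \<mu> f"
  unfolding young_function_def
proof (intro conjI allI impI)
  show "\<mu> {x \<in> topspace X. f x \<notin> prob_radon Y} = 0" using AE unfolding mu.AE_CM_iff .
  fix W assume W: "openin (prob_topology Y) W"
  have cyl: "{x \<in> topspace X. f x \<in> Y.cylinder F} \<in> sets mu.CM" if F: "finite F" "F \<subseteq> D \<times> \<rat> \<times> \<rat>" for F
  proof -
    have m: "{x \<in> space mu.CM. \<forall>p\<in>F. \<bar>h (fst p) x - fst (snd p)\<bar> < snd (snd p)} \<in> sets mu.CM"
    proof (rule sets.sets_Collect_finite_All[OF _ F(1)])
      fix p assume "p \<in> F"
      then have "h (fst p) \<in> borel_measurable mu.CM" using F(2) h(1) by auto
      then show "{x \<in> space mu.CM. \<bar>h (fst p) x - fst (snd p)\<bar> < snd (snd p)} \<in> sets mu.CM" by measurable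
    qed
    have "AE x in mu.CM. \<forall>p\<in>F. radon_integral Y (f x) (fst p) = h (fst p) x"
      using F h(2) by (intro AE_finite_allI) auto
    then have "AE x in mu.CM. indicator {x \<in> space mu.CM. \<forall>p\<in>F. \<bar>h (fst p) x - fst (snd p)\<bar> < snd (snd p)} x
        = (indicator {x \<in> topspace X. f x \<in> Y.cylinder F} x :: real)"
      using AE
    proof (rule AE_mp[OF AE_conjI AE_I2], intro impI, elim conjE)
      fix x assume x: "x \<in> space mu.CM" "\<forall>p\<in>F. radon_integral Y (f x) (fst p) = h (fst p) x" "f x \<in> prob_radon Y"
      have "f x \<in> Y.cylinder F \<longleftrightarrow> (\<forall>p\<in>F. \<bar>h (fst p) x - fst (snd p)\<bar> < snd (snd p))"
        unfolding Y.cylinder_def using x(2,3) by (auto simp: case_prod_beta)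
      then show "indicator {x \<in> space mu.CM. \<forall>p\<in>F. \<bar>h (fst p) x - fst (snd p)\<bar> < snd (snd p)} x
        = (indicator {x \<in> topspace X. f x \<in> Y.cylinder F} x :: real)" using x(1) by (simp add: indicator_def)
    qed
    then have "(indicator {x \<in> topspace X. f x \<in> Y.cylinder F} :: 'a \<Rightarrow> real) \<in> borel_measurable mu.CM"
      by (rule mu.borel_measurable_CM_AE[rotated]) (use m in simp)
    then have "{x \<in> topspace X. f x \<in> Y.cylinder F} \<inter> space mu.CM \<in> sets mu.CM"
      by (simp only: borel_measurable_indicator_iff)
    then show ?thesis by (simp add: Int_absorb2 subset_iff)
  qed
  define \<F> where "\<F> = {F. finite F \<and> F \<subseteq> D \<times> \<rat> \<times> \<rat> \<and> Y.cylinder F \<subseteq> W}"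
  have "countable (D \<times> \<rat> \<times> (\<rat> :: real set))"
    using D unfolding Y.dense_family_def by (intro countable_SIGMA countable_rat) blast
  then have "countable \<F>"
    unfolding \<F>_def by (rule countable_subset[OF _ countable_Collect_finite_subset, rotated]) auto
  moreover have "{x \<in> topspace X. f x \<in> W} = (\<Union>F\<in>\<F>. {x \<in> topspace X. f x \<in> Y.cylinder F})"
    using Y.prob_topology_cylinder_base[OF D W] unfolding \<F>_def by blast
  moreover have "{x \<in> topspace X. f x \<in> Y.cylinder F} \<in> sets mu.CM" if "F \<in> \<F>" for F
    using cyl that unfolding \<F>_def by auto
  ultimately have "{x \<in> topspace X. f x \<in> W} \<in> sets mu.CM"
    using sets.countable_UN'[of \<F> "\<lambda>F. {x \<in> topspace X. f x \<in> Y.cylinder F}" mu.CM] by auto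
  then show "{x \<in> topspace X. f x \<in> W} \<in> caratheodory_sets (topspace X) \<mu>" by (simp add: mu.sets_CM)
qed

text \<open>The signed functional is shifted into the positive range: half of the difference between
  \<open>\<mu>\<close> and \<open>L / C\<close> lies between 0 and \<open>\<mu>\<close>, so it has a
  density \<open>h\<close> in the unit interval, and \<open>C * (1 - 2 * h x)\<close> is a density
  of \<open>L\<close>.\<close>

lemma bilinear_density:
  assumes L: "\<And>g h. g \<in> test_functions X \<Longrightarrow> h \<in> test_functions X \<Longrightarrow> L (\<lambda>x. g x + h x) = L g + L h"
      "\<And>g c. g \<in> test_functions X \<Longrightarrow> L (\<lambda>x. c * g x) = c * L g"
    and bd: "\<And>g. g \<in> test_functions X \<Longrightarrow> (\<And>x. x \<in> topspace X \<Longrightarrow> 0 \<le> g x) \<Longrightarrow> \<bar>L g\<bar> \<le> C * radon_integral X \<mu> g"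
    and C: "0 < C"
  obtains h where "h \<in> borel_measurable mu.CM" "\<And>x. \<bar>h x\<bar> \<le> C"
      "\<And>g. g \<in> test_functions X \<Longrightarrow> L g = (\<integral>x. g x * h x \<partial>mu.CM)"
proof -
  let ?l = "\<lambda>g. (radon_integral X \<mu> g - L g / C) / 2"
  obtain h where h: "h \<in> borel_measurable mu.CM" "\<And>x. 0 \<le> h x \<and> h x \<le> (1::real)"
      "\<And>g. g \<in> test_functions X \<Longrightarrow> ?l g = (\<integral>x. g x * h x \<partial>mu.CM)"
  proof (rule mu.functional_density[of ?l])
    show "?l (\<lambda>x. g x + h x) = ?l g + ?l h" if "g \<in> test_functions X" "h \<in> test_functions X" for g h
      using that by (simp add: L mu.ri_add add_divide_distrib diff_divide_distrib)
    show "?l (\<lambda>x. c * g x) = c * ?l g" if "g \<in> test_functions X" for g c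
      using that by (simp add: L mu.ri_cmult algebra_simps)
    have b: "\<bar>L g / C\<bar> \<le> radon_integral X \<mu> g" if "g \<in> test_functions X" "\<And>x. x \<in> topspace X \<Longrightarrow> 0 \<le> g x" for g
      using bd[OF that] C by (simp add: field_simps abs_le_iff)
    show "0 \<le> ?l g" if "g \<in> test_functions X" "\<And>x. x \<in> topspace X \<Longrightarrow> 0 \<le> g x" for g
    proof -
      have "\<bar>L g / C\<bar> \<le> radon_integral X \<mu> g" by (rule b) (use that in auto)
      from order_trans[OF abs_ge_self this] show ?thesis by simp
    qed
    show "?l g \<le> radon_integral X \<mu> g" if "g \<in> test_functions X" "\<And>x. 0 \<le> g x" for g
    proof -
      have "\<bar>L g\<bar> \<le> C * radon_integral X \<mu> g" using that by (intro bd) auto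
      then have "- (L g / C) \<le> radon_integral X \<mu> g" using C by (simp add: field_simps abs_le_iff)
      then show ?thesis by simp
    qed
  qed (rule that)
  show thesis
  proof (rule that[of "\<lambda>x. C * (1 - 2 * h x)"])
    show "(\<lambda>x. C * (1 - 2 * h x)) \<in> borel_measurable mu.CM" using h(1) by measurable
    show "\<bar>C * (1 - 2 * h x)\<bar> \<le> C" for x
    proof -
      have "\<bar>1 - 2 * h x\<bar> \<le> 1" using h(2)[of x] by (simp add: abs_le_iff)
      then show ?thesis using C by (simp add: abs_mult)
    qed
    fix g assume g: "g \<in> test_functions X"
    have i: "integrable mu.CM (\<lambda>x. g x * h x)"
      using h(1) h(2) mu.tf_integrable[OF g] by (intro mu.mult_bounded_integrable[of h 1]) auto
    have "(\<integral>x. g x * (C * (1 - 2 * h x)) \<partial>mu.CM) = (\<integral>x. C * g x - (2 * C) * (g x * h x) \<partial>mu.CM)"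
      by (simp add: algebra_simps)
    also have "\<dots> = C * (\<integral>x. g x \<partial>mu.CM) - (2 * C) * (\<integral>x. g x * h x \<partial>mu.CM)"
      using i mu.tf_integrable[OF g] by simp
    also have "\<dots> = L g" using C h(3)[OF g] by (simp add: mu.ri_eq[symmetric] field_simps)
    finally show "L g = (\<integral>x. g x * (C * (1 - 2 * h x)) \<partial>mu.CM)" by simp
  qed
qed

text \<open>Applied in both directions it shows that densities are determined almost everywhere,
  which makes the density of a bilinear functional additive and homogeneous in its second argument
  up to null sets.\<close>

lemma AE_mono_if_tf_mono:
  assumes h: "h1 \<in> borel_measurable mu.CM" "\<And>x. \<bar>h1 x\<bar> \<le> (C1::real)" "h2 \<in> borel_measurable mu.CM" "\<And>x. \<bar>h2 x\<bar> \<le> C2"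
    and le: "\<And>g. g \<in> test_functions X \<Longrightarrow> (\<And>x. 0 \<le> g x) \<Longrightarrow> (\<integral>x. g x * h1 x \<partial>mu.CM) \<le> (\<integral>x. g x * h2 x \<partial>mu.CM)"
  shows "AE x in mu.CM. h1 x \<le> h2 x"
proof -
  have "AE x in mu.CM. 0 \<le> h2 x - h1 x"
  proof (rule mu.AE_nonneg_if_tf_nonneg[where C = "C2 + C1"])
    show "(\<lambda>x. h2 x - h1 x) \<in> borel_measurable mu.CM" using h by measurable
    show "\<bar>h2 x - h1 x\<bar> \<le> C2 + C1" for x using h(2,4)[of x] by linarith
    fix g assume g: "g \<in> test_functions X" "\<And>x. 0 \<le> g x"
    have "integrable mu.CM (\<lambda>x. g x * h1 x)" "integrable mu.CM (\<lambda>x. g x * h2 x)"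
      using h mu.tf_integrable[OF g(1)] by (auto intro: mu.mult_bounded_integrable)
    then show "0 \<le> (\<integral>x. g x * (h2 x - h1 x) \<partial>mu.CM)"
      using le[OF g] by (simp add: right_diff_distrib)
  qed
  then show ?thesis by (rule AE_mp) simp
qed

text \<open>The fibre measure at \<open>x\<close> represents the functional that extends \<open>d \<mapsto> h d x\<close> from a countable
  dense set of test functions \<open>d\<close>, where \<open>h d\<close> is the density of \<open>L (\<cdot>, d)\<close>.\<close>

theorem disintegration:
  assumes L1: "\<And>g h k. g \<in> test_functions X \<Longrightarrow> h \<in> test_functions X \<Longrightarrow> k \<in> test_functions Y \<Longrightarrow>
        L (\<lambda>x. g x + h x) k = L g k + L h k"
      "\<And>g c k. g \<in> test_functions X \<Longrightarrow> k \<in> test_functions Y \<Longrightarrow> L (\<lambda>x. c * g x) k = c * L g k"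
    and L2: "\<And>g h k. g \<in> test_functions X \<Longrightarrow> h \<in> test_functions Y \<Longrightarrow> k \<in> test_functions Y \<Longrightarrow>
        L g (\<lambda>y. h y + k y) = L g h + L g k"
      "\<And>g c k. g \<in> test_functions X \<Longrightarrow> k \<in> test_functions Y \<Longrightarrow> L g (\<lambda>y. c * k y) = c * L g k"
    and bd: "\<And>g k c. g \<in> test_functions X \<Longrightarrow> (\<And>x. x \<in> topspace X \<Longrightarrow> 0 \<le> g x) \<Longrightarrow> k \<in> test_functions Y \<Longrightarrow>
        0 \<le> c \<Longrightarrow> (\<And>y. y \<in> topspace Y \<Longrightarrow> k y \<le> c) \<Longrightarrow> L g k \<le> c * radon_integral X \<mu> g"
    and \<eta>: "\<And>j::nat. \<eta> j \<in> test_functions Y" "\<And>j y. y \<in> topspace Y \<Longrightarrow> \<eta> j y \<le> 1"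
      "\<And>g. g \<in> test_functions X \<Longrightarrow> (\<And>x. 0 \<le> g x) \<Longrightarrow> (\<lambda>j. L g (\<eta> j)) \<longlonglongrightarrow> radon_integral X \<mu> g"
  obtains f where "young_function X Y \<mu> f"
    "\<And>g k. g \<in> test_functions X \<Longrightarrow> k \<in> test_functions Y \<Longrightarrow>
        radon_integral X \<mu> (\<lambda>x. g x * radon_integral Y (f x) k) = L g k"
proof -
  obtain D where D: "Y.dense_family D" using Y.dense_family_exists by blast
  have DY: "d \<in> test_functions Y" if "d \<in> D" for d using D that unfolding Y.dense_family_def by blast
  have Dc: "countable D" using D unfolding Y.dense_family_def by blast
  have "\<exists>h C. h \<in> borel_measurable mu.CM \<and> (\<forall>x. \<bar>h x\<bar> \<le> (C::real)) \<and>
      (\<forall>g\<in>test_functions X. L g k = (\<integral>x. g x * h x \<partial>mu.CM))" if k: "k \<in> test_functions Y" for k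
  proof -
    obtain C where C: "0 < C" "\<And>y. y \<in> topspace Y \<Longrightarrow> \<bar>k y\<bar> \<le> C" by (rule Y.tf_bounded[OF k]) (rule that)
    have "\<bar>L g k\<bar> \<le> C * radon_integral X \<mu> g"
      if g: "g \<in> test_functions X" "\<And>x. x \<in> topspace X \<Longrightarrow> 0 \<le> g x" for g
    proof -
      have "L g k \<le> C * radon_integral X \<mu> g" using C by (intro bd g k) (auto simp: abs_le_iff)
      moreover have "L g (\<lambda>y. (-1) * k y) \<le> C * radon_integral X \<mu> g"
        using C by (intro bd g Y.tf_cmult k) (auto simp: abs_le_iff)
      ultimately show ?thesis using L2(2)[OF g(1) k, of "-1"] by (simp add: abs_le_iff)
    qed
    note b = this
    show ?thesis
    proof (rule bilinear_density[of "\<lambda>g. L g k" C])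
      fix h assume "h \<in> borel_measurable mu.CM" "\<And>x. \<bar>h x\<bar> \<le> C"
        "\<And>g. g \<in> test_functions X \<Longrightarrow> L g k = (\<integral>x. g x * h x \<partial>mu.CM)"
      then show ?thesis by blast
    qed (use L1 k b C(1) in \<open>simp_all\<close>)
  qed
  then obtain h C where h: "\<And>k. k \<in> test_functions Y \<Longrightarrow> h k \<in> borel_measurable mu.CM"
      "\<And>k x. k \<in> test_functions Y \<Longrightarrow> \<bar>h k x\<bar> \<le> (C k::real)"
      "\<And>k g. k \<in> test_functions Y \<Longrightarrow> g \<in> test_functions X \<Longrightarrow> L g k = (\<integral>x. g x * h k x \<partial>mu.CM)"
    by metis
  have hi: "integrable mu.CM (\<lambda>x. g x * h k x)" if "g \<in> test_functions X" "k \<in> test_functions Y" for g k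
    using h(1,2)[OF that(2)] mu.tf_integrable[OF that(1)] by (rule mu.mult_bounded_integrable)
  have h_le: "AE x in mu.CM. h k x \<le> c" if k: "k \<in> test_functions Y" and c: "0 \<le> c" "\<And>y. y \<in> topspace Y \<Longrightarrow> k y \<le> c" for k c
  proof (rule AE_mono_if_tf_mono[OF h(1,2)[OF k]])
    fix g assume g: "g \<in> test_functions X" "\<And>x. 0 \<le> g x"
    show "(\<integral>x. g x * h k x \<partial>mu.CM) \<le> (\<integral>x. g x * c \<partial>mu.CM)"
      using bd[OF g k c] h(3)[OF k g(1)] by (simp add: mu.ri_eq mult.commute)
  qed auto
  have h_add: "AE x in mu.CM. h (\<lambda>y. k y + k' y) x = h k x + h k' x"
    if k: "k \<in> test_functions Y" "k' \<in> test_functions Y" for k k'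
  proof -
    note kk = Y.tf_add[OF k]
    have b: "\<bar>h k x + h k' x\<bar> \<le> C k + C k'" for x using h(2)[OF k(1), of x] h(2)[OF k(2), of x] by linarith
    have m: "(\<lambda>x. h k x + h k' x) \<in> borel_measurable mu.CM" using h(1)[OF k(1)] h(1)[OF k(2)] by measurable
    have eq: "(\<integral>x. g x * h (\<lambda>y. k y + k' y) x \<partial>mu.CM) = (\<integral>x. g x * (h k x + h k' x) \<partial>mu.CM)"
      if g: "g \<in> test_functions X" for g
      using hi[OF g k(1)] hi[OF g k(2)] L2(1)[OF g k] h(3)[OF k(1) g] h(3)[OF k(2) g] h(3)[OF kk g]
      by (simp add: distrib_left)
    have "AE x in mu.CM. h (\<lambda>y. k y + k' y) x \<le> h k x + h k' x"
      by (rule AE_mono_if_tf_mono[OF h(1,2)[OF kk] m b]) (simp add: eq)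
    moreover have "AE x in mu.CM. h k x + h k' x \<le> h (\<lambda>y. k y + k' y) x"
      by (rule AE_mono_if_tf_mono[OF m b h(1,2)[OF kk]]) (simp add: eq)
    ultimately show ?thesis by eventually_elim (rule antisym)
  qed
  have h_mult: "AE x in mu.CM. h (\<lambda>y. q * k y) x = q * h k x" if k: "k \<in> test_functions Y" for k q
  proof -
    note kk = Y.tf_cmult[OF k, of q]
    have b: "\<bar>q * h k x\<bar> \<le> \<bar>q\<bar> * C k" for x using h(2)[OF k, of x] by (simp add: abs_mult mult_left_mono)
    have m: "(\<lambda>x. q * h k x) \<in> borel_measurable mu.CM" using h(1)[OF k] by measurable
    have eq: "(\<integral>x. g x * h (\<lambda>y. q * k y) x \<partial>mu.CM) = (\<integral>x. g x * (q * h k x) \<partial>mu.CM)"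
      if g: "g \<in> test_functions X" for g
      using L2(2)[OF g k, of q] h(3)[OF k g] h(3)[OF kk g] by (simp add: mult.left_commute)
    have "AE x in mu.CM. h (\<lambda>y. q * k y) x \<le> q * h k x"
      by (rule AE_mono_if_tf_mono[OF h(1,2)[OF kk] m b]) (simp add: eq)
    moreover have "AE x in mu.CM. q * h k x \<le> h (\<lambda>y. q * k y) x"
      by (rule AE_mono_if_tf_mono[OF m b h(1,2)[OF kk]]) (simp add: eq)
    ultimately show ?thesis by eventually_elim (rule antisym)
  qed
  have h_close: "AE x in mu.CM. \<bar>h k x - h d x\<bar> \<le> e" if k: "k \<in> test_functions Y" "d \<in> test_functions Y"
    and e: "0 \<le> e" and le: "\<And>y. y \<in> topspace Y \<Longrightarrow> \<bar>k y - d y\<bar> \<le> e" for k d e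
  proof -
    have *: "AE x in mu.CM. h k x - h d x \<le> e" if k: "k \<in> test_functions Y" "d \<in> test_functions Y"
      and le: "\<And>y. y \<in> topspace Y \<Longrightarrow> k y - d y \<le> e" for k d
    proof -
      have "AE x in mu.CM. h (\<lambda>y. k y + (-1) * d y) x \<le> e"
        using k le e by (intro h_le Y.tf_add Y.tf_cmult) auto
      then show ?thesis using h_add[OF k(1) Y.tf_cmult[OF k(2), of "-1"]] h_mult[OF k(2), of "-1"]
        by eventually_elim simp
    qed
    have "k y - d y \<le> e" "d y - k y \<le> e" if "y \<in> topspace Y" for y using le[OF that] by linarith+
    then have "AE x in mu.CM. h k x - h d x \<le> e" "AE x in mu.CM. h d x - h k x \<le> e"
      using *[OF k] *[OF k(2,1)] by auto
    then show ?thesis by eventually_elim (simp add: abs_le_iff)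
  qed
  \<comment> \<open>The null sets of \<open>h_add\<close>, \<open>h_mult\<close> and
    \<open>h_le\<close> depend on the functions involved. Only countably many are used, those for
    members of \<open>D\<close> with rational factors and bounds; off their union
    \<open>Y.dense_functional_radon\<close> supplies a measure as \<open>good\<close> demands, and
    \<open>SOME\<close> selects one.\<close>
  define good where "good x \<nu> \<longleftrightarrow> radon Y \<nu> \<and>
      (\<forall>k\<in>test_functions Y. \<forall>d\<in>D. \<forall>e\<ge>0. (\<forall>y\<in>topspace Y. \<bar>k y - d y\<bar> \<le> e) \<longrightarrow> \<bar>radon_integral Y \<nu> k - h d x\<bar> \<le> e) \<and>
      (\<forall>k\<in>test_functions Y. \<forall>c\<ge>0. (\<forall>y\<in>topspace Y. k y \<le> c) \<longrightarrow> radon_integral Y \<nu> k \<le> c)" for x \<nu>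
  define f where "f x = (SOME \<nu>. good x \<nu>)" for x
  have "AE x in mu.CM. \<forall>d\<in>D. \<forall>d'\<in>D. h (\<lambda>y. d y + d' y) x = h d x + h d' x"
    unfolding AE_ball_countable[OF Dc] by (intro ballI h_add DY)
  moreover have "AE x in mu.CM. \<forall>d\<in>D. \<forall>q\<in>\<rat>. h (\<lambda>y. q * d y) x = q * h d x"
    unfolding AE_ball_countable[OF Dc] AE_ball_countable[OF countable_rat] by (intro ballI h_mult DY)
  moreover have "AE x in mu.CM. \<forall>d\<in>D. \<forall>c\<in>\<rat>. 0 \<le> c \<longrightarrow> (\<forall>y\<in>topspace Y. d y \<le> c) \<longrightarrow> h d x \<le> c"
  proof -
    have "AE x in mu.CM. 0 \<le> c \<longrightarrow> (\<forall>y\<in>topspace Y. d y \<le> c) \<longrightarrow> h d x \<le> c" if "d \<in> D" for d c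
      using h_le[OF DY[OF that], of c] by (cases "0 \<le> c \<and> (\<forall>y\<in>topspace Y. d y \<le> c)") auto
    then show ?thesis
      unfolding AE_ball_countable[OF Dc] AE_ball_countable[OF countable_rat] by (intro ballI)
  qed
  ultimately have good: "AE x in mu.CM. good x (f x)"
  proof eventually_elim
    case (elim x)
    obtain \<nu> where \<nu>: "radon Y \<nu>"
      "\<And>k d e. k \<in> test_functions Y \<Longrightarrow> d \<in> D \<Longrightarrow> 0 \<le> e \<Longrightarrow> (\<And>y. y \<in> topspace Y \<Longrightarrow> \<bar>k y - d y\<bar> \<le> e) \<Longrightarrow>
          \<bar>radon_integral Y \<nu> k - h d x\<bar> \<le> e"
      "\<And>k c. k \<in> test_functions Y \<Longrightarrow> 0 \<le> c \<Longrightarrow> (\<And>y. y \<in> topspace Y \<Longrightarrow> k y \<le> c) \<Longrightarrow> radon_integral Y \<nu> k \<le> c"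
      by (rule Y.dense_functional_radon[OF D, of "\<lambda>d. h d x"]) (use elim in \<open>simp_all\<close>)
    have "good x \<nu>" unfolding good_def using \<nu> by simp
    then show "good x (f x)" unfolding f_def by (rule someI[of "good x"])
  qed
  \<comment> \<open>For \<open>k\<close> outside \<open>D\<close> the identity is no part of
    \<open>good\<close>; approximations \<open>d n\<close> from \<open>D\<close> move both sides by
    at most \<open>1 / (n + 1)\<close>, by \<open>good\<close> and by
    \<open>h_close\<close>.\<close>
  have f_eq: "AE x in mu.CM. radon_integral Y (f x) k = h k x" if k: "k \<in> test_functions Y" for k
  proof -
    have "\<exists>d. d \<in> D \<and> (\<forall>y\<in>topspace Y. \<bar>k y - d y\<bar> \<le> inverse (real (Suc n)))" for n
    proof -
      obtain d where "d \<in> D" "\<And>y. y \<in> topspace Y \<Longrightarrow> \<bar>k y - d y\<bar> \<le> inverse (real (Suc n))"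
        by (rule Y.dense_approx[OF D k, of "inverse (real (Suc n))"]) auto
      then show ?thesis by blast
    qed
    then obtain d where d: "\<And>n. d n \<in> D" "\<And>n y. y \<in> topspace Y \<Longrightarrow> \<bar>k y - d n y\<bar> \<le> inverse (real (Suc n))" by metis
    have "AE x in mu.CM. \<bar>h k x - h (d n) x\<bar> \<le> inverse (real (Suc n))" for n
      by (rule h_close[OF k DY[OF d(1)] _ d(2)]) simp_all
    then have "AE x in mu.CM. \<forall>n. \<bar>h k x - h (d n) x\<bar> \<le> inverse (real (Suc n))" unfolding AE_all_countable ..
    then show ?thesis using good
    proof eventually_elim
      case (elim x)
      have "\<bar>radon_integral Y (f x) k - h k x\<bar> \<le> 0"
      proof (rule field_le_epsilon)
        fix e :: real assume "0 < e"
        then obtain n where n: "inverse (real (Suc n)) < e / 2" using reals_Archimedean[of "e/2"] by auto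
        have "\<bar>radon_integral Y (f x) k - h (d n) x\<bar> \<le> inverse (real (Suc n))"
          using elim(2) k d unfolding good_def by simp
        then show "\<bar>radon_integral Y (f x) k - h k x\<bar> \<le> 0 + e" using elim(1)[rule_format, of n] n by linarith
      qed
      then show ?case by simp
    qed
  qed
  have \<eta>0: "AE x in mu.CM. \<forall>e>0. \<exists>j. 1 - e < h (\<eta> j) x"
  proof -
    obtain U where U: "countable U" "U \<subseteq> test_functions X" "\<And>u x. u \<in> U \<Longrightarrow> 0 \<le> u x"
      "\<And>x W. openin X W \<Longrightarrow> x \<in> W \<Longrightarrow>
        \<exists>u\<in>U. \<exists>Q. openin X Q \<and> x \<in> Q \<and> (\<forall>y\<in>Q. u y = 1) \<and> (\<forall>y\<in>topspace X - W. u y = 0)"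
      by (rule X.bumps) (rule that)
    \<comment> \<open>For a bump \<open>u\<close> the integral of the infimum is at most
      \<open>radon_integral X \<mu> u - L u (\<eta> j)\<close> for each \<open>j\<close>, and this
      tends to 0 by the third property of \<open>\<eta>\<close>. The infimum replaces a pointwise
      limit, as \<open>h (\<eta> j) x\<close> need not converge a priori. The bumps make the
      integrals finite, and at each point some bump is 1.\<close>
    have "AE x in mu.CM. (INF j. ennreal (u x * (1 - h (\<eta> j) x))) = 0" if u: "u \<in> U" for u
    proof -
      have ut: "u \<in> test_functions X" using u U(2) by blast
      have m: "(\<lambda>x. ennreal (u x * (1 - h (\<eta> j) x))) \<in> borel_measurable mu.CM" for j
        using h(1)[OF \<eta>(1)] mu.tf_measurable[OF ut] by measurable
      have i: "integrable mu.CM (\<lambda>x. u x * (1 - h (\<eta> j) x))" for j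
        using mu.tf_integrable[OF ut] hi[OF ut \<eta>(1)] by (simp add: right_diff_distrib)
      have "(\<integral>\<^sup>+x. (INF j. ennreal (u x * (1 - h (\<eta> j) x))) \<partial>mu.CM) \<le> ennreal (radon_integral X \<mu> u - L u (\<eta> j))" for j
      proof -
        have "(\<integral>\<^sup>+x. (INF j. ennreal (u x * (1 - h (\<eta> j) x))) \<partial>mu.CM) \<le> (\<integral>\<^sup>+x. ennreal (u x * (1 - h (\<eta> j) x)) \<partial>mu.CM)"
          by (intro nn_integral_mono INF_lower) auto
        also have "\<dots> = ennreal (\<integral>x. u x * (1 - h (\<eta> j) x) \<partial>mu.CM)"
        proof (rule nn_integral_eq_integral[OF i])
          show "AE x in mu.CM. 0 \<le> u x * (1 - h (\<eta> j) x)"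
            using h_le[OF \<eta>(1), of 1 j] \<eta>(2) U(3)[OF u] by auto
        qed
        also have "(\<integral>x. u x * (1 - h (\<eta> j) x) \<partial>mu.CM) = radon_integral X \<mu> u - L u (\<eta> j)"
          using mu.tf_integrable[OF ut] hi[OF ut \<eta>(1)] h(3)[OF \<eta>(1) ut] by (simp add: right_diff_distrib mu.ri_eq)
        finally show ?thesis .
      qed
      moreover have "(\<lambda>j. ennreal (radon_integral X \<mu> u - L u (\<eta> j))) \<longlonglongrightarrow> ennreal (radon_integral X \<mu> u - radon_integral X \<mu> u)"
        by (intro tendsto_ennrealI tendsto_diff tendsto_const \<eta>(3)[OF ut U(3)[OF u]])
      ultimately have "(\<integral>\<^sup>+x. (INF j. ennreal (u x * (1 - h (\<eta> j) x))) \<partial>mu.CM) \<le> 0"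
        by (intro LIMSEQ_le_const[of _ 0]) auto
      then show ?thesis using m by (subst (asm) le_zero_eq, subst (asm) nn_integral_0_iff_AE) auto
    qed
    then have "AE x in mu.CM. \<forall>u\<in>U. (INF j. ennreal (u x * (1 - h (\<eta> j) x))) = 0"
      using U(1) by (simp add: AE_ball_countable)
    then show ?thesis
    proof (rule AE_mp[OF _ AE_I2], intro impI allI)
      fix x and e :: real assume x: "x \<in> space mu.CM" "\<forall>u\<in>U. (INF j. ennreal (u x * (1 - h (\<eta> j) x))) = 0" "0 < e"
      obtain u where "u \<in> U" "u x = 1" using U(4)[OF openin_topspace, of x] x(1) by auto
      then have "(INF j. ennreal (1 - h (\<eta> j) x)) < ennreal e" using x(2,3) by force
      then obtain j where "ennreal (1 - h (\<eta> j) x) < ennreal e" unfolding INF_less_iff by auto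
      then have "\<not> e \<le> 1 - h (\<eta> j) x" using ennreal_leI[of e "1 - h (\<eta> j) x"] by auto
      then show "\<exists>j. 1 - e < h (\<eta> j) x" by (intro exI[of _ j]) simp
    qed
  qed
  have "AE x in mu.CM. \<forall>j. radon_integral Y (f x) (\<eta> j) = h (\<eta> j) x"
    using f_eq[OF \<eta>(1)] unfolding AE_all_countable by blast
  then have prob: "AE x in mu.CM. f x \<in> prob_radon Y"
    using \<eta>0 good
  proof eventually_elim
    case (elim x)
    interpret fx: radon Y "f x" using elim(3) by (simp add: good_def)
    have "f x (topspace Y) \<le> 1"
    proof -
      have "f x K \<le> 1" if K: "compactin Y K" for K
      proof -
        obtain u Q where u: "u \<in> test_functions Y" "\<And>x. 0 \<le> u x" "\<And>x. u x \<le> 1"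
          "openin Y Q" "K \<subseteq> Q" "\<And>x. x \<in> Q \<Longrightarrow> u x = 1" by (rule Y.cutoff[OF K]) (rule that)
        have u1: "1 \<le> u y" if "y \<in> K" for y using u(5) u(6)[of y] that by auto
        have "f x K \<le> ennreal (radon_integral Y (f x) u)"
          using u u1 K by (intro fx.ri_lower fx.rm_compact fx.rm_compact_sets) auto
        also have "\<dots> \<le> ennreal 1"
          using elim(3) u unfolding good_def by (intro ennreal_leI) simp
        finally show ?thesis by simp
      qed
      then show ?thesis unfolding fx.rm_inner[OF openin_topspace] by (auto intro: SUP_least)
    qed
    \<comment> \<open>The constant 1 may fail to be a test function, so the mass is bounded from
      below through a cut-off with integral near 1 that vanishes off a compact
      \<open>K\<close>.\<close>
    moreover have "1 \<le> f x (topspace Y)"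
    proof (rule ennreal_le_epsilon)
      fix e :: real assume e: "0 < e"
      then obtain j where j: "1 - e < h (\<eta> j) x" using elim(2) by blast
      obtain K where K: "compactin Y K" "\<And>y. y \<in> topspace Y \<Longrightarrow> y \<notin> K \<Longrightarrow> \<eta> j y = 0"
        by (rule Y.tf_supp[OF \<eta>(1)]) (rule that)
      have "ennreal (radon_integral Y (f x) (\<eta> j)) \<le> f x K"
        using K \<eta> by (intro fx.ri_upper) auto
      also have "\<dots> \<le> f x (topspace Y)" using compactin_subset_topspace[OF K(1)] by (rule fx.out_mono)
      finally have *: "ennreal (h (\<eta> j) x) \<le> f x (topspace Y)" using elim(1) by simp
      have "ennreal 1 \<le> ennreal (max 0 (h (\<eta> j) x) + e)" using j by (intro ennreal_leI) auto
      also have "\<dots> = ennreal (h (\<eta> j) x) + ennreal e"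
        using e by (simp add: max_def ennreal_neg)
      also have "\<dots> \<le> f x (topspace Y) + ennreal e" using * by (rule add_right_mono)
      finally show "1 \<le> f x (topspace Y) + ennreal e" by simp
    qed
    ultimately show "f x \<in> prob_radon Y"
      unfolding prob_radon_def using fx.rm by auto
  qed
  show thesis
  proof (rule that[of f])
    show "young_function X Y \<mu> f"
      by (rule young_functionI[OF D prob, of h]) (use h(1) f_eq DY in auto)
    fix g k assume g: "g \<in> test_functions X" and k: "k \<in> test_functions Y"
    have m: "(\<lambda>x. radon_integral Y (f x) k) \<in> borel_measurable mu.CM"
      by (rule mu.borel_measurable_CM_AE[OF h(1)[OF k]]) (use f_eq[OF k] in auto)
    have "radon_integral X \<mu> (\<lambda>x. g x * radon_integral Y (f x) k) = (\<integral>x. g x * h k x \<partial>mu.CM)"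
      unfolding mu.ri_eq
    proof (rule integral_cong_AE)
      show "AE x in mu.CM. g x * radon_integral Y (f x) k = g x * h k x" using f_eq[OF k] by eventually_elim simp
    qed (use m h(1)[OF k] mu.tf_measurable[OF g] in measurable)
    then show "radon_integral X \<mu> (\<lambda>x. g x * radon_integral Y (f x) k) = L g k" using h(3)[OF k g] by simp
  qed
qed

end

section \<open>Compactness of Young functions\<close>

lemma diagonal_convergent:
  fixes a :: "nat \<Rightarrow> nat \<Rightarrow> real"
  assumes "\<And>n. bounded (range (\<lambda>i. a i n))"
  obtains r :: "nat \<Rightarrow> nat" where "strict_mono r" "\<And>n. convergent (\<lambda>i. a (r i) n)"
proof -
  let ?P = "\<lambda>n s. convergent (\<lambda>i. a (s i) n)"
  interpret subseqs ?P
  proof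
    fix n :: nat and s :: "nat \<Rightarrow> nat" assume "strict_mono s"
    have "bounded (range (\<lambda>i. a (s i) n))"
      using bounded_subset[OF assms[of n]] by (auto simp: image_subset_iff)
    then obtain l r where "strict_mono r" "((\<lambda>i. a (s i) n) \<circ> r) \<longlonglongrightarrow> l"
      using bounded_imp_convergent_subsequence[of "\<lambda>i. a (s i) n"] by blast
    then show "\<exists>r'. strict_mono r' \<and> convergent (\<lambda>i. a ((s \<circ> r') i) n)"
      by (auto simp: o_def convergent_def)
  qed
  have "convergent (\<lambda>i. a (diagseq i) n)" for n
  proof -
    have "?P n (diagseq \<circ> ((+) (Suc n)))"
    proof (rule diagseq_holds)
      fix r s :: "nat \<Rightarrow> nat" and n assume "strict_mono r" "?P n s"
      then show "?P n (s \<circ> r)" using convergent_subseq_convergent[of "\<lambda>i. a (s i) n" r] by (simp add: o_def)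
    qed
    then have "convergent (\<lambda>i. a (diagseq (i + Suc n)) n)" by (simp add: o_def add.commute)
    then show ?thesis using convergent_ignore_initial_segment[of "\<lambda>i. a (diagseq i) n" "Suc n"] by simp
  qed
  then show thesis using subseq_diagseq that by blast
qed

text \<open>Carries convergence from countably many pairs of test functions to all pairs; the limit
  of \<open>s\<close> is not known beforehand, hence the Cauchy argument.\<close>

lemma convergent_uniform_approx:
  fixes s :: "nat \<Rightarrow> real"
  assumes "\<And>e. 0 < e \<Longrightarrow> \<exists>t. convergent t \<and> (\<forall>i. \<bar>s i - t i\<bar> \<le> e)"
  shows "convergent s"
proof (rule Cauchy_convergent, rule metric_CauchyI)
  fix e :: real assume e: "0 < e"
  then obtain t where t: "convergent t" "\<And>i. \<bar>s i - t i\<bar> \<le> e / 4" using assms[of "e/4"] by auto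
  obtain M where M: "\<And>m n. m \<ge> M \<Longrightarrow> n \<ge> M \<Longrightarrow> dist (t m) (t n) < e / 4"
    using metric_CauchyD[OF convergent_Cauchy[OF t(1)], of "e/4"] e by auto
  have "dist (s m) (s n) < e" if "m \<ge> M" "n \<ge> M" for m n
    using M[OF that] t(2)[of m] t(2)[of n] e unfolding dist_real_def by linarith
  then show "\<exists>M. \<forall>m\<ge>M. \<forall>n\<ge>M. dist (s m) (s n) < e" by blast
qed

lemma (in radon) ri_upper_scaled:
  assumes g: "g \<in> test_functions X" and S: "S \<in> sets CM" "\<phi> S < \<infinity>"
    and C: "\<And>x. x \<in> topspace X \<Longrightarrow> x \<notin> S \<Longrightarrow> g x \<le> 0" "\<And>x. x \<in> topspace X \<Longrightarrow> g x \<le> C"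
  shows "radon_integral X \<phi> g \<le> C * enn2real (\<phi> S)"
proof -
  have i: "integrable CM (indicator S :: 'a \<Rightarrow> real)"
    using S by (auto simp: emeasure_CM simp flip: sets_CM intro!: integrable_real_indicator)
  have "radon_integral X \<phi> g \<le> (\<integral>x. C * indicator S x \<partial>CM)"
    unfolding ri_eq
  proof (rule integral_mono)
    show "integrable CM (\<lambda>x. C * indicator S x)" using i by (rule integrable_mult_right)
  qed (use g C in \<open>auto simp: indicator_def tf_integrable\<close>)
  also have "\<dots> = C * measure CM S"
    using i sets.sets_into_space[OF S(1)] by (simp add: Int_absorb2)
  also have "measure CM S = enn2real (\<phi> S)"
    using S by (simp add: measure_def emeasure_CM flip: sets_CM)
  finally show ?thesis .
qed

section \<open>The bilinear functional of a Young function\<close>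

context young
begin

text \<open>The value of the graph measure on the tensor product of \<open>g\<close> and
  \<open>k\<close> (\<open>pairing_eq\<close>), written as an integral over the base so that bounds
  on \<open>pair x k\<close> for almost every \<open>x\<close> apply.\<close>

definition pairing :: "('a \<Rightarrow> real) \<Rightarrow> ('b \<Rightarrow> real) \<Rightarrow> real" where
  "pairing g k = radon_integral X \<mu> (\<lambda>x. g x * pair x k)"

lemma pairing_eq:
  assumes "g \<in> test_functions X" "k \<in> test_functions Y"
  shows "pairing g k = radon_integral XY GM (\<lambda>z. g (fst z) * k (snd z))"
proof -
  have "pair x (\<lambda>y. g x * k y) = g x * pair x k" for x
    by (simp add: radon_integral_def)
  then show ?thesis
    unfolding pairing_def using graph_measure(2)[OF tf_tensor[OF assms]] by simp
qed

lemma pairing_integrable: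
  assumes "g \<in> test_functions X" "k \<in> test_functions Y"
  shows "integrable mu.CM (\<lambda>x. g x * pair x k)"
proof -
  have "pair x (\<lambda>y. g x * k y) = g x * pair x k" for x
    by (simp add: radon_integral_def)
  then show ?thesis using pair_slice_integrable[OF tf_tensor[OF assms]] by simp
qed

lemma pairing_add1:
  assumes "g \<in> test_functions X" "h \<in> test_functions X" "k \<in> test_functions Y"
  shows "pairing (\<lambda>x. g x + h x) k = pairing g k + pairing h k"
    "pairing (\<lambda>x. g x - h x) k = pairing g k - pairing h k"
  unfolding pairing_def mu.ri_eq using assms pairing_integrable
  by (simp_all add: distrib_right left_diff_distrib)

lemma pairing_cmult1: "pairing (\<lambda>x. c * g x) k = c * pairing g k"
  unfolding pairing_def mu.ri_eq by (simp add: mult.assoc)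

lemma pairing_add2:
  assumes "g \<in> test_functions X" "h \<in> test_functions Y" "k \<in> test_functions Y"
  shows "pairing g (\<lambda>y. h y + k y) = pairing g h + pairing g k"
    "pairing g (\<lambda>y. h y - k y) = pairing g h - pairing g k"
proof -
  interpret G: radon XY GM by (rule graph_measure)
  note t = tf_tensor[OF assms(1)]
  show "pairing g (\<lambda>y. h y + k y) = pairing g h + pairing g k"
    using G.ri_add[OF t[OF assms(2)] t[OF assms(3)]] assms
    by (simp add: pairing_eq Y.tf_add distrib_left)
  show "pairing g (\<lambda>y. h y - k y) = pairing g h - pairing g k"
    using G.ri_diff[OF t[OF assms(2)] t[OF assms(3)]] assms
    by (simp add: pairing_eq Y.tf_diff right_diff_distrib)
qed

lemma pairing_cmult2: "pairing g (\<lambda>y. c * k y) = c * pairing g k"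
proof -
  have "pair x (\<lambda>y. c * k y) = c * pair x k" for x by (simp add: radon_integral_def)
  then show ?thesis unfolding pairing_def mu.ri_eq by (simp add: mult.left_commute)
qed

lemma pairing_abs_le:
  assumes g: "g \<in> test_functions X" and k: "k \<in> test_functions Y" and C: "\<And>y. y \<in> topspace Y \<Longrightarrow> \<bar>k y\<bar> \<le> C"
  shows "\<bar>pairing g k\<bar> \<le> C * radon_integral X \<mu> (\<lambda>x. \<bar>g x\<bar>)"
proof -
  have "\<bar>pairing g k\<bar> \<le> (\<integral>x. \<bar>g x * pair x k\<bar> \<partial>mu.CM)"
    unfolding pairing_def mu.ri_eq by (rule integral_abs_bound)
  also have "\<dots> \<le> (\<integral>x. C * \<bar>g x\<bar> \<partial>mu.CM)"
  proof (rule integral_mono_AE)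
    show "AE x in mu.CM. \<bar>g x * pair x k\<bar> \<le> C * \<bar>g x\<bar>"
      using AE_prob
    proof eventually_elim
      case (elim x)
      have "\<bar>pair x k\<bar> \<le> C" by (rule Y.prob_abs_le[OF elim k C])
      then show ?case using mult_left_mono[of "\<bar>pair x k\<bar>" C "\<bar>g x\<bar>"] by (simp add: abs_mult mult.commute)
    qed
  qed (use pairing_integrable[OF g k] mu.tf_integrable[OF g] in auto)
  finally show ?thesis by (simp add: mu.ri_eq)
qed

lemma pairing_le:
  assumes g: "g \<in> test_functions X" "\<And>x. x \<in> topspace X \<Longrightarrow> 0 \<le> g x" and k: "k \<in> test_functions Y"
    and c: "0 \<le> c" "\<And>y. y \<in> topspace Y \<Longrightarrow> k y \<le> c"
  shows "pairing g k \<le> c * radon_integral X \<mu> g"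
proof -
  have "pairing g k \<le> (\<integral>x. c * g x \<partial>mu.CM)"
    unfolding pairing_def mu.ri_eq
  proof (rule integral_mono_AE)
    show "AE x in mu.CM. g x * pair x k \<le> c * g x"
    proof (rule AE_mp[OF AE_prob AE_I2], intro impI)
      fix x assume x: "x \<in> space mu.CM" "f x \<in> prob_radon Y"
      interpret fx: radon Y "f x" using Y.prob_radonD[OF x(2)] .
      \<comment> \<open>\<open>k\<close> is bounded from above only. Its positive part is a test
        function with absolute value at most \<open>c\<close>, to which the bound for probability
        measures applies.\<close>
      let ?p = "\<lambda>y. max 0 (k y)"
      have p: "?p \<in> test_functions Y"
        by (rule Y.tf_comp[OF _ _ k, of "\<lambda>t. max 0 t"]) (auto intro!: continuous_intros)
      have "pair x k \<le> pair x ?p" using k p by (intro fx.ri_mono) auto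
      also have "\<dots> \<le> c" using Y.prob_abs_le[OF x(2) p, of c] c by (auto simp: abs_le_iff)
      finally show "g x * pair x k \<le> c * g x"
        using g(2)[of x] x(1) mult_left_mono[of "pair x k" c "g x"] by (simp add: mult.commute)
    qed
  qed (use pairing_integrable[OF g(1) k] mu.tf_integrable[OF g(1)] in auto)
  then show ?thesis by (simp add: mu.ri_eq)
qed

text \<open>The same weights \<open>w\<close> and points \<open>p\<close> serve every measure and
  Young function, since the hypotheses on them speak of \<open>\<psi>\<close> and
  \<open>\<eta>\<close> alone; only the factor \<open>radon_integral X \<mu> \<eta>\<close>
  varies.\<close>

lemma graph_approx:
  assumes \<psi>: "\<psi> \<in> test_functions XY" and \<eta>: "\<eta> \<in> test_functions X"
    and w: "\<And>i. i < n \<Longrightarrow> w i \<in> test_functions X" "\<And>i. i < n \<Longrightarrow> p i \<in> topspace X"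
    and le: "\<And>x y. x \<in> topspace X \<Longrightarrow> y \<in> topspace Y \<Longrightarrow> \<bar>\<psi> (x, y) - (\<Sum>i<n. w i x * \<psi> (p i, y))\<bar> \<le> e * \<eta> x"
  shows "\<bar>radon_integral XY GM \<psi> - (\<Sum>i<n. pairing (w i) (\<lambda>y. \<psi> (p i, y)))\<bar> \<le> e * radon_integral X \<mu> \<eta>"
proof -
  have s: "(\<lambda>y. \<psi> (p i, y)) \<in> test_functions Y" if "i < n" for i using tf_slice[OF \<psi> w(2)[OF that]] .
  let ?S = "\<lambda>x. \<Sum>i<n. w i x * pair x (\<lambda>y. \<psi> (p i, y))"
  have iS: "integrable mu.CM ?S" using pairing_integrable w(1) s by (intro Bochner_Integration.integrable_sum) auto
  have "(\<Sum>i<n. pairing (w i) (\<lambda>y. \<psi> (p i, y))) = (\<integral>x. ?S x \<partial>mu.CM)"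
    unfolding pairing_def mu.ri_eq using pairing_integrable w(1) s
    by (intro Bochner_Integration.integral_sum[symmetric]) auto
  then have "\<bar>radon_integral XY GM \<psi> - (\<Sum>i<n. pairing (w i) (\<lambda>y. \<psi> (p i, y)))\<bar>
      = \<bar>\<integral>x. pair x (\<lambda>y. \<psi> (x, y)) - ?S x \<partial>mu.CM\<bar>"
    using graph_measure(2)[OF \<psi>] pair_slice_integrable[OF \<psi>] iS by (simp add: mu.ri_eq)
  also have "\<dots> \<le> (\<integral>x. \<bar>pair x (\<lambda>y. \<psi> (x, y)) - ?S x\<bar> \<partial>mu.CM)" by (rule integral_abs_bound)
  also have "\<dots> \<le> (\<integral>x. e * \<eta> x \<partial>mu.CM)"
  proof (rule integral_mono_AE)
    show "AE x in mu.CM. \<bar>pair x (\<lambda>y. \<psi> (x, y)) - ?S x\<bar> \<le> e * \<eta> x"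
    proof (rule AE_mp[OF AE_prob AE_I2], intro impI)
      fix x assume x: "x \<in> space mu.CM" "f x \<in> prob_radon Y"
      interpret fx: radon Y "f x" using Y.prob_radonD[OF x(2)] .
      have "?S x = pair x (\<lambda>y. \<Sum>i<n. w i x * \<psi> (p i, y))"
        using s by (subst fx.ri_sum) (auto intro: Y.tf_cmult simp: fx.ri_cmult)
      moreover have "\<bar>pair x (\<lambda>y. \<psi> (x, y)) - pair x (\<lambda>y. \<Sum>i<n. w i x * \<psi> (p i, y))\<bar> \<le> e * \<eta> x"
        using le x(1) s by (intro Y.prob_diff_le[OF x(2)] tf_slice[OF \<psi>, of x] Y.tf_sum Y.tf_cmult) auto
      ultimately show "\<bar>pair x (\<lambda>y. \<psi> (x, y)) - ?S x\<bar> \<le> e * \<eta> x" by simp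
    qed
  qed (use pair_slice_integrable[OF \<psi>] iS mu.tf_integrable[OF \<eta>] in auto)
  finally show ?thesis by (simp add: mu.ri_eq)
qed

text \<open>The constant 1 need not be a test function on \<open>Y\<close>. So the integral of
  \<open>g\<close> is reached as the limit of \<open>pairing g (\<eta> l)\<close>, by dominated
  convergence in the fibres and then in the base, while the excess over the term \<open>j\<close> is
  bounded by an integral over \<open>K \<times> (topspace Y - L j)\<close>: on \<open>L j\<close>
  the function \<open>\<eta> j\<close> is already 1 and \<open>\<eta> l\<close> cannot exceed
  it.\<close>

lemma pairing_tight:
  assumes L: "\<And>j::nat. L j \<subseteq> L (Suc j)" "(\<Union>j. L j) = topspace Y" "\<And>j. compactin Y (L j)"
    and \<eta>: "\<And>j. \<eta> j \<in> test_functions Y" "\<And>j y. 0 \<le> \<eta> j y" "\<And>j y. \<eta> j y \<le> 1" "\<And>j y. y \<in> L j \<Longrightarrow> \<eta> j y = 1"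
    and g: "g \<in> test_functions X" "\<And>x. 0 \<le> g x" "\<And>x. x \<in> topspace X \<Longrightarrow> g x \<le> C"
    and K: "compactin X K" "\<And>x. x \<in> topspace X \<Longrightarrow> x \<notin> K \<Longrightarrow> g x = 0"
    and fin: "GM (K \<times> (topspace Y - L j)) < \<infinity>" and C: "0 \<le> C"
  shows "radon_integral X \<mu> g - pairing g (\<eta> j) \<le> C * enn2real (GM (K \<times> (topspace Y - L j)))"
proof -
  interpret G: radon XY GM by (rule graph_measure)
  have Lmono: "L a \<subseteq> L b" if "a \<le> b" for a b using lift_Suc_mono_le[of L, OF L(1) that] .
  have AE1: "AE x in mu.CM. (\<lambda>l. pair x (\<eta> l)) \<longlonglongrightarrow> 1"
    using AE_prob
  proof eventually_elim
    case (elim x)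
    interpret fx: radon Y "f x" using Y.prob_radonD[OF elim] .
    interpret fin: finite_measure fx.CM by (rule finite_measureI) (simp only: Y.prob_space_CM[OF elim], simp)
    have "(\<lambda>l. \<integral>y. \<eta> l y \<partial>fx.CM) \<longlonglongrightarrow> (\<integral>y. 1 \<partial>fx.CM)"
    proof (rule integral_dominated_convergence[where w = "\<lambda>y. 1"])
      show "AE y in fx.CM. (\<lambda>l. \<eta> l y) \<longlonglongrightarrow> 1"
      proof (rule AE_I2)
        fix y assume "y \<in> space fx.CM"
        then obtain m where "y \<in> L m" using L(2) by auto
        then have "\<forall>\<^sub>F l in sequentially. \<eta> l y = 1"
          unfolding eventually_sequentially using Lmono \<eta>(4) by blast
        then show "(\<lambda>l. \<eta> l y) \<longlonglongrightarrow> 1" by (rule tendsto_eventually)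
      qed
    qed (use fx.tf_measurable \<eta> in auto)
    moreover have "measure fx.CM (space fx.CM) = 1" using Y.prob_space_CM[OF elim] by (simp add: measure_def)
    then have "(\<integral>y. 1 \<partial>fx.CM) = (1::real)" by simp
    ultimately show ?case unfolding fx.ri_eq by simp
  qed
  have "(\<lambda>l. pairing g (\<eta> l)) \<longlonglongrightarrow> (\<integral>x. g x \<partial>mu.CM)"
    unfolding pairing_def mu.ri_eq
  proof (rule integral_dominated_convergence[where w = g])
    show "AE x in mu.CM. (\<lambda>l. g x * pair x (\<eta> l)) \<longlonglongrightarrow> g x"
      using AE1
    proof eventually_elim
      case (elim x)
      show ?case using tendsto_mult[OF tendsto_const elim, of "g x"] by simp
    qed
    show "AE x in mu.CM. norm (g x * pair x (\<eta> l)) \<le> g x" for l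
      using AE_prob
    proof eventually_elim
      case (elim x)
      have "\<bar>pair x (\<eta> l)\<bar> \<le> 1" using \<eta> by (intro Y.prob_abs_le[OF elim]) auto
      then show ?case using g(2)[of x] by (simp add: abs_mult mult_left_le)
    qed
  qed (use mu.tf_integrable[OF g(1)] pairing_integrable[OF g(1) \<eta>(1)] in auto)
  then have lim: "(\<lambda>l. pairing g (\<eta> l) - pairing g (\<eta> j)) \<longlonglongrightarrow> radon_integral X \<mu> g - pairing g (\<eta> j)"
    unfolding mu.ri_eq by (intro tendsto_diff tendsto_const)
  let ?S = "K \<times> (topspace Y - L j)"
  have S: "?S \<in> sets G.CM"
  proof -
    have "closedin XY (K \<times> topspace Y)"
      using X.compactin_closedin[OF K(1)] by (simp add: closedin_prod_Times_iff)
    moreover have "closedin XY (K \<times> L j)"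
      using X.compactin_closedin[OF K(1)] Y.compactin_closedin[OF L(3)] by (simp add: closedin_prod_Times_iff)
    ultimately have "K \<times> topspace Y - K \<times> L j \<in> sets G.CM" by (intro sets.Diff G.rm_closed)
    moreover have "?S = K \<times> topspace Y - K \<times> L j" by auto
    ultimately show ?thesis by (simp only:)
  qed
  have "pairing g (\<eta> l) - pairing g (\<eta> j) \<le> C * enn2real (GM ?S)" for l
  proof -
    have t: "(\<lambda>y. \<eta> l y - \<eta> j y) \<in> test_functions Y" using \<eta>(1) by (intro Y.tf_diff)
    have "radon_integral XY GM (\<lambda>z. g (fst z) * (\<eta> l (snd z) - \<eta> j (snd z))) \<le> C * enn2real (GM ?S)"
    proof (rule G.ri_upper_scaled[OF tf_tensor[OF g(1) t] S fin])
      fix z assume z: "z \<in> topspace XY"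
      have d: "\<eta> l (snd z) - \<eta> j (snd z) \<le> 1" using \<eta>(2)[of j "snd z"] \<eta>(3)[of l "snd z"] by linarith
      have "g (fst z) * (\<eta> l (snd z) - \<eta> j (snd z)) \<le> g (fst z) * 1" using d g(2) by (intro mult_left_mono) auto
      also have "\<dots> \<le> C" using g(3)[of "fst z"] z by auto
      finally show "g (fst z) * (\<eta> l (snd z) - \<eta> j (snd z)) \<le> C" .
      assume "z \<notin> ?S"
      then have "fst z \<notin> K \<or> snd z \<in> L j" using z by (cases z) auto
      then show "g (fst z) * (\<eta> l (snd z) - \<eta> j (snd z)) \<le> 0"
      proof
        assume "fst z \<notin> K" then show ?thesis using K(2)[of "fst z"] z by auto
      next
        assume "snd z \<in> L j"
        then show ?thesis using \<eta>(3)[of l "snd z"] \<eta>(4)[of "snd z" j] g(2)[of "fst z"] by (simp add: mult_nonneg_nonpos)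
      qed
    qed
    then show ?thesis
      using pairing_add2(2)[OF g(1) \<eta>(1)[of l] \<eta>(1)[of j]] pairing_eq[OF g(1) t] by simp
  qed
  then show ?thesis by (intro LIMSEQ_le_const2[OF lim]) auto
qed

end

text \<open>A test function on the product is a finite sum of tensor products up to
  \<open>e * \<eta>\<close>. Weak convergence of the base measures bounds their integrals of
  \<open>\<eta>\<close>, so the error is uniform in \<open>i\<close> from some index on.\<close>

lemma (in lch2_pair) weak_graph_convergence:
  assumes y: "\<And>i. young X Y (\<mu>s i) (fs i)" "young X Y \<mu> f"
    and weak: "weakly_converges X \<mu>s \<mu>"
    and pw: "\<And>g k. g \<in> test_functions X \<Longrightarrow> k \<in> test_functions Y \<Longrightarrow>
      (\<lambda>i. young.pairing X Y (\<mu>s i) (fs i) g k) \<longlonglongrightarrow> young.pairing X Y \<mu> f g k"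
  shows "weakly_converges (prod_topology X Y) (\<lambda>i. graph_measure X Y (\<mu>s i) (fs i)) (graph_measure X Y \<mu> f)"
  unfolding weakly_converges_def
proof
  let ?XY = "prod_topology X Y"
  fix \<psi> assume \<psi>: "\<psi> \<in> test_functions ?XY"
  let ?a = "\<lambda>i. radon_integral ?XY (graph_measure X Y (\<mu>s i) (fs i)) \<psi>"
  let ?b = "radon_integral ?XY (graph_measure X Y \<mu> f) \<psi>"
  obtain \<eta> where \<eta>: "\<eta> \<in> test_functions X" "\<And>x. 0 \<le> \<eta> x"
    and approx: "\<And>e. 0 < e \<Longrightarrow> \<exists>(n::nat) w p. (\<forall>i<n. w i \<in> test_functions X \<and> p i \<in> topspace X) \<and>
        (\<forall>x\<in>topspace X. \<forall>y\<in>topspace Y. \<bar>\<psi> (x, y) - (\<Sum>i<n. w i x * \<psi> (p i, y))\<bar> \<le> e * \<eta> x)"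
    by (rule tf_tensor_approx[OF \<psi>]) (rule that)
  have I: "(\<lambda>i. radon_integral X (\<mu>s i) \<eta>) \<longlonglongrightarrow> radon_integral X \<mu> \<eta>"
    using weak \<eta>(1) unfolding weakly_converges_def by blast
  show "?a \<longlonglongrightarrow> ?b"
  proof (rule LIMSEQ_I)
    fix e' :: real assume e': "0 < e'"
    let ?I = "radon_integral X \<mu> \<eta>"
    have I0: "0 \<le> ?I" unfolding radon_integral_def by (rule integral_nonneg_AE) (simp add: \<eta>(2))
    \<comment> \<open>Eventually the integrals of \<open>\<eta>\<close> stay below
      \<open>?I + 1\<close>; with this \<open>e\<close> the two approximation errors and the error
      of the finite sums are each at most \<open>e' / 4\<close>.\<close>
    define e where "e = e' / (4 * (?I + 1))"
    have e: "0 < e" "e * (?I + 1) = e' / 4" using e' I0 by (auto simp: e_def field_simps)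
    from approx[OF e(1)] obtain n :: nat and w p where W: "\<forall>i<n. w i \<in> test_functions X \<and> p i \<in> topspace X"
        "\<forall>x\<in>topspace X. \<forall>y\<in>topspace Y. \<bar>\<psi> (x, y) - (\<Sum>i<n. w i x * \<psi> (p i, y))\<bar> \<le> e * \<eta> x"
      by (elim exE conjE) (rule that)
    have w: "\<And>l. l < n \<Longrightarrow> w l \<in> test_functions X" "\<And>l. l < n \<Longrightarrow> p l \<in> topspace X"
      and le: "\<And>x y. x \<in> topspace X \<Longrightarrow> y \<in> topspace Y \<Longrightarrow> \<bar>\<psi> (x, y) - (\<Sum>i<n. w i x * \<psi> (p i, y))\<bar> \<le> e * \<eta> x"
      using W by simp_all
    let ?S = "\<lambda>i. \<Sum>l<n. young.pairing X Y (\<mu>s i) (fs i) (w l) (\<lambda>y. \<psi> (p l, y))"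
    let ?T = "\<Sum>l<n. young.pairing X Y \<mu> f (w l) (\<lambda>y. \<psi> (p l, y))"
    have "?S \<longlonglongrightarrow> ?T" using w tf_slice[OF \<psi>] by (intro tendsto_sum pw) auto
    then obtain N1 where N1: "\<And>i. i \<ge> N1 \<Longrightarrow> \<bar>?S i - ?T\<bar> < e' / 4"
      using LIMSEQ_D[of ?S ?T "e'/4"] e' by auto
    obtain N2 where N2: "\<And>i. i \<ge> N2 \<Longrightarrow> \<bar>radon_integral X (\<mu>s i) \<eta> - ?I\<bar> < 1"
      using LIMSEQ_D[OF I, of 1] by auto
    have "norm (?a i - ?b) < e'" if "i \<ge> max N1 N2" for i
    proof -
      have a: "\<bar>?a i - ?S i\<bar> \<le> e * radon_integral X (\<mu>s i) \<eta>"
        by (rule young.graph_approx[OF y(1) \<psi> \<eta>(1)]) (use w le in auto)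
      have b: "\<bar>?b - ?T\<bar> \<le> e * ?I"
        by (rule young.graph_approx[OF y(2) \<psi> \<eta>(1)]) (use w le in auto)
      have "e * radon_integral X (\<mu>s i) \<eta> \<le> e * (?I + 1)" "e * ?I \<le> e * (?I + 1)"
        using N2[of i] that e(1) by (auto intro!: mult_left_mono)
      then show ?thesis using a b N1[of i] that e(2) e' unfolding real_norm_def by linarith
    qed
    then show "\<exists>no. \<forall>i\<ge>no. norm (?a i - ?b) < e'" by blast
  qed
qed

theorem (in lch2_pair) young_compactness:
  assumes rad: "\<And>i. radon X (\<mu>s i)" "radon X \<mu>"
    and weak: "weakly_converges X \<mu>s \<mu>"
    and yf: "\<And>i. young_function X Y (\<mu>s i) (fs i)"
    and L: "\<And>j::nat. compactin Y (L j)" "(\<Union>j. L j) = topspace Y" "\<And>j. L j \<subseteq> L (Suc j)"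
    and tight: "\<And>K. compactin X K \<Longrightarrow>
        (\<lambda>j. SUP i. graph_measure X Y (\<mu>s i) (fs i) (K \<times> (topspace Y - L j))) \<longlonglongrightarrow> 0"
  obtains f r where "young_function X Y \<mu> f" "strict_mono (r :: nat \<Rightarrow> nat)"
    "\<And>g k. g \<in> test_functions X \<Longrightarrow> k \<in> test_functions Y \<Longrightarrow>
      (\<lambda>i. young.pairing X Y (\<mu>s (r i)) (fs (r i)) g k) \<longlonglongrightarrow> young.pairing X Y \<mu> f g k"
proof -
  have y: "young X Y (\<mu>s i) (fs i)" for i
    using rad(1)[of i] yf[of i] by (intro young.intro lch2_pair_axioms young_axioms.intro)
  interpret R: lch2_pair_radon X Y \<mu>
    by (intro lch2_pair_radon.intro lch2_pair_axioms radon2.intro X.lch2_axioms rad)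
  let ?p = "\<lambda>i. young.pairing X Y (\<mu>s i) (fs i)"
  have I: "(\<lambda>i. radon_integral X (\<mu>s i) g) \<longlonglongrightarrow> radon_integral X \<mu> g" if "g \<in> test_functions X" for g
    using weak that unfolding weakly_converges_def by blast
  obtain D where D: "X.dense_family D" using X.dense_family_exists by blast
  obtain E where E: "Y.dense_family E" using Y.dense_family_exists by blast
  have DX: "d \<in> test_functions X" if "d \<in> D" for d using D that unfolding X.dense_family_def by blast
  have EY: "d \<in> test_functions Y" if "d \<in> E" for d using E that unfolding Y.dense_family_def by blast
  have c: "countable (D \<times> E)"
    using D E unfolding X.dense_family_def Y.dense_family_def by (intro countable_SIGMA) auto
  \<comment> \<open>The integrals of \<open>\<bar>g x\<bar>\<close> converge along the sequence,
    hence are bounded, and they dominate the pairings.\<close>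
  have bdd: "bounded (range (\<lambda>i. ?p i g k))" if g: "g \<in> test_functions X" and k: "k \<in> test_functions Y" for g k
  proof -
    obtain C where C: "0 < C" "\<And>y. y \<in> topspace Y \<Longrightarrow> \<bar>k y\<bar> \<le> C" by (rule Y.tf_bounded[OF k]) (rule that)
    have "Bseq (\<lambda>i. radon_integral X (\<mu>s i) (\<lambda>x. \<bar>g x\<bar>))"
      using I[OF X.tf_abs[OF g]] by (rule convergent_imp_Bseq[OF convergentI])
    then obtain B where B: "\<And>i. norm (radon_integral X (\<mu>s i) (\<lambda>x. \<bar>g x\<bar>)) \<le> B" unfolding Bseq_def by blast
    have "norm (?p i g k) \<le> C * B" for i
    proof -
      have "\<bar>?p i g k\<bar> \<le> C * radon_integral X (\<mu>s i) (\<lambda>x. \<bar>g x\<bar>)"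
        by (rule young.pairing_abs_le[OF y g k]) (rule C(2))
      also have "\<dots> \<le> C * B" using B[of i] C(1) by (intro mult_left_mono) auto
      finally show ?thesis by simp
    qed
    then show ?thesis unfolding bounded_iff by blast
  qed
  define a where "a i n = (let (d, d') = from_nat_into (D \<times> E) n in ?p i d d')" for i n
  have ne: "D \<times> E \<noteq> {}"
  proof -
    have "\<exists>d. d \<in> D" by (rule X.dense_approx[OF D X.tf_zero, of 1]) auto
    moreover have "\<exists>d. d \<in> E" by (rule Y.dense_approx[OF E Y.tf_zero, of 1]) auto
    ultimately show ?thesis by auto
  qed
  have "bounded (range (\<lambda>i. a i n))" for n
  proof -
    obtain d d' where d: "from_nat_into (D \<times> E) n = (d, d')" by fastforce
    then have "d \<in> D" "d' \<in> E" using from_nat_into[OF ne, of n] by auto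
    then show ?thesis unfolding a_def d using bdd DX EY by simp
  qed
  then obtain r :: "nat \<Rightarrow> nat" where r: "strict_mono r" "\<And>n. convergent (\<lambda>i. a (r i) n)"
    by (rule diagonal_convergent) (rule that)
  have conv0: "convergent (\<lambda>i. ?p (r i) d d')" if "d \<in> D" "d' \<in> E" for d d'
  proof -
    obtain n where "from_nat_into (D \<times> E) n = (d, d')"
      using from_nat_into_surj[OF c, of "(d, d')"] \<open>d \<in> D\<close> \<open>d' \<in> E\<close> by auto
    then show ?thesis using r(2)[of n] by (simp add: a_def)
  qed
  have Ir: "(\<lambda>i. radon_integral X (\<mu>s (r i)) g) \<longlonglongrightarrow> radon_integral X \<mu> g" if "g \<in> test_functions X" for g
    using LIMSEQ_subseq_LIMSEQ[OF I[OF that] r(1)] by (simp add: o_def)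
  have conv: "convergent (\<lambda>i. ?p (r i) g k)" if g: "g \<in> test_functions X" and k: "k \<in> test_functions Y" for g k
  proof (rule convergent_uniform_approx)
    fix e :: real assume e: "0 < e"
    obtain C where C: "0 < C" "\<And>y. y \<in> topspace Y \<Longrightarrow> \<bar>k y\<bar> \<le> C" by (rule Y.tf_bounded[OF k]) (rule that)
    obtain \<eta> where \<eta>: "\<eta> \<in> test_functions X" "\<forall>x. 0 \<le> \<eta> x \<and> \<eta> x \<le> 1"
        "\<forall>e>0. \<exists>d\<in>D. \<forall>x\<in>topspace X. \<bar>g x - d x\<bar> \<le> e * \<eta> x"
      using D g unfolding X.dense_family_def by blast
    \<comment> \<open>Replacing \<open>g\<close> and \<open>k\<close> by \<open>d\<close> and
      \<open>d'\<close> at accuracy \<open>t\<close> changes the pairing by at most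
      \<open>t * ?J i\<close>. As \<open>?J\<close> converges, a bound \<open>B\<close> is available
      before \<open>t\<close> is chosen; \<open>t \<le> 1\<close> is used for the estimate of
      \<open>\<bar>d x\<bar>\<close> by \<open>\<bar>g x\<bar> + \<eta> x\<close>.\<close>
    let ?J = "\<lambda>i. C * radon_integral X (\<mu>s (r i)) \<eta> + (radon_integral X (\<mu>s (r i)) (\<lambda>x. \<bar>g x\<bar>) + radon_integral X (\<mu>s (r i)) \<eta>)"
    have "convergent ?J"
      by (rule convergentI[OF tendsto_add[OF tendsto_mult_left[OF Ir[OF \<eta>(1)]]
            tendsto_add[OF Ir[OF X.tf_abs[OF g]] Ir[OF \<eta>(1)]]]])
    then obtain B where B: "0 < B" "\<And>i. norm (?J i) \<le> B" using convergent_imp_Bseq[of ?J] unfolding Bseq_def by blast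
    define t where "t = min 1 (e / B)"
    have t: "0 < t" "t \<le> 1" "t * B \<le> e" using e B(1) by (auto simp: t_def min_def field_simps)
    obtain d where d: "d \<in> D" "\<And>x. x \<in> topspace X \<Longrightarrow> \<bar>g x - d x\<bar> \<le> t * \<eta> x" using \<eta>(3) t(1) by blast
    obtain d' where d': "d' \<in> E" "\<And>y. y \<in> topspace Y \<Longrightarrow> \<bar>k y - d' y\<bar> \<le> t" by (rule Y.dense_approx[OF E k t(1)]) (rule that)
    note dX = DX[OF d(1)] and dY = EY[OF d'(1)]
    have "\<bar>?p (r i) g k - ?p (r i) d d'\<bar> \<le> e" for i
    proof -
      interpret Z: young X Y "\<mu>s (r i)" "fs (r i)" by (rule y)
      let ?R = "radon_integral X (\<mu>s (r i))"
      have "?p (r i) g k - ?p (r i) d d' = ?p (r i) (\<lambda>x. g x - d x) k + ?p (r i) d (\<lambda>y. k y - d' y)"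
        using Z.pairing_add1(2)[OF g dX k] Z.pairing_add2(2)[OF dX k dY] by simp
      moreover have "\<bar>?p (r i) (\<lambda>x. g x - d x) k\<bar> \<le> C * (t * ?R \<eta>)"
      proof -
        have "\<bar>?p (r i) (\<lambda>x. g x - d x) k\<bar> \<le> C * ?R (\<lambda>x. \<bar>g x - d x\<bar>)"
          by (rule Z.pairing_abs_le[OF X.tf_diff[OF g dX] k]) (rule C(2))
        also have "?R (\<lambda>x. \<bar>g x - d x\<bar>) \<le> ?R (\<lambda>x. t * \<eta> x)"
          by (intro Z.mu.ri_mono X.tf_abs X.tf_diff X.tf_cmult g dX \<eta>(1) d(2))
        finally show ?thesis using C(1) by (simp add: Z.mu.ri_cmult mult_left_mono)
      qed
      moreover have "\<bar>?p (r i) d (\<lambda>y. k y - d' y)\<bar> \<le> t * (?R (\<lambda>x. \<bar>g x\<bar>) + ?R \<eta>)"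
      proof -
        have "\<bar>?p (r i) d (\<lambda>y. k y - d' y)\<bar> \<le> t * ?R (\<lambda>x. \<bar>d x\<bar>)"
          by (rule Z.pairing_abs_le[OF dX Y.tf_diff[OF k dY]]) (rule d'(2))
        also have "?R (\<lambda>x. \<bar>d x\<bar>) \<le> ?R (\<lambda>x. \<bar>g x\<bar> + \<eta> x)"
        proof (intro Z.mu.ri_mono X.tf_abs X.tf_add g dX \<eta>(1))
          fix x assume x: "x \<in> topspace X"
          have "t * \<eta> x \<le> \<eta> x" using t \<eta>(2) by (simp add: mult_left_le_one_le)
          then show "\<bar>d x\<bar> \<le> \<bar>g x\<bar> + \<eta> x" using d(2)[OF x] by linarith
        qed
        finally show ?thesis using t(1) Z.mu.ri_add[OF X.tf_abs[OF g] \<eta>(1)] by (simp add: mult_left_mono)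
      qed
      ultimately have "\<bar>?p (r i) g k - ?p (r i) d d'\<bar> \<le> C * (t * ?R \<eta>) + t * (?R (\<lambda>x. \<bar>g x\<bar>) + ?R \<eta>)"
        by linarith
      also have "\<dots> = t * ?J i" by (simp add: algebra_simps)
      also have "\<dots> \<le> t * B" using B(2)[of i] t(1) by (intro mult_left_mono) (auto simp: abs_le_iff)
      finally show ?thesis using t(3) by linarith
    qed
    then show "\<exists>t. convergent t \<and> (\<forall>i. \<bar>?p (r i) g k - t i\<bar> \<le> e)" using conv0[OF d(1) d'(1)] by blast
  qed
  define Lf where "Lf g k = lim (\<lambda>i. ?p (r i) g k)" for g k
  have Lf: "(\<lambda>i. ?p (r i) g k) \<longlonglongrightarrow> Lf g k" if "g \<in> test_functions X" "k \<in> test_functions Y" for g k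
    unfolding Lf_def using conv[OF that] by (simp add: convergent_LIMSEQ_iff)
  have "\<forall>j. \<exists>u. u \<in> test_functions Y \<and> (\<forall>y. 0 \<le> u y \<and> u y \<le> (1::real)) \<and> (\<forall>y\<in>L j. u y = 1)"
  proof
    fix j
    obtain u Q where u: "u \<in> test_functions Y" "\<And>x. 0 \<le> u x" "\<And>x. u x \<le> 1"
        "openin Y Q" "L j \<subseteq> Q" "\<And>x. x \<in> Q \<Longrightarrow> u x = 1" by (rule Y.cutoff[OF L(1)]) (rule that)
    then show "\<exists>u. u \<in> test_functions Y \<and> (\<forall>y. 0 \<le> u y \<and> u y \<le> (1::real)) \<and> (\<forall>y\<in>L j. u y = 1)"
      by (intro exI[of _ u]) auto
  qed
  from choice[OF this] obtain \<eta> where "\<forall>j. \<eta> j \<in> test_functions Y \<and> (\<forall>y. 0 \<le> \<eta> j y \<and> \<eta> j y \<le> (1::real)) \<and> (\<forall>y\<in>L j. \<eta> j y = 1)"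
    ..
  then have \<eta>: "\<And>j. \<eta> j \<in> test_functions Y" "\<And>j y. 0 \<le> \<eta> j y" "\<And>j y. \<eta> j y \<le> 1" "\<And>j y. y \<in> L j \<Longrightarrow> \<eta> j y = 1"
    by auto
  have limit_tight: "(\<lambda>j. Lf g (\<eta> j)) \<longlonglongrightarrow> radon_integral X \<mu> g" if g: "g \<in> test_functions X" "\<And>x. 0 \<le> g x" for g
  proof (rule LIMSEQ_I)
    fix e :: real assume e: "0 < e"
    obtain C where C: "0 < C" "\<And>x. x \<in> topspace X \<Longrightarrow> \<bar>g x\<bar> \<le> C" by (rule X.tf_bounded[OF g(1)]) (rule that)
    obtain K where K: "compactin X K" "\<And>x. x \<in> topspace X \<Longrightarrow> x \<notin> K \<Longrightarrow> g x = 0"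
      by (rule X.tf_supp[OF g(1)]) (rule that)
    \<comment> \<open>The supremum runs over the whole sequence, so it bounds every index
      \<open>r i\<close> at once, and the resulting estimate, uniform in \<open>i\<close>, survives
      the passage to the limit.\<close>
    let ?\<tau> = "\<lambda>j. SUP i. graph_measure X Y (\<mu>s i) (fs i) (K \<times> (topspace Y - L j))"
    define \<delta> where "\<delta> = e / (2 * C)"
    have \<delta>: "0 < \<delta>" "C * \<delta> = e / 2" using e C(1) by (auto simp: \<delta>_def)
    have "\<forall>\<^sub>F j in sequentially. ?\<tau> j < ennreal \<delta>"
      using order_tendstoD(2)[OF tight[OF K(1)], of "ennreal \<delta>"] \<delta>(1) by simp
    then obtain N where N: "\<And>j. j \<ge> N \<Longrightarrow> ?\<tau> j < ennreal \<delta>" unfolding eventually_sequentially by blast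
    have "norm (Lf g (\<eta> j) - radon_integral X \<mu> g) < e" if "j \<ge> N" for j
    proof -
      have d: "radon_integral X (\<mu>s (r i)) g - ?p (r i) g (\<eta> j) \<le> e / 2"
        "?p (r i) g (\<eta> j) \<le> radon_integral X (\<mu>s (r i)) g" for i
      proof -
        interpret Z: young X Y "\<mu>s (r i)" "fs (r i)" by (rule y)
        have "Z.GM (K \<times> (topspace Y - L j)) \<le> ?\<tau> j" by (rule SUP_upper) simp
        then have l: "Z.GM (K \<times> (topspace Y - L j)) < ennreal \<delta>" using N[OF that] by simp
        then have fin: "Z.GM (K \<times> (topspace Y - L j)) < \<infinity>" by (rule order.strict_trans) simp
        have "radon_integral X (\<mu>s (r i)) g - ?p (r i) g (\<eta> j) \<le> C * enn2real (Z.GM (K \<times> (topspace Y - L j)))"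
          by (rule Z.pairing_tight[OF L(3,2,1) \<eta> g _ K fin]) (use C in \<open>auto simp: abs_le_iff\<close>)
        also have "\<dots> \<le> C * \<delta>"
          using C(1) l \<delta>(1) by (intro mult_left_mono enn2real_leI) auto
        finally show "radon_integral X (\<mu>s (r i)) g - ?p (r i) g (\<eta> j) \<le> e / 2" using \<delta>(2) by simp
        show "?p (r i) g (\<eta> j) \<le> radon_integral X (\<mu>s (r i)) g"
          using Z.pairing_le[OF g(1) _ \<eta>(1)[of j], of 1] g(2) \<eta>(3) by simp
      qed
      have "radon_integral X \<mu> g - Lf g (\<eta> j) \<le> e / 2"
        by (rule LIMSEQ_le_const2[OF tendsto_diff[OF Ir[OF g(1)] Lf[OF g(1) \<eta>(1)]]]) (use d(1) in auto)
      moreover have "Lf g (\<eta> j) \<le> radon_integral X \<mu> g"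
        by (rule LIMSEQ_le[OF Lf[OF g(1) \<eta>(1)] Ir[OF g(1)]]) (use d(2) in auto)
      ultimately show ?thesis using e by simp
    qed
    then show "\<exists>no. \<forall>j\<ge>no. norm (Lf g (\<eta> j) - radon_integral X \<mu> g) < e" by blast
  qed
  obtain f where f: "young_function X Y \<mu> f"
    "\<And>g k. g \<in> test_functions X \<Longrightarrow> k \<in> test_functions Y \<Longrightarrow>
        radon_integral X \<mu> (\<lambda>x. g x * radon_integral Y (f x) k) = Lf g k"
  proof (rule R.disintegration[of Lf \<eta>])
    show "Lf (\<lambda>x. g x + h x) k = Lf g k + Lf h k"
      if t: "g \<in> test_functions X" "h \<in> test_functions X" "k \<in> test_functions Y" for g h k
      by (rule LIMSEQ_unique[OF Lf[OF X.tf_add[OF t(1,2)] t(3)]])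
        (simp only: young.pairing_add1[OF y t], intro tendsto_add Lf t)
    show "Lf (\<lambda>x. c * g x) k = c * Lf g k" if t: "g \<in> test_functions X" "k \<in> test_functions Y" for g c k
      by (rule LIMSEQ_unique[OF Lf[OF X.tf_cmult[OF t(1)] t(2)]])
        (simp only: young.pairing_cmult1[OF y], intro tendsto_mult_left Lf t)
    show "Lf g (\<lambda>y. h y + k y) = Lf g h + Lf g k"
      if t: "g \<in> test_functions X" "h \<in> test_functions Y" "k \<in> test_functions Y" for g h k
      by (rule LIMSEQ_unique[OF Lf[OF t(1) Y.tf_add[OF t(2,3)]]])
        (simp only: young.pairing_add2[OF y t], intro tendsto_add Lf t)
    show "Lf g (\<lambda>y. c * k y) = c * Lf g k" if t: "g \<in> test_functions X" "k \<in> test_functions Y" for g c k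
      by (rule LIMSEQ_unique[OF Lf[OF t(1) Y.tf_cmult[OF t(2)]]])
        (simp only: young.pairing_cmult2[OF y], intro tendsto_mult_left Lf t)
    show "Lf g k \<le> c * radon_integral X \<mu> g"
      if g: "g \<in> test_functions X" "\<And>x. x \<in> topspace X \<Longrightarrow> 0 \<le> g x" and k: "k \<in> test_functions Y"
        and c: "0 \<le> c" "\<And>y. y \<in> topspace Y \<Longrightarrow> k y \<le> c" for g k c
    proof (rule LIMSEQ_le[OF Lf[OF g(1) k] tendsto_mult_left[OF Ir[OF g(1)]]])
      have "?p (r i) g k \<le> c * radon_integral X (\<mu>s (r i)) g" for i
        by (rule young.pairing_le[OF y g(1) _ k c(1)]) (use g(2) c(2) in auto)
      then show "\<exists>N. \<forall>n\<ge>N. ?p (r n) g k \<le> c * radon_integral X (\<mu>s (r n)) g" by blast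
    qed
  qed (use \<eta> limit_tight in auto)
  have yl: "young X Y \<mu> f"
    using rad(2) f(1) by (intro young.intro lch2_pair_axioms young_axioms.intro)
  show thesis
    by (rule that[OF f(1) r(1)]) (use Lf f(2) in \<open>simp add: young.pairing_def[OF yl]\<close>)
qed

section \<open>Marginals along a compact factor\<close>

text \<open>With a compact second factor, cylinders over compact sets are compact. Therefore the
  marginal of a Radon measure is again Radon, and test functions on the base lift to test functions
  on the product.\<close>

locale compact_factor = lch2_pair X G + V: radon "prod_topology X G" V
  for X :: "'a topology" and G :: "'c topology" and V +
  assumes cG: "compact_space G"
begin

abbreviation "XG \<equiv> prod_topology X G"

definition marg :: "'a set \<Rightarrow> ennreal" where "marg A = V (A \<times> topspace G)"

lemma compactin_cylinder: "compactin X K \<Longrightarrow> compactin XG (K \<times> topspace G)"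
  using cG by (simp add: compactin_Times compact_space_def)

lemma openin_cylinder: "openin X W \<Longrightarrow> openin XG (W \<times> topspace G)"
  by (simp add: openin_prod_Times_iff)

lemma measure_over_marg: "measure_over (topspace X) marg"
proof (rule measure_overI)
  show "marg {} = 0" by (simp add: marg_def)
  show "marg A \<le> marg B" if "A \<subseteq> B" for A B unfolding marg_def using that by (intro V.out_mono) auto
  show "marg (\<Union>i. A i) \<le> (\<Sum>i. marg (A i))" for A :: "nat \<Rightarrow> 'a set"
  proof -
    have "(\<Union>i. A i) \<times> topspace G = (\<Union>i. A i \<times> topspace G)" by auto
    then show ?thesis unfolding marg_def using V.out_UN[of "\<lambda>i. A i \<times> topspace G"] by simp
  qed
  show "marg A = marg (A \<inter> topspace X)" for A
  proof -
    have "(A \<times> topspace G) \<inter> topspace XG = ((A \<inter> topspace X) \<times> topspace G) \<inter> topspace XG" by auto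
    then show ?thesis unfolding marg_def by (metis V.out_Int)
  qed
qed

text \<open>Inner regularity is inherited by projecting compact subsets of
  \<open>W \<times> topspace G\<close>. For outer regularity, the tube lemma puts an open cylinder
  between a full cylinder and an open set around it.\<close>

lemma radon_marg: "radon X marg"
proof
  interpret m: outer_meas "topspace X" marg by unfold_locales (rule measure_over_marg)
  show "radon_measure X marg"
    unfolding radon_measure_def
  proof (intro conjI allI impI)
    show "measure_over (topspace X) marg" by (rule measure_over_marg)
    show "marg K < \<infinity>" if "compactin X K" for K
      unfolding marg_def by (rule V.rm_compact[OF compactin_cylinder[OF that]])
    fix W assume W: "openin X W"
    note WG = openin_cylinder[OF W]
    show "W \<in> caratheodory_sets (topspace X) marg"
      unfolding m.carath_iff
    proof (intro conjI allI impI)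
      show "W \<subseteq> topspace X" by (rule openin_subset[OF W])
      fix B assume B: "B \<subseteq> topspace X"
      have "\<forall>Q\<subseteq>topspace XG. V (Q \<inter> (W \<times> topspace G)) + V (Q - (W \<times> topspace G)) \<le> V Q"
        using V.rm_open[OF WG] unfolding V.sets_CM V.carath_iff by (rule conjunct2)
      moreover have "B \<times> topspace G \<subseteq> topspace XG" using B by auto
      ultimately have "V ((B \<times> topspace G) \<inter> (W \<times> topspace G)) + V ((B \<times> topspace G) - (W \<times> topspace G)) \<le> V (B \<times> topspace G)"
        by (elim allE impE)
      moreover have "(B \<times> topspace G) \<inter> (W \<times> topspace G) = (B \<inter> W) \<times> topspace G"
        "(B \<times> topspace G) - (W \<times> topspace G) = (B - W) \<times> topspace G" by auto
      ultimately show "marg (B \<inter> W) + marg (B - W) \<le> marg B" by (simp add: marg_def)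
    qed
    show "marg W = (SUP K\<in>{K. compactin X K \<and> K \<subseteq> W}. marg K)"
    proof (rule antisym)
      show "marg W \<le> (SUP K\<in>{K. compactin X K \<and> K \<subseteq> W}. marg K)"
        unfolding marg_def V.rm_inner[OF WG]
      proof (rule SUP_least)
        fix M assume "M \<in> {K. compactin XG K \<and> K \<subseteq> W \<times> topspace G}"
        then have M: "compactin XG M" "M \<subseteq> W \<times> topspace G" by auto
        have "compactin X (fst ` M)" by (rule image_compactin[OF M(1) continuous_map_fst])
        moreover have "V M \<le> V (fst ` M \<times> topspace G)" using M(2) by (intro V.out_mono) force
        moreover have "fst ` M \<subseteq> W" using M(2) by auto
        ultimately show "V M \<le> (SUP K\<in>{K. compactin X K \<and> K \<subseteq> W}. V (K \<times> topspace G))"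
          by (intro SUP_upper2[of "fst ` M"]) auto
      qed
    qed (auto intro!: SUP_least m.out_mono)
  next
    fix A assume A: "A \<subseteq> topspace X"
    then have AG: "A \<times> topspace G \<subseteq> topspace XG" by auto
    show "marg A = (INF W\<in>{W. openin X W \<and> A \<subseteq> W}. marg W)"
    proof (rule antisym)
      show "(INF W\<in>{W. openin X W \<and> A \<subseteq> W}. marg W) \<le> marg A"
        unfolding marg_def V.rm_outer[OF AG]
      proof (rule INF_greatest)
        fix Q assume "Q \<in> {W. openin XG W \<and> A \<times> topspace G \<subseteq> W}"
        then have Q: "openin XG Q" "A \<times> topspace G \<subseteq> Q" by auto
        have "\<exists>U. openin X U \<and> x \<in> U \<and> U \<times> topspace G \<subseteq> Q" if x: "x \<in> A" for x
        proof -
          have "{x} \<times> topspace G \<subseteq> Q" using x Q(2) by auto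
          then obtain U T where "openin X U" "x \<in> U" "topspace G \<subseteq> T" "U \<times> T \<subseteq> Q"
            using tube_lemma_right[OF Q(1), of "topspace G" x] cG x A unfolding compact_space_def by blast
          then show ?thesis by (intro exI[of _ U]) auto
        qed
        then obtain U where U: "\<And>x. x \<in> A \<Longrightarrow> openin X (U x) \<and> x \<in> U x \<and> U x \<times> topspace G \<subseteq> Q" by metis
        have "openin X (\<Union>x\<in>A. U x)" using U by (intro openin_Union) auto
        moreover have "A \<subseteq> (\<Union>x\<in>A. U x)" using U by auto
        moreover have "V ((\<Union>x\<in>A. U x) \<times> topspace G) \<le> V Q" using U by (intro V.out_mono) blast
        ultimately show "(INF W\<in>{W. openin X W \<and> A \<subseteq> W}. V (W \<times> topspace G)) \<le> V Q"
          by (intro INF_lower2[of "\<Union>x\<in>A. U x"]) auto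
      qed
    qed (auto intro!: INF_greatest m.out_mono)
  qed
qed

sublocale M: radon2 X marg
  by (intro radon2.intro X.lch2_axioms radon_marg)

text \<open>A measurable set of finite measure is a \<open>G\<^sub>\<delta>\<close> set minus a null set, and both lift to the product.\<close>

lemma cylinder_measurable:
  assumes A: "A \<in> sets M.CM"
  shows "A \<times> topspace G \<in> sets V.CM"
proof -
  obtain K where K: "\<And>n::nat. compactin X (K n)" "(\<Union>n. K n) = topspace X"
    by (rule X.sigma_compact) (rule that)
  have "(A \<inter> K n) \<times> topspace G \<in> sets V.CM" for n
  proof -
    let ?A = "A \<inter> K n"
    have Am: "?A \<in> sets M.CM" using A M.rm_compact_sets[OF K(1)] by blast
    have AX: "?A \<subseteq> topspace X" using sets.sets_into_space[OF Am] by simp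
    have Af: "marg ?A < \<infinity>" using M.out_mono[of ?A "K n"] M.rm_compact[OF K(1)[of n]] by (meson inf_le2 le_less_trans)
    have "\<exists>W. openin X W \<and> ?A \<subseteq> W \<and> marg W < marg ?A + ennreal (inverse (real (Suc j)))" for j
    proof -
      have "(INF W\<in>{W. openin X W \<and> ?A \<subseteq> W}. marg W) < marg ?A + ennreal (inverse (real (Suc j)))"
        using Af M.rm_outer[OF AX] ennreal_add_left_cancel_less[of "marg ?A" 0 "ennreal (inverse (real (Suc j)))"]
        by (simp add: less_top[symmetric])
      then show ?thesis unfolding INF_less_iff by auto
    qed
    then obtain W where W: "\<And>j. openin X (W j)" "\<And>j. ?A \<subseteq> W j"
        "\<And>j. marg (W j) < marg ?A + ennreal (inverse (real (Suc j)))" by metis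
    let ?Z = "(\<Inter>j. W j) - ?A"
    have "marg ?Z \<le> ennreal (inverse (real (Suc j)))" for j
    proof -
      have "marg ?Z \<le> marg (W j - ?A)" by (intro M.out_mono) auto
      also have "\<dots> = marg (W j) - marg ?A"
        using emeasure_Diff[of M.CM ?A "W j"] Am Af W(1,2)[of j] M.rm_open[OF W(1)]
        by (simp add: M.emeasure_CM sets.Diff flip: M.sets_CM)
      also have "\<dots> \<le> ennreal (inverse (real (Suc j)))"
        using less_imp_le[OF W(3)[of j]] Af by (auto simp: ennreal_minus_le_iff add.commute)
      finally show ?thesis .
    qed
    moreover have "(\<lambda>j. ennreal (inverse (real (Suc j)))) \<longlonglongrightarrow> 0"
      using tendsto_ennrealI[OF LIMSEQ_inverse_real_of_nat] by simp
    ultimately have "marg ?Z \<le> 0" by (intro LIMSEQ_le_const[of _ 0]) auto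
    then have Z: "?Z \<times> topspace G \<in> null_sets V.CM"
      unfolding V.null_sets_CM marg_def using openin_subset[OF W(1)] by auto
    have "(\<Inter>j. W j \<times> topspace G) - ?Z \<times> topspace G \<in> sets V.CM"
      using V.rm_open[OF openin_cylinder[OF W(1)]] Z by (intro sets.Diff sets.countable_INT) auto
    moreover have "(\<Inter>j. W j \<times> topspace G) - ?Z \<times> topspace G = ?A \<times> topspace G"
      using W(2) by blast
    ultimately show ?thesis by simp
  qed
  then have "(\<Union>n. (A \<inter> K n) \<times> topspace G) \<in> sets V.CM" by (intro sets.countable_UN) auto
  moreover have "(\<Union>n. (A \<inter> K n) \<times> topspace G) = A \<times> topspace G"
    using K(2) sets.sets_into_space[OF A] by auto
  ultimately show ?thesis by simp
qed

lemma fst_vimage: "A \<subseteq> topspace X \<Longrightarrow> fst -` A \<inter> topspace XG = A \<times> topspace G"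
  by auto

lemma fst_measurable: "fst \<in> measurable V.CM M.CM"
proof (rule measurableI)
  fix A assume A: "A \<in> sets M.CM"
  then show "fst -` A \<inter> space V.CM \<in> sets V.CM"
    using cylinder_measurable[OF A] fst_vimage[of A] sets.sets_into_space[OF A]
    by (simp del: topspace_prod_topology)
next
  fix z assume "z \<in> space V.CM"
  then have "z \<in> topspace XG" by (simp only: V.space_CM)
  then show "fst z \<in> space M.CM" by auto
qed

lemma distr_fst: "distr V.CM M.CM fst = M.CM"
proof (rule measure_eqI)
  fix A assume "A \<in> sets (distr V.CM M.CM fst)"
  then have A: "A \<in> sets M.CM" by simp
  then show "emeasure (distr V.CM M.CM fst) A = emeasure M.CM A"
    using cylinder_measurable[OF A] fst_vimage[of A] sets.sets_into_space[OF A]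
    by (simp add: emeasure_distr[OF fst_measurable A] V.emeasure_CM M.emeasure_CM marg_def V.sets_CM M.sets_CM
        del: topspace_prod_topology)
qed simp

lemma integral_marg:
  fixes g :: "'a \<Rightarrow> real"
  shows "g \<in> borel_measurable M.CM \<Longrightarrow> (\<integral>z. g (fst z) \<partial>V.CM) = (\<integral>x. g x \<partial>M.CM)"
  using integral_distr[OF fst_measurable, of g] by (simp add: distr_fst del: topspace_prod_topology)

lemma tf_fst:
  assumes g: "g \<in> test_functions X"
  shows "(\<lambda>z. g (fst z)) \<in> test_functions XG"
proof -
  obtain K where K: "compactin X K" "\<And>x. x \<in> topspace X \<Longrightarrow> x \<notin> K \<Longrightarrow> g x = 0"
    by (rule X.tf_supp[OF g]) (rule that)
  have "continuous_map XG euclideanreal (g \<circ> fst)"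
    using X.tf_cont[OF g] continuous_map_fst by (intro continuous_map_compose)
  then show ?thesis
    using K(2) by (intro P.tfI[OF _ compactin_cylinder[OF K(1)]]) (auto simp: o_def, blast)
qed

lemma ri_marg: "g \<in> test_functions X \<Longrightarrow> radon_integral X marg g = radon_integral XG V (\<lambda>z. g (fst z))"
  using integral_marg[OF M.tf_measurable] by (simp add: M.ri_eq V.ri_eq del: topspace_prod_topology)

text \<open>The exceptional set and all preimages under \<open>f \<circ> fst\<close> are cylinders
  over those of \<open>f\<close>.\<close>

lemma young_function_fst:
  assumes "young_function X Y marg f"
  shows "young_function XG Y V (f \<circ> fst)"
  unfolding young_function_def
proof (intro conjI allI impI)
  have "{z \<in> topspace XG. (f \<circ> fst) z \<notin> prob_radon Y} = {x \<in> topspace X. f x \<notin> prob_radon Y} \<times> topspace G" by auto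
  then show "V {z \<in> topspace XG. (f \<circ> fst) z \<notin> prob_radon Y} = 0"
    using assms unfolding young_function_def marg_def by simp
  fix W assume "openin (prob_topology Y) W"
  then have "{x \<in> topspace X. f x \<in> W} \<in> sets M.CM" using assms unfolding young_function_def M.sets_CM by blast
  moreover have "{z \<in> topspace XG. (f \<circ> fst) z \<in> W} = {x \<in> topspace X. f x \<in> W} \<times> topspace G" by auto
  ultimately show "{z \<in> topspace XG. (f \<circ> fst) z \<in> W} \<in> caratheodory_sets (topspace XG) V"
    using cylinder_measurable unfolding V.sets_CM by simp
qed

end

section \<open>The Grassmannian is compact\<close>

lemma second_countable_top_of_set: "second_countable (top_of_set (S :: 'a::second_countable_topology set))"
proof (rule second_countable_subtopology)
  obtain B :: "'a set set" where B: "countable B" "\<And>C. C \<in> B \<Longrightarrow> open C" "\<And>S. open S \<Longrightarrow> \<exists>U. U \<subseteq> B \<and> S = \<Union>U"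
    by (rule univ_second_countable) (rule that)
  show "second_countable (euclidean :: 'a topology)"
    unfolding second_countable_def
  proof (intro exI[of _ B] conjI allI impI ballI)
    fix U x assume "openin euclidean U \<and> (x :: 'a) \<in> U"
    then show "\<exists>V\<in>B. x \<in> V \<and> V \<subseteq> U" using B(3)[of U] by auto
  qed (use B in auto)
qed

text \<open>Orthonormal frames, written as matrices with orthonormal rows: a compact parameter space
  for the Grassmannian.\<close>

definition frames :: "(real^'n^'m) set" where
  "frames = {A. \<forall>i j. A $ i \<bullet> A $ j = (if i = j then 1 else 0)}"

text \<open>The transpose of \<open>A\<close> times \<open>A\<close>, which for a frame is the
  matrix of the orthogonal projection onto the span of the rows; being polynomial in
  \<open>A\<close>, it is continuous.\<close>

definition frame_projection :: "real^'n^'m \<Rightarrow> real^'n^'n" where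
  "frame_projection A = (\<chi> j k. \<Sum>i\<in>UNIV. A $ i $ j * A $ i $ k)"

lemma compact_frames: "compact (frames :: (real^'n::finite^'m::finite) set)"
proof -
  have c: "closed {A :: real^'n^'m. A $ i \<bullet> A $ j = (if i = j then 1 else 0)}" for i j
    by (intro closed_Collect_eq continuous_intros)
  have "closed (\<Inter>i. \<Inter>j. {A :: real^'n^'m. A $ i \<bullet> A $ j = (if i = j then 1 else 0)})"
    by (intro closed_INT ballI c)
  also have "(\<Inter>i. \<Inter>j. {A :: real^'n^'m. A $ i \<bullet> A $ j = (if i = j then 1 else 0)}) = frames"
    by (auto simp: frames_def)
  finally have "closed (frames :: (real^'n^'m) set)" .
  moreover have "bounded (frames :: (real^'n^'m) set)"
    unfolding bounded_iff
  proof (intro exI ballI)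
    fix A :: "real^'n^'m" assume "A \<in> frames"
    then have "norm (A $ i) = 1" for i unfolding frames_def by (simp add: norm_eq_1)
    then show "norm A \<le> real CARD('m)"
      using norm_le_l1_cart[of "\<chi> i. norm (A $ i)"] unfolding norm_vec_def L2_set_def by simp
  qed
  ultimately show ?thesis by (simp add: compact_eq_bounded_closed)
qed

lemma continuous_frame_projection: "continuous_on S frame_projection"
  unfolding frame_projection_def by (intro continuous_intros)

lemma
  fixes A :: "real^'n::finite^'m::finite"
  assumes A: "A \<in> frames"
  shows frame_grassmannian: "span (range (($) A)) \<in> grassmannian CARD('m)"
    and matrix_closest_point_frame: "matrix (closest_point (span (range (($) A)))) = frame_projection A"
proof -
  let ?S = "span (range (($) A))"
  have ip: "A $ i \<bullet> A $ j = (if i = j then 1 else 0)" for i j using A by (simp add: frames_def)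
  have inj: "inj (($) A)"
  proof (rule injI)
    fix i j assume "A $ i = A $ j"
    then show "i = j" using ip[of i i] ip[of i j] by (auto split: if_splits)
  qed
  have "independent (range (($) A))"
  proof (rule pairwise_orthogonal_independent)
    show "pairwise orthogonal (range (($) A))"
      using ip by (auto simp: pairwise_def orthogonal_def)
    show "0 \<notin> range (($) A)" using ip by (metis imageE inner_zero_left zero_neq_one)
  qed
  then have "dim ?S = card (range (($) A))" by (simp add: dim_eq_card_independent)
  also have "\<dots> = CARD('m)" by (rule card_image[OF inj])
  finally show "?S \<in> grassmannian CARD('m)" by (simp add: grassmannian_def subspace_span)
  \<comment> \<open>The Fourier sum over the frame; its residual is orthogonal to the span, so
    Pythagoras identifies it with the nearest point.\<close>
  define P where "P x = (\<Sum>i\<in>UNIV. (x \<bullet> A $ i) *\<^sub>R A $ i)" for x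
  have PS: "P x \<in> ?S" for x unfolding P_def by (intro span_sum span_scale span_base) auto
  have orth: "(x - P x) \<bullet> z = 0" if "z \<in> ?S" for x z
    using that
  proof (induction rule: span_induct_alt)
    case (step c y z)
    then obtain j where j: "y = A $ j" by auto
    have "P x \<bullet> A $ j = (\<Sum>i\<in>UNIV. (x \<bullet> A $ i) * (if i = j then 1 else 0))"
      unfolding P_def inner_sum_left by (simp add: ip)
    also have "\<dots> = x \<bullet> A $ j" by (simp add: if_distrib cong: if_cong)
    finally show ?case using step j by (simp add: inner_add_right inner_diff_left)
  qed simp
  have cp: "closest_point ?S x = P x" for x
  proof (rule closest_point_unique[symmetric])
    show "\<forall>z\<in>?S. dist x (P x) \<le> dist x z"
    proof
      fix z assume z: "z \<in> ?S"
      have "P x - z \<in> ?S" using PS z by (rule span_diff)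
      then have o: "(x - P x) \<bullet> (P x - z) = 0" by (rule orth)
      have "(x - z) \<bullet> (x - z) = (x - P x) \<bullet> (x - P x) + (P x - z) \<bullet> (P x - z)"
        using o by (simp add: algebra_simps inner_commute)
      then have "(x - P x) \<bullet> (x - P x) \<le> (x - z) \<bullet> (x - z)" by simp
      then show "dist x (P x) \<le> dist x z" by (simp add: dist_norm norm_le)
    qed
  qed (use PS in \<open>auto simp: subspace_imp_convex closed_subspace\<close>)
  show "matrix (closest_point ?S) = frame_projection A"
    unfolding frame_projection_def matrix_def
    by (simp add: cp P_def vec_eq_iff inner_axis' mult.commute)
qed

lemma grassmannian_frame:
  assumes S: "S \<in> grassmannian CARD('m::finite)"
  obtains A :: "real^'n::finite^'m" where "A \<in> frames" "S = span (range (($) A))"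
proof -
  have S: "subspace S" "dim S = CARD('m)" using S by (auto simp: grassmannian_def)
  obtain B where B: "B \<subseteq> S" "pairwise orthogonal B" "\<And>x. x \<in> B \<Longrightarrow> norm x = 1" "independent B"
      "card B = dim S" "span B = S"
    using orthonormal_basis_subspace[OF S(1)] by metis
  have "finite B" using B(4) by (rule independent_imp_finite)
  then obtain h :: "'m \<Rightarrow> real^'n" where h: "bij_betw h UNIV B"
    using finite_same_card_bij[of "UNIV :: 'm set" B] B(5) S(2) by auto
  define A :: "real^'n^'m" where "A = (\<chi> i. h i)"
  have hB: "h i \<in> B" for i using h by (auto simp: bij_betw_def)
  have "A \<in> frames"
    unfolding frames_def A_def
  proof (intro CollectI allI)
    fix i j
    show "(\<chi> i. h i) $ i \<bullet> (\<chi> i. h i) $ j = (if i = j then 1 else 0)"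
    proof (cases "i = j")
      case True then show ?thesis using B(3)[OF hB] by (simp add: norm_eq_1)
    next
      case False
      then have "h i \<noteq> h j" using h by (auto simp: bij_betw_def inj_on_def)
      then show ?thesis using B(2) hB False by (simp add: pairwise_def orthogonal_def)
    qed
  qed
  moreover have "range (($) A) = B" using h by (auto simp: A_def bij_betw_def)
  ultimately show thesis using B(6) that by simp
qed

text \<open>The topology of the Grassmannian is pulled back along this map, so that only injectivity
  and the image are at stake; the image is a continuous image of the compact set of frames.
  Compactness, separation and countability are then read off from a set of matrices.\<close>

lemma homeomorphic_grassmannian:
  "homeomorphic_map (grassmannian_topology CARD('m::finite))
     (top_of_set (frame_projection ` (frames :: (real^'n::finite^'m) set))) (\<lambda>S. matrix (closest_point S))"
proof -
  let ?F = "\<lambda>S :: (real^'n) set. matrix (closest_point S)"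
  let ?T = "grassmannian_topology CARD('m) :: (real^'n) set topology"
  let ?P = "frame_projection ` (frames :: (real^'n^'m) set)"
  have sp: "topspace ?T = grassmannian CARD('m)"
    by (simp add: grassmannian_topology_def topspace_pullback_topology)
  have img: "?F ` grassmannian CARD('m) = ?P"
  proof
    show "?F ` grassmannian CARD('m) \<subseteq> ?P"
    proof
      fix M assume "M \<in> ?F ` grassmannian CARD('m)"
      then obtain S where S: "S \<in> grassmannian CARD('m)" "M = ?F S" by blast
      obtain A :: "real^'n^'m" where "A \<in> frames" "S = span (range (($) A))"
        by (rule grassmannian_frame[OF S(1)]) (rule that)
      then show "M \<in> ?P" using matrix_closest_point_frame[of A] S(2) by simp
    qed
    show "?P \<subseteq> ?F ` grassmannian CARD('m)"
      using frame_grassmannian matrix_closest_point_frame by (metis (no_types, lifting) image_eqI image_subsetI)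
  qed
  have inj: "inj_on ?F (grassmannian CARD('m))"
  proof (rule inj_onI)
    fix S T :: "(real^'n) set" assume S: "S \<in> grassmannian CARD('m)" and T: "T \<in> grassmannian CARD('m)" and eq: "?F S = ?F T"
    \<comment> \<open>A subspace is the set of fixed points of the projection onto it, so the
      projection matrix determines it.\<close>
    have *: "S = {x. ?F S *v x = x}" if S: "S \<in> grassmannian CARD('m)" for S :: "(real^'n) set"
    proof -
      obtain A :: "real^'n^'m" where A: "A \<in> frames" "S = span (range (($) A))"
        by (rule grassmannian_frame[OF S]) (rule that)
      have sub: "subspace S" using S by (simp add: grassmannian_def)
      have FS: "?F S *v x = (\<Sum>i\<in>UNIV. (x \<bullet> A $ i) *\<^sub>R A $ i)" for x
        unfolding A(2) matrix_closest_point_frame[OF A(1)]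
      proof (rule vec_eq_iff[THEN iffD2, rule_format])
        fix j
        have "(frame_projection A *v x) $ j = (\<Sum>k\<in>UNIV. (\<Sum>i\<in>UNIV. A $ i $ j * A $ i $ k) * x $ k)"
          by (simp add: matrix_vector_mult_def frame_projection_def)
        also have "\<dots> = (\<Sum>k\<in>UNIV. \<Sum>i\<in>UNIV. A $ i $ j * A $ i $ k * x $ k)"
          by (simp only: sum_distrib_right)
        also have "\<dots> = (\<Sum>i\<in>UNIV. \<Sum>k\<in>UNIV. A $ i $ j * A $ i $ k * x $ k)" by (rule sum.swap)
        also have "\<dots> = (\<Sum>i\<in>UNIV. (\<Sum>k\<in>UNIV. x $ k * A $ i $ k) * A $ i $ j)"
          unfolding sum_distrib_right by (intro sum.cong refl) simp
        also have "\<dots> = (\<Sum>i\<in>UNIV. (x \<bullet> A $ i) *\<^sub>R A $ i) $ j" by (simp add: inner_vec_def)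
        finally show "(frame_projection A *v x) $ j = (\<Sum>i\<in>UNIV. (x \<bullet> A $ i) *\<^sub>R A $ i) $ j" .
      qed
      have "?F S *v x \<in> S" for x by (subst FS, subst A(2)) (intro span_sum span_scale span_base, auto)
      moreover have "?F S *v x = x" if "x \<in> S" for x
      proof -
        have "\<forall>i. A $ i \<bullet> A $ i = 1" "\<forall>i j. i \<noteq> j \<longrightarrow> A $ i \<bullet> A $ j = 0" using A(1) by (auto simp: frames_def)
        then have b: "?F S *v (A $ j) = A $ j" for j
          unfolding FS by (subst sum.remove[of _ j]) (auto intro!: sum.neutral)
        show ?thesis
          using that unfolding A(2)
        proof (induction rule: span_induct_alt)
          case (step c y z)
          then obtain j where "y = A $ j" by auto
          then show ?case using step b[of j] A(2) by (simp add: matrix_vector_right_distrib matrix_vector_mult_scaleR)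
        qed simp
      qed
      ultimately show ?thesis by (metis (mono_tags, lifting) Collect_cong mem_Collect_eq subsetI subset_antisym)
    qed
    show "S = T" using *[OF S] *[OF T] eq by simp
  qed
  show ?thesis
  proof (rule bijective_open_imp_homeomorphic_map)
    have "continuous_map ?T euclidean ?F"
      unfolding continuous_map_def
    proof (intro conjI allI impI)
      fix W :: "(real^'n^'n) set" assume "openin euclidean W"
      then show "openin ?T {S \<in> topspace ?T. ?F S \<in> W}"
        unfolding sp unfolding grassmannian_topology_def openin_pullback_topology
        by (intro exI[of _ W]) auto
    qed auto
    then show "continuous_map ?T (top_of_set ?P) ?F"
      using img sp by (auto simp: continuous_map_in_subtopology)
    show "open_map ?T (top_of_set ?P) ?F"
      unfolding open_map_def
    proof (intro allI impI)
      fix Q assume "openin ?T Q"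
      then obtain W where W: "open W" "Q = ?F -` W \<inter> grassmannian CARD('m)"
        unfolding grassmannian_topology_def openin_pullback_topology by auto
      have "?F ` Q = ?P \<inter> W" unfolding img[symmetric] W(2) by blast
      then show "openin (top_of_set ?P) (?F ` Q)" using W(1) by (simp add: openin_open_Int)
    qed
  qed (use img inj sp in auto)
qed

lemma compact_grassmannian: "compact_space (grassmannian_topology CARD('m::finite) :: (real^'n::finite) set topology)"
proof -
  have "compact (frame_projection ` (frames :: (real^'n^'m) set))"
    by (rule compact_continuous_image[OF continuous_frame_projection compact_frames])
  then have "compact_space (top_of_set (frame_projection ` (frames :: (real^'n^'m) set)))"
    by (simp add: compact_space_subtopology)
  then show ?thesis
    using homeomorphic_compact_space[OF homeomorphic_map_imp_homeomorphic_space[OF homeomorphic_grassmannian[where 'm='m and 'n='n]]] by blast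
qed

lemma lch2_grassmannian: "lch2 (grassmannian_topology CARD('m::finite) :: (real^'n::finite) set topology)"
proof
  let ?T = "grassmannian_topology CARD('m) :: (real^'n) set topology"
  note h = homeomorphic_grassmannian[where 'm='m and 'n='n]
  show "locally_compact_space ?T" using compact_grassmannian by (rule compact_imp_locally_compact_space)
  show "Hausdorff_space ?T"
    using homeomorphic_Hausdorff_space[OF homeomorphic_map_imp_homeomorphic_space[OF h]]
    by (simp add: Hausdorff_space_subtopology)
  show "second_countable ?T"
    using homeomorphic_space_second_countability[OF homeomorphic_map_imp_homeomorphic_space[OF h]]
    by (simp add: second_countable_top_of_set)
qed

section \<open>Hausdorff measure\<close>

lemma (in outer_meas) out_Diff:
  assumes "A \<in> sets CM" "B \<in> sets CM" "A \<subseteq> B" "\<phi> A < \<infinity>"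
  shows "\<phi> (B - A) = \<phi> B - \<phi> A"
proof -
  have e: "emeasure CM D = \<phi> D" if "D \<in> sets CM" for D using that emeasure_CM by (simp add: sets_CM)
  have "emeasure CM (B - A) = emeasure CM B - emeasure CM A"
    by (rule emeasure_Diff) (use assms e in auto)
  then show ?thesis using assms(1,2) by (simp add: e)
qed

text \<open>The approximating measure at scale \<open>\<delta>\<close> in the construction of
  Hausdorff measure, named in order to be estimated before the supremum is taken.\<close>

definition hausdorff_content :: "nat \<Rightarrow> real \<Rightarrow> 'a::metric_space set \<Rightarrow> ennreal" where
  "hausdorff_content m \<delta> A =
     (INF C\<in>{C :: nat \<Rightarrow> 'a set. A \<subseteq> (\<Union>i. C i) \<and> (\<forall>i. bounded (C i) \<and> diameter (C i) \<le> \<delta>)}.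
        \<Sum>i. ennreal (unit_ball_vol (real m) * (diameter (C i) / 2) ^ m))"

lemma hausdorff_measure_content: "hausdorff_measure m A = (SUP \<delta>\<in>{0<..}. hausdorff_content m \<delta> A)"
  unfolding hausdorff_measure_def hausdorff_content_def ..

lemma content_le_hausdorff: "0 < \<delta> \<Longrightarrow> hausdorff_content m \<delta> A \<le> hausdorff_measure m A"
  unfolding hausdorff_measure_content by (intro SUP_upper) simp

lemma content_upper:
  "A \<subseteq> (\<Union>i. C i) \<Longrightarrow> (\<And>i. bounded (C i)) \<Longrightarrow> (\<And>i. diameter (C i) \<le> \<delta>) \<Longrightarrow>
    hausdorff_content m \<delta> A \<le> (\<Sum>i::nat. ennreal (unit_ball_vol (real m) * (diameter (C i) / 2) ^ m))"
  unfolding hausdorff_content_def by (intro INF_lower) auto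

lemma content_less:
  assumes "hausdorff_content m \<delta> A < c"
  obtains C :: "nat \<Rightarrow> 'a::metric_space set" where "A \<subseteq> (\<Union>i. C i)" "\<And>i. bounded (C i)" "\<And>i. diameter (C i) \<le> \<delta>"
    "(\<Sum>i. ennreal (unit_ball_vol (real m) * (diameter (C i) / 2) ^ m)) < c"
  using assms unfolding hausdorff_content_def INF_less_iff by auto

lemma content_mono: "A \<subseteq> B \<Longrightarrow> hausdorff_content m \<delta> A \<le> hausdorff_content m \<delta> B"
  unfolding hausdorff_content_def by (rule INF_superset_mono) auto

lemma content_antimono: "\<delta> \<le> \<delta>' \<Longrightarrow> hausdorff_content m \<delta>' A \<le> hausdorff_content m \<delta> A"
  unfolding hausdorff_content_def by (rule INF_superset_mono) (auto intro: order_trans)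

lemma hausdorff_measure_mono: "A \<subseteq> B \<Longrightarrow> hausdorff_measure m A \<le> hausdorff_measure m B"
  unfolding hausdorff_measure_content by (intro SUP_mono) (auto intro: content_mono)

text \<open>Along this sequence the contents increase, so that suprema may be added.\<close>

lemma hausdorff_measure_seq: "hausdorff_measure m A = (SUP n. hausdorff_content m (inverse (real (Suc n))) A)"
proof (rule antisym)
  show "hausdorff_measure m A \<le> (SUP n. hausdorff_content m (inverse (real (Suc n))) A)"
    unfolding hausdorff_measure_content
  proof (rule SUP_least)
    fix \<delta> :: real assume "\<delta> \<in> {0<..}"
    then obtain n where n: "inverse (real (Suc n)) < \<delta>" using reals_Archimedean by auto
    have "hausdorff_content m \<delta> A \<le> hausdorff_content m (inverse (real (Suc n))) A"
      by (rule content_antimono) (use n in simp)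
    then show "hausdorff_content m \<delta> A \<le> (SUP n. hausdorff_content m (inverse (real (Suc n))) A)"
      by (rule SUP_upper2[OF UNIV_I])
  qed
qed (auto intro!: SUP_least content_le_hausdorff)

text \<open>For \<open>m = 0\<close> each empty set would contribute \<open>0 ^ 0 = 1\<close>; a
  positive \<open>m\<close> makes it free.\<close>

lemma content_empty: "0 < m \<Longrightarrow> 0 \<le> \<delta> \<Longrightarrow> hausdorff_content m \<delta> ({} :: 'a::metric_space set) = 0"
proof -
  assume m: "0 < m" and \<delta>: "0 \<le> \<delta>"
  have "hausdorff_content m \<delta> ({} :: 'a set)
      \<le> (\<Sum>i::nat. ennreal (unit_ball_vol (real m) * (diameter ({} :: 'a set) / 2) ^ m))"
    by (rule content_upper) (use \<delta> in auto)
  also have "\<dots> = 0" using m by (simp add: zero_power)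
  finally show "hausdorff_content m \<delta> ({} :: 'a set) = 0" by simp
qed

lemma content_UN:
  fixes A :: "nat \<Rightarrow> 'a::metric_space set"
  shows "hausdorff_content m \<delta> (\<Union>i. A i) \<le> (\<Sum>i. hausdorff_content m \<delta> (A i))"
proof (cases "(\<Sum>i. hausdorff_content m \<delta> (A i)) = \<infinity>")
  case False
  let ?v = "\<lambda>S :: 'a set. ennreal (unit_ball_vol (real m) * (diameter S / 2) ^ m)"
  have fin: "hausdorff_content m \<delta> (A i) < \<infinity>" for i
    using False by (metis ennreal_suminf_lessD infinity_ennreal_def less_top)
  show ?thesis
  proof (rule ennreal_le_epsilon)
    fix e :: real assume e: "0 < e"
    have "\<exists>C. A i \<subseteq> (\<Union>j. C j) \<and> (\<forall>j. bounded (C j) \<and> diameter (C j) \<le> \<delta>) \<and>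
        (\<Sum>j::nat. ?v (C j)) \<le> hausdorff_content m \<delta> (A i) + ennreal (e * (1/2)^Suc i)" for i
    proof -
      have "hausdorff_content m \<delta> (A i) < hausdorff_content m \<delta> (A i) + ennreal (e * (1/2)^Suc i)"
        using fin[of i] e ennreal_add_left_cancel_less[of "hausdorff_content m \<delta> (A i)" 0 "ennreal (e * (1/2)^Suc i)"]
        by (simp add: less_top[symmetric])
      then obtain C :: "nat \<Rightarrow> 'a set" where "A i \<subseteq> (\<Union>j. C j)" "\<And>j. bounded (C j)" "\<And>j. diameter (C j) \<le> \<delta>"
        "(\<Sum>j. ?v (C j)) < hausdorff_content m \<delta> (A i) + ennreal (e * (1/2)^Suc i)"
        by (rule content_less) (rule that)
      then show ?thesis by (intro exI[of _ C]) auto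
    qed
    then have "\<forall>i. \<exists>C. A i \<subseteq> (\<Union>j. C j) \<and> (\<forall>j. bounded (C j) \<and> diameter (C j) \<le> \<delta>) \<and>
        (\<Sum>j::nat. ?v (C j)) \<le> hausdorff_content m \<delta> (A i) + ennreal (e * (1/2)^Suc i)" ..
    from choice[OF this] obtain C where "\<forall>i. A i \<subseteq> (\<Union>j. C i j) \<and> (\<forall>j. bounded (C i j) \<and> diameter (C i j) \<le> \<delta>) \<and>
        (\<Sum>j::nat. ?v (C i j)) \<le> hausdorff_content m \<delta> (A i) + ennreal (e * (1/2)^Suc i)" ..
    then have C: "A i \<subseteq> (\<Union>j. C i j)" "bounded (C i j)" "diameter (C i j) \<le> \<delta>"
       "(\<Sum>j. ?v (C i j)) \<le> hausdorff_content m \<delta> (A i) + ennreal (e * (1/2)^Suc i)" for i j by simp_all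
    let ?D = "\<lambda>n. case prod_decode n of (i, j) \<Rightarrow> C i j"
    have "hausdorff_content m \<delta> (\<Union>i. A i) \<le> (\<Sum>n. ?v (?D n))"
    proof (rule content_upper)
      show "(\<Union>i. A i) \<subseteq> (\<Union>n. ?D n)"
      proof
        fix x assume "x \<in> (\<Union>i. A i)"
        then obtain i j where "x \<in> C i j" using C(1) by blast
        then show "x \<in> (\<Union>n. ?D n)" by (intro UN_I[of "prod_encode (i, j)"]) auto
      qed
    qed (auto simp: C split: prod.split)
    also have "\<dots> = (\<Sum>n. (\<lambda>(i, j). ?v (C i j)) (prod_decode n))" by (simp add: case_prod_beta)
    also have "\<dots> = (\<Sum>i. \<Sum>j. ?v (C i j))" by (rule suminf_ennreal_2dimen) simp
    also have "\<dots> \<le> (\<Sum>i. hausdorff_content m \<delta> (A i) + ennreal (e * (1/2)^Suc i))"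
      using C(4) by (intro suminf_le) auto
    also have "\<dots> = (\<Sum>i. hausdorff_content m \<delta> (A i)) + (\<Sum>i. ennreal (e * (1/2)^Suc i))"
      by (intro suminf_add[symmetric]) auto
    also have "(\<Sum>i. ennreal (e * (1/2)^Suc i)) = ennreal e"
    proof (rule suminf_ennreal_eq)
      show "(\<lambda>i. e * (1/2)^Suc i) sums e" using sums_mult[OF power_half_series, of e] by simp
    qed (use e in auto)
    finally show "hausdorff_content m \<delta> (\<Union>i. A i) \<le> (\<Sum>i. hausdorff_content m \<delta> (A i)) + ennreal e" .
  qed
qed simp

lemma measure_over_hausdorff:
  assumes m: "0 < m"
  shows "measure_over (UNIV :: 'a::metric_space set) (hausdorff_measure m)"
proof (rule measure_overI)
  show "hausdorff_measure m ({} :: 'a set) = 0"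
    unfolding hausdorff_measure_content by (rule SUP_eq_const) (auto simp: content_empty[OF m])
  fix A :: "nat \<Rightarrow> 'a set"
  show "hausdorff_measure m (\<Union>i. A i) \<le> (\<Sum>i. hausdorff_measure m (A i))"
    unfolding hausdorff_measure_content[of m "\<Union>i. A i"]
  proof (rule SUP_least)
    fix \<delta> :: real assume "\<delta> \<in> {0<..}"
    then have "(\<Sum>i. hausdorff_content m \<delta> (A i)) \<le> (\<Sum>i. hausdorff_measure m (A i))"
      by (intro suminf_le content_le_hausdorff) auto
    then show "hausdorff_content m \<delta> (\<Union>i. A i) \<le> (\<Sum>i. hausdorff_measure m (A i))"
      using content_UN order_trans by blast
  qed
qed (auto intro: hausdorff_measure_mono)

section \<open>Measurability of Borel sets and inner regularity for Hausdorff measure\<close>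

locale hausdorff =
  fixes m :: nat and H :: "'a::euclidean_space set \<Rightarrow> ennreal"
  assumes m: "0 < m" and H_def: "H = hausdorff_measure m"
begin

sublocale outer_meas "UNIV :: 'a set" H
  using measure_over_hausdorff[OF m] by unfold_locales (simp add: H_def)

text \<open>A set of diameter below \<open>d\<close> cannot meet both \<open>A\<close> and
  \<open>B\<close>, so every fine cover of the union splits into a cover of \<open>A\<close> and one
  of \<open>B\<close>.\<close>

lemma separated_additive:
  assumes d: "0 < d" "\<And>x y. x \<in> A \<Longrightarrow> y \<in> B \<Longrightarrow> d \<le> dist x y"
  shows "H A + H B \<le> H (A \<union> B)"
proof -
  let ?v = "\<lambda>S :: 'a set. ennreal (unit_ball_vol (real m) * (diameter S / 2) ^ m)"
  have v0: "?v {} = 0" using m by (simp add: zero_power)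
  have small: "hausdorff_content m \<delta> A + hausdorff_content m \<delta> B \<le> H (A \<union> B)" if \<delta>: "0 < \<delta>" "\<delta> < d" for \<delta>
  proof -
    have "hausdorff_content m \<delta> A + hausdorff_content m \<delta> B \<le> hausdorff_content m \<delta> (A \<union> B)"
      unfolding hausdorff_content_def[of m \<delta> "A \<union> B"]
    proof (rule INF_greatest)
      fix C :: "nat \<Rightarrow> 'a set" assume "C \<in> {C. A \<union> B \<subseteq> (\<Union>i. C i) \<and> (\<forall>i. bounded (C i) \<and> diameter (C i) \<le> \<delta>)}"
      then have C: "A \<union> B \<subseteq> (\<Union>i. C i)" "\<And>i. bounded (C i)" "\<And>i. diameter (C i) \<le> \<delta>" by auto
      \<comment> \<open>Members of the cover that miss \<open>A\<close> are replaced by the empty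
        set, which costs 0 because \<open>m\<close> is positive.\<close>
      define CA where "CA i = (if C i \<inter> A = {} then {} else C i)" for i
      define CB where "CB i = (if C i \<inter> B = {} then {} else C i)" for i
      have "hausdorff_content m \<delta> A \<le> (\<Sum>i. ?v (CA i))"
        using C \<delta> by (intro content_upper) (auto simp: CA_def, blast)
      moreover have "hausdorff_content m \<delta> B \<le> (\<Sum>i. ?v (CB i))"
        using C \<delta> by (intro content_upper) (auto simp: CB_def, blast)
      moreover have "(\<Sum>i. ?v (CA i)) + (\<Sum>i. ?v (CB i)) \<le> (\<Sum>i. ?v (C i))"
      proof -
        have "?v (CA i) + ?v (CB i) \<le> ?v (C i)" for i
        proof (cases "C i \<inter> A = {} \<or> C i \<inter> B = {}")
          case True
          then have "CA i = {} \<and> CB i \<subseteq> C i \<and> (CB i = {} \<or> CB i = C i) \<or> CB i = {} \<and> (CA i = {} \<or> CA i = C i)"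
            by (auto simp: CA_def CB_def)
          then show ?thesis using v0 by (elim disjE conjE) (simp_all only: v0 add_0 add_0_right order_refl zero_le)
        next
          case False
          then obtain x y where xy: "x \<in> C i" "x \<in> A" "y \<in> C i" "y \<in> B" by blast
          then have "dist x y \<le> diameter (C i)" using C(2) by (intro diameter_bounded_bound)
          then show ?thesis using C(3)[of i] d(2)[OF xy(2,4)] \<delta>(2) by linarith
        qed
        then have "(\<Sum>i. ?v (CA i) + ?v (CB i)) \<le> (\<Sum>i. ?v (C i))" by (intro suminf_le) auto
        then show ?thesis by (subst suminf_add) auto
      qed
      ultimately show "hausdorff_content m \<delta> A + hausdorff_content m \<delta> B \<le> (\<Sum>i. ?v (C i))"
        by (meson add_mono order_trans)
    qed
    then show ?thesis unfolding H_def using content_le_hausdorff[OF \<delta>(1)] order_trans by blast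
  qed
  have "H A + H B = (SUP n. hausdorff_content m (inverse (real (Suc n))) A + hausdorff_content m (inverse (real (Suc n))) B)"
    unfolding H_def hausdorff_measure_seq
    by (rule ennreal_SUP_add[symmetric]) (auto intro!: incseq_SucI content_antimono le_imp_inverse_le)
  also have "\<dots> \<le> H (A \<union> B)"
  proof (rule SUP_least)
    fix n
    obtain k where k: "inverse (real (Suc k)) < d" using reals_Archimedean[OF d(1)] by auto
    let ?j = "max n k"
    have le: "inverse (real (Suc ?j)) \<le> inverse (real (Suc n))" "inverse (real (Suc ?j)) \<le> inverse (real (Suc k))"
      by (auto intro!: le_imp_inverse_le)
    have "hausdorff_content m (inverse (real (Suc n))) A + hausdorff_content m (inverse (real (Suc n))) B
        \<le> hausdorff_content m (inverse (real (Suc ?j))) A + hausdorff_content m (inverse (real (Suc ?j))) B"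
      by (intro add_mono content_antimono le)
    also have "\<dots> \<le> H (A \<union> B)" by (rule small[OF _ le_less_trans[OF le(2) k]]) simp
    finally show "hausdorff_content m (inverse (real (Suc n))) A + hausdorff_content m (inverse (real (Suc n))) B \<le> H (A \<union> B)" .
  qed
  finally show ?thesis .
qed

text \<open>Caratheodory's criterion: \<open>A - C\<close> is exhausted by the sets \<open>P n\<close> of points of \<open>A\<close> at distance at
  least \<open>1/(n+1)\<close> from \<open>C\<close>, and shells \<open>R k\<close> with indices of equal parity are separated.\<close>

lemma closed_measurable:
  assumes C: "closed C"
  shows "C \<in> sets CM"
proof (cases "C = {}")
  case False
  have "H (A \<inter> C) + H (A - C) \<le> H A" if fin: "H A < \<infinity>" for A
  proof -
    define P where "P n = {x \<in> A. inverse (real (Suc n)) \<le> infdist x C}" for n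
    define R where "R k = {x \<in> A. inverse (real (Suc (Suc k))) \<le> infdist x C \<and> infdist x C < inverse (real (Suc k))}" for k
    have sep: "inverse (real a) - inverse (real b) \<le> dist x y"
      if "inverse (real a) \<le> infdist x C" "infdist y C \<le> inverse (real b)" for x y a b
      using that infdist_triangle_abs[of x C y] by linarith
    have inv: "0 < inverse (real (Suc n)) - inverse (real (Suc (Suc n)))" for n
      using less_imp_inverse_less[of "real (Suc n)" "real (Suc (Suc n))"] by simp
    have parity: "(\<Sum>k<N. H (R (2 * k + e))) \<le> H (\<Union>k<N. R (2 * k + e))" for N e
    proof (induction N)
      case (Suc N)
      have "(\<Sum>k<Suc N. H (R (2 * k + e))) \<le> H (\<Union>k<N. R (2 * k + e)) + H (R (2 * N + e))"
        using Suc by (simp add: add_right_mono)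
      also have "\<dots> \<le> H ((\<Union>k<N. R (2 * k + e)) \<union> R (2 * N + e))"
      proof (cases N)
        case (Suc N')
        show ?thesis
        proof (rule separated_additive)
          fix x y assume "x \<in> (\<Union>k<N. R (2 * k + e))" "y \<in> R (2 * N + e)"
          then obtain k where k: "k < N" "x \<in> R (2 * k + e)" and y: "y \<in> R (2 * N + e)" by blast
          \<comment> \<open>At least one whole shell lies between the two: \<open>x\<close> has
            distance at least \<open>1 / (2 * N + e)\<close> from \<open>C\<close>, and
            \<open>y\<close> at most \<open>1 / (2 * N + e + 1)\<close>. The case
            \<open>N = 0\<close>, where the union is empty, is set apart because
            \<open>2 * N + e\<close> could be 0.\<close>
          have "inverse (real (2 * N + e)) \<le> inverse (real (Suc (Suc (2 * k + e))))"
            using k(1) by (intro le_imp_inverse_le) auto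
          then have "inverse (real (2 * N + e)) \<le> infdist x C" using k(2) unfolding R_def by simp
          moreover have "infdist y C \<le> inverse (real (Suc (2 * N + e)))" using y unfolding R_def by simp
          ultimately show "inverse (real (2 * N + e)) - inverse (real (Suc (2 * N + e))) \<le> dist x y" by (rule sep)
        qed (use inv[of "2 * N' + 1 + e"] Suc in \<open>simp add: algebra_simps\<close>)
      qed simp
      also have "(\<Union>k<N. R (2 * k + e)) \<union> R (2 * N + e) = (\<Union>k<Suc N. R (2 * k + e))"
        by (auto simp: lessThan_Suc)
      finally show ?case .
    qed simp
    have parity': "(\<Sum>k<N. H (R (2 * k + e))) \<le> H A" for N e
      using parity[of e N] out_mono[of "\<Union>k<N. R (2 * k + e)" A] unfolding R_def by fastforce
    define h where "h k = enn2real (H (R k))" for k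
    have HR: "H (R k) = ennreal (h k)" for k
    proof -
      have "H (R k) \<le> H A" by (rule out_mono) (auto simp: R_def)
      then show ?thesis using fin unfolding h_def by simp
    qed
    have h0: "0 \<le> h k" for k by (simp add: h_def)
    have "summable h"
    proof (rule summableI_nonneg_bounded[OF h0])
      fix n
      have "(\<Sum>k<n. h k) \<le> (\<Sum>k<2 * n. h k)" by (intro sum_mono2) (auto simp: h0)
      also have "\<dots> = (\<Sum>k<n. h (2 * k + 0)) + (\<Sum>k<n. h (2 * k + 1))"
        by (induction n) (auto simp: algebra_simps)
      also have "\<dots> \<le> enn2real (H A) + enn2real (H A)"
      proof (rule add_mono)
        have "(\<Sum>k<n. h (2 * k + e)) \<le> enn2real (H A)" for e
        proof -
          have "ennreal (\<Sum>k<n. h (2 * k + e)) \<le> H A"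
            using parity'[where N = n and e = e] unfolding HR by (simp add: sum_ennreal h0)
          then have "enn2real (ennreal (\<Sum>k<n. h (2 * k + e))) \<le> enn2real (H A)" using fin by (intro enn2real_mono) auto
          then show ?thesis by (simp add: sum_nonneg h0)
        qed
        then show "(\<Sum>k<n. h (2 * k + 0)) \<le> enn2real (H A)" "(\<Sum>k<n. h (2 * k + 1)) \<le> enn2real (H A)" by blast+
      qed
      finally show "(\<Sum>k<n. h k) \<le> enn2real (H A) + enn2real (H A)" .
    qed
    have main: "H (A \<inter> C) + H (A - C) \<le> H A + ennreal (\<Sum>k. h (k + n))" for n
    proof -
      have sub: "A - C \<subseteq> P n \<union> (\<Union>k. R (k + n))"
      proof
        fix x assume x: "x \<in> A - C"
        then have pos: "0 < infdist x C" using C False by (simp add: infdist_pos_not_in_closed)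
        show "x \<in> P n \<union> (\<Union>k. R (k + n))"
        proof (cases "inverse (real (Suc n)) \<le> infdist x C")
          case True then show ?thesis using x by (simp add: P_def)
        next
          case False
          \<comment> \<open>\<open>x\<close> lies outside \<open>P n\<close>, so
            \<open>j > n\<close>; minimality of \<open>j\<close> places \<open>x\<close> in the
            shell \<open>R (j - 1)\<close>, whose index is at least \<open>n\<close>.\<close>
          define j where "j = (LEAST j. inverse (real (Suc j)) \<le> infdist x C)"
          obtain N where "inverse (real (Suc N)) < infdist x C" using reals_Archimedean[OF pos] by auto
          then have "inverse (real (Suc N)) \<le> infdist x C" by simp
          then have j: "inverse (real (Suc j)) \<le> infdist x C" unfolding j_def by (rule LeastI)
          have nj: "n < j"
          proof (rule ccontr)
            assume "\<not> n < j"
            then have "inverse (real (Suc n)) \<le> inverse (real (Suc j))" by (intro le_imp_inverse_le) auto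
            then show False using j False by linarith
          qed
          then obtain i where i: "j = Suc i" by (cases j) auto
          have "\<not> inverse (real (Suc i)) \<le> infdist x C"
            using not_less_Least[of i "\<lambda>j. inverse (real (Suc j)) \<le> infdist x C"] i unfolding j_def by simp
          then have "x \<in> R i" using x j i unfolding R_def by simp
          moreover have "i = (i - n) + n" using nj i by simp
          ultimately show ?thesis by (metis UN_I UNIV_I UnCI)
        qed
      qed
      have "H (A \<inter> C) + H (P n) \<le> H ((A \<inter> C) \<union> P n)"
      proof (rule separated_additive[of "inverse (real (Suc n))"])
        fix x y assume "x \<in> A \<inter> C" "y \<in> P n"
        then show "inverse (real (Suc n)) \<le> dist x y"
          using infdist_le[of x C y] unfolding P_def by (simp add: dist_commute)
      qed simp
      also have "\<dots> \<le> H A" by (rule out_mono) (auto simp: P_def)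
      finally have 1: "H (A \<inter> C) + H (P n) \<le> H A" .
      have "H (A - C) \<le> H (P n) + H (\<Union>k. R (k + n))" using out_mono[OF sub] out_Un order_trans by blast
      also have "H (\<Union>k. R (k + n)) \<le> (\<Sum>k. H (R (k + n)))" by (rule out_UN)
      also have "\<dots> = ennreal (\<Sum>k. h (k + n))"
        unfolding HR using \<open>summable h\<close> by (intro suminf_ennreal_eq h0 summable_sums) (simp add: summable_iff_shift)
      finally have "H (A - C) \<le> H (P n) + ennreal (\<Sum>k. h (k + n))" by (simp add: add_left_mono)
      then have "H (A \<inter> C) + H (A - C) \<le> (H (A \<inter> C) + H (P n)) + ennreal (\<Sum>k. h (k + n))"
        by (simp add: add.assoc add_left_mono)
      also have "\<dots> \<le> H A + ennreal (\<Sum>k. h (k + n))" using 1 by (rule add_right_mono)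
      finally show ?thesis .
    qed
    have "(\<lambda>n. H A + ennreal (\<Sum>k. h (k + n))) \<longlonglongrightarrow> H A + ennreal 0"
      by (intro tendsto_add tendsto_const tendsto_ennrealI suminf_exist_split2 \<open>summable h\<close>)
    then show ?thesis using main by (intro LIMSEQ_le_const[of _ "H A"]) auto
  qed
  note * = this
  have "H (A \<inter> C) + H (A - C) \<le> H A" for A
    using *[of A] by (cases "H A < \<infinity>") (auto simp: less_top[symmetric])
  then show ?thesis unfolding sets_CM carath_iff by auto
qed auto

lemma borel_sets_CM: "A \<in> sets borel \<Longrightarrow> A \<in> sets CM"
proof -
  have "sigma_sets UNIV (Collect closed) \<subseteq> sets CM"
    using sets.sigma_sets_subset[of "Collect closed" CM] closed_measurable by auto
  then show "A \<in> sets borel \<Longrightarrow> A \<in> sets CM"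
    unfolding borel_eq_closed by (auto simp: sets_measure_of)
qed

text \<open>Closures have the same diameters, so the covers that nearly realise the contents may be
  taken closed; the intersection over all scales of their unions is Borel and has no larger
  measure.\<close>

lemma borel_hull:
  assumes fin: "H A < \<infinity>"
  obtains B where "B \<in> sets borel" "A \<subseteq> B" "H B = H A"
proof -
  let ?v = "\<lambda>S :: 'a set. ennreal (unit_ball_vol (real m) * (diameter S / 2) ^ m)"
  let ?\<delta> = "\<lambda>n. inverse (real (Suc n))"
  have "\<forall>n. \<exists>C. A \<subseteq> (\<Union>i. C i) \<and> (\<forall>i. bounded (C i) \<and> diameter (C i) \<le> ?\<delta> n) \<and>
        (\<Sum>i::nat. ?v (C i)) \<le> H A + ennreal (?\<delta> n)"
  proof
    fix n
    have "hausdorff_content m (?\<delta> n) A \<le> H A" unfolding H_def by (rule content_le_hausdorff) simp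
    also have "H A < H A + ennreal (?\<delta> n)"
      using fin ennreal_add_left_cancel_less[of "H A" 0 "ennreal (?\<delta> n)"] by (simp add: less_top[symmetric])
    finally obtain C :: "nat \<Rightarrow> 'a set" where "A \<subseteq> (\<Union>i. C i)" "\<And>i. bounded (C i)" "\<And>i. diameter (C i) \<le> ?\<delta> n"
      "(\<Sum>i. ?v (C i)) < H A + ennreal (?\<delta> n)" by (rule content_less) (rule that)
    then show "\<exists>C. A \<subseteq> (\<Union>i. C i) \<and> (\<forall>i. bounded (C i) \<and> diameter (C i) \<le> ?\<delta> n) \<and>
        (\<Sum>i::nat. ?v (C i)) \<le> H A + ennreal (?\<delta> n)" by (intro exI[of _ C]) auto
  qed
  from choice[OF this] obtain C where "\<forall>n. A \<subseteq> (\<Union>i. C n i) \<and> (\<forall>i. bounded (C n i) \<and> diameter (C n i) \<le> ?\<delta> n) \<and>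
        (\<Sum>i::nat. ?v (C n i)) \<le> H A + ennreal (?\<delta> n)" ..
  then have C: "A \<subseteq> (\<Union>i. C n i)" "bounded (C n i)" "diameter (C n i) \<le> ?\<delta> n"
     "(\<Sum>i. ?v (C n i)) \<le> H A + ennreal (?\<delta> n)" for n i by simp_all
  define B where "B = (\<Inter>n. \<Union>i. closure (C n i))"
  have "A \<subseteq> B"
    unfolding B_def
  proof (intro subsetI INT_I)
    fix x n assume "x \<in> A"
    then obtain i where "x \<in> C n i" using C(1)[of n] by auto
    then show "x \<in> (\<Union>i. closure (C n i))" using closure_subset[of "C n i"] by auto
  qed
  moreover have "B \<in> sets borel" unfolding B_def by (intro sets.countable_INT sets.countable_UN) auto
  moreover have "H B \<le> H A"
    unfolding H_def hausdorff_measure_seq[of m B]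
  proof (rule SUP_least)
    fix n
    have "hausdorff_content m (?\<delta> n) B \<le> H A + ennreal (?\<delta> k)" if "k \<ge> n" for k
    proof -
      have "hausdorff_content m (?\<delta> n) B \<le> hausdorff_content m (?\<delta> k) B"
        using that by (intro content_antimono le_imp_inverse_le) auto
      also have "\<dots> \<le> (\<Sum>i. ?v (closure (C k i)))"
        using C(2,3)[of k] by (intro content_upper) (auto simp: B_def diameter_closure)
      also have "\<dots> \<le> H A + ennreal (?\<delta> k)" using C(2,4)[of k] by (simp add: diameter_closure)
      finally show ?thesis .
    qed
    moreover have "(\<lambda>k. H A + ennreal (?\<delta> k)) \<longlonglongrightarrow> H A + ennreal 0"
      by (intro tendsto_add tendsto_const tendsto_ennrealI LIMSEQ_inverse_real_of_nat)
    ultimately show "hausdorff_content m (?\<delta> n) B \<le> hausdorff_measure m A"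
      unfolding H_def[symmetric] by (intro LIMSEQ_le_const[of _ "H A"]) auto
  qed
  ultimately show thesis using out_mono[of A B] by (intro that[of B]) auto
qed

text \<open>Removing from a Borel hull of \<open>F\<close> a Borel hull of the null difference
  leaves a Borel subset \<open>B\<close> of \<open>F\<close> with full measure. Finite Borel
  measures are inner regular, and restricting \<open>H\<close> to \<open>B\<close> produces
  one.\<close>

lemma compact_inner:
  assumes F: "F \<in> sets CM" "H F < \<infinity>" and e: "0 < e"
  obtains K where "compact K" "K \<subseteq> F" "H (F - K) \<le> ennreal e"
proof -
  obtain B1 where B1: "B1 \<in> sets borel" "F \<subseteq> B1" "H B1 = H F" by (rule borel_hull[OF F(2)]) (rule that)
  have "H (B1 - F) = H B1 - H F"
    using F B1 borel_sets_CM[OF B1(1)] by (intro out_Diff)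
  then have Z: "H (B1 - F) = 0" using B1(3) F(2) by simp
  obtain B2 where B2: "B2 \<in> sets borel" "B1 - F \<subseteq> B2" "H B2 = H (B1 - F)"
    by (rule borel_hull[of "B1 - F"]) (use Z in \<open>auto intro: that\<close>)
  define B where "B = B1 - B2"
  have B: "B \<in> sets borel" "B \<subseteq> F" unfolding B_def using B1 B2 by auto
  have FB: "H (F - B) = 0"
  proof -
    have "F - B \<subseteq> B2" using B1(2) by (auto simp: B_def)
    then have "H (F - B) \<le> H B2" by (rule out_mono)
    then show ?thesis using B2(3) Z by simp
  qed
  have idm: "(\<lambda>x. x) \<in> measurable CM borel" by (rule measurableI) (auto intro: borel_sets_CM)
  \<comment> \<open>\<open>H\<close> itself need not be sigma-finite; the restriction to
    \<open>B\<close> has total mass \<open>H B\<close>, which is finite.\<close>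
  define N where "N = density (distr CM borel (\<lambda>x. x)) (indicator B)"
  have eN: "emeasure N A = H (A \<inter> B)" if "A \<in> sets borel" for A
  proof -
    have "emeasure N A = (\<integral>\<^sup>+x. indicator B x * indicator A x \<partial>distr CM borel (\<lambda>x. x))"
      unfolding N_def using that B(1) by (subst emeasure_density) auto
    also have "\<dots> = (\<integral>\<^sup>+x. indicator (A \<inter> B) x \<partial>distr CM borel (\<lambda>x. x))"
      by (intro nn_integral_cong) (auto simp: indicator_def)
    also have "\<dots> = emeasure (distr CM borel (\<lambda>x. x)) (A \<inter> B)"
      using that B(1) by (intro nn_integral_indicator) auto
    also have "\<dots> = emeasure CM (A \<inter> B)" using that B(1) by (subst emeasure_distr[OF idm]) auto
    also have "\<dots> = H (A \<inter> B)"
      using that B(1) borel_sets_CM[of "A \<inter> B"] by (intro emeasure_CM) (auto simp: sets_CM)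
    finally show ?thesis .
  qed
  have sN: "sets N = sets borel" "space N = UNIV" by (simp_all add: N_def)
  have HB: "H B < \<infinity>" using out_mono[OF B(2)] F(2) by (rule le_less_trans)
  have "emeasure N (space N) \<noteq> \<infinity>" using eN[of UNIV] HB sN by simp
  then have "emeasure N B = (SUP K\<in>{K. K \<subseteq> B \<and> compact K}. emeasure N K)"
    using sN B(1) by (intro inner_regular) auto
  then have sup: "H B = (SUP K\<in>{K. K \<subseteq> B \<and> compact K}. H K)"
    using eN[OF B(1)] by (auto simp: eN borel_compact Int_absorb2 intro!: SUP_cong)
  have "\<exists>K. K \<subseteq> B \<and> compact K \<and> H B \<le> H K + ennreal e"
  proof (cases "H B = 0")
    case True
    then show ?thesis by (intro exI[of _ "{}"]) auto
  next
    case False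
    then have "H B < H B + ennreal e" using HB e ennreal_add_left_cancel_less[of "H B" 0 "ennreal e"] by (simp add: less_top[symmetric])
    show ?thesis
    proof (rule ccontr)
      assume "\<not> (\<exists>K. K \<subseteq> B \<and> compact K \<and> H B \<le> H K + ennreal e)"
      then have lt: "H K + ennreal e < H B" if "K \<subseteq> B" "compact K" for K using that by (auto simp: not_le)
      have "(SUP K\<in>{K. K \<subseteq> B \<and> compact K}. H K + ennreal e) \<le> H B" 
        by (rule SUP_least) (use less_imp_le[OF lt] in simp)
      moreover have "(SUP K\<in>{K. K \<subseteq> B \<and> compact K}. H K + ennreal e) = H B + ennreal e"
        unfolding sup by (rule ennreal_SUP_add_left) (auto intro: exI[of _ "{}"])
      ultimately show False using \<open>H B < H B + ennreal e\<close> by simp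
    qed
  qed
  then obtain K where K: "K \<subseteq> B" "compact K" "H B \<le> H K + ennreal e" by blast
  have Ks: "K \<in> sets CM" using K(2) by (intro borel_sets_CM borel_compact)
  have HK: "H K < \<infinity>" using out_mono[OF K(1)] HB by (rule le_less_trans)
  have "H (B - K) = H B - H K"
    using K(1) Ks HK borel_sets_CM[OF B(1)] by (intro out_Diff)
  also have "\<dots> \<le> ennreal e" using K(3) HK by (auto simp: ennreal_minus_le_iff)
  finally have "H (B - K) \<le> ennreal e" .
  moreover have "H (F - K) \<le> H (B - K) + H (F - B)"
  proof -
    have "H (F - K) \<le> H ((B - K) \<union> (F - B))" by (rule out_mono) blast
    then show ?thesis using out_Un[of "B - K" "F - B"] by (rule order_trans)
  qed
  ultimately have "H (F - K) \<le> ennreal e" using FB by simp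
  then show thesis using K(1,2) B(2) by (intro that[of K]) auto
qed

end

section \<open>Densities and approximate tangent cones\<close>

context hausdorff
begin

text \<open>Counting estimate after a Vitali covering: the enlarged balls cover \<open>A\<close> at
  scale \<open>\<delta>\<close>, enlargement costs \<open>5 ^ m\<close>, each original ball carries
  at least \<open>t\<close> times the volume of an \<open>m\<close>-dimensional ball of its radius,
  and disjointness adds these portions of \<open>F\<close> up inside \<open>W\<close>.\<close>

lemma content_disjoint_cballs:
  assumes C: "countable C" "pairwise (\<lambda>x y. disjnt (cball x (r x)) (cball y (r y))) C"
    and cov: "A \<subseteq> (\<Union>x\<in>C. cball x (5 * r x))"
    and r: "\<And>x. x \<in> C \<Longrightarrow> 0 < r x \<and> 10 * r x \<le> \<delta>" and \<delta>: "0 < \<delta>"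
    and t: "0 < t" and big: "\<And>x. x \<in> C \<Longrightarrow> ennreal (t * (unit_ball_vol (real m) * r x ^ m)) \<le> H (F \<inter> cball x (r x))"
    and F: "F \<in> sets CM" and W: "\<And>x. x \<in> C \<Longrightarrow> cball x (r x) \<subseteq> W"
  shows "hausdorff_content m \<delta> A \<le> ennreal (5 ^ m / t) * H (F \<inter> W)"
proof -
  \<comment> \<open>Each \<open>P i\<close> is empty or a singleton. This enumerates
    \<open>C\<close>, whether finite or infinite, by the natural numbers without repetition.\<close>
  define P where "P i = {x \<in> C. to_nat_on C x = i}" for i
  have P: "P i = {} \<or> (\<exists>x\<in>C. P i = {x})" for i
    using inj_on_to_nat_on[OF C(1)] unfolding P_def inj_on_def by blast
  let ?D = "\<lambda>i. \<Union>x\<in>P i. cball x (5 * r x)"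
  let ?E = "\<lambda>i. \<Union>x\<in>P i. F \<inter> cball x (r x)"
  let ?v = "\<lambda>S :: 'a set. ennreal (unit_ball_vol (real m) * (diameter S / 2) ^ m)"
  have CP: "C = (\<Union>i. P i)" unfolding P_def by auto
  have "hausdorff_content m \<delta> A \<le> (\<Sum>i. ?v (?D i))"
  proof (rule content_upper)
    show "A \<subseteq> (\<Union>i. ?D i)" using cov CP by auto
    show "bounded (?D i)" for i using P[of i] by (auto simp: bounded_empty)
    show "diameter (?D i) \<le> \<delta>" for i
      using P[of i]
    proof
      assume "\<exists>x\<in>C. P i = {x}"
      then obtain x where x: "x \<in> C" "P i = {x}" by blast
      then show ?thesis using r[OF x(1)] by simp
    qed (use \<delta> in simp)
  qed
  also have "\<dots> \<le> (\<Sum>i. ennreal (5 ^ m / t) * emeasure CM (?E i))"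
  proof (rule suminf_le)
    fix i
    show "?v (?D i) \<le> ennreal (5 ^ m / t) * emeasure CM (?E i)"
      using P[of i]
    proof
      assume "P i = {}"
      then show ?thesis using m by (simp add: zero_power)
    next
      assume "\<exists>x\<in>C. P i = {x}"
      then obtain x where x: "x \<in> C" "P i = {x}" by blast
      have e: "emeasure CM (?E i) = H (F \<inter> cball x (r x))"
        using x(2) F borel_sets_CM[of "cball x (r x)"] sets.Int[of F CM "cball x (r x)"]
        by (simp add: emeasure_CM sets_CM)
      have "?v (?D i) = ennreal (5 ^ m / t * (t * (unit_ball_vol (real m) * r x ^ m)))"
        using x r[OF x(1)] t by (simp add: power_mult_distrib mult_ac)
      also have "\<dots> = ennreal (5 ^ m / t) * ennreal (t * (unit_ball_vol (real m) * r x ^ m))"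
        using t r[OF x(1)] by (intro ennreal_mult) auto
      also have "\<dots> \<le> ennreal (5 ^ m / t) * H (F \<inter> cball x (r x))"
        using big[OF x(1)] by (rule mult_left_mono) simp
      finally show ?thesis unfolding e .
    qed
  qed auto
  also have "\<dots> = ennreal (5 ^ m / t) * (\<Sum>i. emeasure CM (?E i))" by simp
  also have "(\<Sum>i. emeasure CM (?E i)) = emeasure CM (\<Union>i. ?E i)"
  proof (rule suminf_emeasure)
    show "range ?E \<subseteq> sets CM"
    proof
      fix S assume "S \<in> range ?E"
      then obtain i where S: "S = ?E i" by blast
      have "F \<inter> cball x (r x) \<in> sets CM" for x using F borel_sets_CM[of "cball x (r x)"] by auto
      then show "S \<in> sets CM" using P[of i] unfolding S by auto
    qed
    show "disjoint_family ?E"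
      unfolding disjoint_family_on_def
    proof (intro ballI impI)
      fix i j :: nat assume ij: "i \<noteq> j"
      have "(F \<inter> cball x (r x)) \<inter> (F \<inter> cball y (r y)) = {}" if "x \<in> P i" "y \<in> P j" for x y
      proof -
        have "x \<in> C" "y \<in> C" "x \<noteq> y" using that ij unfolding P_def by auto
        then have "disjnt (cball x (r x)) (cball y (r y))" using C(2) unfolding pairwise_def by blast
        then show ?thesis unfolding disjnt_def by blast
      qed
      then show "?E i \<inter> ?E j = {}" by blast
    qed
  qed
  also have "emeasure CM (\<Union>i. ?E i) \<le> H (F \<inter> W)"
  proof -
    have "(\<Union>i. ?E i) \<in> sets CM"
    proof (rule sets.countable_UN)
      show "range ?E \<subseteq> sets CM"
      proof
        fix S assume "S \<in> range ?E"
        then obtain i where S: "S = ?E i" by blast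
        have "F \<inter> cball x (r x) \<in> sets CM" for x using F borel_sets_CM[of "cball x (r x)"] by auto
        then show "S \<in> sets CM" using P[of i] unfolding S by auto
      qed
    qed
    then have "emeasure CM (\<Union>i. ?E i) = H (\<Union>i. ?E i)" by (simp add: emeasure_CM sets_CM)
    also have "\<dots> \<le> H (F \<inter> W)" by (intro out_mono UN_least Int_mono order_refl W) (auto simp: P_def)
    finally show ?thesis .
  qed
  finally show ?thesis by (simp add: mult_left_mono)
qed

text \<open>Around a point outside \<open>F\<close>, hence outside a compact
  \<open>K \<subseteq> F\<close>, small balls miss \<open>K\<close>. Where the density of
  \<open>F\<close> does not vanish, arbitrarily small balls still carry a fixed proportion of
  \<open>F - K\<close>, and by Vitali the content of such points is at most a constant times
  \<open>H (F - K)\<close>, which is arbitrarily small.\<close>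

lemma density_zero:
  assumes F: "F \<in> sets CM" "H F < \<infinity>"
  shows "H {x. x \<notin> F \<and> \<not> has_density m (outer_restrict H F) x 0} = 0"
proof -
  let ?o = "unit_ball_vol (real m)"
  have o: "0 < ?o" by simp
  define A where "A t = {x. x \<notin> F \<and> (\<forall>r0>0. \<exists>r. 0 < r \<and> r < r0 \<and> ennreal (t * (?o * r ^ m)) \<le> H (F \<inter> cball x r))}" for t
  have A0: "H (A t) = 0" if t: "0 < t" for t
  proof -
    have "hausdorff_content m \<delta> (A t) \<le> ennreal e" if \<delta>: "0 < \<delta>" and e: "0 < e" for \<delta> e
    proof -
      \<comment> \<open>Chosen so that the factor \<open>5 ^ m / t\<close> of the covering estimate
        turns it into \<open>e\<close>.\<close>
      define e' where "e' = e * t / 5 ^ m"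
      have e': "0 < e'" using e t by (simp add: e'_def)
      obtain K where K: "compact K" "K \<subseteq> F" "H (F - K) \<le> ennreal e'"
        by (rule compact_inner[OF F e']) (rule that)
      have "\<forall>x\<in>A t. \<exists>r. 0 < r \<and> 10 * r \<le> \<delta> \<and> ennreal (t * (?o * r ^ m)) \<le> H (F \<inter> cball x r) \<and> cball x r \<subseteq> - K"
      proof
        fix x assume x: "x \<in> A t"
        have "open (- K)" "x \<in> - K" using K x compact_imp_closed by (auto simp: A_def)
        then obtain s where s: "0 < s" "cball x s \<subseteq> - K" using open_contains_cball by blast
        have "0 < min s (\<delta> / 10)" using s \<delta> by simp
        then obtain r where r: "0 < r" "r < min s (\<delta> / 10)" "ennreal (t * (?o * r ^ m)) \<le> H (F \<inter> cball x r)"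
          using x unfolding A_def by blast
        have "cball x r \<subseteq> - K" using s(2) r(2) subset_cball[of r s x] by auto
        then show "\<exists>r. 0 < r \<and> 10 * r \<le> \<delta> \<and> ennreal (t * (?o * r ^ m)) \<le> H (F \<inter> cball x r) \<and> cball x r \<subseteq> - K"
          using r by (intro exI[of _ r]) auto
      qed
      from bchoice[OF this] obtain r where r: "\<forall>x\<in>A t. 0 < r x \<and> 10 * r x \<le> \<delta> \<and>
          ennreal (t * (?o * r x ^ m)) \<le> H (F \<inter> cball x (r x)) \<and> cball x (r x) \<subseteq> - K" ..
      have cov: "A t \<subseteq> (\<Union>x\<in>A t. cball x (r x))" using r by force
      have rb: "0 < r x \<and> r x \<le> \<delta>" if "x \<in> A t" for x using r that by force
      obtain C where C: "countable C" "C \<subseteq> A t"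
        "pairwise (\<lambda>i j. disjnt (cball i (r i)) (cball j (r j))) C" "A t \<subseteq> (\<Union>i\<in>C. cball i (5 * r i))"
        by (rule Vitali_covering_lemma_cballs[OF cov rb]) (auto intro: that)
      have "hausdorff_content m \<delta> (A t) \<le> ennreal (5 ^ m / t) * H (F \<inter> - K)"
        using r C(2) \<delta> t F(1) by (intro content_disjoint_cballs[OF C(1,3,4)]) auto
      also have "F \<inter> - K = F - K" by auto
      also have "ennreal (5 ^ m / t) * H (F - K) \<le> ennreal (5 ^ m / t) * ennreal e'"
        using K(3) by (rule mult_left_mono) simp
      also have "\<dots> = ennreal (5 ^ m / t * e')" using t e' by (intro ennreal_mult[symmetric]) auto
      also have "5 ^ m / t * e' = e" using t by (simp add: e'_def)
      finally show ?thesis .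
    qed
    then have "hausdorff_content m \<delta> (A t) = 0" if "0 < \<delta>" for \<delta>
      using that ennreal_le_epsilon[of 0 "hausdorff_content m \<delta> (A t)"] by (metis add_0 le_zero_eq)
    then show ?thesis unfolding H_def hausdorff_measure_content by (intro SUP_eq_const) auto
  qed
  have "{x. x \<notin> F \<and> \<not> has_density m (outer_restrict H F) x 0} \<subseteq> (\<Union>n. A (inverse (real (Suc n))))"
  proof
    fix x assume "x \<in> {x. x \<notin> F \<and> \<not> has_density m (outer_restrict H F) x 0}"
    then have x: "x \<notin> F" "\<not> ((\<lambda>r. H (F \<inter> cball x r) / ennreal (?o * r ^ m)) \<longlongrightarrow> 0) (at_right 0)"
      by (auto simp: has_density_def outer_restrict_def)
    have "\<exists>n. x \<in> A (inverse (real (Suc n)))"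
    proof (rule ccontr)
      assume no: "\<nexists>n. x \<in> A (inverse (real (Suc n)))"
      have "((\<lambda>r. H (F \<inter> cball x r) / ennreal (?o * r ^ m)) \<longlongrightarrow> 0) (at_right 0)"
      proof (rule order_tendstoI)
        fix a :: ennreal assume "0 < a"
        then obtain b :: real where b: "0 < b" "ennreal b \<le> a"
        proof (cases a)
          case (real r)
          then show ?thesis using \<open>0 < a\<close> that[of r] by (cases "r = 0") auto
        next
          case top
          then show ?thesis using that[of 1] by simp
        qed
        obtain n where n: "inverse (real (Suc n)) < b" using reals_Archimedean[OF b(1)] by auto
        have "x \<notin> A (inverse (real (Suc n)))" using no by blast
        then have "\<exists>r0>0. \<forall>r. 0 < r \<longrightarrow> r < r0 \<longrightarrow> H (F \<inter> cball x r) < ennreal (inverse (real (Suc n)) * (?o * r ^ m))"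
          using x(1) unfolding A_def mem_Collect_eq not_le[symmetric] by blast
        then obtain r0 where r0: "0 < r0" "\<And>r. 0 < r \<Longrightarrow> r < r0 \<Longrightarrow> H (F \<inter> cball x r) < ennreal (inverse (real (Suc n)) * (?o * r ^ m))"
          by blast
        have "H (F \<inter> cball x r) / ennreal (?o * r ^ m) < a" if "0 < r" "r < r0" for r
        proof -
          have p: "0 < ?o * r ^ m" using \<open>0 < r\<close> o by simp
          have "H (F \<inter> cball x r) / ennreal (?o * r ^ m) \<le> ennreal (inverse (real (Suc n)) * (?o * r ^ m)) / ennreal (?o * r ^ m)"
            using r0(2)[OF that] by (intro divide_right_mono_ennreal) simp
          also have "\<dots> = ennreal (inverse (real (Suc n)))"
          proof -
            have "0 \<le> inverse (real (Suc n)) * (?o * r ^ m)" using p by simp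
            then have "ennreal (inverse (real (Suc n)) * (?o * r ^ m)) / ennreal (?o * r ^ m)
                = ennreal (inverse (real (Suc n)) * (?o * r ^ m) / (?o * r ^ m))" using p by (rule divide_ennreal)
            also have "inverse (real (Suc n)) * (?o * r ^ m) / (?o * r ^ m) = inverse (real (Suc n))"
              by (intro nonzero_mult_div_cancel_right less_imp_neq[OF p, symmetric])
            finally show ?thesis .
          qed
          also have "\<dots> < ennreal b" using n b(1) by (intro ennreal_lessI) auto
          finally show ?thesis using b(2) by simp
        qed
        then show "\<forall>\<^sub>F r in at_right 0. H (F \<inter> cball x r) / ennreal (?o * r ^ m) < a"
          using r0(1) unfolding eventually_at_right_field by (intro exI[of _ r0]) auto
      qed simp
      then show False using x(2) by blast
    qed
    then show "x \<in> (\<Union>n. A (inverse (real (Suc n))))" by blast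
  qed
  then have "H {x. x \<notin> F \<and> \<not> has_density m (outer_restrict H F) x 0} \<le> (\<Sum>n. H (A (inverse (real (Suc n)))))"
    using out_mono out_UN order_trans by blast
  also have "\<dots> = 0" by (simp add: A0)
  finally show ?thesis by simp
qed

lemma density_zero_dominated:
  assumes d: "has_density m \<phi>1 x 0" "has_density m \<phi>2 x 0"
    and le: "\<forall>\<^sub>F r in at_right 0. \<phi> (cball x r) \<le> \<phi>1 (cball x r) + \<phi>2 (cball x r)"
  shows "has_density m \<phi> x 0"
  unfolding has_density_def
proof -
  let ?q = "\<lambda>\<phi> r. \<phi> (cball x r) / ennreal (unit_ball_vol (real m) * r ^ m)"
  have lim: "((\<lambda>r. ?q \<phi>1 r + ?q \<phi>2 r) \<longlongrightarrow> 0) (at_right 0)"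
    using tendsto_add[OF d[unfolded has_density_def]] by simp
  have le': "\<forall>\<^sub>F r in at_right 0. ?q \<phi> r \<le> ?q \<phi>1 r + ?q \<phi>2 r"
    using le
  proof eventually_elim
    case (elim r)
    show ?case unfolding add_divide_distrib_ennreal[symmetric] by (rule divide_right_mono_ennreal[OF elim])
  qed
  show "(?q \<phi> \<longlongrightarrow> 0) (at_right 0)"
    by (rule tendsto_sandwich[OF _ le' tendsto_const lim]) simp
qed

text \<open>Sets \<open>S\<close> whose complement has density 0 in \<open>E2\<close> have the same
  property for \<open>E1\<close> when \<open>E1 - E2\<close> has density 0, so the intersection that
  defines the cone of \<open>E1\<close> runs over at least as many sets.\<close>

lemma approx_tangent_cone_subset:
  assumes d: "has_density m (outer_restrict H (E1 - E2)) x 0"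
  shows "approx_tangent_cone m (outer_restrict H E1) x \<subseteq> approx_tangent_cone m (outer_restrict H E2) x"
proof -
  have "has_density m (outer_restrict (outer_restrict H E1) (- S)) x 0"
    if "has_density m (outer_restrict (outer_restrict H E2) (- S)) x 0" for S
  proof (rule density_zero_dominated[OF d that], rule always_eventually, rule allI)
    fix r
    have "H (E1 \<inter> (- S \<inter> cball x r)) \<le> H (((E1 - E2) \<inter> cball x r) \<union> (E2 \<inter> (- S \<inter> cball x r)))"
      by (rule out_mono) blast
    then show "outer_restrict (outer_restrict H E1) (- S) (cball x r)
        \<le> outer_restrict H (E1 - E2) (cball x r) + outer_restrict (outer_restrict H E2) (- S) (cball x r)"
      unfolding outer_restrict_def using out_Un order_trans by blast
  qed
  then show ?thesis unfolding approx_tangent_cone_def by blast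
qed

text \<open>\<open>density_zero\<close> applies to sets of finite measure, so the difference of the
  two sets is cut down to the compact sets \<open>K n\<close> that exhaust \<open>U\<close>; at a
  point interior to \<open>K n\<close> small balls do not notice the cut.\<close>

lemma AE_approx_tangent_cone_eq:
  assumes U: "open U" and E: "E1 \<in> sets CM" "E2 \<in> sets CM" "E1 \<subseteq> U"
    and fin: "\<And>K. compact K \<Longrightarrow> K \<subseteq> U \<Longrightarrow> H (E1 \<inter> K) < \<infinity>" "\<And>K. compact K \<Longrightarrow> K \<subseteq> U \<Longrightarrow> H (E2 \<inter> K) < \<infinity>"
  shows "AE x in CM. x \<in> E1 \<inter> E2 \<longrightarrow>
      approx_tangent_cone m (outer_restrict H E1) x = approx_tangent_cone m (outer_restrict H E2) x"
proof -
  obtain K :: "nat \<Rightarrow> 'a set" where K: "\<And>n. compact (K n)" "\<And>n. K n \<subseteq> U" "\<And>n. K n \<subseteq> interior (K (Suc n))" "(\<Union>n. K n) = U"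
    by (rule open_Union_compact_subsets[OF U]) (auto intro: that)
  have *: "AE x in CM. x \<in> E \<inter> U \<longrightarrow> has_density m (outer_restrict H (F - E)) x 0"
    if F: "F \<in> sets CM" "E \<in> sets CM" and fin: "\<And>K. compact K \<Longrightarrow> K \<subseteq> U \<Longrightarrow> H (F \<inter> K) < \<infinity>" for E F
  proof -
    have "AE x in CM. x \<in> E \<inter> interior (K n) \<longrightarrow> has_density m (outer_restrict H (F - E)) x 0" for n
    proof -
      let ?F = "(F - E) \<inter> K n"
      have Fm: "?F \<in> sets CM" using F K(1)[of n] borel_sets_CM[of "K n"] by (auto intro: borel_compact)
      have "H ?F \<le> H (F \<inter> K n)" by (rule out_mono) blast
      then have "H ?F < \<infinity>" using fin[OF K(1,2)[of n]] by (rule le_less_trans)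
      then have "H {x. x \<notin> ?F \<and> \<not> has_density m (outer_restrict H ?F) x 0} = 0" by (rule density_zero[OF Fm])
      then have "AE x in CM. x \<notin> ?F \<longrightarrow> has_density m (outer_restrict H ?F) x 0" unfolding AE_CM_iff by simp
      then show ?thesis
      proof eventually_elim
        case (elim x)
        show ?case
        proof
          assume x: "x \<in> E \<inter> interior (K n)"
          then have d: "has_density m (outer_restrict H ?F) x 0" using elim by blast
          obtain s where s: "0 < s" "cball x s \<subseteq> K n" using x by (auto simp: mem_interior_cball)
          show "has_density m (outer_restrict H (F - E)) x 0"
          \<comment> \<open>Taking \<open>d\<close> twice only doubles a density that is 0; here one
            copy already dominates.\<close>
          proof (rule density_zero_dominated[OF d d])
            have "outer_restrict H (F - E) (cball x r) \<le> outer_restrict H ?F (cball x r) + outer_restrict H ?F (cball x r)"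
              if "0 < r" "r < s" for r
            proof -
              have "cball x r \<subseteq> K n" using s(2) that subset_cball[of r s x] by auto
              then have "(F - E) \<inter> cball x r = ?F \<inter> cball x r" by blast
              then show ?thesis by (simp add: outer_restrict_def)
            qed
            then show "\<forall>\<^sub>F r in at_right 0. outer_restrict H (F - E) (cball x r) \<le> outer_restrict H ?F (cball x r) + outer_restrict H ?F (cball x r)"
              using s(1) unfolding eventually_at_right_field by (intro exI[of _ s]) auto
          qed
        qed
      qed
    qed
    then have "AE x in CM. \<forall>n. x \<in> E \<inter> interior (K n) \<longrightarrow> has_density m (outer_restrict H (F - E)) x 0"
      unfolding AE_all_countable ..
    then show ?thesis
    proof eventually_elim
      case (elim x)
      show ?case
      proof
        assume x: "x \<in> E \<inter> U"
        then obtain n where "x \<in> K n" using K(4) by blast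
        then show "has_density m (outer_restrict H (F - E)) x 0" using elim x K(3)[of n] by blast
      qed
    qed
  qed
  have "AE x in CM. x \<in> E2 \<inter> U \<longrightarrow> has_density m (outer_restrict H (E1 - E2)) x 0"
    by (rule *[OF E(1,2)]) (rule fin(1))
  moreover have "AE x in CM. x \<in> E1 \<inter> U \<longrightarrow> has_density m (outer_restrict H (E2 - E1)) x 0"
    by (rule *[OF E(2,1)]) (rule fin(2))
  ultimately show ?thesis
  proof eventually_elim
    case (elim x)
    show ?case
    proof
      assume "x \<in> E1 \<inter> E2"
      then have "has_density m (outer_restrict H (E1 - E2)) x 0" "has_density m (outer_restrict H (E2 - E1)) x 0"
        using elim E(3) by blast+
      then show "approx_tangent_cone m (outer_restrict H E1) x = approx_tangent_cone m (outer_restrict H E2) x"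
        using approx_tangent_cone_subset by blast
    qed
  qed
qed

end

section \<open>Approximation by continuous functions in the mean\<close>

text \<open>\<open>sets N\<close> may be larger than the Borel sets, so approximation from inside by
  closed sets is assumed. A Urysohn function between a closed part of \<open>A\<close> and a closed
  part of its complement then approximates the indicator of \<open>A\<close>.\<close>

lemma L1_dense_continuous:
  fixes N :: "'a::euclidean_space measure" and h :: "'a \<Rightarrow> real"
  assumes fin: "finite_measure N" and N: "space N = UNIV" "\<And>A. closed A \<Longrightarrow> A \<in> sets N"
    and inner: "\<And>A e. A \<in> sets N \<Longrightarrow> 0 < e \<Longrightarrow> \<exists>C. closed C \<and> C \<subseteq> A \<and> measure N (A - C) \<le> e"
    and h: "integrable N h" and e: "0 < e"
  obtains g where "continuous_on UNIV g" "integrable N g" "(\<integral>x. \<bar>h x - g x\<bar> \<partial>N) \<le> e"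
proof -
  interpret finite_measure N by fact
  have cint: "integrable N g" if "continuous_on UNIV g" "\<And>x. \<bar>g x\<bar> \<le> (B::real)" for g B
  proof (rule integrable_const_bound)
    show "g \<in> borel_measurable N"
    proof (rule borel_measurableI)
      fix W :: "real set" assume "open W"
      then have "open (g -` W)" using that(1) by (simp add: open_vimage continuous_on_eq_continuous_at)
      then have "- (g -` W) \<in> sets N" using N(2)[of "- (g -` W)"] by auto
      then have "space N - (- (g -` W)) \<in> sets N" by (rule sets.compl_sets)
      then show "g -` W \<inter> space N \<in> sets N" using N(1) by (simp add: Compl_eq_Diff_UNIV double_diff)
    qed
    show "AE x in N. norm (g x) \<le> B" using that(2) by simp
  qed
  \<comment> \<open>The bound \<open>B\<close> is carried through the induction because, on a finite
    measure, it makes the approximating function integrable.\<close>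
  have "\<forall>e>0. \<exists>g B. continuous_on UNIV g \<and> (\<forall>x. \<bar>g x\<bar> \<le> (B::real)) \<and> (\<integral>x. \<bar>h x - g x\<bar> \<partial>N) \<le> e"
    using h
  proof (induction rule: integrable_induct)
    case (base A c)
    show ?case
    proof (intro allI impI)
      fix e :: real assume e: "0 < e"
      \<comment> \<open>The two errors of size \<open>t\<close> are scaled by
        \<open>\<bar>c\<bar>\<close>; the summand 1 avoids a division by 0 when
        \<open>c = 0\<close>.\<close>
      define t where "t = e / (2 * (\<bar>c\<bar> + 1))"
      have t: "0 < t" "\<bar>c\<bar> * (2 * t) \<le> e" using e by (auto simp: t_def field_simps)
      have A: "A \<in> sets N" "space N - A \<in> sets N" using base by auto
      obtain C1 where C1: "closed C1" "C1 \<subseteq> A" "measure N (A - C1) \<le> t" using inner[OF A(1) t(1)] by blast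
      obtain C2 where C2: "closed C2" "C2 \<subseteq> space N - A" "measure N (space N - A - C2) \<le> t" using inner[OF A(2) t(1)] by blast
      have dis: "C1 \<inter> C2 = {}" using C1(2) C2(2) by auto
      obtain f :: "'a \<Rightarrow> real" where f: "continuous_on UNIV f" "\<And>x. f x \<in> closed_segment 1 0"
          "\<And>x. x \<in> C1 \<Longrightarrow> f x = 1" "\<And>x. x \<in> C2 \<Longrightarrow> f x = 0"
        by (rule Urysohn[OF C1(1) C2(1) dis, of 1 0]) (auto intro: that)
      have f01: "0 \<le> f x" "f x \<le> 1" for x using f(2)[of x] by (auto simp: closed_segment_eq_real_ivl)
      have fi: "integrable N f" by (rule cint[of f 1]) (use f(1) f01 in auto)
      have s: "A - C1 \<in> sets N" "space N - A - C2 \<in> sets N" using A N(2)[OF C1(1)] N(2)[OF C2(1)] by auto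
      have "(\<integral>x. \<bar>indicator A x *\<^sub>R c - c * f x\<bar> \<partial>N) \<le> (\<integral>x. \<bar>c\<bar> * (indicator (A - C1) x + indicator (space N - A - C2) x) \<partial>N)"
      proof (rule integral_mono)
        show "integrable N (\<lambda>x. \<bar>indicator A x *\<^sub>R c - c * f x\<bar>)" using A fi by (simp add: less_top[symmetric])
        show "integrable N (\<lambda>x. \<bar>c\<bar> * (indicator (A - C1) x + indicator (space N - A - C2) x))"
          using s by (simp add: less_top[symmetric])
        fix x
        have "\<bar>indicator A x - f x\<bar> \<le> indicator (A - C1) x + indicator (space N - A - C2) x"
          using f01[of x] f(3,4)[of x] N(1) by (auto simp: indicator_def)
        then have "\<bar>c\<bar> * \<bar>indicator A x - f x\<bar> \<le> \<bar>c\<bar> * (indicator (A - C1) x + indicator (space N - A - C2) x)"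
          by (rule mult_left_mono) simp
        then show "\<bar>indicator A x *\<^sub>R c - c * f x\<bar> \<le> \<bar>c\<bar> * (indicator (A - C1) x + indicator (space N - A - C2) x)"
          by (simp add: abs_mult[symmetric] algebra_simps)
      qed
      also have "\<dots> = \<bar>c\<bar> * (measure N (A - C1) + measure N (space N - A - C2))"
        using s sets.sets_into_space[OF s(1)] sets.sets_into_space[OF s(2)]
        by (simp add: less_top[symmetric] Int_absorb2)
      also have "\<dots> \<le> \<bar>c\<bar> * (2 * t)" using C1(3) C2(3) by (intro mult_left_mono) auto
      finally have "(\<integral>x. \<bar>indicator A x *\<^sub>R c - c * f x\<bar> \<partial>N) \<le> e" using t(2) by linarith
      moreover have "continuous_on UNIV (\<lambda>x. c * f x)" using f(1) by (intro continuous_intros)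
      moreover have "\<bar>c * f x\<bar> \<le> \<bar>c\<bar>" for x using f01[of x] by (simp add: abs_mult mult_left_le)
      ultimately show "\<exists>g B. continuous_on UNIV g \<and> (\<forall>x. \<bar>g x\<bar> \<le> B) \<and> (\<integral>x. \<bar>indicator A x *\<^sub>R c - g x\<bar> \<partial>N) \<le> e"
        by blast
    qed
  next
    case (add f g)
    show ?case
    proof (intro allI impI)
      fix e :: real assume e: "0 < e"
      then have e2: "0 < e / 2" by simp
      obtain f' B where f': "continuous_on UNIV f'" "\<forall>x. \<bar>f' x\<bar> \<le> B" "(\<integral>x. \<bar>f x - f' x\<bar> \<partial>N) \<le> e / 2" using add.IH(1) e2 by blast
      obtain g' B' where g': "continuous_on UNIV g'" "\<forall>x. \<bar>g' x\<bar> \<le> B'" "(\<integral>x. \<bar>g x - g' x\<bar> \<partial>N) \<le> e / 2" using add.IH(2) e2 by blast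
      have i: "integrable N f'" "integrable N g'" using cint[OF f'(1)] cint[OF g'(1)] f'(2) g'(2) by blast+
      have "(\<integral>x. \<bar>f x + g x - (f' x + g' x)\<bar> \<partial>N) \<le> (\<integral>x. \<bar>f x - f' x\<bar> + \<bar>g x - g' x\<bar> \<partial>N)"
        using i add.hyps by (intro integral_mono) auto
      also have "\<dots> \<le> e" using i add.hyps f'(3) g'(3) by simp
      finally have 1: "(\<integral>x. \<bar>f x + g x - (f' x + g' x)\<bar> \<partial>N) \<le> e" .
      have 2: "\<bar>f' x + g' x\<bar> \<le> B + B'" for x using f'(2)[rule_format, of x] g'(2)[rule_format, of x] by linarith
      have 3: "continuous_on UNIV (\<lambda>x. f' x + g' x)" using f'(1) g'(1) by (intro continuous_intros)
      show "\<exists>k B. continuous_on UNIV k \<and> (\<forall>x. \<bar>k x\<bar> \<le> B) \<and> (\<integral>x. \<bar>f x + g x - k x\<bar> \<partial>N) \<le> e"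
        using 1 2 3 by (intro exI[of _ "\<lambda>x. f' x + g' x"] exI[of _ "B + B'"]) auto
    qed
  next
    case (lim f s)
    show ?case
    proof (intro allI impI)
      fix e :: real assume e: "0 < e"
      \<comment> \<open>The approximating sequence of the induction principle satisfies
        \<open>norm (s i x) \<le> 2 * norm (f x)\<close>, whence the factor 3 below.\<close>
      have "(\<lambda>i. \<integral>x. \<bar>f x - s i x\<bar> \<partial>N) \<longlonglongrightarrow> (\<integral>x. 0 \<partial>N)"
      proof (rule integral_dominated_convergence[where w = "\<lambda>x. 3 * \<bar>f x\<bar>"])
        show "AE x in N. (\<lambda>i. \<bar>f x - s i x\<bar>) \<longlonglongrightarrow> 0"
        proof (rule AE_I2)
          fix x assume x: "x \<in> space N"
          have "(\<lambda>i. \<bar>f x - s i x\<bar>) \<longlonglongrightarrow> \<bar>f x - f x\<bar>" by (intro tendsto_intros lim.hyps(2) x)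
          then show "(\<lambda>i. \<bar>f x - s i x\<bar>) \<longlonglongrightarrow> 0" by simp
        qed
        show "AE x in N. norm \<bar>f x - s i x\<bar> \<le> 3 * \<bar>f x\<bar>" for i
        proof (rule AE_I2)
          fix x assume "x \<in> space N"
          from lim.hyps(3)[OF this, of i] show "norm \<bar>f x - s i x\<bar> \<le> 3 * \<bar>f x\<bar>" by simp
        qed
      qed (use lim.hyps in auto)
      then obtain i where i: "(\<integral>x. \<bar>f x - s i x\<bar> \<partial>N) < e / 2"
        using LIMSEQ_D[of "\<lambda>i. \<integral>x. \<bar>f x - s i x\<bar> \<partial>N" 0 "e/2"] e by (force simp: abs_less_iff)
      obtain g B where g: "continuous_on UNIV g" "\<forall>x. \<bar>g x\<bar> \<le> B" "(\<integral>x. \<bar>s i x - g x\<bar> \<partial>N) \<le> e / 2"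
        using lim.IH[of i] e by (meson half_gt_zero)
      have gi: "integrable N g" using cint[OF g(1)] g(2) by blast
      have "(\<integral>x. \<bar>f x - g x\<bar> \<partial>N) \<le> (\<integral>x. \<bar>f x - s i x\<bar> + \<bar>s i x - g x\<bar> \<partial>N)"
        using gi lim.hyps by (intro integral_mono) auto
      also have "\<dots> \<le> e" using gi lim.hyps i g(3) by simp
      finally show "\<exists>g B. continuous_on UNIV g \<and> (\<forall>x. \<bar>g x\<bar> \<le> B) \<and> (\<integral>x. \<bar>f x - g x\<bar> \<partial>N) \<le> e"
        using g(1,2) by blast
    qed
  qed
  then obtain g B where "continuous_on UNIV g" "\<forall>x. \<bar>g x\<bar> \<le> B" "(\<integral>x. \<bar>h x - g x\<bar> \<partial>N) \<le> e" using e by blast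
  then show thesis using cint[of g B] that by blast
qed

lemma (in hausdorff) compact_exhaustion:
  assumes F: "F \<in> sets CM" "H F < \<infinity>"
  obtains Q :: "nat \<Rightarrow> 'a set" where "\<And>n. compact (Q n)" "\<And>n. Q n \<subseteq> F" "H (F - (\<Union>n. Q n)) = 0"
proof -
  have "\<forall>n. \<exists>K. compact K \<and> K \<subseteq> F \<and> H (F - K) \<le> ennreal (inverse (real (Suc n)))"
  proof
    fix n
    obtain K where "compact K" "K \<subseteq> F" "H (F - K) \<le> ennreal (inverse (real (Suc n)))"
      by (rule compact_inner[OF F, of "inverse (real (Suc n))"]) auto
    then show "\<exists>K. compact K \<and> K \<subseteq> F \<and> H (F - K) \<le> ennreal (inverse (real (Suc n)))" by blast
  qed
  from choice[OF this] obtain Q where Q: "\<forall>n. compact (Q n) \<and> Q n \<subseteq> F \<and> H (F - Q n) \<le> ennreal (inverse (real (Suc n)))" ..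
  have "H (F - (\<Union>n. Q n)) \<le> ennreal (inverse (real (Suc n)))" for n
    using out_mono[of "F - (\<Union>n. Q n)" "F - Q n"] Q by (meson Diff_mono UN_upper UNIV_I order_refl order_trans)
  moreover have "(\<lambda>n. ennreal (inverse (real (Suc n)))) \<longlonglongrightarrow> 0"
    using tendsto_ennrealI[OF LIMSEQ_inverse_real_of_nat] by simp
  ultimately have "H (F - (\<Union>n. Q n)) \<le> 0" by (intro LIMSEQ_le_const[of _ 0]) auto
  then show thesis using Q by (intro that[of Q]) auto
qed

section \<open>Rectifiable varifolds\<close>

lemma lch2_open:
  fixes U :: "(real^'n::finite) set"
  assumes "open U"
  shows "lch2 (top_of_set U)"
proof
  show "locally_compact_space (top_of_set U)"
    using assms locally_compact_space_open_subset[OF _ locally_compact_space_euclidean, of U] by simp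
  show "Hausdorff_space (top_of_set U)" by (simp add: Hausdorff_space_subtopology)
  show "second_countable (top_of_set U)" by (rule second_countable_top_of_set)
qed

lemma topspace_grassmannian [simp]: "topspace (grassmannian_topology m) = grassmannian m"
  by (simp add: grassmannian_topology_def topspace_pullback_topology)

lemma compact_factor_varifold:
  fixes U :: "(real^'n::finite) set"
  assumes "open U" "varifold CARD('m::finite) U V"
  shows "compact_factor (top_of_set U) (grassmannian_topology CARD('m)) V"
proof -
  interpret p: lch2_pair "top_of_set U" "grassmannian_topology CARD('m) :: (real^'n) set topology"
    by (intro lch2_pair.intro lch2_open lch2_grassmannian assms(1))
  show ?thesis
    using assms(2) unfolding varifold_def
    by (intro compact_factor.intro p.lch2_pair_axioms radon.intro p.P.lch_axioms radon_axioms.intro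
        compact_factor_axioms.intro compact_grassmannian)
qed

lemma (in outer_meas) nn_integral_suminf_density:
  fixes c :: "nat \<Rightarrow> real" and f :: "'a \<Rightarrow> ennreal"
  assumes E: "\<And>j. E j \<in> sets CM" and f: "f \<in> borel_measurable CM"
  shows "(\<integral>\<^sup>+x. (\<Sum>j. ennreal (c j) * indicator (E j) x) * f x \<partial>CM) = (\<Sum>j. ennreal (c j) * (\<integral>\<^sup>+x. indicator (E j) x * f x \<partial>CM))"
proof -
  note [measurable] = E f
  have "(\<integral>\<^sup>+x. (\<Sum>j. ennreal (c j) * indicator (E j) x) * f x \<partial>CM) = (\<integral>\<^sup>+x. (\<Sum>j. ennreal (c j) * (indicator (E j) x * f x)) \<partial>CM)"
    by (intro nn_integral_cong) (simp add: mult.assoc flip: ennreal_suminf_multc)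
  also have "\<dots> = (\<Sum>j. \<integral>\<^sup>+x. ennreal (c j) * (indicator (E j) x * f x) \<partial>CM)"
    by (intro nn_integral_suminf) measurable
  also have "\<dots> = (\<Sum>j. ennreal (c j) * (\<integral>\<^sup>+x. indicator (E j) x * f x \<partial>CM))"
    by (intro suminf_cong nn_integral_cmult) measurable
  finally show ?thesis .
qed

text \<open>The defining series of a rectifiable varifold is a sum of integrals over the base, in
  which \<open>w\<close> enters only through \<open>w (x, T j x)\<close>. Almost everywhere this
  value is the same for all \<open>j\<close> with \<open>x \<in> E j\<close>; call it
  \<open>g x\<close>. The distance in the mean of \<open>w\<close> from \<open>a \<circ> fst\<close>
  under \<open>V\<close> is then controlled by the approximation of \<open>g\<close> under a finite
  measure on the base.\<close>

lemma rectifiable_varifold_approx: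
  fixes U :: "(real^'n::finite) set"
  assumes U: "open U" and V: "rectifiable_varifold TYPE('m::finite) U V"
    and w: "w \<in> test_functions (varifold_space CARD('m) U)" and e: "0 < e"
  obtains a where "a \<in> test_functions (top_of_set U)"
    "radon_integral (varifold_space CARD('m) U) V (\<lambda>z. \<bar>w z - a (fst z)\<bar>) \<le> e"
proof -
  let ?m = "CARD('m)" and ?X = "top_of_set U"
  let ?G = "grassmannian_topology ?m :: (real^'n) set topology"
  let ?XG = "varifold_space ?m U"
  define H :: "(real^'n) set \<Rightarrow> ennreal" where "H = hausdorff_measure ?m"
  have "varifold ?m U V" using V by (simp add: rectifiable_varifold_def)
  then interpret cf: compact_factor ?X ?G V by (rule compact_factor_varifold[OF U])
  interpret h: hausdorff ?m H by unfold_locales (simp_all add: H_def)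
  obtain c E where cE: "let H = hausdorff_measure ?m; M = caratheodory_measure UNIV H;
            T = (\<lambda>j. approx_tangent_cone ?m (outer_restrict H (E j)))
        in (\<forall>j. c j > 0 \<and> E j \<subseteq> U \<and> E j \<in> caratheodory_sets UNIV H \<and>
                (\<forall>K. compact K \<and> K \<subseteq> U \<longrightarrow> hm_rectifiable TYPE('m) (E j \<inter> K)) \<and>
                (AE x\<in>E j in M. T j x \<in> grassmannian ?m)) \<and>
           (\<forall>\<beta>\<in>test_functions ?XG.
              (\<forall>j. set_integrable M (E j) (\<lambda>x. \<beta> (x, T j x))) \<and>
              (\<lambda>j. c j * (LINT x:E j|M. \<beta> (x, T j x))) sums radon_integral ?XG V \<beta>)"
    using V unfolding rectifiable_varifold_def by (elim conjE exE) (rule that)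
  define T where "T j = approx_tangent_cone ?m (outer_restrict H (E j))" for j
  have all: "(\<forall>j. c j > 0 \<and> E j \<subseteq> U \<and> E j \<in> caratheodory_sets UNIV H \<and>
                (\<forall>K. compact K \<and> K \<subseteq> U \<longrightarrow> hm_rectifiable TYPE('m) (E j \<inter> K)) \<and>
                (AE x\<in>E j in h.CM. T j x \<in> grassmannian ?m)) \<and>
           (\<forall>\<beta>\<in>test_functions ?XG.
              (\<forall>j. set_integrable h.CM (E j) (\<lambda>x. \<beta> (x, T j x))) \<and>
              (\<lambda>j. c j * (LINT x:E j|h.CM. \<beta> (x, T j x))) sums radon_integral ?XG V \<beta>)"
    using cE unfolding Let_def H_def[symmetric] T_def[symmetric] .
  have c: "0 < c j" and EU: "E j \<subseteq> U" and Em: "E j \<in> sets h.CM"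
    and rect: "\<And>K. compact K \<Longrightarrow> K \<subseteq> U \<Longrightarrow> hm_rectifiable TYPE('m) (E j \<inter> K)"
    and TG: "AE x in h.CM. x \<in> E j \<longrightarrow> T j x \<in> grassmannian ?m" for j
    using all by (simp_all add: h.sets_CM)
  have int: "integrable h.CM (\<lambda>x. indicator (E j) x *\<^sub>R \<beta> (x, T j x))"
    and sums: "(\<lambda>j. c j * (\<integral>x. indicator (E j) x *\<^sub>R \<beta> (x, T j x) \<partial>h.CM)) sums radon_integral ?XG V \<beta>"
    if "\<beta> \<in> test_functions ?XG" for \<beta> j
    using conjunct2[OF all] that unfolding set_integrable_def set_lebesgue_integral_def by blast+
  have fin: "H (E j \<inter> K) < \<infinity>" if "compact K" "K \<subseteq> U" for j K
    using rect[OF that] by (simp add: hm_rectifiable_def H_def)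
  have Teq: "AE x in h.CM. \<forall>i j. x \<in> E i \<inter> E j \<longrightarrow> T i x = T j x"
    unfolding AE_all_countable
  proof (intro allI)
    fix i j
    show "AE x in h.CM. x \<in> E i \<inter> E j \<longrightarrow> T i x = T j x"
      unfolding T_def by (rule h.AE_approx_tangent_cone_eq[OF U Em Em EU]) (rule fin; assumption)+
  qed
  \<comment> \<open>For nonnegative \<open>\<beta>\<close> the series is rewritten with nonnegative
    integrals, where sums and integrals may be interchanged freely.\<close>
  have nn_sum: "(\<Sum>j. ennreal (c j) * (\<integral>\<^sup>+x. indicator (E j) x * ennreal (\<beta> (x, T j x)) \<partial>h.CM)) = ennreal (radon_integral ?XG V \<beta>)"
    if \<beta>: "\<beta> \<in> test_functions ?XG" "\<And>z. 0 \<le> \<beta> z" for \<beta>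
  proof -
    have "ennreal (c j) * (\<integral>\<^sup>+x. indicator (E j) x * ennreal (\<beta> (x, T j x)) \<partial>h.CM)
        = ennreal (c j * (\<integral>x. indicator (E j) x *\<^sub>R \<beta> (x, T j x) \<partial>h.CM))" for j
    proof -
      have "(\<integral>\<^sup>+x. indicator (E j) x * ennreal (\<beta> (x, T j x)) \<partial>h.CM) = (\<integral>\<^sup>+x. ennreal (indicator (E j) x *\<^sub>R \<beta> (x, T j x)) \<partial>h.CM)"
        by (intro nn_integral_cong) (simp add: indicator_def)
      also have "\<dots> = ennreal (\<integral>x. indicator (E j) x *\<^sub>R \<beta> (x, T j x) \<partial>h.CM)"
        by (rule nn_integral_eq_integral[OF int[OF \<beta>(1)]]) (simp add: \<beta>(2))
      finally show ?thesis using c[of j] by (simp add: ennreal_mult')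
    qed
    moreover have "(\<Sum>j. ennreal (c j * (\<integral>x. indicator (E j) x *\<^sub>R \<beta> (x, T j x) \<partial>h.CM))) = ennreal (radon_integral ?XG V \<beta>)"
      using c by (intro suminf_ennreal_eq sums[OF \<beta>(1)] mult_nonneg_nonneg Bochner_Integration.integral_nonneg) (auto simp: \<beta>(2) less_imp_le)
    ultimately show ?thesis by simp
  qed
  \<comment> \<open>A chain of supports and cut-offs: \<open>w\<close> vanishes off
    \<open>S\<close>, \<open>\<eta>\<close> is 1 near the projection of \<open>S\<close> and
    vanishes off \<open>K\<close>, and \<open>\<zeta>\<close> is 1 near \<open>K\<close>.
    \<open>\<eta>\<close> will localise the approximating function, \<open>\<zeta>\<close> will
    bound the mass over \<open>K\<close>.\<close>
  obtain S where S: "compactin ?XG S" "\<And>z. z \<in> topspace ?XG \<Longrightarrow> z \<notin> S \<Longrightarrow> w z = 0"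
    by (rule cf.P.tf_supp[OF w]) (rule that)
  have Kc: "compactin ?X (fst ` S)" by (rule image_compactin[OF S(1) continuous_map_fst])
  obtain \<eta> Q where \<eta>: "\<eta> \<in> test_functions ?X" "\<And>x. 0 \<le> \<eta> x" "\<And>x. \<eta> x \<le> 1"
    "openin ?X Q" "fst ` S \<subseteq> Q" "\<And>x. x \<in> Q \<Longrightarrow> \<eta> x = 1" by (rule cf.X.cutoff[OF Kc]) (rule that)
  obtain K where K: "compactin ?X K" "\<And>x. x \<in> topspace ?X \<Longrightarrow> x \<notin> K \<Longrightarrow> \<eta> x = 0"
    by (rule cf.X.tf_supp[OF \<eta>(1)]) (rule that)
  have KU: "compact K" "K \<subseteq> U" using K(1) by (simp_all add: compactin_subtopology)
  obtain \<zeta> Q' where \<zeta>: "\<zeta> \<in> test_functions ?X" "\<And>x. 0 \<le> \<zeta> x" "\<And>x. \<zeta> x \<le> 1"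
    "openin ?X Q'" "K \<subseteq> Q'" "\<And>x. x \<in> Q' \<Longrightarrow> \<zeta> x = 1" by (rule cf.X.cutoff[OF K(1)]) (rule that)
  have Km: "K \<in> sets h.CM" using KU(1) by (intro h.borel_sets_CM borel_compact)
  \<comment> \<open>Any index with \<open>x \<in> E j\<close> would do, as the values agree almost
    everywhere; the first one keeps \<open>g\<close> measurable.\<close>
  define J where "J x = (LEAST j. x \<in> E j)" for x
  define g where "g x = (if \<exists>j. x \<in> E j then w (x, T (J x) x) else 0)" for x
  have gm: "g \<in> borel_measurable h.CM"
  proof (rule borel_measurable_LIMSEQ_real)
    \<comment> \<open>The disjointed sets single out the first index, so at most one term is
      nonzero; the second factor is measurable because it is integrable by the definition of a
      rectifiable varifold.\<close>
    let ?s = "\<lambda>n x. \<Sum>j<n. indicator (disjointed E j) x * (indicator (E j) x *\<^sub>R w (x, T j x))"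
    have "disjointed E j \<in> sets h.CM" for j using sets.range_disjointed_sets[of E h.CM] Em by auto
    moreover have "(\<lambda>x. indicator (E j) x *\<^sub>R w (x, T j x)) \<in> borel_measurable h.CM" for j
      using int[OF w] by (rule borel_measurable_integrable)
    ultimately show "?s n \<in> borel_measurable h.CM" for n by (intro borel_measurable_sum borel_measurable_times borel_measurable_indicator)
    fix x
    show "(\<lambda>n. ?s n x) \<longlonglongrightarrow> g x"
    proof (cases "\<exists>j. x \<in> E j")
      case True
      then have JE: "x \<in> E (J x)" unfolding J_def by (rule LeastI_ex)
      have dis: "x \<in> disjointed E j \<longleftrightarrow> j = J x" for j
      proof
        assume "x \<in> disjointed E j"
        then have "x \<in> E j" "\<And>i. i < j \<Longrightarrow> x \<notin> E i" by (auto simp: disjointed_def)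
        then show "j = J x" unfolding J_def by (metis Least_equality not_less)
      next
        assume "j = J x"
        moreover have "x \<notin> E i" if "i < J x" for i using not_less_Least[of i "\<lambda>j. x \<in> E j"] that by (simp add: J_def)
        ultimately show "x \<in> disjointed E j" using JE by (simp add: disjointed_def)
      qed
      have "?s n x = g x" if "n > J x" for n
      proof -
        have "?s n x = (\<Sum>j\<in>{J x}. indicator (disjointed E j) x * (indicator (E j) x *\<^sub>R w (x, T j x)))"
          using that dis by (intro sum.mono_neutral_right) (auto simp: indicator_def)
        then show ?thesis using True JE dis by (simp add: g_def)
      qed
      then show ?thesis by (intro tendsto_eventually) (auto simp: eventually_sequentially intro!: exI[of _ "Suc (J x)"])
    next
      case False
      then have "?s n x = g x" for n by (auto simp: g_def intro!: sum.neutral)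
      then show ?thesis by simp
    qed
  qed
  have geq: "AE x in h.CM. \<forall>j. x \<in> E j \<longrightarrow> g x = w (x, T j x)"
    using Teq
  proof eventually_elim
    case (elim x)
    show ?case
    proof (intro allI impI)
      fix j assume j: "x \<in> E j"
      then have "x \<in> E (J x)" unfolding J_def by (rule LeastI)
      then have "T (J x) x = T j x" using elim[rule_format, of "J x" j] j by simp
      moreover have "\<exists>j. x \<in> E j" using j by blast
      ultimately show "g x = w (x, T j x)" by (simp add: g_def)
    qed
  qed
  have TGall: "AE x in h.CM. \<forall>j. x \<in> E j \<longrightarrow> T j x \<in> grassmannian ?m"
    unfolding AE_all_countable by (intro allI TG)
  obtain C where C: "0 < C" "\<And>z. z \<in> topspace ?XG \<Longrightarrow> \<bar>w z\<bar> \<le> C" by (rule cf.P.tf_bounded[OF w]) (rule that)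
  \<comment> \<open>The density, with respect to Hausdorff measure, of the weight of
    \<open>V\<close> over \<open>K\<close>: each \<open>E j\<close> contributes
    \<open>c j\<close>.\<close>
  define \<rho> where "\<rho> x = (\<Sum>j. ennreal (c j) * indicator (E j) x) * indicator K x" for x
  have \<rho>m: "\<rho> \<in> borel_measurable h.CM" 
  proof -
    note [measurable] = Em Km
    show ?thesis unfolding \<rho>_def by measurable
  qed
  define N where "N = density h.CM \<rho>"
  have nnN: "(\<integral>\<^sup>+x. f x \<partial>N) = (\<Sum>j. ennreal (c j) * (\<integral>\<^sup>+x. indicator (E j) x * (indicator K x * f x) \<partial>h.CM))"
    if "f \<in> borel_measurable h.CM" for f
  proof -
    have "(\<integral>\<^sup>+x. f x \<partial>N) = (\<integral>\<^sup>+x. (\<Sum>j. ennreal (c j) * indicator (E j) x) * (indicator K x * f x) \<partial>h.CM)"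
      unfolding N_def using \<rho>m that by (subst nn_integral_density) (auto simp: \<rho>_def mult.assoc)
    also have "\<dots> = (\<Sum>j. ennreal (c j) * (\<integral>\<^sup>+x. indicator (E j) x * (indicator K x * f x) \<partial>h.CM))"
    proof (rule h.nn_integral_suminf_density[OF Em])
      note [measurable] = Km that
      show "(\<lambda>x. indicator K x * f x) \<in> borel_measurable h.CM" by measurable
    qed
    finally show ?thesis .
  qed
  have sN: "space N = UNIV" "sets N = sets h.CM" by (simp_all add: N_def)
  have eN: "emeasure N A = (\<Sum>j. ennreal (c j) * H (E j \<inter> K \<inter> A))" if A: "A \<in> sets h.CM" for A
  proof -
    have "emeasure N A = (\<integral>\<^sup>+x. indicator A x \<partial>N)" using A sN by simp
    also have "\<dots> = (\<Sum>j. ennreal (c j) * (\<integral>\<^sup>+x. indicator (E j \<inter> K \<inter> A) x \<partial>h.CM))"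
      using A by (subst nnN) (auto intro!: suminf_cong arg_cong2[where f = "(*)"] nn_integral_cong simp: indicator_def)
    also have "\<dots> = (\<Sum>j. ennreal (c j) * H (E j \<inter> K \<inter> A))"
    proof (intro suminf_cong arg_cong2[where f = "(*)"] refl)
      fix j
      have "E j \<inter> K \<inter> A \<in> sets h.CM" using Em Km A by blast
      then show "(\<integral>\<^sup>+x. indicator (E j \<inter> K \<inter> A) x \<partial>h.CM) = H (E j \<inter> K \<inter> A)" by (simp add: h.emeasure_CM h.sets_CM)
    qed
    finally show ?thesis .
  qed
  have finN: "finite_measure N"
  proof (rule finite_measureI)
    \<comment> \<open>\<open>\<zeta>\<close> dominates the indicator of \<open>K\<close>, and the
      series for its lift to the product is finite, being the integral of a test function against
      \<open>V\<close>.\<close>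
    let ?\<beta> = "\<lambda>z. \<zeta> (fst z)"
    have \<beta>: "?\<beta> \<in> test_functions ?XG" by (rule cf.tf_fst[OF \<zeta>(1)])
    have "emeasure N (space N) = (\<Sum>j. ennreal (c j) * H (E j \<inter> K \<inter> UNIV))"
      unfolding sN by (rule eN) (use sets.top[of h.CM] in simp)
    also have "\<dots> \<le> (\<Sum>j. ennreal (c j) * (\<integral>\<^sup>+x. indicator (E j) x * ennreal (?\<beta> (x, T j x)) \<partial>h.CM))"
    proof (intro suminf_le mult_left_mono)
      fix j
      have "E j \<inter> K \<in> sets h.CM" using Em Km by blast
      then have "H (E j \<inter> K \<inter> UNIV) = (\<integral>\<^sup>+x. indicator (E j \<inter> K) x \<partial>h.CM)" by (simp add: h.emeasure_CM h.sets_CM)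
      also have "\<dots> \<le> (\<integral>\<^sup>+x. indicator (E j) x * ennreal (?\<beta> (x, T j x)) \<partial>h.CM)"
        using \<zeta>(5,6) by (intro nn_integral_mono) (auto simp: indicator_def)
      finally show "H (E j \<inter> K \<inter> UNIV) \<le> (\<integral>\<^sup>+x. indicator (E j) x * ennreal (?\<beta> (x, T j x)) \<partial>h.CM)" .
    qed auto
    also have "\<dots> = ennreal (radon_integral ?XG V ?\<beta>)" using \<zeta>(2) by (intro nn_sum \<beta>)
    finally show "emeasure N (space N) \<noteq> \<infinity>" by (auto simp: top_unique)
  qed
  then interpret N: finite_measure N .
  \<comment> \<open>\<open>H\<close> is finite on \<open>E j \<inter> K \<inter> A\<close>, which
    allows a compact exhaustion up to a null set for each \<open>j\<close>. Finite unions of these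
    compact sets, enumerated over all \<open>j\<close>, are closed and exhaust \<open>A\<close> up
    to an \<open>N\<close>-null set.\<close>
  have ginner: "\<exists>D. closed D \<and> D \<subseteq> A \<and> measure N (A - D) \<le> e" if A: "A \<in> sets N" and e: "0 < e" for A and e :: real
  proof -
    have Am: "A \<in> sets h.CM" using A sN by simp
    have "\<forall>j. \<exists>Q :: nat \<Rightarrow> (real^'n) set. (\<forall>n. compact (Q n) \<and> Q n \<subseteq> E j \<inter> K \<inter> A) \<and> H (E j \<inter> K \<inter> A - (\<Union>n. Q n)) = 0"
    proof
      fix j
      have m: "E j \<inter> K \<inter> A \<in> sets h.CM" using Em Km Am by blast
      have f: "H (E j \<inter> K \<inter> A) < \<infinity>" using h.out_mono[of "E j \<inter> K \<inter> A" "E j \<inter> K"] fin[OF KU] by (meson inf_le1 le_less_trans)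
      obtain Q :: "nat \<Rightarrow> (real^'n) set" where "\<And>n. compact (Q n)" "\<And>n. Q n \<subseteq> E j \<inter> K \<inter> A" "H (E j \<inter> K \<inter> A - (\<Union>n. Q n)) = 0"
        by (rule h.compact_exhaustion[OF m f]) (rule that)
      then show "\<exists>Q :: nat \<Rightarrow> (real^'n) set. (\<forall>n. compact (Q n) \<and> Q n \<subseteq> E j \<inter> K \<inter> A) \<and> H (E j \<inter> K \<inter> A - (\<Union>n. Q n)) = 0"
        by (intro exI[of _ Q]) simp
    qed
    from choice[OF this] obtain Q :: "nat \<Rightarrow> nat \<Rightarrow> (real^'n) set" where Q: "\<forall>j. (\<forall>n. compact (Q j n) \<and> Q j n \<subseteq> E j \<inter> K \<inter> A) \<and> H (E j \<inter> K \<inter> A - (\<Union>n. Q j n)) = 0" ..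
    define P where "P i = (case prod_decode i of (j, n) \<Rightarrow> Q j n)" for i
    have P: "compact (P i)" "P i \<subseteq> A" for i using Q unfolding P_def by (auto split: prod.split)
    have QP: "Q j n \<subseteq> (\<Union>i. P i)" for j n
      by (rule subset_trans[OF _ UN_upper[of "prod_encode (j, n)"]]) (auto simp: P_def)
    let ?D = "\<lambda>k. \<Union>i<k. P i"
    have clD: "closed (?D k)" for k using P(1) by (intro closed_UN) (auto intro: compact_imp_closed)
    have Dm: "?D k \<in> sets N" for k unfolding sN by (intro h.closed_measurable clD)
    have "(\<lambda>k. measure N (A - ?D k)) \<longlonglongrightarrow> measure N (\<Inter>k. A - ?D k)"
    proof (rule N.finite_Lim_measure_decseq)
      show "decseq (\<lambda>k. A - ?D k)" unfolding decseq_def by (auto intro: less_le_trans)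
    qed (use A Dm in auto)
    moreover have "measure N (\<Inter>k. A - ?D k) = 0"
    proof -
      have m: "(\<Inter>k. A - ?D k) \<in> sets h.CM" using A Dm unfolding sN by (intro sets.countable_INT) auto
      have "H (E j \<inter> K \<inter> (\<Inter>k. A - ?D k)) = 0" for j
      proof -
        have "E j \<inter> K \<inter> (\<Inter>k. A - ?D k) \<subseteq> E j \<inter> K \<inter> A - (\<Union>n. Q j n)"
        proof
          fix x assume x: "x \<in> E j \<inter> K \<inter> (\<Inter>k. A - ?D k)"
          have "x \<notin> P i" for i using x by (auto dest: INT_D[of _ _ _ "Suc i"])
          then have "x \<notin> (\<Union>n. Q j n)" using QP by blast
          then show "x \<in> E j \<inter> K \<inter> A - (\<Union>n. Q j n)" using x by auto
        qed
        then have "H (E j \<inter> K \<inter> (\<Inter>k. A - ?D k)) \<le> H (E j \<inter> K \<inter> A - (\<Union>n. Q j n))" by (rule h.out_mono)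
        then show ?thesis using Q by simp
      qed
      then have "emeasure N (\<Inter>k. A - ?D k) = 0" using eN[OF m] by simp
      then show ?thesis by (simp add: measure_def)
    qed
    ultimately have lim: "(\<lambda>k. measure N (A - ?D k)) \<longlonglongrightarrow> 0" by simp
    have "\<forall>\<^sub>F k in sequentially. measure N (A - ?D k) < e" using order_tendstoD(2)[OF lim e] .
    then obtain k where "measure N (A - ?D k) < e" by (auto simp: eventually_sequentially)
    then show ?thesis using clD P(2) by (intro exI[of _ "?D k"]) auto
  qed
  have gN: "integrable N g"
  proof (rule N.integrable_const_bound[of g C])
    have "AE x in h.CM. \<bar>g x\<bar> \<le> C"
      using geq TGall
    proof eventually_elim
      case (elim x)
      show ?case
      proof (cases "\<exists>j. x \<in> E j")
        case True
        then obtain j where j: "x \<in> E j" by blast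
        then have "(x, T j x) \<in> topspace ?XG" using elim(2) EU by auto
        then show ?thesis using C(2) elim(1) j by auto
      next
        case False then show ?thesis using C(1) by (simp add: g_def)
      qed
    qed
    then show "AE x in N. norm (g x) \<le> C"
      unfolding N_def AE_density[OF \<rho>m] by eventually_elim simp
    show "g \<in> borel_measurable N" using gm by (simp add: N_def)
  qed
  have clN: "A \<in> sets N" if "closed A" for A using h.closed_measurable[OF that] sN by simp
  obtain f where f: "continuous_on UNIV f" "integrable N f" "(\<integral>x. \<bar>g x - f x\<bar> \<partial>N) \<le> e"
    by (rule L1_dense_continuous[OF finN sN(1) _ _ gN e]) (erule clN, erule (1) ginner, rule that)
  \<comment> \<open>The factor \<open>\<eta>\<close> gives \<open>a\<close> compact support and does
    no harm: over the projection of \<open>S\<close> it is 1, and elsewhere \<open>g\<close>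
    vanishes on the sets \<open>E j\<close> almost everywhere, so that shrinking \<open>f\<close>
    towards 0 cannot worsen the approximation.\<close>
  define a where "a x = \<eta> x * f x" for x
  have at: "a \<in> test_functions ?X"
  proof -
    have "continuous_map ?X euclideanreal f" using continuous_on_subset[OF f(1)] by simp
    then show ?thesis unfolding a_def using \<eta>(1) by (rule cf.X.tf_mult2)
  qed
  let ?\<beta> = "\<lambda>z. \<bar>w z - a (fst z)\<bar>"
  have \<beta>: "?\<beta> \<in> test_functions ?XG" by (rule cf.P.tf_abs[OF cf.P.tf_diff[OF w cf.tf_fst[OF at]]])
  have fm: "f \<in> borel_measurable h.CM" using borel_measurable_integrable[OF f(2)] by (simp add: N_def)
  have le: "AE x in h.CM. \<forall>j. indicator (E j) x * ennreal (?\<beta> (x, T j x)) \<le> indicator (E j) x * (indicator K x * ennreal \<bar>g x - f x\<bar>)"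
    using geq TGall
  proof eventually_elim
    case (elim x)
    show ?case
    proof
      fix j
      show "indicator (E j) x * ennreal (?\<beta> (x, T j x)) \<le> indicator (E j) x * (indicator K x * ennreal \<bar>g x - f x\<bar>)"
      proof (cases "x \<in> E j")
        case True
        have xU: "x \<in> U" using True EU by blast
        have z: "(x, T j x) \<in> topspace ?XG" using True elim(2) xU by auto
        have gw: "g x = w (x, T j x)" using True elim(1) by blast
        have notS: "w (x, T j x) = 0" if "x \<notin> fst ` S" using S(2)[OF z] that by force
        show ?thesis
        proof (cases "x \<in> K")
          case False
          have \<eta>0: "\<eta> x = 0" using K(2) False xU by simp
          moreover have "x \<notin> fst ` S"
          proof
            assume "x \<in> fst ` S"
            then have "x \<in> Q" using \<eta>(5) by blast
            from \<eta>(6)[OF this] \<eta>0 show False by simp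
          qed
          ultimately show ?thesis using notS by (simp add: a_def)
        next
          case inK: True
          have "\<bar>w (x, T j x) - \<eta> x * f x\<bar> \<le> \<bar>g x - f x\<bar>"
          proof (cases "x \<in> fst ` S")
            case True
            then have "\<eta> x = 1" using \<eta>(5,6) by blast
            then show ?thesis using gw by simp
          next
            case False
            then show ?thesis using gw notS \<eta>(2,3)[of x] by (simp add: abs_mult mult_left_le_one_le)
          qed
          then show ?thesis using True inK by (simp add: a_def ennreal_leI)
        qed
      qed simp
    qed
  qed
  have "ennreal (radon_integral ?XG V ?\<beta>) = (\<Sum>j. ennreal (c j) * (\<integral>\<^sup>+x. indicator (E j) x * ennreal (?\<beta> (x, T j x)) \<partial>h.CM))"
    by (rule nn_sum[symmetric, OF \<beta>]) simp
  also have "\<dots> \<le> (\<Sum>j. ennreal (c j) * (\<integral>\<^sup>+x. indicator (E j) x * (indicator K x * ennreal \<bar>g x - f x\<bar>) \<partial>h.CM))"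
  proof (intro suminf_le mult_left_mono nn_integral_mono_AE)
    fix j
    show "AE x in h.CM. indicator (E j) x * ennreal (?\<beta> (x, T j x)) \<le> indicator (E j) x * (indicator K x * ennreal \<bar>g x - f x\<bar>)"
      using le by eventually_elim blast
  qed auto
  also have "\<dots> = (\<integral>\<^sup>+x. ennreal \<bar>g x - f x\<bar> \<partial>N)"
    using gm fm by (intro nnN[symmetric]) measurable
  also have "\<dots> = ennreal (\<integral>x. \<bar>g x - f x\<bar> \<partial>N)"
    using gN f(2) by (intro nn_integral_eq_integral) auto
  also have "\<dots> \<le> ennreal e" using f(3) by (rule ennreal_leI)
  finally have "radon_integral ?XG V ?\<beta> \<le> e" using e by (simp add: ennreal_le_iff)
  then show thesis using at by (intro that[of a])
qed

section \<open>Lifting Young functions and their pairings from the base to the product\<close>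

context compact_factor
begin

lemma pairing_marg:
  assumes y: "young X Y marg f" "young XG Y V (f \<circ> fst)"
    and a: "a \<in> test_functions X" and k: "k \<in> test_functions Y"
  shows "young.pairing XG Y V (f \<circ> fst) (\<lambda>z. a (fst z)) k = young.pairing X Y marg f a k"
proof -
  have "(\<lambda>x. a x * radon_integral Y (f x) k) \<in> borel_measurable M.CM"
    by (rule borel_measurable_integrable[OF young.pairing_integrable[OF y(1) a k]])
  from integral_marg[OF this] show ?thesis
    unfolding young.pairing_def[OF y(1)] young.pairing_def[OF y(2)] M.ri_eq V.ri_eq by simp
qed

lemma young_lift:
  assumes "young X Y marg f"
  shows "young XG Y V (f \<circ> fst)"
proof -
  interpret y: young X Y marg f by fact
  show ?thesis
    by (intro young.intro lch2_pair.intro P.lch2_axioms y.Y.lch2_axioms V.radon_axioms young_axioms.intro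
        young_function_fst y.yf)
qed

end

text \<open>Pairings with a function of the base point alone reduce to the base by
  \<open>pairing_marg\<close>; the remainder is bounded by \<open>C\<close> times the integral of a
  test function, so weak convergence controls it along the sequence.\<close>

lemma pairing_convergence_lift:
  assumes cf: "\<And>i. compact_factor X G (Vs i)" "compact_factor X G V"
    and weak: "weakly_converges (prod_topology X G) Vs V"
    and y: "\<And>i. young X Y (compact_factor.marg G (Vs i)) (fs i)" "young X Y (compact_factor.marg G V) f"
    and conv: "\<And>g k. g \<in> test_functions X \<Longrightarrow> k \<in> test_functions Y \<Longrightarrow>
      (\<lambda>i. young.pairing X Y (compact_factor.marg G (Vs i)) (fs i) g k) \<longlonglongrightarrow> young.pairing X Y (compact_factor.marg G V) f g k"
    and approx: "\<And>e. 0 < e \<Longrightarrow> \<exists>a\<in>test_functions X. radon_integral (prod_topology X G) V (\<lambda>z. \<bar>w z - a (fst z)\<bar>) \<le> e"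
    and w: "w \<in> test_functions (prod_topology X G)" and k: "k \<in> test_functions Y"
  shows "(\<lambda>i. young.pairing (prod_topology X G) Y (Vs i) (fs i \<circ> fst) w k) \<longlonglongrightarrow> young.pairing (prod_topology X G) Y V (f \<circ> fst) w k"
proof (rule LIMSEQ_I)
  let ?XG = "prod_topology X G"
  let ?p = "\<lambda>i. young.pairing ?XG Y (Vs i) (fs i \<circ> fst)" and ?q = "young.pairing ?XG Y V (f \<circ> fst)"
  interpret c: compact_factor X G V by (rule cf(2))
  interpret y: young X Y c.marg f by (rule y(2))
  note yl = compact_factor.young_lift[OF cf(1) y(1)] and ylV = c.young_lift[OF y(2)]
  obtain C where C: "0 < C" "\<And>y. y \<in> topspace Y \<Longrightarrow> \<bar>k y\<bar> \<le> C" by (rule y.Y.tf_bounded[OF k]) (rule that)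
  fix e :: real assume e: "0 < e"
  \<comment> \<open>The remainder costs at most \<open>2 * t * C = e / 2\<close> along the sequence
    and \<open>t * C = e / 4\<close> in the limit; less than \<open>e / 4\<close> is left for the
    convergence over the base.\<close>
  define t where "t = e / (4 * C)"
  have t: "0 < t" "C * t = e / 4" using e C(1) by (auto simp: t_def)
  obtain a where a: "a \<in> test_functions X" "radon_integral ?XG V (\<lambda>z. \<bar>w z - a (fst z)\<bar>) \<le> t"
    using approx[OF t(1)] by blast
  note at = c.tf_fst[OF a(1)]
  have \<beta>: "(\<lambda>z. \<bar>w z - a (fst z)\<bar>) \<in> test_functions ?XG" by (rule c.P.tf_abs[OF c.P.tf_diff[OF w at]])
  have close: "\<bar>young.pairing ?XG Y V' f' w k - young.pairing ?XG Y V' f' (\<lambda>z. a (fst z)) k\<bar>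
      \<le> C * radon_integral ?XG V' (\<lambda>z. \<bar>w z - a (fst z)\<bar>)" if "young ?XG Y V' f'" for V' f'
    using young.pairing_abs_le[OF that c.P.tf_diff[OF w at] k C(2)] young.pairing_add1(2)[OF that w at k] by simp
  have "(\<lambda>i. radon_integral ?XG (Vs i) (\<lambda>z. \<bar>w z - a (fst z)\<bar>)) \<longlonglongrightarrow> radon_integral ?XG V (\<lambda>z. \<bar>w z - a (fst z)\<bar>)"
    using weak \<beta> unfolding weakly_converges_def by blast
  then have "\<forall>\<^sub>F i in sequentially. radon_integral ?XG (Vs i) (\<lambda>z. \<bar>w z - a (fst z)\<bar>) < 2 * t"
    by (rule order_tendstoD) (use a(2) t(1) in linarith)
  then obtain N1 where N1: "\<And>i. i \<ge> N1 \<Longrightarrow> radon_integral ?XG (Vs i) (\<lambda>z. \<bar>w z - a (fst z)\<bar>) < 2 * t"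
    unfolding eventually_sequentially by blast
  have "(\<lambda>i. ?p i (\<lambda>z. a (fst z)) k) \<longlonglongrightarrow> ?q (\<lambda>z. a (fst z)) k"
    using conv[OF a(1) k]
    unfolding compact_factor.pairing_marg[OF cf(1) y(1) yl a(1) k] c.pairing_marg[OF y(2) ylV a(1) k] .
  from LIMSEQ_D[OF this, of "e/4"] e obtain N2 where N2: "\<And>i. i \<ge> N2 \<Longrightarrow> \<bar>?p i (\<lambda>z. a (fst z)) k - ?q (\<lambda>z. a (fst z)) k\<bar> < e / 4"
    by auto
  have "norm (?p i w k - ?q w k) < e" if "i \<ge> max N1 N2" for i
  proof -
    have "\<bar>?p i w k - ?p i (\<lambda>z. a (fst z)) k\<bar> \<le> C * radon_integral ?XG (Vs i) (\<lambda>z. \<bar>w z - a (fst z)\<bar>)"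
      by (rule close[OF yl])
    also have "\<dots> \<le> C * (2 * t)" using N1[of i] that C(1) by (intro mult_left_mono) auto
    finally have 1: "\<bar>?p i w k - ?p i (\<lambda>z. a (fst z)) k\<bar> \<le> e / 2" using t(2) by simp
    have "\<bar>?q w k - ?q (\<lambda>z. a (fst z)) k\<bar> \<le> C * radon_integral ?XG V (\<lambda>z. \<bar>w z - a (fst z)\<bar>)"
      by (rule close[OF ylV])
    also have "\<dots> \<le> C * t" using a(2) C(1) by (intro mult_left_mono) auto
    finally have 2: "\<bar>?q w k - ?q (\<lambda>z. a (fst z)) k\<bar> \<le> e / 4" using t(2) by simp
    show ?thesis using 1 2 N2[of i] that unfolding real_norm_def by linarith
  qed
  then show "\<exists>no. \<forall>i\<ge>no. norm (?p i w k - ?q w k) < e" by blast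
qed

section \<open>Passage to subsequences and the theorem on varifolds\<close>

lemma weakly_converges_subseq:
  assumes "weakly_converges X \<mu>s \<mu>" "strict_mono r"
  shows "weakly_converges X (\<lambda>i. \<mu>s (r i)) \<mu>"
  unfolding weakly_converges_def
proof
  fix g assume "g \<in> test_functions X"
  then have "(\<lambda>i. radon_integral X (\<mu>s i) g) \<longlonglongrightarrow> radon_integral X \<mu> g"
    using assms(1) unfolding weakly_converges_def by blast
  from LIMSEQ_subseq_LIMSEQ[OF this assms(2)]
  show "(\<lambda>i. radon_integral X (\<mu>s (r i)) g) \<longlonglongrightarrow> radon_integral X \<mu> g" by (simp add: o_def)
qed

theorem theorem3p27:
  fixes U :: "(real^'n::finite) set"
    and V :: "((real^'n) \<times> (real^'n) set) set \<Rightarrow> ennreal"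
    and Vs :: "nat \<Rightarrow> ((real^'n) \<times> (real^'n) set) set \<Rightarrow> ennreal"
    and Y :: "'y topology"
    and L :: "nat \<Rightarrow> 'y set"
    and fs :: "nat \<Rightarrow> (real^'n) \<Rightarrow> 'y set \<Rightarrow> ennreal"
    and m :: nat
  assumes "m = CARD('m::finite)" and "m \<le> CARD('n)"
    and "open U"
    and "\<And>i. varifold m U (Vs i)"
    and "varifold m U V"
    and "weakly_converges (varifold_space m U) Vs V"
    and "second_countable Y" and "locally_compact_space Y" and "Hausdorff_space Y"
    and "\<And>j. compactin Y (L j)"
    and "(\<Union>j. L j) = topspace Y"
    and "\<And>j. L j \<subseteq> Y interior_of L (Suc j)"
    and "\<And>i. young_function (top_of_set U) Y (varifold_weight m (Vs i)) (fs i)"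
    and "\<And>K. compact K \<Longrightarrow> K \<subseteq> U \<Longrightarrow>
           (\<lambda>j. SUP i. graph_measure (top_of_set U) Y (varifold_weight m (Vs i)) (fs i)
                         (K \<times> (topspace Y - L j))) \<longlonglongrightarrow> 0"
  shows "\<exists>f r. young_function (top_of_set U) Y (varifold_weight m V) f \<and>
           strict_mono (r :: nat \<Rightarrow> nat) \<and>
           weakly_converges (prod_topology (top_of_set U) Y)
             (\<lambda>i. graph_measure (top_of_set U) Y (varifold_weight m (Vs (r i))) (fs (r i)))
             (graph_measure (top_of_set U) Y (varifold_weight m V) f) \<and>
           ((\<forall>i. rectifiable_varifold TYPE('m) U (Vs i)) \<and> rectifiable_varifold TYPE('m) U V \<longrightarrow>
            weakly_converges (prod_topology (varifold_space m U) Y)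
              (\<lambda>i. graph_measure (varifold_space m U) Y (Vs (r i)) (fs (r i) \<circ> fst))
              (graph_measure (varifold_space m U) Y V (f \<circ> fst)))"
proof -
  let ?X = "top_of_set U" and ?G = "grassmannian_topology m :: (real^'n) set topology"
  let ?XG = "varifold_space m U"
  note m = assms(1)
  have cf: "compact_factor ?X ?G (Vs i)" for i
    using assms(4) unfolding m by (intro compact_factor_varifold assms(3))
  have cfV: "compact_factor ?X ?G V"
    using assms(5) unfolding m by (intro compact_factor_varifold assms(3))
  interpret c: compact_factor ?X ?G V by (rule cfV)
  \<comment> \<open>\<open>marg\<close> evaluates the cylinder over \<open>topspace ?G\<close>,
    which is the Grassmannian itself.\<close>
  have marg: "compact_factor.marg ?G W = varifold_weight m W" if "compact_factor ?X ?G W" for W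
    by (rule ext) (simp add: compact_factor.marg_def[OF that] varifold_weight_def)
  interpret Y: lch2 Y by unfold_locales (use assms(7-9) in auto)
  interpret p: lch2_pair ?X Y by (intro lch2_pair.intro c.X.lch2_axioms Y.lch2_axioms)
  have rad: "radon ?X (varifold_weight m (Vs i))" for i
    using compact_factor.radon_marg[OF cf[of i]] unfolding marg[OF cf] .
  have radV: "radon ?X (varifold_weight m V)" using c.radon_marg unfolding marg[OF cfV] .
  \<comment> \<open>Test functions on \<open>U\<close> pull back to test functions on the product,
    the fibres being compact, so convergence of varifolds passes to the weights.\<close>
  have weak: "weakly_converges ?X (\<lambda>i. varifold_weight m (Vs i)) (varifold_weight m V)"
    unfolding weakly_converges_def
  proof
    fix g assume g: "g \<in> test_functions ?X"
    have "(\<lambda>i. radon_integral ?XG (Vs i) (\<lambda>z. g (fst z))) \<longlonglongrightarrow> radon_integral ?XG V (\<lambda>z. g (fst z))"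
      using assms(6) c.tf_fst[OF g] unfolding weakly_converges_def by blast
    then show "(\<lambda>i. radon_integral ?X (varifold_weight m (Vs i)) g) \<longlonglongrightarrow> radon_integral ?X (varifold_weight m V) g"
      using compact_factor.ri_marg[OF cf g] c.ri_marg[OF g] unfolding marg[OF cf] marg[OF cfV] by simp
  qed
  have L: "L j \<subseteq> L (Suc j)" for j using assms(12)[of j] interior_of_subset[of Y "L (Suc j)"] by blast
  have tight: "(\<lambda>j. SUP i. graph_measure ?X Y (varifold_weight m (Vs i)) (fs i) (K \<times> (topspace Y - L j))) \<longlonglongrightarrow> 0"
    if "compactin ?X K" for K
    using assms(14)[of K] that by (simp add: compactin_subtopology)
  obtain f r where f: "young_function ?X Y (varifold_weight m V) f" "strict_mono (r :: nat \<Rightarrow> nat)"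
    "\<And>g k. g \<in> test_functions ?X \<Longrightarrow> k \<in> test_functions Y \<Longrightarrow>
      (\<lambda>i. young.pairing ?X Y (varifold_weight m (Vs (r i))) (fs (r i)) g k) \<longlonglongrightarrow> young.pairing ?X Y (varifold_weight m V) f g k"
    by (rule p.young_compactness[OF rad radV weak assms(13) assms(10,11) L]) (erule tight, rule that)
  have y: "young ?X Y (varifold_weight m (Vs i)) (fs i)" for i
    by (intro young.intro p.lch2_pair_axioms young_axioms.intro rad assms(13))
  have yV: "young ?X Y (varifold_weight m V) f"
    by (intro young.intro p.lch2_pair_axioms young_axioms.intro radV f(1))
  have 1: "weakly_converges (prod_topology ?X Y)
      (\<lambda>i. graph_measure ?X Y (varifold_weight m (Vs (r i))) (fs (r i))) (graph_measure ?X Y (varifold_weight m V) f)"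
    by (rule p.weak_graph_convergence[OF y yV weakly_converges_subseq[OF weak f(2)] f(3)])
  have 2: "weakly_converges (prod_topology ?XG Y)
      (\<lambda>i. graph_measure ?XG Y (Vs (r i)) (fs (r i) \<circ> fst)) (graph_measure ?XG Y V (f \<circ> fst))"
    if V: "rectifiable_varifold TYPE('m) U V"
  proof -
    \<comment> \<open>The lifted claim is \<open>weak_graph_convergence\<close> with the product as
      base space, so that only pairings with test functions on the product remain to be
      treated.\<close>
    interpret q: lch2_pair ?XG Y by (intro lch2_pair.intro c.P.lch2_axioms Y.lch2_axioms)
    have ym: "young ?X Y (compact_factor.marg ?G (Vs i)) (fs i)" for i using y unfolding marg[OF cf] .
    have ymV: "young ?X Y (compact_factor.marg ?G V) f" using yV unfolding marg[OF cfV] .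
    have ap: "\<exists>a\<in>test_functions ?X. radon_integral ?XG V (\<lambda>z. \<bar>w z - a (fst z)\<bar>) \<le> e"
      if w: "w \<in> test_functions ?XG" and e: "0 < e" for w and e :: real
      using rectifiable_varifold_approx[OF assms(3) V w[unfolded m] e] unfolding m by blast
    have weakV: "weakly_converges ?XG (\<lambda>i. Vs (r i)) V" by (rule weakly_converges_subseq[OF assms(6) f(2)])
    show ?thesis
    proof (rule q.weak_graph_convergence[OF compact_factor.young_lift[OF cf ym] c.young_lift[OF ymV] weakV])
      fix w k assume w: "w \<in> test_functions ?XG" and k: "k \<in> test_functions Y"
      show "(\<lambda>i. young.pairing ?XG Y (Vs (r i)) (fs (r i) \<circ> fst) w k) \<longlonglongrightarrow> young.pairing ?XG Y V (f \<circ> fst) w k"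
      proof (rule pairing_convergence_lift[OF cf cfV weakV ym ymV _ ap[OF w] w k])
        show "(\<lambda>i. young.pairing ?X Y (compact_factor.marg ?G (Vs (r i))) (fs (r i)) g k)
            \<longlonglongrightarrow> young.pairing ?X Y (compact_factor.marg ?G V) f g k"
          if "g \<in> test_functions ?X" "k \<in> test_functions Y" for g k
          using f(3)[OF that] unfolding marg[OF cf] marg[OF cfV] .
      qed
    qed
  qed
  show ?thesis using f(1,2) 1 2 by blast
qed

end
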